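(* Let $T:J\to J$, $J=[0,z)$, be a 3-interval exchange transformation which is the first return map to $J$ of the rotation $R$ by $\alpha$ (as set up in the context), and suppose that $T$ satisfies the assumptions (A0)-(A9) listed in the context. Then for every $x\in J$ and every continuous function $f:[0,z]\to\mathbb{R}$, $$\lim_{N\to\infty}\frac1N\sum_{n=0}^{N-1} f(T^n x)\,\mu(n)=0,$$ where $\mu$ is the Möbius function.
   Context: Möbius function: $\mu(n)=0$ if $n$ is not square-free, and for square-free $n$, $\mu(n)=1$ or $-1$ according to whether $n$ has an even or odd number of prime factors; set $\mu(0)=0$. Setup: $\alpha\in(0,1)$ is irrational, $R:[0,1)\to[0,1)$ is $R(x)=x+\alpha \bmod 1$, $\lambda$ is Lebesgue measure, $d(x,y)=\min\{|x-y|,1-|x-y|\}$, and $\|y\|$ denotes the distance from $y\in\mathbb{R}$ to $\mathbb{Z}$. Let $a_0,a_1,\dots$ be the continued fraction expansion of $\alpha$ and $p_k/q_k$ its convergents, so $q_{k+1}=a_{k+1}q_k+q_{k-1}$. $J=[0,z)\subset[0,1)$ is an interval such that $x\notin J$ implies $Rx\in J$, and $T:J\to J$ is the first return (induced) map of $R$ to $J$; it is a 3-interval exchange transformation (3-IET). For $r\in\mathbb{N}$ put $\psi_r(x)=\sum_{j=0}^{r-1}\chi_J(R^jx)$, $x\in[0,1)$. The associated torus is $\hat X=\mathbb{R}^2/\Lambda$, with $\Lambda$ the lattice generated by $(1,0)$ and $(-\alpha,1)$; the two marked points are the endpoints $(0,0)$ and $(z,0)$ of the horizontal segment of length $z$.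 Assumptions (A0)-(A9): there exist constants $C_1,C_2,C_3,C_4>1$ such that for every $\ell\in\mathbb{N}$ and every sufficiently small $\eta>0$ there exist $\hat c_\eta>0$ (depending on $\eta$) and $c_\ell>0$ (depending on $\ell$) such that for every $0<c<c_\ell$ there exist a constant $k_c\in\mathbb{N}$ and infinite sequences of natural numbers $(L_i)$, $(k_i)$ such that: (A0) $q_{k_i-1}<cL_i<q_{k_i}$. (A1) $a_{k_i}<C_1$. (A2) $a_{k_i+1}<C_2$. (A3) $a_{k_i+2}<C_3$. (A4) The shortest vertical trajectory on the torus from one marked point to a $\|q_{k_i}\alpha\|$-neighborhood of the other has length at least $q_{k_i}/C_4$. (A5) There exists $u_i$ such that either $\lambda(\psi_{L_i}^{-1}(u_i))>\hat c_\eta$ and $\lambda(\psi_{L_i}^{-1}((-\infty,u_i)))<\eta\hat c_\eta$, or $\lambda(\psi_{L_i}^{-1}(u_i))>\hat c_\eta$ and $\lambda(\psi_{L_i}^{-1}((u_i,\infty)))<\eta\hat c_\eta$. (A6) $\lim_{i\to\infty}\int_0^1 d(R^{L_i}x,x)\,d\lambda(x)=0$. (A7) $L_i>q_{k_i+\ell}$. (A8) $\max\{j:\psi_{L_i}^{-1}(j)\neq\emptyset\}-\min\{j:\psi_{L_i}^{-1}(j)\ne\emptyset\}<k_c$. (A9) There exists $v_i$ such that $q_{v_i}\le L_i<q_{v_i+1}$ and either $L_i=q_{v_i}$, or $a_{v_i+1}>4$ and $L_i=pq_{v_i}$ for some positive integer $p\le\lfloor a_{v_i+1}/4\rfloor$.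 *)

theory Defs
  imports "HOL-Analysis.Analysis" "HOL-Computational_Algebra.Computational_Algebra"
begin

section \<open>The Moebius function\<close>

text \<open>Since \<open>0\<close> is not squarefree in the library's sense, this gives \<open>moebius_mu 0 = 0\<close>.\<close>

definition moebius_mu :: "nat \<Rightarrow> int" where
  "moebius_mu n = (if squarefree n then (- 1) ^ card (prime_factors n) else 0)"

section \<open>Rotations, induced maps and interval exchanges\<close>

definition rot :: "real \<Rightarrow> real \<Rightarrow> real" where
  "rot \<alpha> x = frac (x + \<alpha>)"

definition circle_dist :: "real \<Rightarrow> real \<Rightarrow> real" where
  "circle_dist x y = min \<bar>x - y\<bar> (1 - \<bar>x - y\<bar>)"

definition first_return :: "('a \<Rightarrow> 'a) \<Rightarrow> 'a set \<Rightarrow> 'a \<Rightarrow> 'a" where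
  "first_return F J x = (F ^^ (LEAST n. 0 < n \<and> (F ^^ n) x \<in> J)) x"

text \<open>\<open>T\<close> exchanges \<open>n\<close> consecutive half-open subintervals of \<open>[0,z)\<close>: the \<open>i\<close>-th one, of length
  \<open>l i\<close>, is translated so that after the exchange it is the \<open>\<pi> i\<close>-th from the left.\<close>

definition interval_exchange :: "nat \<Rightarrow> real \<Rightarrow> (real \<Rightarrow> real) \<Rightarrow> bool" where
  "interval_exchange n z T \<longleftrightarrow>
     (\<exists>(l :: nat \<Rightarrow> real) \<pi>. (\<forall>i<n. 0 < l i) \<and> (\<Sum>i<n. l i) = z \<and> \<pi> permutes {..<n} \<and>
        (\<forall>i<n. \<forall>x\<in>{(\<Sum>j<i. l j)..<(\<Sum>j<Suc i. l j)}.
           T x = x - (\<Sum>j<i. l j) + (\<Sum>j | j < n \<and> \<pi> j < \<pi> i. l j)))"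

text \<open>The number of visits to \<open>[0,z)\<close> during the first \<open>r\<close> steps of the rotation orbit of \<open>x\<close>.\<close>

definition visits :: "real \<Rightarrow> real \<Rightarrow> nat \<Rightarrow> real \<Rightarrow> nat" where
  "visits \<alpha> z r x = (\<Sum>j<r. indicator {0..<z} ((rot \<alpha> ^^ j) x))"

text \<open>The preimage of \<open>S\<close> under the function \<open>visits \<alpha> z r\<close> on its domain \<open>[0,1)\<close>.\<close>

definition visits_preimage :: "real \<Rightarrow> real \<Rightarrow> nat \<Rightarrow> nat set \<Rightarrow> real set" where
  "visits_preimage \<alpha> z r S = {x \<in> {0..<1}. visits \<alpha> z r x \<in> S}"

definition visits_range :: "real \<Rightarrow> real \<Rightarrow> nat \<Rightarrow> nat set" where
  "visits_range \<alpha> z r = {j. visits_preimage \<alpha> z r {j} \<noteq> {}}"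

section \<open>Continued fractions\<close>

text \<open>\<open>cf_rem \<alpha> k\<close> is the \<open>k\<close>-th complete quotient \<open>[a\<^sub>k; a\<^sub>k\<^sub>+\<^sub>1, \<dots>]\<close> of \<open>\<alpha>\<close>; the definitions are
  used for irrational \<open>\<alpha> \<in> (0,1)\<close>, so that no division by zero occurs and all partial quotients
  are natural numbers.\<close>

fun cf_rem :: "real \<Rightarrow> nat \<Rightarrow> real" where
  "cf_rem \<alpha> 0 = \<alpha>"
| "cf_rem \<alpha> (Suc k) = 1 / frac (cf_rem \<alpha> k)"

definition cf_a :: "real \<Rightarrow> nat \<Rightarrow> nat" where
  "cf_a \<alpha> k = nat \<lfloor>cf_rem \<alpha> k\<rfloor>"

text \<open>The denominators of the convergents.\<close>

fun cf_q :: "real \<Rightarrow> nat \<Rightarrow> nat" where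
  "cf_q \<alpha> 0 = 1"
| "cf_q \<alpha> (Suc 0) = cf_a \<alpha> 1"
| "cf_q \<alpha> (Suc (Suc k)) = cf_a \<alpha> (Suc (Suc k)) * cf_q \<alpha> (Suc k) + cf_q \<alpha> k"

definition dist_int :: "real \<Rightarrow> real" where
  "dist_int y = infdist y \<int>"

section \<open>The torus with two marked points\<close>

definition torus_lattice :: "real \<Rightarrow> (real \<times> real) set" where
  "torus_lattice \<alpha> = range (\<lambda>(m :: int, n :: int). of_int m *\<^sub>R (1, 0) + of_int n *\<^sub>R (- \<alpha>, 1))"

text \<open>The flat quotient metric of the torus, evaluated on representatives in the plane.\<close>

definition torus_dist :: "real \<Rightarrow> real \<times> real \<Rightarrow> real \<times> real \<Rightarrow> real" where
  "torus_dist \<alpha> P Q = infdist (P - Q) (torus_lattice \<alpha>)"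

text \<open>Every vertical trajectory from one of the two marked points to the \<open>\<epsilon>\<close>-neighbourhood of the
  other has length at least \<open>B\<close>. Vertical trajectories are unoriented. It suffices to let them run
  upwards, because both orders of the marked points are considered: running down from \<open>P\<close> one comes
  close to \<open>Q\<close> after time \<open>t\<close> iff running up from \<open>Q\<close> one comes close to \<open>P\<close> after time \<open>t\<close>.\<close>

definition vertical_sep :: "real \<Rightarrow> real \<Rightarrow> real \<Rightarrow> real \<Rightarrow> bool" where
  "vertical_sep \<alpha> z \<epsilon> B \<longleftrightarrow>
     (\<forall>(P, Q) \<in> {((0, 0), (z, 0)), ((z, 0), (0, 0))}.
        \<forall>t\<ge>0. torus_dist \<alpha> (P + (0, t)) Q < \<epsilon> \<longrightarrow> B \<le> t)"

section \<open>The assumptions (A0)--(A9)\<close>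

text \<open>The conditions for one member \<open>L = L\<^sub>i\<close>, \<open>k = k\<^sub>i\<close> of the two sequences, that is, all
  assumptions except the limit (A6). For \<open>k = 0\<close>, where \<open>k - 1 = 0\<close>, condition (A0) is false, so
  that (A0) includes \<open>k \<ge> 1\<close>.\<close>

definition A_conditions ::
  "real \<Rightarrow> real \<Rightarrow> real \<Rightarrow> real \<Rightarrow> real \<Rightarrow> real \<Rightarrow> nat \<Rightarrow> real \<Rightarrow> real \<Rightarrow> real \<Rightarrow> nat \<Rightarrow> nat \<Rightarrow> nat \<Rightarrow> bool" where
  "A_conditions \<alpha> z C1 C2 C3 C4 l \<eta> chat c kc L k \<longleftrightarrow>
     \<comment> \<open>A0\<close>
     real (cf_q \<alpha> (k - 1)) < c * real L \<and> c * real L < real (cf_q \<alpha> k) \<and>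
     \<comment> \<open>A1, A2, A3\<close>
     real (cf_a \<alpha> k) < C1 \<and> real (cf_a \<alpha> (k + 1)) < C2 \<and> real (cf_a \<alpha> (k + 2)) < C3 \<and>
     \<comment> \<open>A4\<close>
     vertical_sep \<alpha> z (dist_int (real (cf_q \<alpha> k) * \<alpha>)) (real (cf_q \<alpha> k) / C4) \<and>
     \<comment> \<open>A5\<close>
     (\<exists>u. measure lborel (visits_preimage \<alpha> z L {u}) > chat \<and>
            measure lborel (visits_preimage \<alpha> z L {..<u}) < \<eta> * chat
        \<or> measure lborel (visits_preimage \<alpha> z L {u}) > chat \<and>
            measure lborel (visits_preimage \<alpha> z L {u<..}) < \<eta> * chat) \<and>
     \<comment> \<open>A7\<close>
     L > cf_q \<alpha> (k + l) \<and>
     \<comment> \<open>A8\<close>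
     Max (visits_range \<alpha> z L) - Min (visits_range \<alpha> z L) < kc \<and>
     \<comment> \<open>A9\<close>
     (\<exists>v. cf_q \<alpha> v \<le> L \<and> L < cf_q \<alpha> (v + 1) \<and>
        (L = cf_q \<alpha> v \<or>
         cf_a \<alpha> (v + 1) > 4 \<and>
           (\<exists>p>0. p \<le> \<lfloor>real (cf_a \<alpha> (v + 1)) / 4\<rfloor> \<and> int L = p * int (cf_q \<alpha> v))))"

text \<open>The constant \<open>chat \<eta>\<close> depends on \<open>\<eta>\<close> only and \<open>cbar l\<close> depends on \<open>l\<close> only, hence both are
  functions chosen in advance; accordingly, how small \<open>\<eta>\<close> has to be does not depend on \<open>l\<close>.\<close>

definition A_assumptions :: "real \<Rightarrow> real \<Rightarrow> bool" where
  "A_assumptions \<alpha> z \<longleftrightarrow>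
     (\<exists>C1>1. \<exists>C2>1. \<exists>C3>1. \<exists>C4>1.
      \<exists>(chat :: real \<Rightarrow> real) (cbar :: nat \<Rightarrow> real).
        (\<forall>l. 0 < cbar l) \<and>
        (\<forall>\<^sub>F \<eta> in at_right 0. 0 < chat \<eta> \<and>
          (\<forall>l c. 0 < c \<and> c < cbar l \<longrightarrow>
            (\<exists>(kc :: nat) (L :: nat \<Rightarrow> nat) (k :: nat \<Rightarrow> nat).
               (\<forall>i. A_conditions \<alpha> z C1 C2 C3 C4 l \<eta> (chat \<eta>) c kc (L i) (k i)) \<and>
               \<comment> \<open>A6\<close>
               (\<lambda>i. LINT x:{0..<1}|lborel. circle_dist ((rot \<alpha> ^^ L i) x) x)
                 \<longlonglongrightarrow> 0))))"

end

theory Submission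
  imports Defs "HOL-Complex_Analysis.Complex_Analysis"
begin

text \<open>By the prime number theorem in the form \<open>\<Sum>n\<le>N. \<mu>(n) = o(N)\<close>, proved with Newman's contour, one may subtract
  from \<open>f\<close> its mean over the orbits of \<open>T\<close>, which exists uniformly. For the remaining \<open>f\<close> of mean zero Katai's criterion
  asks that the averages of \<open>f (T\<^sup>p\<^sup>j x) f (T\<^sup>q\<^sup>j x)\<close> vanish for distinct primes \<open>p\<close>, \<open>q\<close>.

  Let \<open>L\<close> be a denominator of a convergent of \<open>\<alpha>\<close>, so that \<open>R\<^sup>L\<close> is close to the identity. The orbit of \<open>x\<close> visits
  \<open>J\<close> exactly \<open>\<psi>(x)\<close> times up to time \<open>pL\<close>, hence \<open>T\<^sup>p\<^sup>u x\<close> is close to \<open>T\<^sup>a x\<close> with \<open>a = pu - \<psi>(x)\<close>, and by the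
  Denjoy-Koksma inequality \<open>a\<close> is bounded for a suitable \<open>u\<close>. Along an orbit \<open>\<psi>\<close> moves by one when the orbit passes
  an endpoint of \<open>J\<close>. The assumptions make these passages occur with gaps that are long and comparable
  to each other, so \<open>p\<close> does not divide \<open>a\<close> with positive frequency.

  Consider \<open>F s t (x, y) = f (T\<^sup>s x) f (T\<^sup>t y)\<close> and an invariant mean for \<open>T\<^sup>p \<times> T\<^sup>q\<close>. A convex combination of
  translates of \<open>F\<close> in the indices whose norm is almost minimal is almost invariant under \<open>(p, q)\<close>, and then, by
  the drift above, under \<open>(a, b)\<close> with \<open>pb \<noteq> qa\<close>, hence under \<open>(0, pb - qa)\<close>. Averaging over this
  progression kills it, because the averages of \<open>f\<close> along \<open>T\<^sup>D\<close> vanish for every \<open>D\<close>; the latter follows from the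
  same argument applied to the product of \<open>T\<close> with a periodic rotation.\<close>

section \<open>Almost invariant convex combinations\<close>

text \<open>The claim concerns every point x and T is discontinuous, so all averages are controlled
  uniformly in the starting point. If some were not small, a limit along the offending orbit
  segments would give a finitely additive mean \<open>Lam\<close> that is exactly invariant; its
  mean-square seminorm takes the place of an L2 norm. The difficulty is the order of choices. The
  convex combination is picked before the scale and looks at a bounded window of the orbit, so the
  drift must act at arbitrarily fine scales while the frequency \<kappa> of useful drifts must not
  deteriorate. The parameters of the assumptions allow this: l is taken large first, which makes the
  displacement small compared with the separation of the endpoint orbits, then c is fixed, and along
  the sequence the ratio of hitting time to separation time stays below 4 C4 / c. The separation
  comes from (A4), the bound for the hitting time from (A0) and (A7). One scale has to serve all
  exponents n up to a bound, because both coordinates of the product system are moved by the same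
  u.\<close>

lemma compact_PiE_real:
  fixes B :: "'i \<Rightarrow> real"
  shows "compact (Pi\<^sub>E UNIV (\<lambda>i. {- B i..B i}))"
proof -
  have "compactin (product_topology (\<lambda>i. euclideanreal) UNIV) (Pi\<^sub>E UNIV (\<lambda>i. {- B i..B i}))"
    by (simp add: compactin_PiE)
  then show ?thesis
    by (simp add: euclidean_product_topology)
qed

text \<open>Tychonoff replaces the ultrafilter lemma: an index \<open>x\<close> is sent to the point
  of a product of compact intervals whose coordinate at a bounded \<open>a\<close> is
  \<open>a x\<close>. These points have a cluster point \<open>p\<close> along \<open>F\<close>, and
  refining \<open>F\<close> by the preimages of the neighbourhoods of \<open>p\<close> makes every
  coordinate converge.\<close>

lemma ultrafilter_limits:
  fixes F :: "'a filter"
  assumes "F \<noteq> bot"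
  obtains G where "G \<le> F" "G \<noteq> bot" "\<And>a :: 'a \<Rightarrow> real. bounded (range a) \<Longrightarrow> \<exists>l. (a \<longlongrightarrow> l) G"
proof -
  define B :: "('a \<Rightarrow> real) \<Rightarrow> real" where "B = (\<lambda>a. SOME b. \<forall>x. \<bar>a x\<bar> \<le> b)"
  have B: "\<bar>a x\<bar> \<le> B a" if "bounded (range a)" for a x
  proof -
    have "\<exists>b. \<forall>x. \<bar>a x\<bar> \<le> b" using that by (auto simp: bounded_iff)
    from someI_ex[OF this] show ?thesis by (auto simp: B_def)
  qed
  define X :: "'a \<Rightarrow> ('a \<Rightarrow> real) \<Rightarrow> real" where "X = (\<lambda>x a. if bounded (range a) then a x else 0)"
  define U where "U = Pi\<^sub>E UNIV (\<lambda>a. {- \<bar>B a\<bar>..\<bar>B a\<bar>})"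
  have XU: "X x \<in> U" for x
  proof -
    have "- \<bar>B a\<bar> \<le> a x \<and> a x \<le> \<bar>B a\<bar>" if "bounded (range a)" for a
      using B[OF that, of x] by linarith
    then show ?thesis by (auto simp: X_def U_def)
  qed
  have "filtermap X F \<noteq> bot" using assms by (simp add: filtermap_bot_iff)
  moreover have "eventually (\<lambda>y. y \<in> U) (filtermap X F)"
    by (simp add: eventually_filtermap XU)
  moreover have "compact U" unfolding U_def by (rule compact_PiE_real)
  ultimately obtain p where p: "p \<in> U" "inf (nhds p) (filtermap X F) \<noteq> bot"
    unfolding compact_filter by blast
  define G where "G = inf F (filtercomap X (nhds p))"
  have "G \<noteq> bot"
  proof
    assume "G = bot"
    then have "eventually (\<lambda>_. False) G" by simp
    then obtain P Q where P: "eventually P F" and Q: "eventually Q (filtercomap X (nhds p))"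
      and PQ: "\<And>x. P x \<Longrightarrow> Q x \<Longrightarrow> False"
      unfolding G_def eventually_inf by auto
    from Q obtain R where R: "eventually R (nhds p)" "\<And>x. R (X x) \<Longrightarrow> Q x"
      unfolding eventually_filtercomap by auto
    have "eventually (\<lambda>y. \<not> R y) (filtermap X F)"
      unfolding eventually_filtermap using P by eventually_elim (use PQ R in blast)
    with R(1) have "eventually (\<lambda>_. False) (inf (nhds p) (filtermap X F))"
      unfolding eventually_inf by blast
    with p(2) show False by (simp add: trivial_limit_def)
  qed
  moreover have "G \<le> F" by (simp add: G_def)
  moreover have "\<exists>l. (a \<longlongrightarrow> l) G" if "bounded (range a)" for a :: "'a \<Rightarrow> real"
  proof -
    have 1: "filterlim X (nhds p) G"
      unfolding G_def by (meson filterlim_filtercomap filterlim_mono inf_le2 order_refl)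
    have "((\<lambda>y. y a) \<longlongrightarrow> p a) (nhds p)"
    proof (rule topological_tendstoI)
      fix S :: "real set" assume S: "open S" "p a \<in> S"
      have "open ((\<lambda>y. y a) -` S :: (('a \<Rightarrow> real) \<Rightarrow> real) set)"
        using continuous_on_product_coordinates[of a] S(1) open_vimage by blast
      then show "eventually (\<lambda>y. y a \<in> S) (nhds p)"
        unfolding eventually_nhds using S(2) by (auto intro!: exI[of _ "(\<lambda>y. y a) -` S"])
    qed
    then have "((\<lambda>x. X x a) \<longlongrightarrow> p a) G"
      using 1 by (rule filterlim_compose)
    then show ?thesis using that by (auto simp: X_def)
  qed
  ultimately show thesis using that by blast
qed

text \<open>The axioms are those of integration against a finitely additive
  \<open>V\<close>-invariant probability, defined on all functions bounded on \<open>X\<close>.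
  Limits of orbit averages satisfy them even for discontinuous \<open>V\<close>, where weak limits
  of empirical measures may fail to be invariant.\<close>

locale invariant_mean =
  fixes X :: "'x set" and V :: "'x \<Rightarrow> 'x" and Lam :: "('x \<Rightarrow> real) \<Rightarrow> real"
  assumes V_in: "x \<in> X \<Longrightarrow> V x \<in> X"
    and Lam_add: "bounded (f ` X) \<Longrightarrow> bounded (g ` X) \<Longrightarrow> Lam (\<lambda>x. f x + g x) = Lam f + Lam g"
    and Lam_scale: "bounded (f ` X) \<Longrightarrow> Lam (\<lambda>x. c * f x) = c * Lam f"
    and Lam_mono: "bounded (f ` X) \<Longrightarrow> bounded (g ` X) \<Longrightarrow> (\<And>x. x \<in> X \<Longrightarrow> f x \<le> g x) \<Longrightarrow> Lam f \<le> Lam g"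
    and Lam_one: "Lam (\<lambda>_. 1) = 1"
    and Lam_V: "bounded (f ` X) \<Longrightarrow> Lam (\<lambda>x. f (V x)) = Lam f"

lemma funpow_in:
  assumes "\<And>x. x \<in> X \<Longrightarrow> V x \<in> X" "x \<in> X"
  shows "(V ^^ n) x \<in> X"
  using assms by (induction n) auto

lemma abs_sum_div_le:
  fixes g :: "nat \<Rightarrow> real"
  assumes "\<And>j. j < K \<Longrightarrow> \<bar>g j\<bar> \<le> B" "0 \<le> B"
  shows "\<bar>(\<Sum>j<K. g j) / real K\<bar> \<le> B"
proof (cases "K = 0")
  case False
  have "\<bar>\<Sum>j<K. g j\<bar> \<le> (\<Sum>j<K. B)"
    by (rule order_trans[OF sum_abs sum_mono]) (use assms in auto)
  then show ?thesis using False by (simp add: field_simps abs_mult)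
qed (use assms in auto)

text \<open>\<open>Lam g\<close> is the limit, along a fixed refinement of
  \<open>sequentially\<close>, of the averages over the orbit segments of length \<open>K k\<close>
  from \<open>w k\<close>. Composing \<open>g\<close> with \<open>V\<close> changes such an average
  by two boundary terms divided by \<open>K k\<close>. The second conclusion carries eventual upper
  bounds for these averages over to \<open>Lam\<close>.\<close>

lemma invariant_mean_exists:
  fixes V :: "'x \<Rightarrow> 'x" and w :: "nat \<Rightarrow> 'x" and K :: "nat \<Rightarrow> nat"
  assumes V: "\<And>x. x \<in> X \<Longrightarrow> V x \<in> X" and w: "\<And>k. w k \<in> X"
    and K: "filterlim K at_top sequentially"
  obtains Lam where "invariant_mean X V Lam"
    "\<And>g c. bounded (g ` X) \<Longrightarrow> eventually (\<lambda>k. (\<Sum>j<K k. g ((V ^^ j) (w k))) / real (K k) \<le> c) sequentially \<Longrightarrow> Lam g \<le> c"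
proof -
  obtain G where G: "G \<le> sequentially" "G \<noteq> bot"
    "\<And>a :: nat \<Rightarrow> real. bounded (range a) \<Longrightarrow> \<exists>l. (a \<longlongrightarrow> l) G"
    using ultrafilter_limits[of sequentially] by auto
  define avg where "avg = (\<lambda>(g :: 'x \<Rightarrow> real) k. (\<Sum>j<K k. g ((V ^^ j) (w k))) / real (K k))"
  define Lam where "Lam = (\<lambda>g. Lim G (avg g))"
  have orb: "(V ^^ j) (w k) \<in> X" for j k using funpow_in[OF V w] .
  have lim: "(avg g \<longlongrightarrow> Lam g) G" if "bounded (g ` X)" for g
  proof -
    from that obtain B where B: "\<And>x. x \<in> X \<Longrightarrow> \<bar>g x\<bar> \<le> B" "0 \<le> B"
      by (auto simp: bounded_iff) (metis abs_ge_zero order_trans le_cases)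
    have "\<bar>avg g k\<bar> \<le> B" for k
      unfolding avg_def by (rule abs_sum_div_le) (use B orb in auto)
    then have "bounded (range (avg g))" by (auto simp: bounded_iff)
    from G(3)[OF this] show ?thesis
      unfolding Lam_def using G(2) by (metis tendsto_Lim)
  qed
  have evpos: "eventually (\<lambda>k. K k > 0) sequentially"
    using K by (auto simp: filterlim_at_top dest!: spec[of _ 1] elim!: eventually_mono)
  have LamE: "Lam g = l" if "bounded (g ` X)" "(avg g \<longlongrightarrow> l) G" for g l
    using lim[OF that(1)] that(2) tendsto_unique G(2) by blast
  have bdV: "bounded ((\<lambda>x. f (V x)) ` X)" if "bounded (f ` X)" for f :: "'x \<Rightarrow> real"
    by (rule bounded_subset[OF that]) (use V in auto)
  have "invariant_mean X V Lam"
  proof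
    show "V x \<in> X" if "x \<in> X" for x using V that .
  next
    fix f g :: "'x \<Rightarrow> real" assume f: "bounded (f ` X)" and g: "bounded (g ` X)"
    have bfg: "bounded ((\<lambda>x. f x + g x) ` X)" using f g by (rule bounded_plus_comp)
    have "avg (\<lambda>x. f x + g x) = (\<lambda>k. avg f k + avg g k)"
      by (auto simp: avg_def sum.distrib add_divide_distrib)
    then have "(avg (\<lambda>x. f x + g x) \<longlongrightarrow> Lam f + Lam g) G"
      using tendsto_add[OF lim[OF f] lim[OF g]] by simp
    then show "Lam (\<lambda>x. f x + g x) = Lam f + Lam g" using LamE bfg by blast
  next
    fix f :: "'x \<Rightarrow> real" and c assume f: "bounded (f ` X)"
    have bf: "bounded ((\<lambda>x. c * f x) ` X)"
      using bounded_scaling[OF f, of c] by (simp add: image_image)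
    have "avg (\<lambda>x. c * f x) = (\<lambda>k. c * avg f k)"
      by (auto simp: avg_def sum_distrib_left)
    then have "(avg (\<lambda>x. c * f x) \<longlongrightarrow> c * Lam f) G"
      using tendsto_mult_left[OF lim[OF f]] by simp
    then show "Lam (\<lambda>x. c * f x) = c * Lam f" using LamE bf by blast
  next
    fix f g :: "'x \<Rightarrow> real" assume f: "bounded (f ` X)" and g: "bounded (g ` X)"
      and le: "\<And>x. x \<in> X \<Longrightarrow> f x \<le> g x"
    have "avg f k \<le> avg g k" for k
      unfolding avg_def by (intro divide_right_mono sum_mono le orb) auto
    then show "Lam f \<le> Lam g"
      by (intro tendsto_le[OF G(2) lim[OF g] lim[OF f]]) auto
  next
    have "(avg (\<lambda>_. 1) \<longlongrightarrow> 1) sequentially"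
      by (rule tendsto_eventually) (use evpos in eventually_elim, auto simp: avg_def)
    then have "(avg (\<lambda>_. 1) \<longlongrightarrow> 1) G" using G(1) tendsto_mono by blast
    then show "Lam (\<lambda>_. 1) = 1" by (intro LamE) (auto simp: image_constant_conv)
  next
    fix f :: "'x \<Rightarrow> real" assume f: "bounded (f ` X)"
    then obtain B where B: "\<And>x. x \<in> X \<Longrightarrow> \<bar>f x\<bar> \<le> B"
      by (auto simp: bounded_iff)
    have diff: "avg (\<lambda>x. f (V x)) k - avg f k = (f ((V ^^ K k) (w k)) - f (w k)) / real (K k)" for k
    proof -
      have "(\<Sum>j<K k. f (V ((V ^^ j) (w k)))) - (\<Sum>j<K k. f ((V ^^ j) (w k))) = f ((V ^^ K k) (w k)) - f (w k)"
        by (simp add: sum_subtractf[symmetric] sum_lessThan_telescope[where f="\<lambda>j. f ((V ^^ j) (w k))", simplified])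
      then show ?thesis by (simp add: avg_def diff_divide_distrib[symmetric])
    qed
    have "((\<lambda>k. avg (\<lambda>x. f (V x)) k - avg f k) \<longlongrightarrow> 0) sequentially"
    proof (rule Lim_null_comparison)
      show "\<forall>\<^sub>F k in sequentially. norm (avg (\<lambda>x. f (V x)) k - avg f k) \<le> 2 * B / real (K k)"
      proof (rule always_eventually, rule allI)
        fix k
        have "\<bar>f ((V ^^ K k) (w k)) - f (w k)\<bar> \<le> 2 * B"
          using B[OF orb[of "K k" k]] B[OF orb[of 0 k]] by auto
        then show "norm (avg (\<lambda>x. f (V x)) k - avg f k) \<le> 2 * B / real (K k)"
          unfolding diff by (simp add: divide_right_mono)
      qed
      have "filterlim (\<lambda>k. real (K k)) at_top sequentially"
        using K filterlim_compose filterlim_real_sequentially by blast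
      then show "((\<lambda>k. 2 * B / real (K k)) \<longlongrightarrow> 0) sequentially"
        by (rule real_tendsto_divide_at_top[OF tendsto_const])
    qed
    then have "((\<lambda>k. avg (\<lambda>x. f (V x)) k - avg f k) \<longlongrightarrow> 0) G" using G(1) tendsto_mono by blast
    from tendsto_add[OF this lim[OF f]] show "Lam (\<lambda>x. f (V x)) = Lam f"
      by (intro LamE bdV f) simp
  qed
  moreover have "Lam g \<le> c" if "bounded (g ` X)" "eventually (\<lambda>k. (\<Sum>j<K k. g ((V ^^ j) (w k))) / real (K k) \<le> c) sequentially" for g c
    by (rule tendsto_upperbound[OF lim[OF that(1)] _ G(2)])
      (use that(2) G(1) in \<open>auto simp: avg_def filter_leD\<close>)
  ultimately show thesis using that by blast
qed

text \<open>Dyadic convex combinations of the powers of the composition operator of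
  \<open>V\<close>. They are kept as operators on all functions so that the same combination acts on
  every \<open>F s t\<close> at once; closure under shift and midpoint is what the parallelogram law
  uses.\<close>

inductive convex_op :: "('x \<Rightarrow> 'x) \<Rightarrow> (('x \<Rightarrow> real) \<Rightarrow> 'x \<Rightarrow> real) \<Rightarrow> bool" for V where
  convex_op_id: "convex_op V (\<lambda>g. g)"
| convex_op_shift: "convex_op V P \<Longrightarrow> convex_op V (\<lambda>g x. P g (V x))"
| convex_op_mid: "convex_op V P \<Longrightarrow> convex_op V P' \<Longrightarrow> convex_op V (\<lambda>g x. (P g x + P' g x) / 2)"

text \<open>Only finitely many powers of \<open>V\<close> occur in \<open>P\<close> and their
  weights sum to one, so agreement up to \<open>e\<close> on a window of the orbits is inherited.
  Functions and points vary independently because the window compares different translates at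
  different points.\<close>

lemma convex_op_local:
  assumes "convex_op V P"
  shows "\<exists>W. \<forall>f g x y e. (\<forall>i<W. \<bar>f ((V ^^ i) x) - g ((V ^^ i) y)\<bar> \<le> e) \<longrightarrow> \<bar>P f x - P g y\<bar> \<le> e"
  using assms
proof induction
  case convex_op_id
  show ?case by (rule exI[of _ 1]) auto
next
  case (convex_op_shift P)
  then obtain W where W: "\<And>f g x y e. (\<forall>i<W. \<bar>f ((V ^^ i) x) - g ((V ^^ i) y)\<bar> \<le> e) \<Longrightarrow> \<bar>P f x - P g y\<bar> \<le> e"
    by blast
  show ?case
  proof (intro exI[of _ "Suc W"] allI impI W)
    fix f g :: "'a \<Rightarrow> real" and x y e i assume *: "\<forall>i<Suc W. \<bar>f ((V ^^ i) x) - g ((V ^^ i) y)\<bar> \<le> e" and "i < W"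
    then show "\<bar>f ((V ^^ i) (V x)) - g ((V ^^ i) (V y))\<bar> \<le> e"
      using *[rule_format, of "Suc i"] by (simp add: funpow_swap1)
  qed
next
  case (convex_op_mid P P')
  then obtain W W' where W: "\<And>f g x y e. (\<forall>i<W. \<bar>f ((V ^^ i) x) - g ((V ^^ i) y)\<bar> \<le> e) \<Longrightarrow> \<bar>P f x - P g y\<bar> \<le> e"
    and W': "\<And>f g x y e. (\<forall>i<W'. \<bar>f ((V ^^ i) x) - g ((V ^^ i) y)\<bar> \<le> e) \<Longrightarrow> \<bar>P' f x - P' g y\<bar> \<le> e"
    by blast
  show ?case
  proof (intro exI[of _ "max W W'"] allI impI)
    fix f g :: "'a \<Rightarrow> real" and x y e assume *: "\<forall>i<max W W'. \<bar>f ((V ^^ i) x) - g ((V ^^ i) y)\<bar> \<le> e"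
    have "\<bar>P f x - P g y\<bar> \<le> e" "\<bar>P' f x - P' g y\<bar> \<le> e"
      using * by (auto intro!: W W')
    then show "\<bar>(P f x + P' f x) / 2 - (P g y + P' g y) / 2\<bar> \<le> e" by (auto simp: abs_if field_simps split: if_splits)
  qed
qed

lemma convex_op_sum:
  assumes "convex_op V P"
  shows "P (\<lambda>x. \<Sum>r\<in>I. f r x) y = (\<Sum>r\<in>I. P (f r) y)"
  using assms by (induction arbitrary: y) (auto simp: sum.distrib sum_divide_distrib[symmetric])

lemma convex_op_comp:
  assumes "convex_op V P"
  shows "P (\<lambda>x. f (V x)) y = P f (V y)"
  using assms by (induction arbitrary: y) auto

lemma convex_op_abs_le:
  assumes "convex_op V P" "\<And>x. x \<in> X \<Longrightarrow> V x \<in> X" "\<And>x. x \<in> X \<Longrightarrow> \<bar>f x\<bar> \<le> B" "x \<in> X"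
  shows "\<bar>P f x\<bar> \<le> B"
  using assms(1,4)
proof (induction arbitrary: x)
  case (convex_op_mid P P')
  from convex_op_mid(3,4)[OF \<open>x \<in> X\<close>] show ?case by (auto simp: abs_if field_simps split: if_splits)
qed (use assms in auto)

lemma convex_op_funpow:
  assumes "convex_op V P"
  shows "convex_op V (\<lambda>g x. P g ((V ^^ w) x))"
proof (induction w)
  case (Suc w)
  from convex_op_shift[OF this] show ?case by (simp add: funpow_swap1)
qed (use assms in simp)

context invariant_mean
begin

abbreviation bd :: "('x \<Rightarrow> real) \<Rightarrow> bool" where "bd f \<equiv> bounded (f ` X)"

lemma bdI: "(\<And>x. x \<in> X \<Longrightarrow> \<bar>f x\<bar> \<le> B) \<Longrightarrow> bd f"
  by (auto simp: bounded_iff)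

lemma bdE:
  assumes "bd f"
  obtains B where "B \<ge> 0" "\<And>x. x \<in> X \<Longrightarrow> \<bar>f x\<bar> \<le> B"
proof -
  from assms obtain B where "\<And>x. x \<in> X \<Longrightarrow> \<bar>f x\<bar> \<le> B" by (auto simp: bounded_iff)
  then show thesis by (intro that[of "\<bar>B\<bar>"]) force+
qed

lemma bd_const [simp]: "bd (\<lambda>x. c)"
  by (rule bdI[of _ "\<bar>c\<bar>"]) simp

lemma bd_add: "bd f \<Longrightarrow> bd g \<Longrightarrow> bd (\<lambda>x. f x + g x)"
  by (rule bounded_plus_comp)

lemma bd_diff: "bd f \<Longrightarrow> bd g \<Longrightarrow> bd (\<lambda>x. f x - g x)"
  by (rule bounded_minus_comp)

lemma bd_mult:
  assumes "bd f" "bd g" shows "bd (\<lambda>x. f x * g x)"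
proof -
  obtain A B where "A \<ge> 0" "\<And>x. x \<in> X \<Longrightarrow> \<bar>f x\<bar> \<le> A" "B \<ge> 0" "\<And>x. x \<in> X \<Longrightarrow> \<bar>g x\<bar> \<le> B"
    using assms bdE by metis
  then show ?thesis by (intro bdI[of _ "A * B"]) (auto simp: abs_mult intro!: mult_mono)
qed

lemma bd_power2: "bd f \<Longrightarrow> bd (\<lambda>x. (f x)\<^sup>2)"
  unfolding power2_eq_square by (rule bd_mult)

lemma bd_sum: "(\<And>i. i \<in> I \<Longrightarrow> bd (f i)) \<Longrightarrow> bd (\<lambda>x. \<Sum>i\<in>I. f i x)"
proof (induction I rule: infinite_finite_induct)
  case (insert i I)
  then show ?case using bd_add[of "f i" "\<lambda>x. \<Sum>i\<in>I. f i x"] by simp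
qed simp_all

lemma funpow_V_in: "x \<in> X \<Longrightarrow> (V ^^ n) x \<in> X"
  by (rule funpow_in[OF V_in])

lemma bd_funpow: "bd f \<Longrightarrow> bd (\<lambda>x. f ((V ^^ w) x))"
  by (erule bounded_subset) (auto intro: funpow_V_in)

lemma bd_convex_op: "convex_op V P \<Longrightarrow> bd f \<Longrightarrow> bd (P f)"
  by (erule bdE, rule bdI, erule convex_op_abs_le[OF _ V_in])

lemma Lam_const: "Lam (\<lambda>x. c) = c"
  using Lam_scale[of "\<lambda>_. 1" c] Lam_one by simp

lemma Lam_nonneg: "bd f \<Longrightarrow> (\<And>x. x \<in> X \<Longrightarrow> 0 \<le> f x) \<Longrightarrow> 0 \<le> Lam f"
  using Lam_mono[of "\<lambda>_. 0" f] by (simp add: Lam_const)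

lemma Lam_sum: "(\<And>i. i \<in> I \<Longrightarrow> bd (f i)) \<Longrightarrow> Lam (\<lambda>x. \<Sum>i\<in>I. f i x) = (\<Sum>i\<in>I. Lam (f i))"
proof (induction I rule: infinite_finite_induct)
  case (insert i I)
  then show ?case using Lam_add[of "f i" "\<lambda>x. \<Sum>i\<in>I. f i x"] bd_sum[of I f] by simp
qed (simp_all add: Lam_const)

lemma Lam_diff: "bd f \<Longrightarrow> bd g \<Longrightarrow> Lam (\<lambda>x. f x - g x) = Lam f - Lam g"
  using Lam_add[of f "\<lambda>x. (-1) * g x"] Lam_scale[of g "-1"] bd_mult[of "\<lambda>_. -1" g] by simp

lemma Lam_funpow: "bd f \<Longrightarrow> Lam (\<lambda>x. f ((V ^^ w) x)) = Lam f"
proof (induction w)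
  case (Suc w)
  then show ?case using Lam_V[of "\<lambda>x. f ((V ^^ w) x)"] bd_funpow[of f w]
    by (simp add: funpow_swap1)
qed simp

lemma Lam_convex_op:
  assumes "convex_op V P" "bd f"
  shows "Lam (P f) = Lam f"
  using assms
proof induction
  case (convex_op_mid P P')
  have b: "bd (P f)" "bd (P' f)" using bd_convex_op[of P f] bd_convex_op[of P' f] convex_op_mid by simp_all
  show ?case using Lam_scale[OF bd_add[OF b], of "1/2"] Lam_add[OF b] convex_op_mid by simp
next
  case (convex_op_shift P)
  then show ?case using Lam_V[of "P f"] bd_convex_op[of P f] by simp
qed simp

text \<open>By the parallelogram law, two convex combinations of almost minimal norm are close to each other.\<close>

lemma near_invariant:
  assumes "finite I" "\<And>i. i \<in> I \<Longrightarrow> bd (F i)" "\<epsilon> > 0"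
  obtains P where "convex_op V P"
    "\<And>w. (\<Sum>i\<in>I. Lam (\<lambda>x. (P (F i) x - P (F i) ((V ^^ w) x))\<^sup>2)) \<le> \<epsilon>"
proof -
  define Q where "Q = (\<lambda>P. \<Sum>i\<in>I. Lam (\<lambda>x. (P (F i) x)\<^sup>2))"
  have Q0: "Q P \<ge> 0" if "convex_op V P" for P
    unfolding Q_def
  proof (intro sum_nonneg Lam_nonneg)
    show "bd (\<lambda>x. (P (F i) x)\<^sup>2)" if "i \<in> I" for i
      using bd_power2[OF bd_convex_op[OF \<open>convex_op V P\<close> assms(2)[OF that]]] .
  qed simp
  define m where "m = Inf (Q ` Collect (convex_op V))"
  have bb: "bdd_below (Q ` Collect (convex_op V))" using Q0 by (auto intro!: bdd_belowI[of _ 0])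
  have mle: "m \<le> Q P" if "convex_op V P" for P
    unfolding m_def by (rule cInf_lower[OF _ bb]) (use that in auto)
  \<comment> \<open>By the parallelogram law the defect is 2 Q(P) + 2 Q(P') - 4 Q(M) with M the
    midpoint of P and its translate P'. Invariance gives Q(P') = Q(P), so the defect is at most 4
    (Q(P) - m); hence the margin \<epsilon> / 4. As \<open>P\<close> is chosen before
    \<open>w\<close>, the bound is uniform in \<open>w\<close>.\<close>
  have "\<exists>y\<in>Q ` Collect (convex_op V). y < m + \<epsilon> / 4"
    unfolding m_def by (rule cInf_lessD) (use assms convex_op_id[of V] in auto)
  then obtain P where P: "convex_op V P" "Q P < m + \<epsilon> / 4" by auto
  have "(\<Sum>i\<in>I. Lam (\<lambda>x. (P (F i) x - P (F i) ((V ^^ w) x))\<^sup>2)) \<le> \<epsilon>" for w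
  proof -
    let ?P' = "\<lambda>g x. P g ((V ^^ w) x)"
    have P': "convex_op V ?P'" using convex_op_funpow P(1) .
    let ?M = "\<lambda>g x. (P g x + ?P' g x) / 2"
    have M: "convex_op V ?M" using convex_op_mid P(1) P' .
    have QP': "Q ?P' = Q P"
      unfolding Q_def
    proof (rule sum.cong[OF refl])
      fix i assume "i \<in> I"
      then have "bd (\<lambda>x. (P (F i) x)\<^sup>2)" using bd_power2[OF bd_convex_op[OF P(1) assms(2)]] by simp
      from Lam_funpow[OF this, of w] show "Lam (\<lambda>x. (P (F i) ((V ^^ w) x))\<^sup>2) = Lam (\<lambda>x. (P (F i) x)\<^sup>2)" .
    qed
    have "Lam (\<lambda>x. (P (F i) x - ?P' (F i) x)\<^sup>2) = 2 * Lam (\<lambda>x. (P (F i) x)\<^sup>2) + 2 * Lam (\<lambda>x. (?P' (F i) x)\<^sup>2) - 4 * Lam (\<lambda>x. (?M (F i) x)\<^sup>2)"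
      if "i \<in> I" for i
    proof -
      have b: "bd (P (F i))" "bd (?P' (F i))" "bd (?M (F i))"
        using bd_convex_op[OF P(1), of "F i"] bd_convex_op[OF P', of "F i"] bd_convex_op[OF M, of "F i"] assms(2)[OF that] by simp_all
      have "Lam (\<lambda>x. (P (F i) x - ?P' (F i) x)\<^sup>2) = Lam (\<lambda>x. 2 * (P (F i) x)\<^sup>2 + 2 * (?P' (F i) x)\<^sup>2 - 4 * (?M (F i) x)\<^sup>2)"
        by (rule arg_cong[of _ _ Lam]) (auto simp: fun_eq_iff power2_eq_square field_simps)
      also have "\<dots> = Lam (\<lambda>x. 2 * (P (F i) x)\<^sup>2 + 2 * (?P' (F i) x)\<^sup>2) - Lam (\<lambda>x. 4 * (?M (F i) x)\<^sup>2)"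
        by (intro Lam_diff bd_add bd_mult bd_const bd_power2 b)
      also have "Lam (\<lambda>x. 2 * (P (F i) x)\<^sup>2 + 2 * (?P' (F i) x)\<^sup>2) = Lam (\<lambda>x. 2 * (P (F i) x)\<^sup>2) + Lam (\<lambda>x. 2 * (?P' (F i) x)\<^sup>2)"
        by (intro Lam_add bd_mult bd_const bd_power2 b)
      also have "Lam (\<lambda>x. 2 * (P (F i) x)\<^sup>2) = 2 * Lam (\<lambda>x. (P (F i) x)\<^sup>2)" by (intro Lam_scale bd_power2 b)
      also have "Lam (\<lambda>x. 2 * (?P' (F i) x)\<^sup>2) = 2 * Lam (\<lambda>x. (?P' (F i) x)\<^sup>2)" by (intro Lam_scale bd_power2 b)
      also have "Lam (\<lambda>x. 4 * (?M (F i) x)\<^sup>2) = 4 * Lam (\<lambda>x. (?M (F i) x)\<^sup>2)" by (intro Lam_scale bd_power2 b)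
      finally show ?thesis .
    qed
    then have "(\<Sum>i\<in>I. Lam (\<lambda>x. (P (F i) x - P (F i) ((V ^^ w) x))\<^sup>2)) = 2 * Q P + 2 * Q ?P' - 4 * Q ?M"
      unfolding Q_def by (simp add: sum.distrib sum_subtractf sum_distrib_left)
    also have "\<dots> \<le> \<epsilon>" using P(2) QP' mle[OF M] by linarith
    finally show ?thesis .
  qed
  with P(1) show thesis using that by blast
qed

end

section \<open>Combining two almost invariant translations of the indices\<close>

lemma diagonal_chain:
  fixes H :: "nat \<Rightarrow> nat \<Rightarrow> real"
  assumes "\<And>s t. s \<le> B \<Longrightarrow> t \<le> B \<Longrightarrow> \<bar>H s t - H (s + a) (t + b)\<bar> \<le> \<tau>"
    and "s + k * a \<le> B" "t + k * b \<le> B"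
  shows "\<bar>H s t - H (s + k * a) (t + k * b)\<bar> \<le> real k * \<tau>"
  using assms(2,3)
proof (induction k)
  case (Suc k)
  have "\<bar>H s t - H (s + k * a) (t + k * b)\<bar> \<le> real k * \<tau>" using Suc by simp
  moreover have "\<bar>H (s + k * a) (t + k * b) - H (s + k * a + a) (t + k * b + b)\<bar> \<le> \<tau>"
    using Suc.prems by (intro assms(1)) auto
  ultimately show ?case by (simp add: algebra_simps)
qed simp

lemma nearly_constant_on_progression:
  fixes G :: "nat \<Rightarrow> real"
  assumes "\<And>t. t < K * D \<Longrightarrow> \<bar>G t - G (t + D)\<bar> \<le> \<tau>" "r \<le> K" "0 < D"
  shows "\<bar>G 0 - G (r * D)\<bar> \<le> real r * \<tau>"
  using assms(2)
proof (induction r)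
  case (Suc r)
  have "\<bar>G (r * D) - G (r * D + D)\<bar> \<le> \<tau>" using Suc.prems assms(3) by (intro assms(1)) auto
  with Suc show ?case by (simp add: algebra_simps)
qed simp

text \<open>The idea is the identity \<open>n (a, b) - a (n, m) = (0, nb - ma)\<close> between translations.\<close>

lemma two_translations:
  fixes H :: "nat \<Rightarrow> nat \<Rightarrow> real" and n m a b K B :: nat
  defines "D \<equiv> nat \<bar>int (n * b) - int (m * a)\<bar>"
  assumes 1: "\<And>s t. s \<le> B \<Longrightarrow> t \<le> B \<Longrightarrow> \<bar>H s t - H (s + n) (t + m)\<bar> \<le> \<tau>"
    and 2: "\<And>s t. s \<le> B \<Longrightarrow> t \<le> B \<Longrightarrow> \<bar>H s t - H (s + a) (t + b)\<bar> \<le> \<tau>"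
    and B: "n * a \<le> B" "K * D + n * b + m * a \<le> B" and K: "0 < K" and ne: "n * b \<noteq> m * a"
    and \<tau>: "0 \<le> \<tau>"
  shows "\<bar>H 0 0\<bar> \<le> \<bar>\<Sum>r<K. H (n * a) (min (n * b) (m * a) + r * D)\<bar> / real K + real ((K + 1) * (n + a)) * \<tau>"
proof -
  define l where "l = min (n * b) (m * a)"
  define G where "G = (\<lambda>t. H (n * a) (l + t))"
  define \<sigma> where "\<sigma> = real (n + a) * \<tau>"
  \<comment> \<open>Following (n, m) for \<open>a\<close> steps and (a, b) for \<open>n\<close>
    steps leads in both cases to the first index \<open>n * a\<close>; comparing the two end points
    gives almost invariance of \<open>G\<close> under \<open>D\<close>.\<close>
  have e1: "\<bar>H 0 t - H (n * a) (t + m * a)\<bar> \<le> real a * \<tau>" if "t + m * a \<le> B" for t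
    using diagonal_chain[of B H n m \<tau> 0 a t, OF 1] that B(1) by (simp add: mult.commute)
  have e2: "\<bar>H 0 t - H (n * a) (t + n * b)\<bar> \<le> real n * \<tau>" if "t + n * b \<le> B" for t
    using diagonal_chain[of B H a b \<tau> 0 n t, OF 2] that B(1) by (simp add: mult.commute)
  have D: "D > 0" using ne unfolding D_def by (simp add: of_nat_mult[symmetric] del: of_nat_mult)
  have lD: "(l = n * b \<and> l + D = m * a) \<or> (l = m * a \<and> l + D = n * b)"
  proof -
    have "(min p q = p \<and> min p q + nat \<bar>int p - int q\<bar> = q) \<or> (min p q = q \<and> min p q + nat \<bar>int p - int q\<bar> = p)" for p q :: nat
      by (auto simp: min_def)
    then show ?thesis unfolding l_def D_def .
  qed
  have stp: "\<bar>G t - G (t + D)\<bar> \<le> \<sigma>" if "t < K * D" for t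
  proof -
    have "\<bar>H (n * a) (t + m * a) - H (n * a) (t + n * b)\<bar> \<le> \<sigma>"
      using e1[of t] e2[of t] that B(2) unfolding \<sigma>_def by (simp add: algebra_simps)
    moreover have "(l + t = t + n * b \<and> l + (t + D) = t + m * a) \<or> (l + t = t + m * a \<and> l + (t + D) = t + n * b)"
      using lD by auto
    ultimately show ?thesis unfolding G_def by (metis abs_minus_commute)
  qed
  have G0: "\<bar>H 0 0 - G 0\<bar> \<le> \<sigma>"
  proof -
    have "real a * \<tau> \<le> \<sigma>" "real n * \<tau> \<le> \<sigma>" unfolding \<sigma>_def using \<tau> by (auto intro!: mult_right_mono)
    then show ?thesis using e1[of 0] e2[of 0] B(2) unfolding G_def l_def by (auto simp: min_def)
  qed
  have \<sigma>0: "0 \<le> \<sigma>" unfolding \<sigma>_def using \<tau> by simp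
  have gr: "\<bar>G 0 - G (r * D)\<bar> \<le> real K * \<sigma>" if "r < K" for r
  proof -
    have "\<bar>G 0 - G (r * D)\<bar> \<le> real r * \<sigma>"
      by (rule nearly_constant_on_progression[of K]) (use stp that D in auto)
    also have "\<dots> \<le> real K * \<sigma>" using that \<sigma>0 by (intro mult_right_mono) auto
    finally show ?thesis .
  qed
  \<comment> \<open>\<open>G 0\<close> nearly equals each \<open>G (r * D)\<close>, hence also their
    average, which stays in the bound as its first summand.\<close>
  have "real K * G 0 = (\<Sum>r<K. G (r * D)) + (\<Sum>r<K. G 0 - G (r * D))"
    by (simp add: sum_subtractf)
  moreover have "\<bar>\<Sum>r<K. G 0 - G (r * D)\<bar> \<le> (\<Sum>r<K. real K * \<sigma>)"
    by (rule order_trans[OF sum_abs sum_mono]) (use gr in auto)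
  ultimately have "real K * \<bar>G 0\<bar> \<le> \<bar>\<Sum>r<K. G (r * D)\<bar> + real K * (real K * \<sigma>)"
    by (simp add: abs_mult[symmetric])
  then have "\<bar>G 0\<bar> \<le> \<bar>\<Sum>r<K. G (r * D)\<bar> / real K + real K * \<sigma>"
    using K by (simp add: field_simps)
  with G0 have "\<bar>H 0 0\<bar> \<le> \<bar>\<Sum>r<K. G (r * D)\<bar> / real K + real K * \<sigma> + \<sigma>" by linarith
  also have "\<dots> = \<bar>\<Sum>r<K. G (r * D)\<bar> / real K + real ((K + 1) * (n + a)) * \<tau>"
    unfolding \<sigma>_def by (simp add: algebra_simps)
  finally show ?thesis unfolding G_def l_def .
qed

lemma sum_squares_3:
  fixes a b c :: real
  shows "(a + b + c)\<^sup>2 \<le> 3 * (a\<^sup>2 + b\<^sup>2 + c\<^sup>2)"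
proof -
  have "3 * (a\<^sup>2 + b\<^sup>2 + c\<^sup>2) - (a + b + c)\<^sup>2 = (a - b)\<^sup>2 + (b - c)\<^sup>2 + (a - c)\<^sup>2"
    by (simp add: power2_eq_square algebra_simps)
  then show ?thesis by (smt (verit) zero_le_power2)
qed

text \<open>By the condition \<open>scale\<close>, going \<open>u\<close> steps ahead amounts, outside a set \<open>E\<close> of small density, to a translation
  of the indices by \<open>(al x, bl x)\<close>.\<close>

locale drifting_averages =
  fixes X :: "'x set" and V :: "'x \<Rightarrow> 'x" and F :: "nat \<Rightarrow> nat \<Rightarrow> 'x \<Rightarrow> real"
    and n m A0 :: nat and Adm :: "(nat \<times> nat) set" and \<kappa> :: real
  assumes V_in_X: "x \<in> X \<Longrightarrow> V x \<in> X"
    and F_le_1: "x \<in> X \<Longrightarrow> \<bar>F s t x\<bar> \<le> 1"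
    and F_V: "F s t (V x) = F (s + n) (t + m) x"
    and Adm_ne: "(a, b) \<in> Adm \<Longrightarrow> n * b \<noteq> m * a"
    and kill: "\<epsilon> > 0 \<Longrightarrow> \<exists>K>0. \<forall>(a, b)\<in>Adm. \<forall>x\<in>X. \<forall>s t.
      \<bar>\<Sum>r<K. F s (t + r * nat \<bar>int (n * b) - int (m * a)\<bar>) x\<bar> \<le> \<epsilon> * real K"
    and \<kappa>: "\<kappa> > 0"
    and scale: "\<epsilon> > 0 \<Longrightarrow> \<exists>u al bl E.
      (\<forall>x\<in>X. al x \<le> A0 \<and> bl x \<le> A0) \<and>
      (\<exists>K0. \<forall>K\<ge>K0. \<forall>x\<in>X. real (card {j. j < K \<and> (V ^^ j) x \<in> E}) \<le> \<epsilon> * real K) \<and>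
      (\<forall>x\<in>X - E. \<forall>s\<le>B. \<forall>t\<le>B. \<forall>i<W. \<bar>F s t ((V ^^ (u + i)) x) - F (s + al x) (t + bl x) ((V ^^ i) x)\<bar> \<le> \<epsilon>) \<and>
      (\<exists>W2>0. \<forall>x\<in>X. real (card {w. w < W2 \<and> (al ((V ^^ w) x), bl ((V ^^ w) x)) \<in> Adm}) \<ge> \<kappa> * real W2)"
begin

text \<open>Averages above \<epsilon> would give an invariant mean with \<open>Lam (F 0 0)\<close>
  at least \<epsilon>, whereas the almost invariant combination \<open>P (F 0 0)\<close> has the
  same mean and is small up to an error of small mean. The order of choices is \<open>K\<close> from
  \<open>kill\<close>, then the index box, then \<open>P\<close> with its window \<open>W\<close>,
  then the scale; hence \<kappa> and \<open>A0\<close> are fixed in the locale.\<close>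

lemma averages_upper_bound:
  assumes "\<epsilon> > 0"
  shows "\<exists>K0. \<forall>K\<ge>K0. \<forall>x\<in>X. (\<Sum>j<K. F 0 0 ((V ^^ j) x)) \<le> \<epsilon> * real K"
proof (rule ccontr)
  assume "\<not> ?thesis"
  then have "\<forall>k. \<exists>K x. K \<ge> Suc k \<and> x \<in> X \<and> (\<Sum>j<K. F 0 0 ((V ^^ j) x)) > \<epsilon> * real K"
    by (meson not_le)
  then obtain Kk wk where Kk: "\<And>k. Kk k \<ge> Suc k" and wk: "\<And>k. wk k \<in> X"
    and big: "\<And>k. (\<Sum>j<Kk k. F 0 0 ((V ^^ j) (wk k))) > \<epsilon> * real (Kk k)"
    by metis
  have Klim: "filterlim Kk at_top sequentially"
    unfolding filterlim_at_top eventually_sequentially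
  proof (intro allI exI impI)
    fix Z k :: nat assume "Z \<le> k" then show "Z \<le> Kk k" using Kk[of k] by simp
  qed
  obtain Lam where Lam: "invariant_mean X V Lam"
    and Lam_le: "\<And>g c. bounded (g ` X) \<Longrightarrow> eventually (\<lambda>k. (\<Sum>j<Kk k. g ((V ^^ j) (wk k))) / real (Kk k) \<le> c) sequentially \<Longrightarrow> Lam g \<le> c"
    by (rule invariant_mean_exists[of X V wk Kk, OF V_in_X wk Klim]) (assumption | rule that)+
  interpret invariant_mean X V Lam by (rule Lam)
  have bdF: "bd (F s t)" for s t using F_le_1 by (rule bdI)
  have LamF: "Lam (F 0 0) \<ge> \<epsilon>"
  proof -
    have "Lam (\<lambda>x. - 1 * F 0 0 x) \<le> - \<epsilon>"
    proof (rule Lam_le)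
      show "bounded ((\<lambda>x. - 1 * F 0 0 x) ` X)" using bd_mult[OF bd_const bdF] .
      have "(\<Sum>j<Kk k. - 1 * F 0 0 ((V ^^ j) (wk k))) / real (Kk k) \<le> - \<epsilon>" for k
        using big[of k] Kk[of k] by (simp add: field_simps sum_negf)
      then show "eventually (\<lambda>k. (\<Sum>j<Kk k. - 1 * F 0 0 ((V ^^ j) (wk k))) / real (Kk k) \<le> - \<epsilon>) sequentially"
        by simp
    qed
    then show ?thesis using Lam_scale[OF bdF, of "-1" 0 0] by simp
  qed
  from assms have "\<epsilon> / 4 > 0" by simp
  from kill[OF this] obtain K where K: "K > 0"
    and Kall: "\<forall>(a, b)\<in>Adm. \<forall>x\<in>X. \<forall>s t.
      \<bar>\<Sum>r<K. F s (t + r * nat \<bar>int (n * b) - int (m * a)\<bar>) x\<bar> \<le> \<epsilon> / 4 * real K" by blast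
  have Kkill: "\<bar>\<Sum>r<K. F s (t + r * nat \<bar>int (n * b) - int (m * a)\<bar>) x\<bar> \<le> \<epsilon> / 4 * real K"
    if "(a, b) \<in> Adm" "x \<in> X" for a b x s t
    using bspec[OF Kall that(1)] that(2) by simp
  \<comment> \<open>\<open>B'\<close> leaves room for the progression in
    \<open>two_translations\<close> for all \<open>a\<close>, \<open>b\<close> up to
    \<open>A0\<close>; the margin \<open>A0\<close> in \<open>B\<close> keeps the inner box inside
    \<open>I\<close> after a translation by (a, b).\<close>
  define B' where "B' = (K + 1) * (n * A0 + m * A0)"
  define B where "B = B' + A0"
  define I where "I = {..B} \<times> {..B}"
  define I' where "I' = {..B'} \<times> {..B'}"
  define N where "N = real (card I)"
  \<comment> \<open>\<open>C1\<close> bounds the factor (K + 1)(n + a) of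
    \<open>two_translations\<close>. The constants make \<open>C1 * \<tau>0\<close> equal to
    \<epsilon> / 4 and \<open>C1 / \<tau>0 * \<rho>\<close> equal to \<epsilon> / 8, while
    \<open>\<delta>0\<close> and \<delta> keep the mean of the final error \<open>v\<close> at most
    \<rho>.\<close>
  define C1 where "C1 = real ((K + 1) * (n + A0)) + 1"
  define \<tau>0 where "\<tau>0 = \<epsilon> / (4 * C1)"
  define \<rho> where "\<rho> = \<epsilon> * \<tau>0 / (8 * C1)"
  define \<delta>0 where "\<delta>0 = min (\<rho> / 2) (\<rho> * \<kappa> / 24)"
  define \<delta> where "\<delta> = min 1 (\<rho> * \<kappa> / (60 * N))"
  have fin: "finite I" "finite I'" and NI: "N \<ge> 1" and I'I: "I' \<subseteq> I"
    by (auto simp: I_def I'_def N_def B_def)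
  have C1: "C1 \<ge> 1" by (simp add: C1_def)
  have \<tau>0: "\<tau>0 > 0" and \<rho>: "\<rho> > 0" using assms C1 by (auto simp: \<tau>0_def \<rho>_def)
  have \<delta>0: "\<delta>0 > 0" and \<delta>: "\<delta> > 0" using \<rho> \<kappa> NI by (auto simp: \<delta>0_def \<delta>_def)
  obtain P where P: "convex_op V P"
    and Pinv: "\<And>w. (\<Sum>i\<in>I. Lam (\<lambda>x. (P (F (fst i) (snd i)) x - P (F (fst i) (snd i)) ((V ^^ w) x))\<^sup>2)) \<le> \<delta>0"
    by (rule near_invariant[OF fin(1), of "\<lambda>i. F (fst i) (snd i)", OF bdF \<delta>0]) (assumption | rule that)+
  obtain W where W: "\<And>f g x y e. (\<forall>i<W. \<bar>f ((V ^^ i) x) - g ((V ^^ i) y)\<bar> \<le> e) \<Longrightarrow> \<bar>P f x - P g y\<bar> \<le> e"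
    using convex_op_local[OF P] by blast
  from scale[OF \<delta>, of B W] obtain u al bl E where ab1: "\<forall>x\<in>X. al x \<le> A0 \<and> bl x \<le> A0"
    and E1: "\<exists>K0. \<forall>K\<ge>K0. \<forall>x\<in>X. real (card {j. j < K \<and> (V ^^ j) x \<in> E}) \<le> \<delta> * real K"
    and good1: "\<forall>x\<in>X - E. \<forall>s\<le>B. \<forall>t\<le>B. \<forall>i<W. \<bar>F s t ((V ^^ (u + i)) x) - F (s + al x) (t + bl x) ((V ^^ i) x)\<bar> \<le> \<delta>"
    and freq1: "\<exists>W2>0. \<forall>x\<in>X. real (card {w. w < W2 \<and> (al ((V ^^ w) x), bl ((V ^^ w) x)) \<in> Adm}) \<ge> \<kappa> * real W2"
    by blast
  from E1 obtain K0 where E: "\<And>k x. k \<ge> K0 \<Longrightarrow> x \<in> X \<Longrightarrow> real (card {j. j < k \<and> (V ^^ j) x \<in> E}) \<le> \<delta> * real k"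
    by blast
  from freq1 obtain W2 where W2: "W2 > 0"
    and freq: "\<And>x. x \<in> X \<Longrightarrow> real (card {w. w < W2 \<and> (al ((V ^^ w) x), bl ((V ^^ w) x)) \<in> Adm}) \<ge> \<kappa> * real W2"
    by blast
  note ab = ab1[rule_format] and good = good1[rule_format]
  define H where "H = (\<lambda>s t. P (F s t))"
  have bdH: "bd (H s t)" for s t unfolding H_def by (rule bd_convex_op[OF P bdF])
  have H1: "\<bar>H s t x\<bar> \<le> 1" if "x \<in> X" for s t x
    unfolding H_def by (rule convex_op_abs_le[OF P V_in_X F_le_1 that])
  have HV: "H s t (V x) = H (s + n) (t + m) x" for s t x
    using convex_op_comp[OF P, of "F s t" x] by (simp add: H_def F_V)
  define S where "S = (\<lambda>w x. \<Sum>i\<in>I. (H (fst i) (snd i) x - H (fst i) (snd i) ((V ^^ w) x))\<^sup>2)"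
  have bdS1: "bd (\<lambda>x. (H s t x - H s t ((V ^^ w) x))\<^sup>2)" for s t w
    by (intro bd_power2 bd_diff bdH bd_funpow)
  have bdS: "bd (S w)" for w unfolding S_def by (intro bd_sum bdS1)
  have LS: "Lam (S w) \<le> \<delta>0" for w
    unfolding S_def using Pinv[of w] by (subst Lam_sum) (simp_all add: H_def bdS1[unfolded H_def])
  define iE where "iE = (\<lambda>x. if x \<in> E then 1 else 0 :: real)"
  have bdiE: "bd iE" by (rule bdI[of _ 1]) (auto simp: iE_def)
  have LiE: "Lam iE \<le> \<delta>"
  proof (rule Lam_le[OF bdiE])
    show "\<forall>\<^sub>F k in sequentially. (\<Sum>j<Kk k. iE ((V ^^ j) (wk k))) / real (Kk k) \<le> \<delta>"
      unfolding eventually_sequentially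
    proof (intro exI allI impI)
      fix k assume "K0 \<le> k"
      then have "Kk k \<ge> K0" "Kk k > 0" using Kk[of k] by auto
      have "(\<Sum>j<Kk k. iE ((V ^^ j) (wk k))) = real (card {j. j < Kk k \<and> (V ^^ j) (wk k) \<in> E})"
        unfolding iE_def by (subst sum.If_cases) (auto intro!: arg_cong[of _ _ card])
      also have "\<dots> \<le> \<delta> * real (Kk k)" using E[OF \<open>Kk k \<ge> K0\<close> wk[of k]] .
      finally show "(\<Sum>j<Kk k. iE ((V ^^ j) (wk k))) / real (Kk k) \<le> \<delta>"
        using \<open>Kk k > 0\<close> by (simp add: field_simps)
    qed
  qed
  \<comment> \<open>On \<open>E\<close> there is only the trivial bound 2 for the difference, whose
    square is the factor of \<open>iE\<close>; this is harmless since \<open>iE\<close> has small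
    mean.\<close>
  have drift: "(H s t ((V ^^ u) y) - H (s + al y) (t + bl y) y)\<^sup>2 \<le> \<delta>\<^sup>2 + 4 * iE y"
    if "y \<in> X" "s \<le> B" "t \<le> B" for y s t
  proof (cases "y \<in> E")
    case True
    have "\<bar>H s t ((V ^^ u) y) - H (s + al y) (t + bl y) y\<bar> \<le> 2"
      using H1[OF funpow_V_in[OF that(1), of u], of s t] H1[OF that(1), of "s + al y" "t + bl y"] by linarith
    then have "(H s t ((V ^^ u) y) - H (s + al y) (t + bl y) y)\<^sup>2 \<le> 2\<^sup>2"
      by (simp only: abs_le_square_iff[symmetric] abs_numeral)
    then show ?thesis using True add_increasing[OF zero_le_power2[of \<delta>]] by (simp add: iE_def)
  next
    case False
    have "\<bar>H s t ((V ^^ u) y) - H (s + al y) (t + bl y) y\<bar> \<le> \<delta>"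
      unfolding H_def
    proof (rule W, intro allI impI)
      fix i assume "i < W"
      then have "\<bar>F s t ((V ^^ (u + i)) y) - F (s + al y) (t + bl y) ((V ^^ i) y)\<bar> \<le> \<delta>"
        using good that False by blast
      then show "\<bar>F s t ((V ^^ i) ((V ^^ u) y)) - F (s + al y) (t + bl y) ((V ^^ i) y)\<bar> \<le> \<delta>"
        by (simp add: funpow_add add.commute)
    qed
    then have "(H s t ((V ^^ u) y) - H (s + al y) (t + bl y) y)\<^sup>2 \<le> \<delta>\<^sup>2"
      using \<delta> by (simp add: abs_le_square_iff[symmetric])
    then show ?thesis using False by (simp add: iE_def)
  qed
  \<comment> \<open>\<open>e a b x\<close> measures how far the translation (a, b) is from being a
    symmetry at \<open>x\<close>. With (a, b) read off at \<open>y = (V ^^ w) x\<close>, it is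
    bounded by going from \<open>x\<close> to \<open>(V ^^ u) y\<close>, by the drift to
    \<open>y\<close> with translated indices, and back to \<open>x\<close>. So a drift seen anywhere
    along the orbit can be used at \<open>x\<close> itself.\<close>
  define e where "e = (\<lambda>a b x. \<Sum>i\<in>I'. (H (fst i) (snd i) x - H (fst i + a) (snd i + b) x)\<^sup>2)"
  define T where "T = (\<lambda>w x. 3 * (S (w + u) x + N * (\<delta>\<^sup>2 + 4 * iE ((V ^^ w) x)) + S w x))"
  have eT: "e (al ((V ^^ w) x)) (bl ((V ^^ w) x)) x \<le> T w x" if x: "x \<in> X" for w x
  proof -
    define y where "y = (V ^^ w) x"
    define a b where "a = al y" and "b = bl y"
    have y: "y \<in> X" unfolding y_def by (rule funpow_V_in[OF x])
    have ab': "a \<le> A0" "b \<le> A0" using ab[OF y] by (auto simp: a_def b_def)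
    have VV: "(V ^^ u) y = (V ^^ (w + u)) x" by (simp add: y_def funpow_add add.commute)
    let ?h = "\<lambda>i. H (fst i) (snd i)"
    let ?g = "\<lambda>i. H (fst i + a) (snd i + b)"
    have "(?h i x - ?g i x)\<^sup>2 \<le> 3 * ((?h i x - ?h i ((V ^^ (w + u)) x))\<^sup>2 + (\<delta>\<^sup>2 + 4 * iE y) + (?g i x - ?g i y)\<^sup>2)"
      if i: "i \<in> I'" for i
    proof -
      have "(?h i x - ?g i x)\<^sup>2 = ((?h i x - ?h i ((V ^^ (w + u)) x)) + (?h i ((V ^^ u) y) - ?g i y) + (?g i y - ?g i x))\<^sup>2"
        unfolding VV by simp
      also have "\<dots> \<le> 3 * ((?h i x - ?h i ((V ^^ (w + u)) x))\<^sup>2 + (?h i ((V ^^ u) y) - ?g i y)\<^sup>2 + (?g i y - ?g i x)\<^sup>2)"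
        by (rule sum_squares_3)
      also have "\<dots> \<le> 3 * ((?h i x - ?h i ((V ^^ (w + u)) x))\<^sup>2 + (\<delta>\<^sup>2 + 4 * iE y) + (?g i x - ?g i y)\<^sup>2)"
      proof -
        have "fst i \<le> B" "snd i \<le> B" using i by (auto simp: I'_def B_def)
        from drift[OF y this] show ?thesis
          unfolding a_def b_def by (simp add: power2_commute)
      qed
      finally show ?thesis .
    qed
    then have "e a b x \<le> (\<Sum>i\<in>I'. 3 * ((?h i x - ?h i ((V ^^ (w + u)) x))\<^sup>2 + (\<delta>\<^sup>2 + 4 * iE y) + (?g i x - ?g i y)\<^sup>2))"
      unfolding e_def by (rule sum_mono)
    also have "\<dots> = 3 * ((\<Sum>i\<in>I'. (?h i x - ?h i ((V ^^ (w + u)) x))\<^sup>2) + real (card I') * (\<delta>\<^sup>2 + 4 * iE y) + (\<Sum>i\<in>I'. (?g i x - ?g i y)\<^sup>2))"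
      by (simp add: sum_distrib_left[symmetric] sum.distrib)
    also have "\<dots> \<le> T w x"
    proof -
      have "(\<Sum>i\<in>I'. (?h i x - ?h i ((V ^^ (w + u)) x))\<^sup>2) \<le> S (w + u) x"
        unfolding S_def by (rule sum_mono2[OF fin(1) I'I]) auto
      moreover have "real (card I') * (\<delta>\<^sup>2 + 4 * iE y) \<le> N * (\<delta>\<^sup>2 + 4 * iE y)"
        unfolding N_def using card_mono[OF fin(1) I'I] by (intro mult_right_mono) (auto simp: iE_def)
      moreover have "(\<Sum>i\<in>I'. (?g i x - ?g i y)\<^sup>2) \<le> S w x"
      proof -
        let ?sh = "\<lambda>i. (fst i + a, snd i + b)"
        have "(\<Sum>i\<in>I'. (?g i x - ?g i y)\<^sup>2) = (\<Sum>i\<in>?sh ` I'. (?h i x - ?h i y)\<^sup>2)"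
          by (subst sum.reindex) (auto simp: inj_on_def prod_eq_iff)
        also have "\<dots> \<le> S w x"
          unfolding S_def y_def by (rule sum_mono2[OF fin(1)]) (use ab' in \<open>auto simp: I_def I'_def B_def\<close>)
        finally show ?thesis .
      qed
      ultimately show ?thesis unfolding T_def y_def[symmetric] by simp
    qed
    finally show ?thesis by (simp add: a_def b_def y_def)
  qed
  \<comment> \<open>At least \<open>\<kappa> * real W2\<close> of the times \<open>w\<close> below
    \<open>W2\<close> show an admissible drift, so with this normalisation \<open>R x\<close> is at
    least \<open>T w x\<close> for one of them. Its mean is small because each \<open>T w\<close>
    has small mean.\<close>
  define R where "R = (\<lambda>x. 1 / (\<kappa> * real W2) * (\<Sum>w<W2. T w x))"
  have T0: "T w x \<ge> 0" for w x
    unfolding T_def S_def using NI by (intro mult_nonneg_nonneg add_nonneg_nonneg sum_nonneg) (auto simp: iE_def)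
  have bdT: "bd (T w)" for w
    unfolding T_def by (intro bd_mult bd_add bd_const bdS bd_funpow bdiE)
  have bdR: "bd R" unfolding R_def by (intro bd_mult bd_const bd_sum bdT)
  have LT: "Lam (T w) \<le> 3 * (2 * \<delta>0 + N * (\<delta>\<^sup>2 + 4 * \<delta>))" for w
  proof -
    have bN: "bd (\<lambda>x. N * (\<delta>\<^sup>2 + 4 * iE ((V ^^ w) x)))"
      by (intro bd_mult bd_add bd_const bd_funpow bdiE)
    note b4 = bd_mult[OF bd_const bd_funpow[OF bdiE], of 4 w]
    have "Lam (T w) = 3 * Lam (\<lambda>x. (S (w + u) x + N * (\<delta>\<^sup>2 + 4 * iE ((V ^^ w) x))) + S w x)"
      unfolding T_def by (rule Lam_scale[OF bd_add[OF bd_add[OF bdS bN] bdS]])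
    also have "\<dots> = 3 * (Lam (S (w + u)) + Lam (\<lambda>x. N * (\<delta>\<^sup>2 + 4 * iE ((V ^^ w) x))) + Lam (S w))"
      by (simp only: Lam_add[OF bd_add[OF bdS bN] bdS] Lam_add[OF bdS bN])
    also have "Lam (\<lambda>x. N * (\<delta>\<^sup>2 + 4 * iE ((V ^^ w) x))) = N * (\<delta>\<^sup>2 + 4 * Lam iE)"
      by (simp only: Lam_scale[OF bd_add[OF bd_const b4]] Lam_add[OF bd_const b4] Lam_const Lam_scale[OF bd_funpow[OF bdiE]] Lam_funpow[OF bdiE])
    finally have *: "Lam (T w) = 3 * (Lam (S (w + u)) + N * (\<delta>\<^sup>2 + 4 * Lam iE) + Lam (S w))" .
    have "N * (\<delta>\<^sup>2 + 4 * Lam iE) \<le> N * (\<delta>\<^sup>2 + 4 * \<delta>)"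
      using LiE NI by (intro mult_left_mono) auto
    from add_mono[OF add_mono[OF LS[of "w + u"] this] LS[of w]]
    have "3 * (Lam (S (w + u)) + N * (\<delta>\<^sup>2 + 4 * Lam iE) + Lam (S w)) \<le> 3 * (\<delta>0 + N * (\<delta>\<^sup>2 + 4 * \<delta>) + \<delta>0)"
      by (rule mult_left_mono) simp
    then show ?thesis unfolding * by simp
  qed
  have LR: "Lam R \<le> \<rho> / 2"
  proof -
    have "Lam R = 1 / (\<kappa> * real W2) * (\<Sum>w<W2. Lam (T w))"
      unfolding R_def by (subst Lam_scale) (auto simp: bd_sum bdT Lam_sum)
    also have "\<dots> \<le> 1 / (\<kappa> * real W2) * (\<Sum>w<W2. 3 * (2 * \<delta>0 + N * (\<delta>\<^sup>2 + 4 * \<delta>)))"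
      using \<kappa> by (intro mult_left_mono sum_mono LT) auto
    also have "\<dots> = (3 / \<kappa>) * (2 * \<delta>0 + N * (\<delta>\<^sup>2 + 4 * \<delta>))"
      using W2 \<kappa> by simp
    also have "\<dots> \<le> (3 / \<kappa>) * (\<rho> * \<kappa> / 12 + \<rho> * \<kappa> / 12)"
    proof (intro mult_left_mono add_mono)
      show "2 * \<delta>0 \<le> \<rho> * \<kappa> / 12" by (simp add: \<delta>0_def)
      have "\<delta>\<^sup>2 \<le> \<delta>" using \<delta> mult_left_le[of \<delta> \<delta>] min.cobounded1[of 1 "\<rho> * \<kappa> / (60 * N)"]
        unfolding power2_eq_square \<delta>_def[symmetric] by simp
      then have "N * (\<delta>\<^sup>2 + 4 * \<delta>) \<le> N * (5 * \<delta>)" using NI by (intro mult_left_mono) auto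
      also have "\<dots> \<le> N * (5 * (\<rho> * \<kappa> / (60 * N)))" using NI by (intro mult_left_mono) (auto simp: \<delta>_def)
      also have "\<dots> = \<rho> * \<kappa> / 12" using NI by (simp add: field_simps)
      finally show "N * (\<delta>\<^sup>2 + 4 * \<delta>) \<le> \<rho> * \<kappa> / 12" .
    qed (use \<kappa> in auto)
    also have "\<dots> = \<rho> / 2" using \<kappa> by (simp add: field_simps)
    finally show ?thesis .
  qed
  have exR: "\<exists>(a, b)\<in>Adm. a \<le> A0 \<and> b \<le> A0 \<and> e a b x \<le> R x" if x: "x \<in> X" for x
  proof (rule ccontr)
    assume no: "\<not> ?thesis"
    define Gd where "Gd = {w. w < W2 \<and> (al ((V ^^ w) x), bl ((V ^^ w) x)) \<in> Adm}"
    have fG: "finite Gd" and cG: "\<kappa> * real W2 \<le> real (card Gd)" using freq[OF x] by (auto simp: Gd_def)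
    have kW: "\<kappa> * real W2 > 0" using \<kappa> W2 by simp
    then have ne: "Gd \<noteq> {}" using cG by auto
    have R0: "R x \<ge> 0" unfolding R_def using T0 \<kappa> by (intro mult_nonneg_nonneg sum_nonneg) auto
    have "\<kappa> * real W2 * R x \<le> real (card Gd) * R x" using cG R0 by (rule mult_right_mono)
    also have "\<dots> = (\<Sum>w\<in>Gd. R x)" by simp
    also have "\<dots> < (\<Sum>w\<in>Gd. T w x)"
    proof (rule sum_strict_mono[OF fG ne])
      fix w assume w: "w \<in> Gd"
      have "R x < e (al ((V ^^ w) x)) (bl ((V ^^ w) x)) x"
        using no w ab[OF funpow_V_in[OF x]] by (force simp: Gd_def)
      then show "R x < T w x" using eT[OF x, of w] by linarith
    qed
    also have "\<dots> \<le> (\<Sum>w<W2. T w x)"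
      by (rule sum_mono2) (use T0 in \<open>auto simp: Gd_def\<close>)
    also have "\<dots> = \<kappa> * real W2 * R x"
    proof -
      have "q = c * (1 / c * q)" if "c > 0" for c q :: real using that by simp
      from this[OF kW] show ?thesis unfolding R_def .
    qed
    finally show False by simp
  qed
  define v where "v = (\<lambda>x. R x + S 1 x)"
  have bdv: "bd v" unfolding v_def by (intro bd_add bdR bdS)
  have Lv: "Lam v \<le> \<rho>"
    unfolding v_def using Lam_add[OF bdR bdS] LR LS[of 1] by (simp add: \<delta>0_def)
  have S0: "S w x \<ge> 0" for w x unfolding S_def by (intro sum_nonneg) auto
  have pointwise: "H 0 0 x \<le> (\<epsilon> / 4 + C1 * \<tau>0) + C1 / \<tau>0 * v x" if x: "x \<in> X" for x
  proof -
    obtain a b where abA: "(a, b) \<in> Adm" "a \<le> A0" "b \<le> A0" "e a b x \<le> R x" using exR[OF x] by auto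
    have e0: "e a b x \<ge> 0" unfolding e_def by (intro sum_nonneg) auto
    have v0: "v x \<ge> 0" using e0 abA(4) S0[of 1 x] unfolding v_def by simp
    define \<tau> where "\<tau> = sqrt (v x)"
    have sq: "\<bar>p\<bar> \<le> \<tau>" if "p\<^sup>2 \<le> v x" for p
      unfolding \<tau>_def using that by (simp add: real_le_rsqrt)
    let ?D = "nat \<bar>int (n * b) - int (m * a)\<bar>"
    let ?l = "min (n * b) (m * a)"
    have le: "n * a \<le> n * A0" "n * b \<le> n * A0" "m * a \<le> m * A0" using abA by auto
    have "nat \<bar>int p - int q\<bar> \<le> p + q" for p q :: nat by auto
    then have "?D \<le> n * b + m * a" .
    also have "\<dots> \<le> n * A0 + m * A0" using le by linarith
    finally have Dle: "K * ?D \<le> K * (n * A0 + m * A0)" by simp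
    have "\<bar>H 0 0 x\<bar> \<le> \<bar>\<Sum>r<K. H (n * a) (?l + r * ?D) x\<bar> / real K + real ((K + 1) * (n + a)) * \<tau>"
    proof (rule two_translations[of B' "\<lambda>s t. H s t x"])
      fix s t assume st: "s \<le> B'" "t \<le> B'"
      then have i: "(s, t) \<in> I'" "(s, t) \<in> I" using I'I by (auto simp: I'_def)
      have "(H s t x - H (s + n) (t + m) x)\<^sup>2 \<le> S 1 x"
        unfolding S_def using member_le_sum[OF i(2), of "\<lambda>i. (H (fst i) (snd i) x - H (fst i) (snd i) ((V ^^ 1) x))\<^sup>2"] fin
        by (simp add: HV)
      then show "\<bar>H s t x - H (s + n) (t + m) x\<bar> \<le> \<tau>" using e0 abA(4) by (intro sq) (simp add: v_def)
      have "(H s t x - H (s + a) (t + b) x)\<^sup>2 \<le> e a b x"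
        unfolding e_def using member_le_sum[OF i(1), of "\<lambda>i. (H (fst i) (snd i) x - H (fst i + a) (snd i + b) x)\<^sup>2"] fin by simp
      then show "\<bar>H s t x - H (s + a) (t + b) x\<bar> \<le> \<tau>" using abA(4) S0[of 1 x] by (intro sq) (simp add: v_def)
    next
      have B'_eq: "B' = K * (n * A0 + m * A0) + (n * A0 + m * A0)" by (simp add: B'_def)
      show "n * a \<le> B'" using le B'_eq by linarith
      show "K * ?D + n * b + m * a \<le> B'" using le Dle B'_eq by linarith
      show "0 < K" by fact
      show "n * b \<noteq> m * a" using Adm_ne abA(1) .
      show "0 \<le> \<tau>" using v0 by (simp add: \<tau>_def)
    qed
    also have "\<bar>\<Sum>r<K. H (n * a) (?l + r * ?D) x\<bar> / real K \<le> \<epsilon> / 4"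
    proof -
      have "(\<Sum>r<K. H (n * a) (?l + r * ?D) x) = P (\<lambda>y. \<Sum>r<K. F (n * a) (?l + r * ?D) y) x"
        unfolding H_def by (rule convex_op_sum[OF P, symmetric])
      also have "\<bar>\<dots>\<bar> \<le> \<epsilon> / 4 * real K"
        using Kkill[OF abA(1)] by (intro convex_op_abs_le[OF P V_in_X _ x]) auto
      finally show ?thesis using K by (simp add: field_simps)
    qed
    also have "real ((K + 1) * (n + a)) * \<tau> \<le> C1 * (\<tau>0 + v x / \<tau>0)"
    proof (rule mult_mono)
      have "(K + 1) * (n + a) \<le> (K + 1) * (n + A0)" using abA(2) by (intro mult_left_mono) auto
      then show "real ((K + 1) * (n + a)) \<le> C1" unfolding C1_def by linarith
      \<comment> \<open>The square root of \<open>v x\<close> is replaced by a linear bound, as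
        \<open>Lam\<close> controls only the mean of \<open>v\<close>.\<close>
      have "\<tau> * \<tau>0 \<le> \<tau>0\<^sup>2 + \<tau>\<^sup>2"
      proof -
        have "0 \<le> \<tau> * \<tau>0" using \<tau>0 v0 by (simp add: \<tau>_def)
        then show ?thesis using sum_squares_bound[of \<tau> \<tau>0] by linarith
      qed
      then show "\<tau> \<le> \<tau>0 + v x / \<tau>0" using \<tau>0 v0 by (simp add: \<tau>_def field_simps power2_eq_square)
    qed (use C1 v0 in \<open>auto simp: \<tau>_def\<close>)
    finally have "\<bar>H 0 0 x\<bar> \<le> \<epsilon> / 4 + C1 * (\<tau>0 + v x / \<tau>0)" by simp
    then show ?thesis by (simp add: algebra_simps)
  qed
  have "\<epsilon> \<le> Lam (H 0 0)" using LamF Lam_convex_op[OF P bdF] by (simp add: H_def)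
  also have "\<dots> \<le> Lam (\<lambda>x. (\<epsilon> / 4 + C1 * \<tau>0) + C1 / \<tau>0 * v x)"
    by (rule Lam_mono[OF bdH bd_add[OF bd_const bd_mult[OF bd_const bdv]] pointwise])
  also have "\<dots> = \<epsilon> / 4 + C1 * \<tau>0 + C1 / \<tau>0 * Lam v"
    by (simp only: Lam_add[OF bd_const bd_mult[OF bd_const bdv]] Lam_const Lam_scale[OF bdv])
  also have "\<dots> \<le> \<epsilon> / 4 + C1 * \<tau>0 + C1 / \<tau>0 * \<rho>"
    using Lv C1 \<tau>0 by (intro add_left_mono mult_left_mono) auto
  also have "\<dots> = \<epsilon> / 4 + \<epsilon> / 4 + \<epsilon> / 8"
    using C1 \<tau>0 by (simp add: \<rho>_def \<tau>0_def)
  finally show False using assms by simp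
qed

end

text \<open>The locale assumptions are invariant under a change of sign of \<open>F\<close>, so the
  lower bound is the upper bound for \<open>- F\<close>.\<close>

lemma (in drifting_averages) uniform_averages:
  assumes "\<epsilon> > 0"
  shows "\<exists>K0. \<forall>K\<ge>K0. \<forall>x\<in>X. \<bar>\<Sum>j<K. F 0 0 ((V ^^ j) x)\<bar> \<le> \<epsilon> * real K"
proof -
  interpret neg: drifting_averages X V "\<lambda>s t x. - F s t x" n m A0 Adm \<kappa>
  proof
    show "\<bar>- F s t x\<bar> \<le> 1" if "x \<in> X" for s t x using F_le_1[OF that] by simp
    show "- F s t (V x) = - F (s + n) (t + m) x" for s t x by (simp add: F_V)
    show "\<exists>K>0. \<forall>(a, b)\<in>Adm. \<forall>x\<in>X. \<forall>s t.
      \<bar>\<Sum>r<K. - F s (t + r * nat \<bar>int (n * b) - int (m * a)\<bar>) x\<bar> \<le> \<epsilon> * real K" if "\<epsilon> > 0" for \<epsilon>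
      unfolding sum_negf abs_minus_cancel using kill[OF that] .
    have eq: "\<bar>- p - - q\<bar> = \<bar>p - q\<bar>" for p q :: real by simp
    show "\<exists>u al bl E.
      (\<forall>x\<in>X. al x \<le> A0 \<and> bl x \<le> A0) \<and>
      (\<exists>K0. \<forall>K\<ge>K0. \<forall>x\<in>X. real (card {j. j < K \<and> (V ^^ j) x \<in> E}) \<le> \<epsilon> * real K) \<and>
      (\<forall>x\<in>X - E. \<forall>s\<le>B. \<forall>t\<le>B. \<forall>i<W. \<bar>- F s t ((V ^^ (u + i)) x) - - F (s + al x) (t + bl x) ((V ^^ i) x)\<bar> \<le> \<epsilon>) \<and>
      (\<exists>W2>0. \<forall>x\<in>X. real (card {w. w < W2 \<and> (al ((V ^^ w) x), bl ((V ^^ w) x)) \<in> Adm}) \<ge> \<kappa> * real W2)"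
      if "\<epsilon> > 0" for \<epsilon> B W
      unfolding eq using scale[OF that] .
  qed (use V_in_X Adm_ne \<kappa> in auto)
  obtain K0 K1 where "\<And>K x. K \<ge> K0 \<Longrightarrow> x \<in> X \<Longrightarrow> (\<Sum>j<K. F 0 0 ((V ^^ j) x)) \<le> \<epsilon> * real K"
    "\<And>K x. K \<ge> K1 \<Longrightarrow> x \<in> X \<Longrightarrow> (\<Sum>j<K. - F 0 0 ((V ^^ j) x)) \<le> \<epsilon> * real K"
    using averages_upper_bound[OF assms] neg.averages_upper_bound[OF assms] by blast
  then show ?thesis
    by (intro exI[of _ "max K0 K1"]) (auto simp: sum_negf abs_le_iff)
qed

section \<open>Continued fractions\<close>

fun cf_p :: "real \<Rightarrow> nat \<Rightarrow> nat" where
  "cf_p \<alpha> 0 = 0"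
| "cf_p \<alpha> (Suc 0) = 1"
| "cf_p \<alpha> (Suc (Suc k)) = cf_a \<alpha> (Suc (Suc k)) * cf_p \<alpha> (Suc k) + cf_p \<alpha> k"

definition cf_D :: "real \<Rightarrow> nat \<Rightarrow> real" where
  "cf_D \<alpha> k = real (cf_q \<alpha> k) * \<alpha> - real (cf_p \<alpha> k)"

lemma Rats_frac_iff: "frac x \<in> \<rat> \<longleftrightarrow> (x :: real) \<in> \<rat>"
proof -
  have "of_int \<lfloor>x\<rfloor> \<in> (\<rat> :: real set)" by simp
  then show ?thesis unfolding frac_def by (metis Rats_add Rats_diff add_diff_cancel diff_add_cancel)
qed

locale irrational =
  fixes \<alpha> :: real
  assumes \<alpha>01: "0 < \<alpha>" "\<alpha> < 1" and irrat: "\<alpha> \<notin> \<rat>"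
begin

lemma cf_rem_irrational: "cf_rem \<alpha> k \<notin> \<rat>"
proof (induction k)
  case (Suc k)
  then have "frac (cf_rem \<alpha> k) \<notin> \<rat>" by (simp add: Rats_frac_iff)
  then show ?case by (metis cf_rem.simps(2) Rats_inverse inverse_eq_divide inverse_inverse_eq)
qed (use irrat in simp)

lemma frac_cf_rem: "0 < frac (cf_rem \<alpha> k)" "frac (cf_rem \<alpha> k) < 1"
proof -
  have "frac (cf_rem \<alpha> k) \<noteq> 0" using cf_rem_irrational[of k] Rats_frac_iff by (metis Rats_0)
  then show "0 < frac (cf_rem \<alpha> k)" using frac_ge_0[of "cf_rem \<alpha> k"] by linarith
qed (rule frac_lt_1)

lemma cf_rem_gt_1: "cf_rem \<alpha> (Suc k) > 1"
  using frac_cf_rem[of k] by simp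

lemma cf_a_eq: "real (cf_a \<alpha> (Suc k)) = cf_rem \<alpha> (Suc k) - frac (cf_rem \<alpha> (Suc k))"
proof -
  have "0 \<le> \<lfloor>cf_rem \<alpha> (Suc k)\<rfloor>" using cf_rem_gt_1[of k] by simp
  then show ?thesis unfolding cf_a_def frac_def by (simp del: cf_rem.simps)
qed

lemma cf_a_pos: "cf_a \<alpha> (Suc k) \<ge> 1"
proof -
  have "1 \<le> \<lfloor>cf_rem \<alpha> (Suc k)\<rfloor>" using cf_rem_gt_1[of k] by linarith
  then show ?thesis unfolding cf_a_def by linarith
qed

text \<open>By the recursion the error at k + 2 is \<open>cf_a\<close> times the error at k + 1 plus
  the error at k; the induction hypothesis turns the latter into minus the error at k + 1 times the
  complete quotient, and only its fractional part survives. Hence signs alternate and sizes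
  shrink.\<close>

lemma cf_D_Suc: "cf_D \<alpha> (Suc k) = - cf_D \<alpha> k * frac (cf_rem \<alpha> (Suc k))"
proof (induction k)
  case 0
  have "frac \<alpha> = \<alpha>" using \<alpha>01 by (simp add: frac_eq)
  then have "\<alpha> * (real (cf_a \<alpha> 1) + frac (1 / \<alpha>)) = 1" using cf_a_eq[of 0] \<alpha>01 by simp
  then show ?case using \<open>frac \<alpha> = \<alpha>\<close> by (simp add: cf_D_def algebra_simps)
next
  case (Suc k)
  have "cf_D \<alpha> (Suc (Suc k)) = real (cf_a \<alpha> (Suc (Suc k))) * cf_D \<alpha> (Suc k) + cf_D \<alpha> k"
    by (simp add: cf_D_def algebra_simps)
  also have "cf_D \<alpha> k = - cf_D \<alpha> (Suc k) * cf_rem \<alpha> (Suc (Suc k))"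
    using Suc frac_cf_rem[of "Suc k"] by simp
  also have "real (cf_a \<alpha> (Suc (Suc k))) * cf_D \<alpha> (Suc k) + \<dots> = - cf_D \<alpha> (Suc k) * frac (cf_rem \<alpha> (Suc (Suc k)))"
    unfolding cf_a_eq by (simp add: algebra_simps del: cf_rem.simps)
  finally show ?case .
qed

lemma cf_D_nz: "cf_D \<alpha> k \<noteq> 0"
proof (induction k)
  case (Suc k)
  then show ?case using frac_cf_rem[of "Suc k"] by (simp add: cf_D_Suc del: cf_rem.simps)
qed (use \<alpha>01 in \<open>simp add: cf_D_def\<close>)

lemma cf_D_opposite: "cf_D \<alpha> k * cf_D \<alpha> (Suc k) < 0"
proof -
  have "cf_D \<alpha> k * cf_D \<alpha> (Suc k) = - ((cf_D \<alpha> k)\<^sup>2 * frac (cf_rem \<alpha> (Suc k)))"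
    by (simp add: cf_D_Suc power2_eq_square)
  then show ?thesis using cf_D_nz[of k] frac_cf_rem[of "Suc k"] by simp
qed

lemma cf_det: "int (cf_p \<alpha> (Suc k)) * int (cf_q \<alpha> k) - int (cf_p \<alpha> k) * int (cf_q \<alpha> (Suc k)) = (- 1) ^ k"
proof (induction k)
  case (Suc k)
  have "int (cf_p \<alpha> (Suc (Suc k))) * int (cf_q \<alpha> (Suc k)) - int (cf_p \<alpha> (Suc k)) * int (cf_q \<alpha> (Suc (Suc k))) =
    - (int (cf_p \<alpha> (Suc k)) * int (cf_q \<alpha> k) - int (cf_p \<alpha> k) * int (cf_q \<alpha> (Suc k)))"
    by (simp add: algebra_simps)
  then show ?case using Suc by simp
qed simp

lemma cf_q_pos: "cf_q \<alpha> k > 0"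
proof (induction k rule: cf_q.induct[of "\<lambda>_ k. cf_q \<alpha> k > 0"])
  case (2 \<alpha>)
  then show ?case using cf_a_pos[of 0] by simp
qed auto

lemma cf_q_mono_Suc: "cf_q \<alpha> k \<le> cf_q \<alpha> (Suc k)"
proof (cases k)
  case 0
  then show ?thesis using cf_a_pos[of 0] by simp
next
  case (Suc j)
  have "1 * cf_q \<alpha> (Suc j) \<le> cf_a \<alpha> (Suc (Suc j)) * cf_q \<alpha> (Suc j)"
    using cf_a_pos[of "Suc j"] by (intro mult_right_mono) auto
  moreover have "cf_q \<alpha> (Suc (Suc j)) = cf_a \<alpha> (Suc (Suc j)) * cf_q \<alpha> (Suc j) + cf_q \<alpha> j" by simp
  ultimately show ?thesis unfolding Suc by linarith
qed

lemma cf_q_double: "2 * cf_q \<alpha> k \<le> cf_q \<alpha> (k + 2)"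
proof -
  have "1 * cf_q \<alpha> (Suc k) \<le> cf_a \<alpha> (Suc (Suc k)) * cf_q \<alpha> (Suc k)"
    using cf_a_pos[of "Suc k"] by (intro mult_right_mono) auto
  moreover have "cf_q \<alpha> (k + 2) = cf_a \<alpha> (Suc (Suc k)) * cf_q \<alpha> (Suc k) + cf_q \<alpha> k" by simp
  ultimately show ?thesis using cf_q_mono_Suc[of k] by linarith
qed

lemma cf_q_growth: "2 ^ s * cf_q \<alpha> k \<le> cf_q \<alpha> (k + 2 * s)"
proof (induction s)
  case (Suc s)
  then show ?case using cf_q_double[of "k + 2 * s"] by simp
qed simp

text \<open>The determinant of consecutive convergents is 1 or -1 and the two errors have opposite
  signs, so the absolute values add up. Both bounds for a single error rest on this.\<close>

lemma cf_D_sum: "real (cf_q \<alpha> (Suc k)) * \<bar>cf_D \<alpha> k\<bar> + real (cf_q \<alpha> k) * \<bar>cf_D \<alpha> (Suc k)\<bar> = 1"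
proof -
  let ?a = "real (cf_q \<alpha> (Suc k)) * cf_D \<alpha> k" and ?b = "real (cf_q \<alpha> k) * cf_D \<alpha> (Suc k)"
  have "?a - ?b = real_of_int (int (cf_p \<alpha> (Suc k)) * int (cf_q \<alpha> k) - int (cf_p \<alpha> k) * int (cf_q \<alpha> (Suc k)))"
    by (simp add: cf_D_def algebra_simps del: cf_q.simps cf_p.simps)
  then have "\<bar>?a - ?b\<bar> = 1" unfolding cf_det by simp
  moreover have "?a * ?b < 0"
  proof -
    have "?a * ?b = (real (cf_q \<alpha> (Suc k)) * real (cf_q \<alpha> k)) * (cf_D \<alpha> k * cf_D \<alpha> (Suc k))" by simp
    moreover have "0 < real (cf_q \<alpha> (Suc k)) * real (cf_q \<alpha> k)" using cf_q_pos[of "Suc k"] cf_q_pos[of k] by (simp del: cf_q.simps)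
    ultimately show ?thesis using mult_pos_neg[OF _ cf_D_opposite[of k]] by (simp only:)
  qed
  moreover have "\<bar>x\<bar> + \<bar>y\<bar> = \<bar>x - y\<bar>" if "x * y < 0" for x y :: real
    using that by (auto simp: mult_less_0_iff)
  ultimately have "\<bar>?a\<bar> + \<bar>?b\<bar> = 1" by metis
  then show ?thesis by (simp add: abs_mult del: cf_q.simps)
qed

lemma cf_D_upper: "\<bar>cf_D \<alpha> k\<bar> < 1 / real (cf_q \<alpha> (Suc k))"
proof -
  have "real (cf_q \<alpha> k) * \<bar>cf_D \<alpha> (Suc k)\<bar> > 0" using cf_q_pos cf_D_nz by simp
  then have "real (cf_q \<alpha> (Suc k)) * \<bar>cf_D \<alpha> k\<bar> < 1" using cf_D_sum[of k] by linarith
  then show ?thesis using cf_q_pos[of "Suc k"] by (simp add: field_simps del: cf_q.simps)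
qed

lemma cf_D_lower: "1 / (2 * real (cf_q \<alpha> (Suc k))) \<le> \<bar>cf_D \<alpha> k\<bar>"
proof -
  have "\<bar>cf_D \<alpha> (Suc k)\<bar> \<le> \<bar>cf_D \<alpha> k\<bar>"
    unfolding cf_D_Suc abs_mult using frac_cf_rem[of "Suc k"] by (simp add: mult_left_le del: cf_rem.simps)
  then have "real (cf_q \<alpha> k) * \<bar>cf_D \<alpha> (Suc k)\<bar> \<le> real (cf_q \<alpha> (Suc k)) * \<bar>cf_D \<alpha> k\<bar>"
    using cf_q_mono_Suc[of k] by (intro mult_mono) auto
  then have "1 \<le> 2 * real (cf_q \<alpha> (Suc k)) * \<bar>cf_D \<alpha> k\<bar>" using cf_D_sum[of k] by linarith
  then show ?thesis using cf_q_pos[of "Suc k"] by (simp add: field_simps del: cf_q.simps)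
qed

lemma cf_coprime: "coprime (int (cf_p \<alpha> k)) (int (cf_q \<alpha> k))"
proof (rule coprimeI)
  fix c assume "c dvd int (cf_p \<alpha> k)" "c dvd int (cf_q \<alpha> k)"
  then have "c dvd (- 1) ^ k" unfolding cf_det[of k, symmetric] by (intro dvd_diff dvd_mult dvd_mult2) auto
  moreover have "(- 1 :: int) ^ k dvd 1" by (metis dvd_refl minus_one_power_iff minus_dvd_iff)
  ultimately show "is_unit c" using dvd_trans by blast
qed

end

text \<open>For t < L the point t \<alpha> lies within 1 / L of t p / L, and coprimality makes the
  latter run through all multiples of 1 / L modulo 1. The instances used are convergents.\<close>

definition approximant :: "real \<Rightarrow> nat \<Rightarrow> int \<Rightarrow> bool" where
  "approximant \<alpha> L p \<longleftrightarrow> 0 < L \<and> coprime p (int L) \<and> \<bar>real L * \<alpha> - of_int p\<bar> < 1 / real L"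

lemma (in irrational) approximant_cf: "approximant \<alpha> (cf_q \<alpha> k) (int (cf_p \<alpha> k))"
proof -
  have "\<bar>cf_D \<alpha> k\<bar> < 1 / real (cf_q \<alpha> (Suc k))" by (rule cf_D_upper)
  also have "\<dots> \<le> 1 / real (cf_q \<alpha> k)"
    using cf_q_mono_Suc[of k] cf_q_pos[of k] by (intro divide_left_mono) auto
  finally show ?thesis unfolding approximant_def using cf_q_pos cf_coprime by (simp add: cf_D_def)
qed

section \<open>Orbit segments of the rotation compared with the grid of mesh 1 / L\<close>

lemma approximant_error:
  assumes "approximant \<alpha> L p" "t < L"
  shows "\<bar>real t * \<alpha> - real t * of_int p / real L\<bar> < 1 / real L"
proof -
  have L: "L > 0" "\<bar>real L * \<alpha> - of_int p\<bar> < 1 / real L" using assms by (auto simp: approximant_def)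
  have "real t * \<alpha> - real t * of_int p / real L = real t / real L * (real L * \<alpha> - of_int p)"
    using L by (simp add: field_simps)
  then have "\<bar>real t * \<alpha> - real t * of_int p / real L\<bar> = real t / real L * \<bar>real L * \<alpha> - of_int p\<bar>"
    by (simp add: abs_mult)
  also have "\<dots> \<le> 1 * \<bar>real L * \<alpha> - of_int p\<bar>" using assms(2) by (intro mult_right_mono) auto
  finally show ?thesis using L by simp
qed

lemma coprime_solve:
  fixes p i :: int and L :: nat
  assumes "coprime p (int L)" "0 < L"
  obtains t m where "t < L" "int t * p = i + m * int L"
proof -
  obtain c v where c: "c * p + v * int L = 1" using bezout_int[of p "int L"] assms(1) by auto
  define t where "t = nat ((c * i) mod int L)"
  have t: "int t = (c * i) mod int L" using assms(2) by (simp add: t_def)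
  define d where "d = (c * i) div int L"
  have td: "int t = c * i - d * int L" unfolding t d_def by (simp add: minus_div_mult_eq_mod)
  have "int t * p = (c * p) * i - d * p * int L" unfolding td by (simp add: algebra_simps)
  also have "c * p = 1 - v * int L" using c by simp
  also have "(1 - v * int L) * i - d * p * int L = i + (- v * i - d * p) * int L"
    by (simp add: algebra_simps)
  finally have "int t * p = i + (- v * i - d * p) * int L" .
  moreover have "t < L" using t assms(2) by (metis of_nat_0_less_iff of_nat_less_iff pos_mod_bound)
  ultimately show thesis using that by blast
qed

text \<open>The target is a grid point at distance between 1 / L and 2 / L to the right of
  \<open>w\<close>; the error of the approximation is below 1 / L, so an interval of length 3 / L
  catches the orbit point.\<close>

lemma approximant_hits:
  assumes "approximant \<alpha> L p" "3 / real L \<le> d"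
  shows "\<exists>t<L. \<exists>k::int. w \<le> x + real t * \<alpha> - of_int k \<and> x + real t * \<alpha> - of_int k < w + d"
proof -
  have L: "L > 0" "coprime p (int L)" using assms by (auto simp: approximant_def)
  define i where "i = \<lceil>real L * (w - x)\<rceil> + 1"
  obtain t m where t: "t < L" "int t * p = i + m * int L" using coprime_solve[OF L(2,1)] .
  have "real t * of_int p = of_int i + of_int m * real L"
    using arg_cong[OF t(2), of real_of_int] by simp
  then have "real t * of_int p / real L = of_int i / real L + of_int m"
    using L(1) by (simp add: add_divide_distrib)
  then have e: "\<bar>real t * \<alpha> - of_int i / real L - of_int m\<bar> < 1 / real L"
    using approximant_error[OF assms(1) t(1)] by (simp add: algebra_simps)
  have i: "real L * (w - x) + 1 \<le> of_int i" "of_int i < real L * (w - x) + 2" unfolding i_def by linarith+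
  have "(real L * (w - x) + 1) / real L \<le> of_int i / real L" by (rule divide_right_mono[OF i(1)]) simp
  moreover have "of_int i / real L < (real L * (w - x) + 2) / real L" using L(1) by (intro divide_strict_right_mono i(2)) simp
  ultimately have "w - x + 1 / real L \<le> of_int i / real L" "of_int i / real L < w - x + 2 / real L"
    using L(1) by (simp_all add: add_divide_distrib)
  moreover have "2 / real L + 1 / real L \<le> d" using assms(2) by (simp add: add_divide_distrib[symmetric])
  ultimately have "w \<le> x + real t * \<alpha> - of_int m" "x + real t * \<alpha> - of_int m < w + d" using e by linarith+
  then show ?thesis using t(1) by blast
qed

section \<open>The induced map of the rotation\<close>

definition near :: "real \<Rightarrow> real \<Rightarrow> real \<Rightarrow> bool" where
  "near e a w \<longleftrightarrow> (\<exists>k::int. \<bar>a - w - of_int k\<bar> < e)"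

lemma frac_frac_add: "frac (frac a + b) = frac (a + b :: real)"
proof -
  have *: "frac a + b = a + b - of_int \<lfloor>a\<rfloor>" by (simp add: frac_def)
  show ?thesis unfolding * unfolding frac_def floor_diff_of_int by simp
qed

text \<open>A point at circle distance at least \<open>e\<close> from 0 and from \<open>z\<close>
  neither wraps around nor passes \<open>z\<close> when moved by less than \<open>e\<close>.\<close>

lemma frac_stable:
  assumes "\<bar>a - b - of_int k\<bar> < e" "\<not> near e a 0" "\<not> near e a z"
  shows "frac a < z \<longleftrightarrow> frac b < z" "\<bar>frac a - frac b\<bar> < e"
proof -
  have n0: "e \<le> \<bar>a - of_int m\<bar>" and nz: "e \<le> \<bar>a - z - of_int m\<bar>" for m
    using assms(2,3) by (auto simp: near_def not_less)
  have f: "e \<le> frac a" "frac a \<le> 1 - e" "e \<le> \<bar>frac a - z\<bar>"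
    using n0[of "\<lfloor>a\<rfloor>"] n0[of "\<lfloor>a\<rfloor> + 1"] nz[of "\<lfloor>a\<rfloor>"] frac_ge_0[of a] frac_lt_1[of a]
    by (auto simp: frac_def algebra_simps)
  define d where "d = b + of_int k - a"
  have d: "\<bar>d\<bar> < e" using assms(1) by (simp add: d_def)
  have "b - (frac a + d) = of_int (\<lfloor>a\<rfloor> - k)" by (simp add: d_def frac_def)
  then have "b - (frac a + d) \<in> \<int>" by (metis Ints_of_int)
  moreover have "0 \<le> frac a + d" "frac a + d < 1" using f d by linarith+
  ultimately have b: "frac b = frac a + d" unfolding frac_unique_iff by simp
  then show "frac a < z \<longleftrightarrow> frac b < z" "\<bar>frac a - frac b\<bar> < e" using f d by linarith+
qed

text \<open>On the grid some time t < L carries \<open>y\<close> next to \<open>x\<close>, so the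
  cyclic shift by t matches the two orbit segments. Two errors of approximation and one of rounding
  add up to 3 / L.\<close>

lemma approximant_matching:
  assumes "approximant \<alpha> L p"
  obtains \<pi> where "bij_betw \<pi> {..<L} {..<L}"
    "\<And>r. r < L \<Longrightarrow> \<exists>k::int. \<bar>(x + real r * \<alpha>) - (y + real (\<pi> r) * \<alpha>) - of_int k\<bar> < 3 / real L"
proof -
  have L: "L > 0" "coprime p (int L)" using assms by (auto simp: approximant_def)
  define s where "s = \<lfloor>real L * (x - y)\<rfloor>"
  obtain t m where t: "t < L" "int t * p = s + m * int L" using coprime_solve[OF L(2,1)] .
  define \<pi> where "\<pi> = (\<lambda>r. (r + t) mod L)"
  have le: "r = r'" if "r < L" "r' < L" "(r + t) mod L = (r' + t) mod L" "r \<le> r'" for r r'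
  proof -
    have "L dvd (r' + t) - (r + t)" using that by (subst mod_eq_dvd_iff_nat[symmetric]) auto
    then show ?thesis using that by (auto dest: dvd_imp_le)
  qed
  have "inj_on \<pi> {..<L}"
  proof (rule inj_onI)
    fix r r' assume "r \<in> {..<L}" "r' \<in> {..<L}" "\<pi> r = \<pi> r'"
    then show "r = r'" using le[of r r'] le[of r' r] by (cases "r \<le> r'") (auto simp: \<pi>_def)
  qed
  moreover have "\<pi> ` {..<L} \<subseteq> {..<L}" using L by (auto simp: \<pi>_def)
  ultimately have bij: "bij_betw \<pi> {..<L} {..<L}"
    by (simp add: bij_betw_def endo_inj_surj)
  have "\<exists>k::int. \<bar>(x + real r * \<alpha>) - (y + real (\<pi> r) * \<alpha>) - of_int k\<bar> < 3 / real L" if r: "r < L" for r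
  proof -
    define j where "j = (r + t) div L"
    have "r + t = j * L + \<pi> r" by (simp add: j_def \<pi>_def)
    then have "real (\<pi> r) = real r + real t - real j * real L" by (metis add_diff_cancel_left' of_nat_add of_nat_mult)
    then have "real (\<pi> r) * of_int p / real L = (real r + real t - real j * real L) * of_int p / real L" by simp
    also have "\<dots> = real r * of_int p / real L + real t * of_int p / real L - real j * of_int p"
      using L(1) by (simp add: field_simps)
    also have "real t * of_int p = of_int s + of_int m * real L" using arg_cong[OF t(2), of real_of_int] by simp
    finally have eq: "real (\<pi> r) * of_int p / real L = real r * of_int p / real L + of_int s / real L + of_int (m - int j * p)"
      using L(1) by (simp add: add_divide_distrib)
    have e1: "\<bar>real r * \<alpha> - real r * of_int p / real L\<bar> < 1 / real L" by (rule approximant_error[OF assms r])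
    have "\<pi> r < L" using L by (simp add: \<pi>_def)
    then have e2: "\<bar>real (\<pi> r) * \<alpha> - real (\<pi> r) * of_int p / real L\<bar> < 1 / real L" by (rule approximant_error[OF assms])
    have s: "of_int s \<le> real L * (x - y)" "real L * (x - y) < of_int s + 1" unfolding s_def by linarith+
    have "of_int s / real L \<le> (real L * (x - y)) / real L" by (rule divide_right_mono[OF s(1)]) simp
    moreover have "(real L * (x - y)) / real L < (of_int s + 1) / real L" using L by (intro divide_strict_right_mono s(2)) simp
    ultimately have "of_int s / real L \<le> x - y" "x - y < of_int s / real L + 1 / real L"
      using L(1) by (simp_all add: add_divide_distrib)
    with e1 e2 eq have "\<bar>(x + real r * \<alpha>) - (y + real (\<pi> r) * \<alpha>) - of_int (int j * p - m)\<bar> < 1 / real L + 1 / real L + 1 / real L"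
      by (simp add: abs_less_iff)
    then show ?thesis by (intro exI[of _ "int j * p - m"]) simp
  qed
  with bij show thesis using that by blast
qed

text \<open>The numerators \<open>\<phi> r\<close> of the grid points are distinct by coprimality
  and differ from \<open>c\<close> by less than 4, namely 3 for the distance and 1 for the
  approximation; this leaves 8 integers.\<close>

lemma approximant_near_count:
  assumes "approximant \<alpha> L p"
  shows "card {r. r < L \<and> near (3 / real L) (x + real r * \<alpha>) w} \<le> 8"
proof -
  have L: "L > 0" "coprime p (int L)" using assms by (auto simp: approximant_def)
  define A where "A = {r. r < L \<and> near (3 / real L) (x + real r * \<alpha>) w}"
  have "\<forall>r\<in>A. \<exists>k::int. \<bar>x + real r * \<alpha> - w - of_int k\<bar> < 3 / real L" by (auto simp: A_def near_def)
  then obtain k :: "nat \<Rightarrow> int" where k: "\<And>r. r \<in> A \<Longrightarrow> \<bar>x + real r * \<alpha> - w - of_int (k r)\<bar> < 3 / real L" by metis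
  define \<phi> where "\<phi> = (\<lambda>r. int r * p - k r * int L)"
  define c where "c = real L * (w - x)"
  have "\<phi> r \<in> {\<lfloor>c\<rfloor> - 3..\<lfloor>c\<rfloor> + 4}" if r: "r \<in> A" for r
  proof -
    have "r < L" using r by (simp add: A_def)
    have "\<bar>real r * of_int p / real L - of_int (k r) - (w - x)\<bar> < 4 / real L"
      using k[OF r] approximant_error[OF assms \<open>r < L\<close>]
      by (simp add: abs_less_iff add_divide_distrib[symmetric])
    then have "real L * \<bar>real r * of_int p / real L - of_int (k r) - (w - x)\<bar> < real L * (4 / real L)"
      using L by (intro mult_strict_left_mono) auto
    then have "\<bar>real L * (real r * of_int p / real L - of_int (k r) - (w - x))\<bar> < 4"
      using L by (simp add: abs_mult)
    also have "real L * (real r * of_int p / real L - of_int (k r) - (w - x)) = of_int (\<phi> r) - c"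
      using L by (simp add: \<phi>_def c_def field_simps)
    finally show ?thesis by simp linarith
  qed
  then have sub: "\<phi> ` A \<subseteq> {\<lfloor>c\<rfloor> - 3..\<lfloor>c\<rfloor> + 4}" by blast
  have "inj_on \<phi> A"
  proof (rule inj_onI)
    fix r r' assume r: "r \<in> A" "r' \<in> A" "\<phi> r = \<phi> r'"
    then have "(int r - int r') * p = (k r - k r') * int L" by (simp add: \<phi>_def algebra_simps)
    then have "int L dvd (int r - int r') * p" by simp
    then have "int L dvd int r - int r'" using L(2) by (simp add: coprime_commute coprime_dvd_mult_left_iff)
    then show "r = r'" using r(1,2) dvd_imp_le_int[of "int r - int r'" "int L"] by (force simp: A_def)
  qed
  then have "card A = card (\<phi> ` A)" by (simp add: card_image)
  also have "\<dots> \<le> card {\<lfloor>c\<rfloor> - 3..\<lfloor>c\<rfloor> + 4}" by (rule card_mono[OF _ sub]) simp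
  finally show ?thesis by (simp add: A_def)
qed

text \<open>After matching the two orbits only indices near the discontinuities 0 and
  \<open>z\<close> can contribute more than \<epsilon>. There are at most 8 near each of the two,
  and each costs at most 2 M, whence 32 M.\<close>

lemma approximant_sum_diff:
  fixes G :: "real \<Rightarrow> real"
  assumes "approximant \<alpha> L p" and M: "\<And>a. \<bar>G a\<bar> \<le> M" and e: "0 \<le> \<epsilon>"
    and osc: "\<And>a b. a \<in> {0..<1} \<Longrightarrow> b \<in> {0..<1} \<Longrightarrow> \<bar>a - b\<bar> < 3 / real L \<Longrightarrow> (a < z \<longleftrightarrow> b < z) \<Longrightarrow> \<bar>G a - G b\<bar> \<le> \<epsilon>"
  shows "\<bar>(\<Sum>r<L. G (frac (x + real r * \<alpha>))) - (\<Sum>r<L. G (frac (y + real r * \<alpha>)))\<bar> \<le> \<epsilon> * real L + 32 * M"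
proof -
  obtain \<pi> where bij: "bij_betw \<pi> {..<L} {..<L}"
    and \<pi>: "\<And>r. r < L \<Longrightarrow> \<exists>k::int. \<bar>(x + real r * \<alpha>) - (y + real (\<pi> r) * \<alpha>) - of_int k\<bar> < 3 / real L"
    using approximant_matching[OF assms(1), of x y] by metis
  have M0: "0 \<le> M" using M[of 0] by linarith
  define N where "N = (\<lambda>w. {r. r < L \<and> near (3 / real L) (x + real r * \<alpha>) w})"
  have N: "card (N w) \<le> 8" "finite (N w)" for w using approximant_near_count[OF assms(1)] by (auto simp: N_def)
  let ?b = "\<lambda>w r. if r \<in> N w then 2 * M else 0"
  have 1: "\<bar>G (frac (x + real r * \<alpha>)) - G (frac (y + real (\<pi> r) * \<alpha>))\<bar> \<le> \<epsilon> + ?b 0 r + ?b z r" if r: "r < L" for r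
  proof (cases "r \<in> N 0 \<union> N z")
    case True
    have "\<bar>G (frac (x + real r * \<alpha>)) - G (frac (y + real (\<pi> r) * \<alpha>))\<bar> \<le> 2 * M"
      using M[of "frac (x + real r * \<alpha>)"] M[of "frac (y + real (\<pi> r) * \<alpha>)"] by linarith
    then show ?thesis using True e M0 by auto
  next
    case False
    then have nn: "\<not> near (3 / real L) (x + real r * \<alpha>) 0" "\<not> near (3 / real L) (x + real r * \<alpha>) z" using r by (auto simp: N_def)
    obtain k :: int where k: "\<bar>(x + real r * \<alpha>) - (y + real (\<pi> r) * \<alpha>) - of_int k\<bar> < 3 / real L" using \<pi>[OF r] by blast
    have "\<bar>G (frac (x + real r * \<alpha>)) - G (frac (y + real (\<pi> r) * \<alpha>))\<bar> \<le> \<epsilon>"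
      using frac_stable[OF k nn] by (intro osc) (auto simp: frac_lt_1)
    then show ?thesis using e M0 by auto
  qed
  have sb: "(\<Sum>r<L. ?b w r) \<le> 16 * M" for w
  proof -
    have "(\<Sum>r<L. ?b w r) = real (card (N w)) * (2 * M)"
      by (subst sum.If_cases) (auto simp: N_def intro!: arg_cong[of _ _ card])
    also have "\<dots> \<le> 8 * (2 * M)" using N(1)[of w] M0 by (intro mult_right_mono) auto
    finally show ?thesis by simp
  qed
  have "(\<Sum>r<L. G (frac (y + real r * \<alpha>))) = (\<Sum>r<L. G (frac (y + real (\<pi> r) * \<alpha>)))"
    by (rule sum.reindex_bij_betw[OF bij, symmetric])
  then have "\<bar>(\<Sum>r<L. G (frac (x + real r * \<alpha>))) - (\<Sum>r<L. G (frac (y + real r * \<alpha>)))\<bar>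
      = \<bar>\<Sum>r<L. G (frac (x + real r * \<alpha>)) - G (frac (y + real (\<pi> r) * \<alpha>))\<bar>"
    by (simp add: sum_subtractf)
  also have "\<dots> \<le> (\<Sum>r<L. \<epsilon> + ?b 0 r + ?b z r)"
    by (rule order_trans[OF sum_abs sum_mono]) (use 1 in auto)
  also have "\<dots> = \<epsilon> * real L + (\<Sum>r<L. ?b 0 r) + (\<Sum>r<L. ?b z r)"
    by (simp only: sum.distrib) simp
  also have "\<dots> \<le> \<epsilon> * real L + 32 * M" using sb[of 0] sb[of z] by linarith
  finally show ?thesis .
qed

section \<open>Visits, return times and the first return map\<close>

locale return_map =
  fixes \<alpha> z :: real
  assumes z: "0 < z" "z < 1" and ret0: "\<And>y. 0 \<le> y \<Longrightarrow> y < 1 \<Longrightarrow> \<not> y < z \<Longrightarrow> frac (y + \<alpha>) < z"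
begin

text \<open>By \<open>ret0\<close> the return time is 1 or 2, so the induced map has this closed
  form; \<open>first_return_eq_T\<close> identifies it with \<open>first_return\<close>.\<close>

definition T :: "real \<Rightarrow> real" where
  "T y = (if frac (y + \<alpha>) < z then frac (y + \<alpha>) else frac (y + 2 * \<alpha>))"

text \<open>Unlike \<open>visits\<close> it accepts any real starting point and depends only on its
  class modulo 1, so orbit points need not be reduced to the unit interval.\<close>

definition vis :: "nat \<Rightarrow> real \<Rightarrow> nat" where
  "vis r x = (\<Sum>j<r. of_bool (frac (x + real j * \<alpha>) < z))"

fun tau :: "nat \<Rightarrow> real \<Rightarrow> nat" where
  "tau 0 x = 0"
| "tau (Suc k) x = (if frac (x + real (tau k x + 1) * \<alpha>) < z then tau k x + 1 else tau k x + 2)"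

lemma ret: "\<not> frac a < z \<Longrightarrow> frac (a + \<alpha>) < z"
  using ret0[of "frac a"] frac_lt_1[of a] by (simp add: frac_frac_add)

lemma T_in: "y \<in> {0..<z} \<Longrightarrow> T y \<in> {0..<z}"
  using ret[of "y + \<alpha>"] by (auto simp: T_def algebra_simps)

lemma T_frac: "T (frac a) = (if frac (a + \<alpha>) < z then frac (a + \<alpha>) else frac (a + 2 * \<alpha>))"
  by (simp add: T_def frac_frac_add)

lemma vis_0 [simp]: "vis 0 x = 0" and vis_Suc: "vis (Suc r) x = vis r x + of_bool (frac (x + real r * \<alpha>) < z)"
  by (simp_all add: vis_def)

lemma vis_add: "vis (r + s) x = vis r x + vis s (x + real r * \<alpha>)"
  by (induction s) (simp_all add: vis_Suc algebra_simps)

lemma vis_frac: "vis r (frac x) = vis r x"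
  by (simp add: vis_def frac_frac_add)

lemma vis_le: "vis r x \<le> r"
  by (induction r) (auto simp: vis_Suc)

lemma vis_mono: "r \<le> s \<Longrightarrow> vis r x \<le> vis s x"
  using vis_add[of r "s - r" x] by simp

text \<open>\<open>vis r x\<close> counts the visits before time r, so this power of
  \<open>T\<close> reaches the first visit at time r or later; by \<open>ret\<close> that happens at
  time r or r + 1.\<close>

lemma T_vis:
  assumes "x \<in> {0..<z}"
  shows "(T ^^ vis r x) x = (if frac (x + real r * \<alpha>) < z then frac (x + real r * \<alpha>) else frac (x + real (Suc r) * \<alpha>))"
proof (induction r)
  case 0
  have "frac x = x" using assms z by (simp add: frac_eq)
  then show ?case using assms by simp
next
  case (Suc r)
  show ?case
  proof (cases "frac (x + real r * \<alpha>) < z")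
    case True
    then have "(T ^^ vis (Suc r) x) x = T (frac (x + real r * \<alpha>))" using Suc by (simp add: vis_Suc)
    then show ?thesis by (simp add: T_frac algebra_simps)
  next
    case False
    then have "frac (x + real (Suc r) * \<alpha>) < z" using ret[OF False] by (simp add: algebra_simps)
    then show ?thesis using Suc False by (simp add: vis_Suc)
  qed
qed

lemma tau_props:
  assumes "frac x < z"
  shows "frac (x + real (tau k x) * \<alpha>) < z \<and> vis (tau k x) x = k"
proof (induction k)
  case (Suc k)
  show ?case
  proof (cases "frac (x + real (tau k x + 1) * \<alpha>) < z")
    case False
    then have "frac (x + real (tau k x + 2) * \<alpha>) < z" using ret[OF False] by (simp add: algebra_simps)
    moreover have "vis (tau k x + 2) x = Suc k"
      using Suc False vis_Suc[of "tau k x" x] vis_Suc[of "Suc (tau k x)" x] by simp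
    ultimately show ?thesis using False by simp
  qed (use Suc vis_Suc[of "tau k x" x] in simp)
qed (use assms in simp)

lemma tau_bounds: "k \<le> tau k x" "tau k x \<le> 2 * k"
  by (induction k) auto

lemma tau_strict_mono: "j < k \<Longrightarrow> tau j x < tau k x"
  by (rule lift_Suc_mono_less[of "\<lambda>k. tau k x"]) auto

lemma T_tau:
  assumes "x \<in> {0..<z}"
  shows "(T ^^ k) x = frac (x + real (tau k x) * \<alpha>)"
proof -
  have "frac x < z" using assms z by (simp add: frac_eq)
  with T_vis[OF assms, of "tau k x"] tau_props[of x k] show ?thesis by simp
qed

text \<open>Two consecutive misses are impossible, so the induction goes in steps of two.\<close>

lemma vis_lower: "r \<le> 2 * vis r x + 1"
proof (induction r rule: induct_nat_012)
  case (ge2 n)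
  have "vis (Suc (Suc n)) x \<ge> vis n x + 1"
    using ret[of "x + real n * \<alpha>"] by (auto simp: vis_Suc algebra_simps)
  then show ?case using ge2 by simp
qed auto

lemma sum_vis:
  fixes f :: "real \<Rightarrow> real"
  assumes "x \<in> {0..<z}"
  shows "(\<Sum>j<vis r x. f ((T ^^ j) x)) = (\<Sum>i<r. if frac (x + real i * \<alpha>) < z then f (frac (x + real i * \<alpha>)) else 0)"
  by (induction r) (simp_all add: vis_Suc T_vis[OF assms])

end

text \<open>A long sum is cut into blocks of length \<open>L\<close>, on which \<open>osc\<close>
  makes it nearly independent of the starting point. This gives for each \<epsilon> an approximate
  mean \<open>m\<close>, uniformly in x; the averages at 0 are then Cauchy, and their limit replaces
  all the \<open>m\<close>.\<close>

lemma uniform_mean_exists: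
  fixes S :: "nat \<Rightarrow> real \<Rightarrow> real"
  assumes add: "\<And>a b x. S (a + b) x = S a x + S b (x + real a * \<alpha>)"
    and bd: "\<And>a x. \<bar>S a x\<bar> \<le> M * real a"
    and osc: "\<And>\<epsilon>. \<epsilon> > 0 \<Longrightarrow> \<exists>L>0. \<forall>x y. \<bar>S L x - S L y\<bar> \<le> \<epsilon> * real L"
  shows "\<exists>c. \<forall>\<epsilon>>0. \<exists>K0. \<forall>K\<ge>K0. \<forall>x. \<bar>S K x - c * real K\<bar> \<le> \<epsilon> * real K"
proof -
  have M0: "0 \<le> M" using bd[of 1 0] by linarith
  have block: "\<exists>m K0. \<forall>K\<ge>K0. \<forall>x. \<bar>S K x - m * real K\<bar> \<le> \<epsilon> * real K" if e: "\<epsilon> > 0" for \<epsilon>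
  proof -
    obtain L where L: "L > 0" "\<And>x y. \<bar>S L x - S L y\<bar> \<le> \<epsilon> / 2 * real L" using osc[of "\<epsilon> / 2"] e by auto
    have S0: "S 0 x = 0" for x using bd[of 0 x] by simp
    have mult: "\<bar>S (a * L) x - real a * S L 0\<bar> \<le> real a * (\<epsilon> / 2 * real L)" for a x
    proof (induction a)
      case (Suc a)
      have "S (Suc a * L) x = S (a * L) x + S L (x + real (a * L) * \<alpha>)" using add[of "a * L" L x] by (simp add: add.commute)
      moreover have "real (Suc a) * S L 0 = real a * S L 0 + S L 0"
        "real (Suc a) * (\<epsilon> / 2 * real L) = real a * (\<epsilon> / 2 * real L) + \<epsilon> / 2 * real L"
        by (simp_all add: algebra_simps)
      ultimately show ?case using Suc L(2)[of "x + real (a * L) * \<alpha>" 0] by linarith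
    qed (simp add: S0)
    define m where "m = S L 0 / real L"
    have "\<bar>S K x - m * real K\<bar> \<le> \<epsilon> * real K" if K: "K \<ge> nat \<lceil>4 * M * real L / \<epsilon>\<rceil>" for K x
    proof -
      define a b where "a = K div L" and "b = K mod L"
      have Kab: "K = a * L + b" "b < L" using L(1) by (auto simp: a_def b_def)
      have "S K x = S (a * L) x + S b (x + real (a * L) * \<alpha>)" using add[of "a * L" b x] Kab by simp
      moreover have "\<bar>S b (x + real (a * L) * \<alpha>)\<bar> \<le> M * real L"
        by (rule order_trans[OF bd mult_left_mono]) (use Kab(2) M0 in auto)
      moreover have "m * real K = real a * S L 0 + m * real b"
        using Kab(1) L(1) by (simp add: m_def field_simps)
      moreover have "\<bar>m * real b\<bar> \<le> M * real L"
      proof -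
        have "\<bar>m\<bar> \<le> M" using bd[of L 0] L(1) by (simp add: m_def field_simps)
        then have "\<bar>m * real b\<bar> \<le> M * real b" by (simp add: abs_mult mult_right_mono)
        also have "\<dots> \<le> M * real L" using Kab(2) M0 by (intro mult_left_mono) auto
        finally show ?thesis .
      qed
      moreover have "real a * (\<epsilon> / 2 * real L) \<le> \<epsilon> / 2 * real K" using Kab e by (simp add: algebra_simps)
      moreover have "2 * (M * real L) \<le> \<epsilon> / 2 * real K"
      proof -
        have "4 * M * real L / \<epsilon> \<le> real K" using K by linarith
        then show ?thesis using e by (simp add: field_simps)
      qed
      ultimately have "\<bar>S K x - m * real K\<bar> \<le> \<epsilon> / 2 * real K + \<epsilon> / 2 * real K" using mult[of a x] by linarith
      then show ?thesis by simp
    qed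
    then show ?thesis by blast
  qed
  define X where "X = (\<lambda>K. S K 0 / real K)"
  have near_m: "\<exists>m K0. (\<forall>K\<ge>K0. \<bar>X K - m\<bar> \<le> \<epsilon>) \<and> (\<forall>K\<ge>K0. \<forall>x. \<bar>S K x - m * real K\<bar> \<le> \<epsilon> * real K)" if e: "\<epsilon> > 0" for \<epsilon>
  proof -
    obtain m K0 where m: "\<forall>K\<ge>K0. \<forall>x. \<bar>S K x - m * real K\<bar> \<le> \<epsilon> * real K" using block[OF e] by blast
    have "\<bar>X K - m\<bar> \<le> \<epsilon>" if "K \<ge> max K0 1" for K
    proof -
      have K: "real K > 0" using that by simp
      have "X K - m = (S K 0 - m * real K) / real K" using K by (simp add: X_def field_simps)
      then have "\<bar>X K - m\<bar> = \<bar>S K 0 - m * real K\<bar> / real K" using K by simp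
      also have "\<dots> \<le> \<epsilon>" using m that K by (simp add: field_simps)
      finally show ?thesis .
    qed
    then show ?thesis using m by (intro exI[of _ m] exI[of _ "max K0 1"]) auto
  qed
  have "Cauchy X"
  proof (rule metric_CauchyI)
    fix e :: real assume "e > 0"
    then obtain m K0 where m: "\<forall>K\<ge>K0. \<bar>X K - m\<bar> \<le> e / 3" using near_m[of "e / 3"] divide_pos_pos[of e 3] by (metis zero_less_numeral)
    have "dist (X i) (X j) < e" if "i \<ge> K0" "j \<ge> K0" for i j
    proof -
      have "\<bar>X i - m\<bar> \<le> e / 3" "\<bar>X j - m\<bar> \<le> e / 3" using m that by auto
      then show ?thesis using \<open>e > 0\<close> unfolding dist_real_def by linarith
    qed
    then show "\<exists>M. \<forall>m\<ge>M. \<forall>n\<ge>M. dist (X m) (X n) < e" by blast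
  qed
  then obtain c where c: "X \<longlonglongrightarrow> c" using Cauchy_convergent convergent_def by blast
  have "\<exists>K0. \<forall>K\<ge>K0. \<forall>x. \<bar>S K x - c * real K\<bar> \<le> \<epsilon> * real K" if "\<epsilon> > 0" for \<epsilon>
  proof -
    obtain m K0 where m: "\<forall>K\<ge>K0. \<bar>X K - m\<bar> \<le> \<epsilon> / 2" "\<forall>K\<ge>K0. \<forall>x. \<bar>S K x - m * real K\<bar> \<le> \<epsilon> / 2 * real K"
      using near_m[OF half_gt_zero[OF \<open>\<epsilon> > 0\<close>]] by blast
    have "(\<lambda>K. \<bar>X K - m\<bar>) \<longlonglongrightarrow> \<bar>c - m\<bar>" by (intro tendsto_intros c)
    then have cm: "\<bar>c - m\<bar> \<le> \<epsilon> / 2"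
      by (rule tendsto_upperbound) (use m(1) in \<open>auto simp: eventually_sequentially\<close>)
    have "\<bar>S K x - c * real K\<bar> \<le> \<epsilon> * real K" if "K \<ge> K0" for K x
    proof -
      have "\<bar>(c - m) * real K\<bar> \<le> \<epsilon> / 2 * real K" using mult_right_mono[OF cm, of "real K"] by (simp add: abs_mult)
      moreover have "S K x - c * real K = (S K x - m * real K) - (c - m) * real K" by (simp add: algebra_simps)
      moreover have "\<bar>S K x - m * real K\<bar> \<le> \<epsilon> / 2 * real K" using m(2) that by blast
      ultimately show ?thesis by linarith
    qed
    then show ?thesis by blast
  qed
  then show ?thesis by blast
qed

section \<open>Uniform averages for the rotation and for the induced map\<close>

locale irrational_return = irrational \<alpha> + return_map \<alpha> z for \<alpha> z :: real
begin

lemma rotation_mean: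
  fixes G :: "real \<Rightarrow> real"
  assumes M: "\<And>a. \<bar>G a\<bar> \<le> M"
    and osc: "\<And>\<epsilon>. \<epsilon> > 0 \<Longrightarrow> \<exists>d>0. \<forall>a\<in>{0..<1}. \<forall>b\<in>{0..<1}. \<bar>a - b\<bar> < d \<longrightarrow> (a < z \<longleftrightarrow> b < z) \<longrightarrow> \<bar>G a - G b\<bar> \<le> \<epsilon>"
  shows "\<exists>c. \<forall>\<epsilon>>0. \<exists>K0. \<forall>K\<ge>K0. \<forall>x. \<bar>(\<Sum>i<K. G (frac (x + real i * \<alpha>))) - c * real K\<bar> \<le> \<epsilon> * real K"
proof (rule uniform_mean_exists[where S = "\<lambda>K x. \<Sum>i<K. G (frac (x + real i * \<alpha>))" and \<alpha> = \<alpha> and M = M])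
  show "(\<Sum>i<a + b. G (frac (x + real i * \<alpha>))) = (\<Sum>i<a. G (frac (x + real i * \<alpha>))) + (\<Sum>i<b. G (frac (x + real a * \<alpha> + real i * \<alpha>)))" for a b x
    by (induction b) (simp_all add: algebra_simps)
  show "\<bar>\<Sum>i<a. G (frac (x + real i * \<alpha>))\<bar> \<le> M * real a" for a x
  proof -
    have "\<bar>\<Sum>i<a. G (frac (x + real i * \<alpha>))\<bar> \<le> (\<Sum>i<a. M)" by (rule order_trans[OF sum_abs sum_mono[OF M]])
    then show ?thesis by (simp add: mult.commute)
  qed
  fix \<epsilon> :: real assume e: "\<epsilon> > 0"
  have M0: "0 \<le> M" using M[of 0] by linarith
  obtain d where d: "d > 0" "\<forall>a\<in>{0..<1}. \<forall>b\<in>{0..<1}. \<bar>a - b\<bar> < d \<longrightarrow> (a < z \<longleftrightarrow> b < z) \<longrightarrow> \<bar>G a - G b\<bar> \<le> \<epsilon> / 2"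
    using osc[of "\<epsilon> / 2"] e by auto
  \<comment> \<open>For L beyond \<open>B\<close> the distance 3 / L is below \<open>d\<close> and
    the boundary term 32 M is at most half of the allowed error.\<close>
  define B where "B = max (3 / d) (64 * M / \<epsilon>)"
  obtain s where s: "B < 2 ^ s" using real_arch_pow[of 2 B] by auto
  define L where "L = cf_q \<alpha> (2 * s)"
  have "2 ^ s \<le> L" using cf_q_growth[of s 0] by (simp add: L_def)
  then have "(2::real) ^ s \<le> real L" by (metis of_nat_le_iff of_nat_numeral of_nat_power)
  then have LB: "B < real L" using s by linarith
  have L: "L > 0" by (simp add: L_def cf_q_pos)
  have "3 / real L < d" using LB L d by (simp add: B_def field_simps)
  moreover have "32 * M \<le> \<epsilon> / 2 * real L" using LB e by (simp add: B_def field_simps)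
  moreover have "approximant \<alpha> L (int (cf_p \<alpha> (2 * s)))" unfolding L_def by (rule approximant_cf)
  ultimately have "\<bar>(\<Sum>i<L. G (frac (x + real i * \<alpha>))) - (\<Sum>i<L. G (frac (y + real i * \<alpha>)))\<bar> \<le> \<epsilon> / 2 * real L + 32 * M" for x y
    by (intro approximant_sum_diff[of \<alpha> L _ G M "\<epsilon> / 2" z x y] M) (use d(2) e in auto)
  then have "\<bar>(\<Sum>i<L. G (frac (x + real i * \<alpha>))) - (\<Sum>i<L. G (frac (y + real i * \<alpha>)))\<bar> \<le> \<epsilon> * real L" for x y
    by (rule order_trans) (use \<open>32 * M \<le> \<epsilon> / 2 * real L\<close> in linarith)
  then show "\<exists>L>0. \<forall>x y. \<bar>(\<Sum>i<L. G (frac (x + real i * \<alpha>))) - (\<Sum>i<L. G (frac (y + real i * \<alpha>)))\<bar> \<le> \<epsilon> * real L"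
    using L by blast
qed

text \<open>The sum along \<open>K\<close> steps of \<open>T\<close> is the rotation sum of
  \<open>G\<close> up to the K-th return time, so the mean is the quotient of the rotation means of
  \<open>G\<close> and of the indicator of [0, z). The latter is positive because at least every
  second time is a visit.\<close>

lemma T_mean:
  fixes f :: "real \<Rightarrow> real"
  assumes "continuous_on {0..z} f"
  shows "\<exists>c. \<forall>\<epsilon>>0. \<exists>K0. \<forall>K\<ge>K0. \<forall>x\<in>{0..<z}. \<bar>(\<Sum>j<K. f ((T ^^ j) x)) - c * real K\<bar> \<le> \<epsilon> * real K"
proof -
  have "compact (f ` {0..z})" using assms compact_continuous_image by blast
  then obtain M where M: "\<And>a. a \<in> {0..z} \<Longrightarrow> \<bar>f a\<bar> \<le> M" using compact_imp_bounded by (fastforce simp: bounded_iff)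
  have uc: "uniformly_continuous_on {0..z} f" using assms compact_uniformly_continuous by blast
  define G where "G = (\<lambda>a. if 0 \<le> a \<and> a < z then f a else 0)"
  have "\<exists>c. \<forall>\<epsilon>>0. \<exists>K0. \<forall>K\<ge>K0. \<forall>x. \<bar>(\<Sum>i<K. G (frac (x + real i * \<alpha>))) - c * real K\<bar> \<le> \<epsilon> * real K"
  proof (rule rotation_mean)
    show "\<bar>G a\<bar> \<le> M" for a using M[of a] M[of 0] z by (auto simp: G_def)
    fix \<epsilon> :: real assume "\<epsilon> > 0"
    then obtain d where "d > 0" "\<And>a b. a \<in> {0..z} \<Longrightarrow> b \<in> {0..z} \<Longrightarrow> dist b a < d \<Longrightarrow> dist (f b) (f a) < \<epsilon>"
      using uc unfolding uniformly_continuous_on_def by metis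
    then have "\<bar>G a - G b\<bar> \<le> \<epsilon>" if "a \<in> {0..<1}" "b \<in> {0..<1}" "\<bar>a - b\<bar> < d" "a < z \<longleftrightarrow> b < z" for a b
      using that \<open>\<epsilon> > 0\<close> by (auto simp: G_def dist_real_def less_imp_le)
    then show "\<exists>d>0. \<forall>a\<in>{0..<1}. \<forall>b\<in>{0..<1}. \<bar>a - b\<bar> < d \<longrightarrow> (a < z \<longleftrightarrow> b < z) \<longrightarrow> \<bar>G a - G b\<bar> \<le> \<epsilon>"
      using \<open>d > 0\<close> by blast
  qed
  then obtain cf where cf: "\<And>\<epsilon>. \<epsilon> > 0 \<Longrightarrow> \<exists>K0. \<forall>K\<ge>K0. \<forall>x. \<bar>(\<Sum>i<K. G (frac (x + real i * \<alpha>))) - cf * real K\<bar> \<le> \<epsilon> * real K"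
    by blast
  have "\<exists>c. \<forall>\<epsilon>>0. \<exists>K0. \<forall>K\<ge>K0. \<forall>x. \<bar>(\<Sum>i<K. of_bool (frac (x + real i * \<alpha>) < z)) - c * real K\<bar> \<le> \<epsilon> * real K"
    by (rule rotation_mean[where M = 1]) (auto intro: exI[of _ 1])
  then obtain c1 where c1': "\<And>\<epsilon>. \<epsilon> > 0 \<Longrightarrow> \<exists>K0. \<forall>K\<ge>K0. \<forall>x. \<bar>(\<Sum>i<K. of_bool (frac (x + real i * \<alpha>) < z)) - c1 * real K\<bar> \<le> \<epsilon> * real K"
    by blast
  have c1: "\<exists>K0. \<forall>K\<ge>K0. \<forall>x. \<bar>real (vis K x) - c1 * real K\<bar> \<le> \<epsilon> * real K" if "\<epsilon> > 0" for \<epsilon>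
    using c1'[OF that] by (simp add: vis_def)
  have c1_pos: "c1 > 0"
  proof -
    obtain K0 where K0: "\<And>K x. K \<ge> K0 \<Longrightarrow> \<bar>real (vis K x) - c1 * real K\<bar> \<le> 1 / 8 * real K" using c1[of "1/8"] by auto
    define K where "K = K0 + 4"
    have "\<bar>real (vis K 0) - c1 * real K\<bar> \<le> 1 / 8 * real K" by (rule K0) (simp add: K_def)
    moreover have "real K \<le> 2 * real (vis K 0) + 1" using vis_lower[of K 0] by linarith
    moreover have "real K \<ge> 4" by (simp add: K_def)
    ultimately have "c1 * real K > 0" by linarith
    then show ?thesis by (simp add: zero_less_mult_iff)
  qed
  define c where "c = cf / c1"
  have "\<exists>K0. \<forall>K\<ge>K0. \<forall>x\<in>{0..<z}. \<bar>(\<Sum>j<K. f ((T ^^ j) x)) - c * real K\<bar> \<le> \<epsilon> * real K" if e: "\<epsilon> > 0" for \<epsilon>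
  proof -
    \<comment> \<open>The return time is at most 2 K, and the error in the number of visits enters
      multiplied by \<open>c\<close>; \<open>\<epsilon>'\<close> allows for both.\<close>
    define \<epsilon>' where "\<epsilon>' = \<epsilon> / (2 * (1 + \<bar>c\<bar>))"
    have e': "\<epsilon>' > 0" using e by (simp add: \<epsilon>'_def add_pos_nonneg)
    obtain K1 where K1: "\<And>K x. K \<ge> K1 \<Longrightarrow> \<bar>(\<Sum>i<K. G (frac (x + real i * \<alpha>))) - cf * real K\<bar> \<le> \<epsilon>' * real K" using cf[OF e'] by blast
    obtain K2 where K2: "\<And>K x. K \<ge> K2 \<Longrightarrow> \<bar>real (vis K x) - c1 * real K\<bar> \<le> \<epsilon>' * real K" using c1[OF e'] by blast
    have "\<bar>(\<Sum>j<K. f ((T ^^ j) x)) - c * real K\<bar> \<le> \<epsilon> * real K" if K: "K \<ge> max K1 K2" and x: "x \<in> {0..<z}" for K x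
    proof -
      define r where "r = tau K x"
      have fx: "frac x < z" using x z by (simp add: frac_eq)
      have r: "vis r x = K" "K \<le> r" "r \<le> 2 * K" using tau_props[OF fx, of K] tau_bounds[of K x] by (auto simp: r_def)
      have "(\<Sum>j<K. f ((T ^^ j) x)) = (\<Sum>i<r. G (frac (x + real i * \<alpha>)))"
        using sum_vis[OF x, of f r] r(1) by (simp add: G_def)
      moreover have "\<bar>(\<Sum>i<r. G (frac (x + real i * \<alpha>))) - cf * real r\<bar> \<le> \<epsilon>' * real r" using K1 K r by simp
      moreover have "\<bar>c * real K - cf * real r\<bar> \<le> \<bar>c\<bar> * (\<epsilon>' * real r)"
      proof -
      have "\<bar>real K - c1 * real r\<bar> \<le> \<epsilon>' * real r" using K2[of r x] K r by simp
      then have "\<bar>c\<bar> * \<bar>real K - c1 * real r\<bar> \<le> \<bar>c\<bar> * (\<epsilon>' * real r)" by (rule mult_left_mono) simp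
      moreover have "c * real K - cf * real r = c * (real K - c1 * real r)"
        using c1_pos by (simp add: c_def field_simps)
      ultimately show ?thesis by (simp only: abs_mult)
      qed
      ultimately have "\<bar>(\<Sum>j<K. f ((T ^^ j) x)) - c * real K\<bar> \<le> \<epsilon>' * real r + \<bar>c\<bar> * (\<epsilon>' * real r)" by linarith
      also have "\<dots> = (\<epsilon>' * (1 + \<bar>c\<bar>)) * real r" by (simp add: algebra_simps)
      also have "\<epsilon>' * (1 + \<bar>c\<bar>) = \<epsilon> / 2" by (simp add: \<epsilon>'_def add_pos_nonneg field_simps)
      also have "\<epsilon> / 2 * real r \<le> \<epsilon> / 2 * (2 * real K)" using r e by (intro mult_left_mono) auto
      finally show ?thesis by simp
    qed
    then show ?thesis by blast
  qed
  then show ?thesis by blast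
qed

end

section \<open>Drift at a single scale\<close>

lemma near_frac: "near e (frac a + b) w \<longleftrightarrow> near e (a + b) w"
proof -
  have eq: "frac a + b - w - of_int k = a + b - w - of_int (k + \<lfloor>a\<rfloor>)" for k by (simp add: frac_def)
  have eq': "a + b - w - of_int k = frac a + b - w - of_int (k - \<lfloor>a\<rfloor>)" for k by (simp add: frac_def)
  show ?thesis unfolding near_def using eq eq' by metis
qed

lemma card_separated:
  fixes A :: "nat set"
  assumes "A \<subseteq> {..<N}" "0 < h" "\<And>s s'. s \<in> A \<Longrightarrow> s' \<in> A \<Longrightarrow> s < s' \<Longrightarrow> s + h \<le> s'"
  shows "card A \<le> N div h + 1"
proof -
  have "inj_on (\<lambda>s. s div h) A"
  proof (rule linorder_inj_onI)
    fix s s' assume "s < s'" "s \<in> A" "s' \<in> A"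
    then have "s + h \<le> s'" using assms(3) by blast
    then have "(s + h) div h \<le> s' div h" by (rule div_le_mono)
    then show "s div h \<noteq> s' div h" using assms(2) by simp
  qed auto
  then have "card A = card ((\<lambda>s. s div h) ` A)" by (simp add: card_image)
  also have "\<dots> \<le> card {..N div h}"
    using assms(1) by (intro card_mono) (auto simp: div_le_mono less_imp_le)
  finally show ?thesis by simp
qed

text \<open>Within fewer than \<open>h\<close> steps an orbit has no second passage near the
  endpoints 0 and \<open>z\<close> (\<open>sep0\<close>, \<open>sepz\<close>), and within
  \<open>H\<close> steps it hits every interval as long as the displacement |L \<alpha> - p|.
  \<open>N0\<close> counts the displacements that are kept free, so one scale treats all multiples n
  L with 2 (n + 1) at most \<open>N0\<close>.\<close>

locale scale = irrational_return \<alpha> z for \<alpha> z +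
  fixes N0 L h H :: nat and p :: int
  assumes appr: "approximant \<alpha> L p" and h_pos: "0 < h" and \<beta>_nz: "real L * \<alpha> - of_int p \<noteq> 0"
    and sep0: "\<And>t k :: int. t \<noteq> 0 \<Longrightarrow> \<bar>t\<bar> < int h \<Longrightarrow>
      real N0 * \<bar>real L * \<alpha> - of_int p\<bar> \<le> \<bar>of_int t * \<alpha> - of_int k\<bar>"
    and sepz: "\<And>t k :: int. \<bar>t\<bar> < int h \<Longrightarrow>
      real N0 * \<bar>real L * \<alpha> - of_int p\<bar> \<le> \<bar>of_int t * \<alpha> - z - of_int k\<bar>"
    and hits: "\<And>x w. \<exists>t<H. \<exists>k::int. w \<le> x + real t * \<alpha> - of_int k \<and>
      x + real t * \<alpha> - of_int k < w + \<bar>real L * \<alpha> - of_int p\<bar>"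
begin

definition \<delta> :: real where "\<delta> = \<bar>real L * \<alpha> - of_int p\<bar>"

lemma \<delta>_pos: "0 < \<delta>" using \<beta>_nz by (simp add: \<delta>_def)

lemma N0_\<delta>: "real N0 * \<delta> \<le> z" "real N0 * \<delta> \<le> 1 - z"
proof -
  have h: "\<bar>0 :: int\<bar> < int h" using h_pos by simp
  have "real N0 * \<delta> \<le> \<bar>of_int 0 * \<alpha> - z - of_int 0\<bar>" "real N0 * \<delta> \<le> \<bar>of_int 0 * \<alpha> - z - of_int (- 1)\<bar>"
    unfolding \<delta>_def using sepz[OF h] by blast+
  then show "real N0 * \<delta> \<le> z" "real N0 * \<delta> \<le> 1 - z" using z by simp_all
qed

lemma vis_shift: "vis r (x + \<alpha>) + of_bool (frac x < z) = vis r x + of_bool (frac (x + real r * \<alpha>) < z)"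
proof -
  have 1: "vis 1 y = of_bool (frac y < z)" for y using vis_Suc[of 0 y] by simp
  have "vis (1 + r) x = vis 1 x + vis r (x + \<alpha>)" using vis_add[of 1 r x] by simp
  moreover have "vis (r + 1) x = vis r x + vis 1 (x + real r * \<alpha>)" by (rule vis_add)
  ultimately show ?thesis unfolding 1 by (metis add.commute)
qed

text \<open>\<open>approximant_sum_diff\<close> applies with error 0 and M = 1, as the indicator is
  constant on either side of \<open>z\<close>.\<close>

lemma vis_L_bounded: "\<bar>real (vis L x) - real (vis L y)\<bar> \<le> 32"
proof -
  have "\<bar>(\<Sum>r<L. of_bool (frac (x + real r * \<alpha>) < z)) - (\<Sum>r<L. of_bool (frac (y + real r * \<alpha>) < z))\<bar> \<le> 0 * real L + 32 * (1 :: real)"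
    by (rule approximant_sum_diff[OF appr, where z = z]) simp_all
  then show ?thesis by (simp add: vis_def)
qed

lemma vis_mult_bounded: "\<bar>real (vis (n * L) x) - real n * real (vis L 0)\<bar> \<le> 32 * real n"
proof (induction n)
  case (Suc n)
  have "vis (Suc n * L) x = vis (n * L) x + vis L (x + real (n * L) * \<alpha>)"
    using vis_add[of "n * L" L x] by (simp add: add.commute)
  then show ?case using Suc vis_L_bounded[of "x + real (n * L) * \<alpha>" 0] by (simp add: algebra_simps)
qed simp

context
  fixes n :: nat and \<eta> :: real
  assumes n: "0 < n" "2 * (n + 1) \<le> N0"
  defines "\<eta> \<equiv> real (n + 1) * \<delta>"
begin

lemma \<eta>_le: "2 * \<eta> \<le> real N0 * \<delta>"
proof -
  have "real (2 * (n + 1)) * \<delta> \<le> real N0 * \<delta>" using n \<delta>_pos by (intro mult_right_mono) auto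
  then show ?thesis by (simp add: \<eta>_def algebra_simps)
qed

text \<open>The points x where the visit count over n L steps may differ between x and x + \<alpha>.
  The radius \<eta> exceeds the displacement n \<delta> by one \<delta>, which makes
  \<open>displacement\<close> strict, and twice \<eta> still fits into N0 \<delta>.\<close>

definition edge :: "real \<Rightarrow> bool" where "edge x \<longleftrightarrow> near \<eta> x 0 \<or> near \<eta> x z"

lemma displacement: "\<bar>x - (x + real (n * L) * \<alpha>) - of_int (- int n * p)\<bar> < \<eta>"
proof -
  have "x - (x + real (n * L) * \<alpha>) - of_int (- int n * p) = - (real n * (real L * \<alpha> - of_int p))" by (simp add: algebra_simps)
  then have "\<bar>x - (x + real (n * L) * \<alpha>) - of_int (- int n * p)\<bar> = real n * \<delta>"
    by (simp only: abs_minus_cancel abs_mult) (simp add: \<delta>_def)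
  then show ?thesis using \<delta>_pos by (simp add: \<eta>_def algebra_simps)
qed

lemma not_edge_stable:
  assumes "\<not> edge x"
  shows "frac x < z \<longleftrightarrow> frac (x + real (n * L) * \<alpha>) < z" "\<bar>frac x - frac (x + real (n * L) * \<alpha>)\<bar> < \<eta>"
proof -
  have "\<not> near \<eta> x 0" "\<not> near \<eta> x z" using assms by (auto simp: edge_def)
  from frac_stable[OF displacement this]
  show "frac x < z \<longleftrightarrow> frac (x + real (n * L) * \<alpha>) < z" "\<bar>frac x - frac (x + real (n * L) * \<alpha>)\<bar> < \<eta>" .
qed

lemma not_edge_vis:
  assumes "\<not> edge x"
  shows "vis (n * L) (x + \<alpha>) = vis (n * L) x"
proof -
  have "(of_bool (frac x < z) :: nat) = of_bool (frac (x + real (n * L) * \<alpha>) < z)"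
    using not_edge_stable(1)[OF assms] by (rule arg_cong)
  with vis_shift[of "n * L" x] show ?thesis by (simp only: add_right_cancel)
qed

text \<open>Two edge points whose times differ by t put t \<alpha>, t \<alpha> - z or t \<alpha> + z
  within 2 \<eta> of an integer, against \<open>sep0\<close> or \<open>sepz\<close>.\<close>

lemma edge_separated:
  assumes "edge x" "edge (x + of_int t * \<alpha>)" "t \<noteq> 0"
  shows "int h \<le> \<bar>t\<bar>"
proof (rule ccontr)
  assume "\<not> int h \<le> \<bar>t\<bar>"
  then have t: "\<bar>t\<bar> < int h" "\<bar>- t\<bar> < int h" by auto
  have s0: "2 * \<eta> \<le> \<bar>of_int t * \<alpha> - of_int k\<bar>" for k
    using sep0[OF assms(3) t(1), of k] \<eta>_le by (simp add: \<delta>_def)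
  have s1: "2 * \<eta> \<le> \<bar>of_int t * \<alpha> - z - of_int k\<bar>" for k
    using sepz[OF t(1), of k] \<eta>_le by (simp add: \<delta>_def)
  have s2: "2 * \<eta> \<le> \<bar>of_int t * \<alpha> + z - of_int k\<bar>" for k
    using sepz[OF t(2), of "- k"] \<eta>_le by (simp add: \<delta>_def abs_if split: if_splits)
  obtain w k where k: "w = 0 \<or> w = z" "\<bar>x - w - of_int k\<bar> < \<eta>"
    using assms(1) unfolding edge_def near_def by metis
  obtain w' k' where k': "w' = 0 \<or> w' = z" "\<bar>x + of_int t * \<alpha> - w' - of_int k'\<bar> < \<eta>"
    using assms(2) unfolding edge_def near_def by metis
  have "\<bar>of_int t * \<alpha> - (w' - w) - of_int (k' - k)\<bar> < 2 * \<eta>" using k(2) k'(2) by (simp add: abs_less_iff)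
  moreover have "w' - w = 0 \<or> w' - w = z \<or> w' - w = - z" using k(1) k'(1) by auto
  ultimately show False using s0[of "k' - k"] s1[of "k' - k"] s2[of "k' - k"] by fastforce
qed

text \<open>An orbit point is taken within \<delta> of 0, on the side from which n L steps carry it
  across 0. The displacement n \<delta> is at least \<delta> and at most the minimum of z and 1 - z,
  so it does pass 0 and does not pass z as well.\<close>

lemma change_exists:
  "\<exists>t<H. edge (x + real t * \<alpha>) \<and>
    (frac (x + real t * \<alpha>) < z \<longleftrightarrow> \<not> frac (x + real t * \<alpha> + real (n * L) * \<alpha>) < z)"
proof -
  define \<beta> where "\<beta> = real L * \<alpha> - of_int p"
  have nd: "real n * \<delta> \<le> real N0 * \<delta>" using n \<delta>_pos by (intro mult_right_mono) auto
  have d1: "1 * \<delta> \<le> real n * \<delta>" using n \<delta>_pos by (intro mult_right_mono) auto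
  define e where "e = real n * \<delta>"
  have bnd: "e \<le> z" "e \<le> 1 - z" "\<delta> \<le> e" unfolding e_def using nd d1 N0_\<delta> by linarith+
  have de: "\<delta> < \<eta>" using n \<delta>_pos by (simp add: \<eta>_def)
  have fr: "frac y = y - of_int k" if "of_int k \<le> y" "y < of_int k + 1" for y and k :: int
    using that by (simp add: frac_unique_iff)
  show ?thesis
  proof (cases "\<beta> > 0")
    case True
    then have \<beta>: "real L * \<alpha> - of_int p = \<delta>" by (simp add: \<beta>_def \<delta>_def)
    obtain t k where t: "t < H" "- \<delta> \<le> x + real t * \<alpha> - of_int k" "x + real t * \<alpha> - of_int k < 0"
      using hits[of "- \<delta>" x] by (auto simp: \<delta>_def)
    define y where "y = x + real t * \<alpha>"
    have ty: "- \<delta> \<le> y - of_int k" "y - of_int k < 0" using t by (simp_all add: y_def)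
    have "frac y = y - of_int (k - 1)"
    proof (rule fr)
      show "of_int (k - 1) \<le> y" "y < of_int (k - 1) + 1" using ty bnd z by simp_all
    qed
    then have 1: "\<not> frac y < z" using ty bnd by simp
    have nL: "real (n * L) * \<alpha> = e + of_int (int n * p)" unfolding e_def \<beta>[symmetric] by (simp add: algebra_simps)
    have "frac (y + real (n * L) * \<alpha>) = y + real (n * L) * \<alpha> - of_int (k + int n * p)"
    proof (rule fr)
      show "of_int (k + int n * p) \<le> y + real (n * L) * \<alpha>" "y + real (n * L) * \<alpha> < of_int (k + int n * p) + 1"
        unfolding nL using ty bnd z by simp_all
    qed
    then have 2: "frac (y + real (n * L) * \<alpha>) < z" unfolding nL using ty bnd by simp
    have "\<bar>y - 0 - of_int k\<bar> < \<eta>" using ty de by (simp add: abs_less_iff)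
    then have "edge y" unfolding edge_def near_def by blast
    then show ?thesis using t(1) 1 2 unfolding y_def by blast
  next
    case False
    then have \<beta>: "real L * \<alpha> - of_int p = - \<delta>" by (simp add: \<beta>_def \<delta>_def)
    obtain t k where t: "t < H" "0 \<le> x + real t * \<alpha> - of_int k" "x + real t * \<alpha> - of_int k < \<delta>"
      using hits[of 0 x] by (auto simp: \<delta>_def)
    define y where "y = x + real t * \<alpha>"
    have ty: "0 \<le> y - of_int k" "y - of_int k < \<delta>" using t by (simp_all add: y_def)
    have "frac y = y - of_int k"
    proof (rule fr)
      show "of_int k \<le> y" "y < of_int k + 1" using ty bnd z by simp_all
    qed
    then have 1: "frac y < z" using ty bnd by simp
    have nL: "real (n * L) * \<alpha> = - e + of_int (int n * p)" unfolding e_def using arg_cong[OF \<beta>, of "\<lambda>b. real n * b"] by (simp add: algebra_simps)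
    have "frac (y + real (n * L) * \<alpha>) = y + real (n * L) * \<alpha> - of_int (k + int n * p - 1)"
    proof (rule fr)
      show "of_int (k + int n * p - 1) \<le> y + real (n * L) * \<alpha>" "y + real (n * L) * \<alpha> < of_int (k + int n * p - 1) + 1"
        unfolding nL using ty bnd z by simp_all
    qed
    then have 2: "\<not> frac (y + real (n * L) * \<alpha>) < z" unfolding nL using ty bnd by simp
    have "\<bar>y - 0 - of_int k\<bar> < \<eta>" using ty de by (simp add: abs_less_iff)
    then have "edge y" unfolding edge_def near_def by blast
    then show ?thesis using t(1) 1 2 unfolding y_def by blast
  qed
qed

text \<open>Between two consecutive changes, which are at least \<open>h\<close> steps apart, the visit count is constant,
  and at a change it moves by one; so it avoids the multiples of \<open>d\<close> before or after the change.\<close>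

lemma run_exists:
  assumes d: "2 \<le> d"
  shows "\<exists>t1\<le>h + H. \<forall>t. t1 \<le> t \<and> t < t1 + h \<longrightarrow> \<not> d dvd vis (n * L) (x + real t * \<alpha>)"
proof -
  \<comment> \<open>The search starts at time \<open>h\<close>, so that \<open>h\<close> times
    before the change are available as well as those after it.\<close>
  obtain s where s: "s < H" and es: "edge (x + real h * \<alpha> + real s * \<alpha>)"
    and ch: "frac (x + real h * \<alpha> + real s * \<alpha>) < z \<longleftrightarrow> \<not> frac (x + real h * \<alpha> + real s * \<alpha> + real (n * L) * \<alpha>) < z"
    using change_exists[of "x + real h * \<alpha>"] by blast
  define t0 where "t0 = h + s"
  define g where "g = (\<lambda>t. vis (n * L) (x + real t * \<alpha>))"
  have y: "x + real h * \<alpha> + real s * \<alpha> = x + real t0 * \<alpha>" by (simp add: t0_def algebra_simps)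
  have gS: "g (Suc t) = vis (n * L) (x + real t * \<alpha> + \<alpha>)" for t by (simp add: g_def algebra_simps)
  have step: "g (Suc t) = g t" if "t \<noteq> t0" "\<bar>int t - int t0\<bar> < int h" for t
  proof -
    have eq: "x + real t * \<alpha> = x + real t0 * \<alpha> + of_int (int t - int t0) * \<alpha>" by (simp add: algebra_simps)
    have "\<not> edge (x + real t * \<alpha>)"
    proof
      assume "edge (x + real t * \<alpha>)"
      then have "int h \<le> \<bar>int t - int t0\<bar>" unfolding eq by (rule edge_separated[OF es[unfolded y]]) (use that in simp)
      then show False using that by simp
    qed
    then show ?thesis unfolding gS by (simp add: not_edge_vis g_def)
  qed
  have jump: "g (Suc t0) = Suc (g t0) \<or> g t0 = Suc (g (Suc t0))"
  proof -
    have "g (Suc t0) + of_bool (frac (x + real t0 * \<alpha>) < z) = g t0 + of_bool (frac (x + real t0 * \<alpha> + real (n * L) * \<alpha>) < z)"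
      unfolding gS using vis_shift[of "n * L" "x + real t0 * \<alpha>"] by (simp only: g_def)
    then show ?thesis using ch unfolding y by (cases "frac (x + real t0 * \<alpha>) < z") simp_all
  qed
  have before: "g (t0 - i) = g t0" if "i < h" for i
    using that
  proof (induction i)
    case (Suc i)
    have "Suc (t0 - Suc i) = t0 - i" using Suc.prems by (simp add: t0_def)
    then show ?case using step[of "t0 - Suc i"] Suc by (simp add: t0_def)
  qed simp
  have after: "g (Suc t0 + i) = g (Suc t0)" if "i < h" for i
    using that
  proof (induction i)
    case (Suc i)
    then show ?case using step[of "Suc t0 + i"] by simp
  qed simp
  show ?thesis
  proof (cases "d dvd g t0")
    case False
    show ?thesis
    proof (intro exI[of _ "Suc t0 - h"] conjI allI impI)
      show "Suc t0 - h \<le> h + H" using s by (simp add: t0_def)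
      fix t assume t: "Suc t0 - h \<le> t \<and> t < Suc t0 - h + h"
      then have "g (t0 - (t0 - t)) = g t0" by (intro before) (auto simp: t0_def)
      moreover have "t0 - (t0 - t) = t" using t by (simp add: t0_def)
      ultimately show "\<not> d dvd vis (n * L) (x + real t * \<alpha>)" using False by (simp add: g_def)
    qed
  next
    case True
    have "\<not> d dvd g (Suc t0)"
    proof
      assume "d dvd g (Suc t0)"
      with True jump have "d dvd 1" by (metis dvd_add_right_iff Suc_eq_plus1 add.commute)
      then show False using d by simp
    qed
    show ?thesis
    proof (intro exI[of _ "Suc t0"] conjI allI impI)
      show "Suc t0 \<le> h + H" using s by (simp add: t0_def)
      fix t assume t: "Suc t0 \<le> t \<and> t < Suc t0 + h"
      then have "g (Suc t0 + (t - Suc t0)) = g (Suc t0)" by (intro after) auto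
      then show "\<not> d dvd vis (n * L) (x + real t * \<alpha>)" using t \<open>\<not> d dvd g (Suc t0)\<close> by (simp add: g_def)
    qed
  qed
qed

text \<open>A run of length h for the rotation contains m visits with 2 m + 1 at least h, and these
  are consecutive iterates of \<open>T\<close>. At least m / n - 1 of their indices are multiples of
  n.\<close>

lemma nondivisible_frequency:
  assumes d: "2 \<le> d" and x: "x \<in> {0..<z}"
  shows "real h / (2 * real n) - 2 \<le> real (card {w. w < 2 * h + H \<and> \<not> d dvd vis (n * L) ((T ^^ (n * w)) x)})"
proof -
  obtain t1 where t1: "t1 \<le> h + H" "\<And>t. t1 \<le> t \<Longrightarrow> t < t1 + h \<Longrightarrow> \<not> d dvd vis (n * L) (x + real t * \<alpha>)"
    using run_exists[OF d, of x] by blast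
  define k0 m where "k0 = vis t1 x" and "m = vis h (x + real t1 * \<alpha>)"
  have k0m: "vis (t1 + h) x = k0 + m" by (simp add: k0_def m_def vis_add)
  have fx: "frac x < z" using x z by (simp add: frac_eq)
  have nd: "\<not> d dvd vis (n * L) ((T ^^ k) x)" if k: "k0 \<le> k" "k < k0 + m" for k
  proof -
    define t where "t = tau k x"
    have t: "frac (x + real t * \<alpha>) < z" "vis t x = k" using tau_props[OF fx, of k] by (auto simp: t_def)
    have "t1 \<le> t"
    proof (rule ccontr)
      assume "\<not> t1 \<le> t"
      then have "vis (Suc t) x \<le> vis t1 x" by (intro vis_mono) simp
      then show False using t k by (simp add: vis_Suc k0_def)
    qed
    moreover have "t < t1 + h"
    proof (rule ccontr)
      assume "\<not> t < t1 + h"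
      then have "vis (t1 + h) x \<le> vis t x" by (intro vis_mono) simp
      then show False using t k k0m by simp
    qed
    ultimately have "\<not> d dvd vis (n * L) (x + real t * \<alpha>)" using t1(2) by blast
    then show ?thesis by (simp add: T_tau[OF x] t_def[symmetric] vis_frac)
  qed
  \<comment> \<open>\<open>n * c\<close> is the least multiple of \<open>n\<close> that is at least
    \<open>k0\<close>.\<close>
  define c where "c = (k0 + n - 1) div n"
  have c: "k0 \<le> n * c" "n * c \<le> k0 + n - 1"
  proof -
    have "k0 + n - 1 < n * c + n" unfolding c_def using dividend_less_div_times[OF n(1), of "k0 + n - 1"] by (simp only: mult.commute add.commute)
    moreover have "k0 \<le> q" if "k0 + n - 1 < q + n" for q using that n(1) by linarith
    ultimately show "k0 \<le> n * c" by blast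
    show "n * c \<le> k0 + n - 1" unfolding c_def by (rule times_div_less_eq_dividend)
  qed
  have "(\<lambda>i. c + i) ` {..<m div n} \<subseteq> {w. w < 2 * h + H \<and> \<not> d dvd vis (n * L) ((T ^^ (n * w)) x)}"
  proof clarify
    fix i assume i: "i < m div n"
    have "n * Suc i \<le> n * (m div n)" using i by (intro mult_le_mono2) simp
    also have "\<dots> \<le> m" by simp
    finally have lt: "n * (c + i) < k0 + m" using c n(1) by (simp add: algebra_simps)
    have "c + i \<le> n * (c + i)" using n(1) by simp
    also have "\<dots> < vis (t1 + h) x" using lt k0m by simp
    also have "\<dots> \<le> t1 + h" by (rule vis_le)
    finally have "c + i < 2 * h + H" using t1(1) by linarith
    moreover have "\<not> d dvd vis (n * L) ((T ^^ (n * (c + i))) x)"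
      using lt c(1) by (intro nd) (auto simp: algebra_simps)
    ultimately show "c + i < 2 * h + H \<and> \<not> d dvd vis (n * L) ((T ^^ (n * (c + i))) x)" by blast
  qed
  from card_mono[OF _ this] have "m div n \<le> card {w. w < 2 * h + H \<and> \<not> d dvd vis (n * L) ((T ^^ (n * w)) x)}"
    by (simp add: card_image)
  then have "real (m div n) \<le> real (card {w. w < 2 * h + H \<and> \<not> d dvd vis (n * L) ((T ^^ (n * w)) x)})" by simp
  moreover have "real m / real n - 1 \<le> real (m div n)"
  proof -
    have "m \<le> (m div n) * n + n" using dividend_less_div_times[OF n(1), of m] by simp
    then have "real m \<le> real (m div n) * real n + real n" by (metis of_nat_add of_nat_le_iff of_nat_mult)
    then show ?thesis using n(1) by (simp add: field_simps)
  qed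
  moreover have "real h / (2 * real n) - 1 \<le> real m / real n"
  proof -
    have "real h \<le> 2 * real m + 1" using vis_lower[of h "x + real t1 * \<alpha>"] by (simp add: m_def)
    then have "real h \<le> 2 * real m + 2 * real n" using n(1) by linarith
    then have "real h / (2 * real n) \<le> (2 * real m + 2 * real n) / (2 * real n)" by (rule divide_right_mono) simp
    then show ?thesis using n(1) by (simp add: add_divide_distrib)
  qed
  ultimately show ?thesis by linarith
qed

text \<open>Outside this set the orbits of y and of its image under n L steps of the rotation agree,
  up to time \<open>tm\<close>, on which times are visits.\<close>

definition exceptional :: "nat \<Rightarrow> real set" where
  "exceptional tm = {y. \<exists>t\<le>tm. edge (y + real t * \<alpha>)}"

text \<open>The times at which the orbit of x is at an edge are h-separated. Each j in question has
  its return time \<open>tau (n * j) x\<close> at most \<open>tm\<close> before one of them, and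
  distinct j have distinct return times. The range 2 n K + tm + 1 comes from
  \<open>tau_bounds\<close>.\<close>

lemma exceptional_density:
  assumes x: "x \<in> {0..<z}"
  shows "card {j. j < K \<and> (T ^^ (n * j)) x \<in> exceptional tm} \<le> (tm + 1) * ((2 * n * K + tm + 1) div h + 1)"
proof -
  define N where "N = 2 * n * K + tm + 1"
  define A where "A = {s. s < N \<and> edge (x + real s * \<alpha>)}"
  have finA: "finite A" by (simp add: A_def)
  have cA: "card A \<le> N div h + 1"
  proof (rule card_separated)
    fix s s' assume s: "s \<in> A" "s' \<in> A" "s < s'"
    have eq: "x + real s' * \<alpha> = x + real s * \<alpha> + of_int (int s' - int s) * \<alpha>" by (simp add: algebra_simps)
    have "edge (x + real s * \<alpha>)" "edge (x + real s' * \<alpha>)" using s by (auto simp: A_def)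
    then have "int h \<le> \<bar>int s' - int s\<bar>" unfolding eq by (rule edge_separated) (use s in simp)
    then show "s + h \<le> s'" using s by linarith
  qed (auto simp: A_def h_pos)
  define U where "U = (\<Union>t\<in>{..tm}. (\<lambda>a. a - t) ` A)"
  have "(\<lambda>j. tau (n * j) x) ` {j. j < K \<and> (T ^^ (n * j)) x \<in> exceptional tm} \<subseteq> U" (is "?f ` ?S \<subseteq> U")
  proof clarify
    fix j assume j: "j < K" "(T ^^ (n * j)) x \<in> exceptional tm"
    define s where "s = tau (n * j) x"
    obtain t where t: "t \<le> tm" "edge (frac (x + real s * \<alpha>) + real t * \<alpha>)"
      using j(2) by (auto simp: exceptional_def T_tau[OF x] s_def)
    have eq: "x + real (s + t) * \<alpha> = (x + real s * \<alpha>) + real t * \<alpha>" by (simp add: algebra_simps)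
    have "edge (x + real (s + t) * \<alpha>)" using t(2) unfolding eq edge_def near_frac .
    moreover have "s + t < N"
    proof -
      have "s \<le> 2 * (n * j)" unfolding s_def by (rule tau_bounds)
      also have "\<dots> \<le> 2 * n * K" using j(1) by simp
      finally show ?thesis using t(1) by (simp add: N_def)
    qed
    ultimately have "s + t \<in> A" by (simp add: A_def)
    then have "s + t - t \<in> (\<lambda>a. a - t) ` A" by blast
    then show "tau (n * j) x \<in> U" unfolding U_def s_def[symmetric] using t(1) by auto
  qed
  then have "card (?f ` ?S) \<le> card U" by (rule card_mono[rotated]) (simp add: U_def finA)
  moreover have "inj_on (\<lambda>j. tau (n * j) x) {j. j < K \<and> (T ^^ (n * j)) x \<in> exceptional tm}"
  proof (rule linorder_inj_onI)
    fix i j :: nat assume "i < j"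
    then have "tau (n * i) x < tau (n * j) x" using n(1) by (intro tau_strict_mono) simp
    then show "tau (n * i) x \<noteq> tau (n * j) x" by simp
  qed auto
  ultimately have "card {j. j < K \<and> (T ^^ (n * j)) x \<in> exceptional tm} \<le> card U" by (simp add: card_image)
  also have "\<dots> \<le> (\<Sum>t\<in>{..tm}. card ((\<lambda>a. a - t) ` A))" unfolding U_def by (rule card_UN_le) simp
  also have "\<dots> \<le> (\<Sum>t\<in>{..tm}. N div h + 1)"
    by (intro sum_mono order_trans[OF card_image_le[OF finA] cA])
  also have "\<dots> = (tm + 1) * (N div h + 1)" by simp
  finally show ?thesis by (simp add: N_def)
qed

text \<open>Without an edge up to time \<open>tm\<close>, y and its image visit [0, z) at the same
  times; hence they have the same return times and stay within \<eta>. The condition on k reflects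
  that k returns take at most 2 k steps.\<close>

lemma return_of_shift:
  assumes y: "y \<in> {0..<z}" "y \<notin> exceptional tm" and k: "2 * k \<le> tm"
  shows "tau k (frac (y + real (n * L) * \<alpha>)) = tau k y"
    "\<bar>(T ^^ k) (frac (y + real (n * L) * \<alpha>)) - (T ^^ k) y\<bar> < \<eta>"
    "frac (y + real (n * L) * \<alpha>) \<in> {0..<z}"
proof -
  let ?y = "frac (y + real (n * L) * \<alpha>)"
  have ne: "\<not> edge (y + real t * \<alpha>)" if "t \<le> tm" for t using y(2) that by (auto simp: exceptional_def)
  have sh: "frac (?y + real t * \<alpha>) = frac (y + real t * \<alpha> + real (n * L) * \<alpha>)" for t
    by (simp add: frac_frac_add algebra_simps)
  have st: "frac (?y + real t * \<alpha>) < z \<longleftrightarrow> frac (y + real t * \<alpha>) < z"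
    "\<bar>frac (?y + real t * \<alpha>) - frac (y + real t * \<alpha>)\<bar> < \<eta>" if "t \<le> tm" for t
    using not_edge_stable[OF ne[OF that]] unfolding sh by (auto simp: abs_minus_commute)
  have tau: "tau k ?y = tau k y" if "2 * k \<le> tm" for k
    using that
  proof (induction k)
    case (Suc k)
    have "tau k y + 1 \<le> tm" using tau_bounds(2)[of k y] Suc.prems by simp
    then show ?case using Suc st(1)[of "tau k y + 1"] by simp
  qed simp
  show "tau k ?y = tau k y" by (rule tau[OF k])
  have "frac y = y" using y(1) z by (simp add: frac_eq)
  then show y': "?y \<in> {0..<z}" using st(1)[of 0] y(1) by (simp add: frac_frac_add[of _ 0, simplified])
  have "tau k y \<le> tm" using tau_bounds(2)[of k y] k by simp
  then show "\<bar>(T ^^ k) ?y - (T ^^ k) y\<bar> < \<eta>"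
    using st(2)[of "tau k y"] by (simp only: T_tau[OF y'] T_tau[OF y(1)] tau[OF k])
qed

text \<open>\<open>(T ^^ vis (n * L) y) y\<close> is the image of y under n L steps of the rotation,
  a point close to y. The remaining iterates therefore follow the orbit of y, and their surplus n u
  - vis (n L) y is the drift.\<close>

lemma drift:
  assumes y: "y \<in> {0..<z}" "y \<notin> exceptional tm"
    and u: "vis (n * L) y \<le> n * u" "2 * (n * u - vis (n * L) y + k) \<le> tm"
  shows "\<bar>(T ^^ (k + n * u)) y - (T ^^ (k + (n * u - vis (n * L) y))) y\<bar> < \<eta>"
proof -
  let ?y = "frac (y + real (n * L) * \<alpha>)" and ?v = "vis (n * L) y"
  have "?y \<in> {0..<z}" using return_of_shift(3)[OF y, of 0] by simp
  then have Tv: "(T ^^ ?v) y = ?y" using T_vis[OF y(1), of "n * L"] by simp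
  have "k + n * u = (k + (n * u - ?v)) + ?v" using u(1) by simp
  then have "(T ^^ (k + n * u)) y = (T ^^ (k + (n * u - ?v))) ((T ^^ ?v) y)" by (metis comp_apply funpow_add)
  then show ?thesis using return_of_shift(2)[OF y, of "k + (n * u - ?v)"] u(2) by (simp add: Tv)
qed

end

end

section \<open>Scales provided by the assumptions\<close>

lemma rot_funpow:
  assumes "x \<in> {0..<1}"
  shows "(rot \<alpha> ^^ k) x = frac (x + real k * \<alpha>)"
proof (induction k)
  case 0
  then show ?case using assms by (simp add: frac_eq)
next
  case (Suc k)
  then show ?case by (simp add: rot_def frac_frac_add algebra_simps)
qed

lemma circle_dist_rot:
  assumes "x \<in> {0..<1}"
  shows "circle_dist ((rot \<alpha> ^^ k) x) x = min (frac (real k * \<alpha>)) (1 - frac (real k * \<alpha>))"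
proof -
  define \<beta> where "\<beta> = frac (real k * \<alpha>)"
  have \<beta>: "0 \<le> \<beta>" "\<beta> < 1" by (simp_all add: \<beta>_def frac_lt_1)
  have x: "0 \<le> x" "x < 1" using assms by auto
  have eq: "(rot \<alpha> ^^ k) x = frac (x + \<beta>)"
    unfolding rot_funpow[OF assms] \<beta>_def by (metis add.commute frac_frac_add)
  consider "frac (x + \<beta>) = x + \<beta>" | "frac (x + \<beta>) = x + \<beta> - 1"
  proof (cases "x + \<beta> < 1")
    case True
    then have "frac (x + \<beta>) = x + \<beta>" using x \<beta> by (simp add: frac_eq)
    then show ?thesis by (rule that)
  next
    case False
    have "frac (x + \<beta>) = x + \<beta> - 1" using False x \<beta> by (simp add: frac_unique_iff)
    then show ?thesis by (rule that)
  qed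
  then show ?thesis
  proof cases
    case 1
    then show ?thesis using \<beta> by (simp add: eq circle_dist_def \<beta>_def[symmetric])
  next
    case 2
    then show ?thesis using \<beta> by (simp add: eq circle_dist_def \<beta>_def[symmetric] min.commute)
  qed
qed

text \<open>A rotation moves all points by the same distance, so the integrand is constant. Thus
  (A6) says that the distance of \<open>real (L i) * \<alpha>\<close> from the integers tends to
  0.\<close>

lemma set_integral_circle_dist_rot:
  "(LINT x:{0..<1}|lborel. circle_dist ((rot \<alpha> ^^ k) x) x) = min (frac (real k * \<alpha>)) (1 - frac (real k * \<alpha>))"
proof -
  define m where "m = min (frac (real k * \<alpha>)) (1 - frac (real k * \<alpha>))"
  have "(LINT x:{0..<1}|lborel. circle_dist ((rot \<alpha> ^^ k) x) x) = (LINT x:{0..<(1::real)}|lborel. m)"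
    by (rule set_lebesgue_integral_cong) (auto simp: circle_dist_rot m_def)
  also have "\<dots> = m" by (simp add: set_lebesgue_integral_def)
  finally show ?thesis by (simp add: m_def)
qed

lemma le_dist_int:
  assumes "\<And>k::int. c \<le> \<bar>y - of_int k\<bar>"
  shows "c \<le> dist_int y"
proof -
  have "c \<le> (INF a\<in>\<int>. dist y a)"
  proof (rule cINF_greatest)
    show "(\<int> :: real set) \<noteq> {}" using Ints_0 by blast
    fix a :: real assume "a \<in> \<int>"
    then obtain k :: int where "a = of_int k" by (rule Ints_cases)
    then show "c \<le> dist y a" using assms[of k] by (simp add: dist_real_def)
  qed
  moreover have "dist_int y = (INF a\<in>\<int>. dist y a)"
    unfolding dist_int_def by (rule infdist_notempty) (use Ints_0 in blast)
  ultimately show ?thesis by simp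
qed

lemma torus_lattice_member: "(of_int m - of_int n * \<alpha>, of_int n) \<in> torus_lattice \<alpha>"
proof -
  have "(of_int m - of_int n * \<alpha>, of_int n :: real) = (\<lambda>(m :: int, n :: int). of_int m *\<^sub>R (1, 0) + of_int n *\<^sub>R (- \<alpha>, 1)) (m, n)"
    by simp
  then show ?thesis unfolding torus_lattice_def by (metis rangeI)
qed

lemma torus_dist_le:
  assumes "snd P = snd Q + of_int n"
  shows "torus_dist \<alpha> P Q \<le> \<bar>fst P - fst Q + of_int n * \<alpha> - of_int m\<bar>"
proof -
  have "torus_dist \<alpha> P Q \<le> dist (P - Q) (of_int m - of_int n * \<alpha>, of_int n)"
    unfolding torus_dist_def by (rule infdist_le[OF torus_lattice_member])
  also have "P - Q = (fst P - fst Q, of_int n)" using assms by (simp add: prod_eq_iff)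
  also have "dist (fst P - fst Q, of_int n) (of_int m - of_int n * \<alpha>, of_int n :: real) = \<bar>fst P - fst Q + of_int n * \<alpha> - of_int m\<bar>"
    by (simp add: dist_Pair_Pair dist_real_def algebra_simps)
  finally show ?thesis .
qed

text \<open>Running up for an integer time t and returning along the lattice vector (-\<alpha>, 1)
  shifts horizontally by t \<alpha>, so vertical trajectories at integer times are rotation orbits.
  For negative t the two marked points exchange roles.\<close>

lemma vertical_sep_bound:
  assumes "vertical_sep \<alpha> z \<epsilon> B" and t: "real_of_int \<bar>t\<bar> < B"
  shows "\<epsilon> \<le> \<bar>of_int t * \<alpha> - z - of_int k\<bar>"
proof (rule ccontr)
  assume neg: "\<not> ?thesis"
  have sep: "\<And>s. 0 \<le> s \<Longrightarrow> torus_dist \<alpha> ((0, 0) + (0, s)) (z, 0) < \<epsilon> \<Longrightarrow> B \<le> s"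
    "\<And>s. 0 \<le> s \<Longrightarrow> torus_dist \<alpha> ((z, 0) + (0, s)) (0, 0) < \<epsilon> \<Longrightarrow> B \<le> s"
    using assms(1) unfolding vertical_sep_def by auto
  show False
  proof (cases "0 \<le> t")
    case True
    have "torus_dist \<alpha> ((0, 0) + (0, of_int t)) (z, 0) \<le> \<bar>of_int t * \<alpha> - z - of_int k\<bar>"
      using torus_dist_le[of "(0, 0) + (0, of_int t)" "(z, 0)" t \<alpha> k] by (simp add: algebra_simps)
    with neg have "torus_dist \<alpha> ((0, 0) + (0, of_int t)) (z, 0) < \<epsilon>" by linarith
    then have "B \<le> of_int t" using True by (intro sep) auto
    then show False using t True by simp
  next
    case False
    have "torus_dist \<alpha> ((z, 0) + (0, of_int (- t))) (0, 0) \<le> \<bar>z + of_int (- t) * \<alpha> - of_int (- k)\<bar>"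
      using torus_dist_le[of "(z, 0) + (0, of_int (- t))" "(0, 0)" "- t" \<alpha> "- k"] by simp
    also have "\<dots> = \<bar>of_int t * \<alpha> - z - of_int k\<bar>"
      by (rule trans[OF abs_minus_cancel[symmetric]]) simp
    finally have "torus_dist \<alpha> ((z, 0) + (0, of_int (- t))) (0, 0) < \<epsilon>" using neg by linarith
    then have "B \<le> of_int (- t)" using False by (intro sep) auto
    then show False using t False by simp
  qed
qed

context irrational
begin

lemma mult_not_Ints: "0 < L \<Longrightarrow> real L * \<alpha> \<notin> \<int>"
proof
  assume L: "0 < L" "real L * \<alpha> \<in> \<int>"
  then have "real L * \<alpha> / real L \<in> \<rat>" using Ints_subset_Rats by (intro Rats_divide) auto
  then show False using L irrat by simp
qed

text \<open>Multiplied by the denominator, the difference becomes t times the error of the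
  convergent plus the integer \<open>r\<close>. The latter is nonzero because the denominator does
  not divide t, and the former is at most 1 / 2 in absolute value.\<close>

lemma cf_separation:
  assumes "t \<noteq> 0" "2 * \<bar>t\<bar> < int (cf_q \<alpha> k)"
  shows "1 / (2 * real (cf_q \<alpha> k)) \<le> \<bar>of_int t * \<alpha> - of_int m\<bar>"
proof -
  define q where "q = real (cf_q \<alpha> k)"
  have q: "q > 0" using cf_q_pos by (simp add: q_def)
  define r where "r = t * int (cf_p \<alpha> k) - m * int (cf_q \<alpha> k)"
  have "r \<noteq> 0"
  proof
    assume "r = 0"
    then have "int (cf_q \<alpha> k) dvd t * int (cf_p \<alpha> k)" by (simp add: r_def)
    then have "int (cf_q \<alpha> k) dvd t" using cf_coprime[of k] by (simp add: coprime_commute coprime_dvd_mult_left_iff)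
    then show False using assms dvd_imp_le_int[of t "int (cf_q \<alpha> k)"] by auto
  qed
  then have "1 \<le> \<bar>r\<bar>" by linarith
  then have r1: "1 \<le> \<bar>real_of_int r\<bar>" by linarith
  have eq: "q * (of_int t * \<alpha> - of_int m) = of_int t * cf_D \<alpha> k + of_int r"
    by (simp add: cf_D_def r_def q_def algebra_simps)
  have D: "q * \<bar>cf_D \<alpha> k\<bar> \<le> 1"
  proof -
    have "\<bar>cf_D \<alpha> k\<bar> < 1 / real (cf_q \<alpha> (Suc k))" by (rule cf_D_upper)
    also have "\<dots> \<le> 1 / q" unfolding q_def using cf_q_mono_Suc[of k] cf_q_pos[of k] by (intro divide_left_mono) auto
    finally show ?thesis using q by (simp add: field_simps)
  qed
  have "2 * \<bar>real_of_int t\<bar> \<le> q"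
  proof -
    have "real_of_int (2 * \<bar>t\<bar>) < real_of_int (int (cf_q \<alpha> k))" using assms(2) by (simp only: of_int_less_iff)
    then show ?thesis by (simp add: q_def)
  qed
  then have "2 * \<bar>real_of_int t\<bar> * \<bar>cf_D \<alpha> k\<bar> \<le> q * \<bar>cf_D \<alpha> k\<bar>" by (intro mult_right_mono) auto
  then have "\<bar>of_int t * cf_D \<alpha> k\<bar> \<le> 1 / 2" using D by (simp add: abs_mult)
  then have "1 / 2 \<le> \<bar>q * (of_int t * \<alpha> - of_int m)\<bar>" unfolding eq using r1 by linarith
  then have "1 / 2 \<le> q * \<bar>of_int t * \<alpha> - of_int m\<bar>" using q by (simp add: abs_mult)
  then show ?thesis using q by (simp add: q_def[symmetric] field_simps)
qed

text \<open>With the next denominator at least 2 the error of the convergent is below 1 / 2, so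
  \<open>cf_p \<alpha> k\<close> is the nearest integer and \<open>cf_D_lower\<close> applies; every
  other integer is at distance at least 1 / 2.\<close>

lemma cf_dist_int:
  assumes "2 \<le> cf_q \<alpha> (Suc k)"
  shows "1 / (2 * real (cf_q \<alpha> (Suc k))) \<le> dist_int (real (cf_q \<alpha> k) * \<alpha>)"
proof (rule le_dist_int)
  fix m :: int
  define q where "q = real (cf_q \<alpha> (Suc k))"
  have "real 2 \<le> q" unfolding q_def of_nat_le_iff by (rule assms)
  then have q: "q \<ge> 2" by simp
  have q1: "1 / q \<le> 1 / 2" using q by (intro divide_left_mono) auto
  show "1 / (2 * q) \<le> \<bar>real (cf_q \<alpha> k) * \<alpha> - of_int m\<bar>"
  proof (cases "m = int (cf_p \<alpha> k)")
    case True
    have "1 / (2 * q) \<le> \<bar>cf_D \<alpha> k\<bar>" unfolding q_def by (rule cf_D_lower)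
    then show ?thesis unfolding True cf_D_def by (simp only: of_int_of_nat_eq)
  next
    case False
    then have "1 \<le> \<bar>int (cf_p \<alpha> k) - m\<bar>" by linarith
    then have "1 \<le> \<bar>real_of_int (int (cf_p \<alpha> k) - m)\<bar>" by linarith
    moreover have "\<bar>cf_D \<alpha> k\<bar> < 1 / 2" using cf_D_upper[of k] q1 unfolding q_def by linarith
    moreover have "real (cf_q \<alpha> k) * \<alpha> - of_int m = cf_D \<alpha> k + of_int (int (cf_p \<alpha> k) - m)" by (simp add: cf_D_def)
    ultimately have "1 / 2 \<le> \<bar>real (cf_q \<alpha> k) * \<alpha> - of_int m\<bar>" by linarith
    moreover have "1 / (2 * q) \<le> 1 / 2" using q by (simp add: field_simps)
    ultimately show ?thesis by linarith
  qed
qed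

text \<open>On a bounded range of times the integrals have a positive minimum, as \<alpha> is
  irrational. Large times are what later makes \<open>cf_q \<alpha> k\<close> large, through
  (A0).\<close>

lemma rigidity_times_unbounded:
  fixes Li :: "nat \<Rightarrow> nat"
  assumes pos: "\<And>i. 0 < Li i"
    and lim: "(\<lambda>i. LINT x:{0..<1}|lborel. circle_dist ((rot \<alpha> ^^ Li i) x) x) \<longlonglongrightarrow> 0"
  shows "\<exists>i. B < Li i"
proof (rule ccontr)
  assume "\<not> ?thesis"
  then have B: "Li i \<in> {1..B}" for i using pos[of i] by (auto simp: not_less Suc_le_eq)
  define I where "I = (\<lambda>k. min (frac (real k * \<alpha>)) (1 - frac (real k * \<alpha>)))"
  have I0: "0 < I k" if "0 < k" for k
  proof -
    have "frac (real k * \<alpha>) \<noteq> 0" using mult_not_Ints[OF that] by (simp add: frac_eq_0_iff)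
    then have "0 < frac (real k * \<alpha>)" using frac_ge_0[of "real k * \<alpha>"] by linarith
    then show ?thesis by (simp add: I_def frac_lt_1)
  qed
  have ne: "I ` {1..B} \<noteq> {}" using B[of 0] by blast
  define m where "m = Min (I ` {1..B})"
  have "m \<in> I ` {1..B}" unfolding m_def by (rule Min_in[OF _ ne]) simp
  then have m0: "0 < m" using I0 by auto
  have m: "m \<le> I (Li i)" for i unfolding m_def using B[of i] by (intro Min_le) auto
  have "(\<lambda>i. I (Li i)) \<longlonglongrightarrow> 0" using lim unfolding set_integral_circle_dist_rot I_def .
  then have "m \<le> 0" by (rule tendsto_lowerbound) (use m in auto)
  then show False using m0 by simp
qed

text \<open>Write q_j for the denominators. The scale uses the convergent of index k' = k + 2 s,
  whose error is below 1 / (2^s q_(k+1)); so 2^s \<ge> 4 N0 puts N0 times the error below the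
  separation 1 / (2 q_(k+1)) that (A4) and \<open>cf_dist_int\<close> provide up to time h, about
  q_k / (2 C4). The hitting time H is the denominator of index k + 2 s + 7: six indices beyond k' +
  1 it has grown at least 8-fold, so 3 / H is at most the error. By (A7) and (A0), H < Li < q_k / c,
  which compares H with h.\<close>

lemma scale_of_A_conditions:
  assumes ret: "\<And>y. 0 \<le> y \<Longrightarrow> y < 1 \<Longrightarrow> \<not> y < z \<Longrightarrow> frac (y + \<alpha>) < z" and z: "0 < z" "z < 1"
    and A: "A_conditions \<alpha> z C1 C2 C3 C4 (2 * s + 7) \<eta> chat c kc Li k"
    and c: "0 < c" and C4: "1 < C4" and s: "4 * N0 \<le> 2 ^ s" and big: "4 * C4 * (real Q + 1) \<le> real (cf_q \<alpha> k)"
  shows "\<exists>L p h H. scale \<alpha> z N0 L h H p \<and> Q \<le> h \<and> real H \<le> (4 * C4 / c) * real h \<and>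
    real N0 * \<bar>real L * \<alpha> - of_int p\<bar> \<le> 1 / (real Q + 1)"
proof -
  have A0: "c * real Li < real (cf_q \<alpha> k)" and A7: "Li > cf_q \<alpha> (k + (2 * s + 7))"
    and A4: "vertical_sep \<alpha> z (dist_int (real (cf_q \<alpha> k) * \<alpha>)) (real (cf_q \<alpha> k) / C4)"
    using A unfolding A_conditions_def by auto
  define k' h H where "k' = k + 2 * s" and "h = nat \<lfloor>real (cf_q \<alpha> k) / (2 * C4)\<rfloor>" and "H = cf_q \<alpha> (k + (2 * s + 7))"
  define q q1 where "q = real (cf_q \<alpha> k)" and "q1 = real (cf_q \<alpha> (Suc k))"
  have q: "0 < q" "q \<le> q1" using cf_q_pos cf_q_mono_Suc[of k] by (simp_all add: q_def q1_def del: cf_q.simps)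
  have C4Q: "4 * (real Q + 1) \<le> q"
  proof -
    have "1 * (4 * (real Q + 1)) \<le> C4 * (4 * (real Q + 1))" using C4 by (intro mult_right_mono) auto
    then show ?thesis using big by (simp add: q_def algebra_simps)
  qed
  then have q4: "4 \<le> q" by (simp add: algebra_simps)
  have hC: "real Q + 1 \<le> q / (4 * C4)" using big C4 by (simp add: q_def field_simps)
  have h1: "real h \<le> q / (2 * C4)" "q / (2 * C4) - 1 \<le> real h"
  proof -
    have "0 \<le> q / (2 * C4)" using q C4 by simp
    then show "real h \<le> q / (2 * C4)" "q / (2 * C4) - 1 \<le> real h" unfolding h_def q_def[symmetric] by linarith+
  qed
  have half: "q / (2 * C4) = q / (4 * C4) + q / (4 * C4)" by (simp add: field_simps)
  then have h2: "q / (4 * C4) \<le> real h" using h1 hC by linarith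
  have hQ: "Q + 1 \<le> h"
  proof -
    have "real (Q + 1) \<le> real h" using h2 hC by simp
    then show ?thesis by (simp only: of_nat_le_iff)
  qed
  define \<delta> where "\<delta> = \<bar>real (cf_q \<alpha> k') * \<alpha> - of_int (int (cf_p \<alpha> k'))\<bar>"
  have \<delta>D: "\<delta> = \<bar>cf_D \<alpha> k'\<bar>" by (simp add: \<delta>_def cf_D_def)
  have N0\<delta>: "real N0 * \<delta> \<le> 1 / (4 * q1)"
  proof -
    have "2 ^ s * cf_q \<alpha> (Suc k) \<le> cf_q \<alpha> (Suc k + 2 * s)" by (rule cf_q_growth)
    then have "4 * N0 * cf_q \<alpha> (Suc k) \<le> cf_q \<alpha> (Suc k')"
      using order_trans[OF mult_le_mono1[OF s, of "cf_q \<alpha> (Suc k)"]] by (simp only: k'_def add_Suc)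
    then have g: "4 * real N0 * q1 \<le> real (cf_q \<alpha> (Suc k'))"
      unfolding q1_def by (metis of_nat_le_iff of_nat_mult of_nat_numeral)
    have "real N0 * \<delta> \<le> real N0 * (1 / real (cf_q \<alpha> (Suc k')))"
      unfolding \<delta>D using cf_D_upper[of k'] by (intro mult_left_mono) auto
    also have "\<dots> \<le> 1 / (4 * q1)"
      using g q cf_q_pos[of "Suc k'"] by (simp add: field_simps del: cf_q.simps)
    finally show ?thesis .
  qed
  have N0\<delta>': "real N0 * \<delta> \<le> 1 / (2 * q1)" "real N0 * \<delta> \<le> 1 / (2 * q)" "real N0 * \<delta> \<le> 1 / (real Q + 1)"
  proof -
    have "1 / (4 * q1) \<le> 1 / (2 * q1)" using q by (simp add: field_simps)
    then show 1: "real N0 * \<delta> \<le> 1 / (2 * q1)" using N0\<delta> by linarith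
    have "1 / (2 * q1) \<le> 1 / (2 * q)" using q by (simp add: field_simps)
    then show 2: "real N0 * \<delta> \<le> 1 / (2 * q)" using 1 by linarith
    have "1 / (2 * q) \<le> 1 / (real Q + 1)" using q C4Q by (intro divide_left_mono) auto
    then show "real N0 * \<delta> \<le> 1 / (real Q + 1)" using 2 by linarith
  qed
  have hq: "2 * real h \<le> q"
  proof -
    have "q / (2 * C4) \<le> q / 2" using C4 q by (intro divide_left_mono) auto
    then show ?thesis using h1 by linarith
  qed
  interpret return_map \<alpha> z by standard (use z ret in auto)
  have "scale \<alpha> z N0 (cf_q \<alpha> k') h H (int (cf_p \<alpha> k'))"
  proof
    show "approximant \<alpha> (cf_q \<alpha> k') (int (cf_p \<alpha> k'))" by (rule approximant_cf)
    show "0 < h" using hQ by simp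
    show "real (cf_q \<alpha> k') * \<alpha> - of_int (int (cf_p \<alpha> k')) \<noteq> 0" using cf_D_nz[of k'] by (simp add: cf_D_def)
    show "real N0 * \<bar>real (cf_q \<alpha> k') * \<alpha> - of_int (int (cf_p \<alpha> k'))\<bar> \<le> \<bar>of_int t * \<alpha> - of_int m\<bar>"
      if t: "t \<noteq> 0" "\<bar>t\<bar> < int h" for t m
    proof -
      have "2 * h \<le> cf_q \<alpha> k"
      proof -
        have "real (2 * h) \<le> real (cf_q \<alpha> k)" using hq by (simp add: q_def)
        then show ?thesis by (simp only: of_nat_le_iff)
      qed
      then have "2 * \<bar>t\<bar> < int (cf_q \<alpha> k)" using t by linarith
      from cf_separation[OF t(1) this, of m] show ?thesis using N0\<delta>'(2) unfolding \<delta>_def q_def by linarith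
    qed
    show "real N0 * \<bar>real (cf_q \<alpha> k') * \<alpha> - of_int (int (cf_p \<alpha> k'))\<bar> \<le> \<bar>of_int t * \<alpha> - z - of_int m\<bar>"
      if t: "\<bar>t\<bar> < int h" for t m
    proof -
      have "real_of_int \<bar>t\<bar> < real h" using t by linarith
      also have "\<dots> \<le> q / C4"
      proof -
        have "q / (2 * C4) \<le> q / C4" using q C4 by (intro divide_left_mono) auto
        then show ?thesis using h1 by linarith
      qed
      finally have "real_of_int \<bar>t\<bar> < real (cf_q \<alpha> k) / C4" by (simp add: q_def)
      from vertical_sep_bound[OF A4 this, of m]
      have "dist_int (real (cf_q \<alpha> k) * \<alpha>) \<le> \<bar>of_int t * \<alpha> - z - of_int m\<bar>" .
      moreover have "1 / (2 * q1) \<le> dist_int (real (cf_q \<alpha> k) * \<alpha>)"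
      proof -
        have "real 2 \<le> real (cf_q \<alpha> (Suc k))" using q q4 unfolding q1_def by linarith
        then have "2 \<le> cf_q \<alpha> (Suc k)" by (simp only: of_nat_le_iff)
        then show ?thesis unfolding q1_def by (rule cf_dist_int)
      qed
      ultimately show ?thesis using N0\<delta>'(1) unfolding \<delta>_def by linarith
    qed
    show "\<exists>t<H. \<exists>m::int. w \<le> x + real t * \<alpha> - of_int m \<and>
      x + real t * \<alpha> - of_int m < w + \<bar>real (cf_q \<alpha> k') * \<alpha> - of_int (int (cf_p \<alpha> k'))\<bar>" for x w
      unfolding H_def
    proof (rule approximant_hits[OF approximant_cf])
      have "2 ^ 3 * cf_q \<alpha> (Suc k') \<le> cf_q \<alpha> (Suc k' + 2 * 3)" by (rule cf_q_growth)
      also have "Suc k' + 2 * 3 = k + (2 * s + 7)" by (simp add: k'_def)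
      finally have "8 * cf_q \<alpha> (Suc k') \<le> cf_q \<alpha> (k + (2 * s + 7))" by (simp del: cf_q.simps)
      then have "8 * real (cf_q \<alpha> (Suc k')) \<le> real (cf_q \<alpha> (k + (2 * s + 7)))"
        by (metis of_nat_le_iff of_nat_mult of_nat_numeral)
      moreover have "0 < real (cf_q \<alpha> (Suc k'))" using cf_q_pos by (simp del: cf_q.simps)
      ultimately have "3 / real (cf_q \<alpha> (k + (2 * s + 7))) \<le> 3 / (8 * real (cf_q \<alpha> (Suc k')))"
        by (intro divide_left_mono) auto
      also have "\<dots> \<le> 1 / (2 * real (cf_q \<alpha> (Suc k')))"
        using cf_q_pos[of "Suc k'"] by (simp add: field_simps del: cf_q.simps)
      also have "\<dots> \<le> \<delta>" unfolding \<delta>D by (rule cf_D_lower)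
      finally show "3 / real (cf_q \<alpha> (k + (2 * s + 7))) \<le> \<bar>real (cf_q \<alpha> k') * \<alpha> - of_int (int (cf_p \<alpha> k'))\<bar>"
        by (simp only: \<delta>_def)
    qed
  qed
  moreover have "real H \<le> (4 * C4 / c) * real h"
  proof -
    have "real H < real Li" using A7 unfolding H_def by (simp only: of_nat_less_iff)
    also have "\<dots> < q / c" using A0 c by (simp add: q_def field_simps)
    also have "\<dots> = (4 * C4 / c) * (q / (4 * C4))" using C4 by simp
    also have "\<dots> \<le> (4 * C4 / c) * real h" using h2 c C4 by (intro mult_left_mono) auto
    finally show ?thesis by simp
  qed
  ultimately show ?thesis using hQ N0\<delta>'(3) unfolding \<delta>_def by (meson add_leD1)
qed

text \<open>For z = 1 the two marked points coincide on the torus, so a trajectory is at the other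
  point already at time 0, against (A4).\<close>

lemma A_conditions_z_less_1:
  assumes "A_conditions \<alpha> z C1 C2 C3 C4 l \<eta> chat c kc L k" "z \<le> 1" "1 < C4"
  shows "z < 1"
proof (rule ccontr)
  assume "\<not> ?thesis"
  then have z: "z = 1" using assms(2) by simp
  have sep: "vertical_sep \<alpha> z (dist_int (real (cf_q \<alpha> k) * \<alpha>)) (real (cf_q \<alpha> k) / C4)"
    using assms(1) unfolding A_conditions_def by blast
  have "dist_int (real (cf_q \<alpha> k) * \<alpha>) \<le> \<bar>of_int 0 * \<alpha> - z - of_int (- 1)\<bar>"
    using cf_q_pos[of k] assms(3) by (intro vertical_sep_bound[OF sep]) simp
  then have "dist_int (real (cf_q \<alpha> k) * \<alpha>) \<le> 0" using z by simp
  moreover have "0 < dist_int (real (cf_q \<alpha> k) * \<alpha>)"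
    unfolding dist_int_def
    using mult_not_Ints[OF cf_q_pos[of k]] by (intro infdist_pos_not_in_closed closed_Ints) auto
  ultimately show False by simp
qed

lemma A_assumptions_elim:
  assumes "A_assumptions \<alpha> z"
  shows "\<exists>C1 C2 C3 C4 \<eta> chat cbar. 1 < C4 \<and> (\<forall>l. 0 < cbar l) \<and> (\<forall>l c. 0 < c \<longrightarrow> c < cbar l \<longrightarrow>
    (\<exists>kc L k. (\<forall>i. A_conditions \<alpha> z C1 C2 C3 C4 l \<eta> chat c kc (L i) (k i)) \<and>
      (\<lambda>i. LINT x:{0..<1}|lborel. circle_dist ((rot \<alpha> ^^ L i) x) x) \<longlonglongrightarrow> 0))"
proof -
  let ?P = "\<lambda>C1 C2 C3 C4 \<eta> chat cbar. \<forall>(l :: nat) c. 0 < c \<and> c < cbar l \<longrightarrow>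
      (\<exists>(kc :: nat) (L :: nat \<Rightarrow> nat) (k :: nat \<Rightarrow> nat). (\<forall>i. A_conditions \<alpha> z C1 C2 C3 C4 l \<eta> chat c kc (L i) (k i)) \<and>
        (\<lambda>i. LINT x:{0..<1}|lborel. circle_dist ((rot \<alpha> ^^ L i) x) x) \<longlonglongrightarrow> 0)"
  from assms obtain C1 C2 C3 C4 chat cbar where C: "1 < C4" and cbar: "\<forall>l. 0 < cbar l"
    and ev: "\<forall>\<^sub>F \<eta> in at_right 0. 0 < chat \<eta> \<and> ?P C1 C2 C3 C4 \<eta> (chat \<eta>) cbar"
    unfolding A_assumptions_def by (elim exE conjE) (rule that)
  from eventually_happens'[OF trivial_limit_at_right_real ev] obtain \<eta> where "?P C1 C2 C3 C4 \<eta> (chat \<eta>) cbar" by blast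
  then show ?thesis using C cbar
    by (intro exI[of _ C1] exI[of _ C2] exI[of _ C3] exI[of _ C4] exI[of _ \<eta>] exI[of _ "chat \<eta>"] exI[of _ cbar]) simp
qed

lemma A_assumptions_z_less_1:
  assumes "A_assumptions \<alpha> z" "z \<le> 1"
  shows "z < 1"
proof -
  from A_assumptions_elim[OF assms(1)] obtain C1 C2 C3 C4 \<eta> chat cbar where C: "1 < C4" and cbar: "\<forall>l. 0 < cbar l"
    and \<eta>: "\<forall>l c. 0 < c \<longrightarrow> c < cbar l \<longrightarrow> (\<exists>kc L k. (\<forall>i. A_conditions \<alpha> z C1 C2 C3 C4 l \<eta> chat c kc (L i) (k i)) \<and>
      (\<lambda>i. LINT x:{0..<1}|lborel. circle_dist ((rot \<alpha> ^^ L i) x) x) \<longlonglongrightarrow> 0)"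
    by (elim exE conjE) (rule that)
  obtain kc L k where "A_conditions \<alpha> z C1 C2 C3 C4 0 \<eta> chat (cbar 0 / 2) kc (L (0 :: nat)) (k (0 :: nat))"
    using \<eta>[rule_format, of "cbar 0 / 2" 0] cbar[rule_format, of 0] by auto
  then show ?thesis by (rule A_conditions_z_less_1[OF _ assms(2) C])
qed

end

text \<open>\<open>M\<close> may depend on \<open>N0\<close> but not on \<open>Q\<close>: hitting
  and separation times must stay comparable while the scale becomes finer.\<close>

definition (in irrational_return) good_scales :: bool where
  "good_scales \<longleftrightarrow> (\<forall>N0. \<exists>M>0. \<forall>Q. \<exists>L p h H. scale \<alpha> z N0 L h H p \<and> Q \<le> h \<and> real H \<le> M * real h \<and>
    real N0 * \<bar>real L * \<alpha> - of_int p\<bar> \<le> 1 / (real Q + 1))"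

text \<open>\<open>N0\<close> determines l, then c is chosen, and this fixes the ratio
  \<open>M\<close>. \<open>Q\<close> is met by going far along the sequence, as \<open>L i\<close>
  is unbounded and (A0) makes the denominator of index \<open>k i\<close> larger than c times
  it.\<close>

lemma (in irrational_return) A_assumptions_good_scales:
  assumes "A_assumptions \<alpha> z"
  shows good_scales
  unfolding good_scales_def
proof
  fix N0
  from A_assumptions_elim[OF assms(1)] obtain C1 C2 C3 C4 \<eta> chat cbar where C: "1 < C4" and cbar: "\<forall>l. 0 < cbar l"
    and \<eta>: "\<forall>l c. 0 < c \<longrightarrow> c < cbar l \<longrightarrow> (\<exists>kc L k. (\<forall>i. A_conditions \<alpha> z C1 C2 C3 C4 l \<eta> chat c kc (L i) (k i)) \<and>
      (\<lambda>i. LINT x:{0..<1}|lborel. circle_dist ((rot \<alpha> ^^ L i) x) x) \<longlonglongrightarrow> 0)"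
    by (elim exE conjE) (rule that)
  have s: "4 * N0 \<le> 2 ^ (4 * N0)" using less_exp[of "4 * N0"] by simp
  define l c where "l = 2 * (4 * N0) + 7" and "c = cbar l / 2"
  have c: "0 < c" "c < cbar l" using cbar[rule_format, of l] by (simp_all add: c_def)
  obtain kc L k where A: "\<And>i. A_conditions \<alpha> z C1 C2 C3 C4 l \<eta> chat c kc (L i) (k i)"
    and lim: "(\<lambda>i. LINT x:{0..<1}|lborel. circle_dist ((rot \<alpha> ^^ L i) x) x) \<longlonglongrightarrow> 0"
    using \<eta>[rule_format, OF c] by blast
  have L0: "0 < L i" for i
  proof -
    have "cf_q \<alpha> (k i + l) < L i" using A[of i] unfolding A_conditions_def by blast
    then show ?thesis by simp
  qed
  show "\<exists>M>0. \<forall>Q. \<exists>L p h H. scale \<alpha> z N0 L h H p \<and> Q \<le> h \<and> real H \<le> M * real h \<and>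
    real N0 * \<bar>real L * \<alpha> - of_int p\<bar> \<le> 1 / (real Q + 1)"
  proof (intro exI[of _ "4 * C4 / c"] conjI allI)
    show "0 < 4 * C4 / c" using C c by simp
    fix Q
    obtain i where i: "nat \<lceil>4 * C4 * (real Q + 1) / c\<rceil> < L i" using rigidity_times_unbounded[OF L0 lim] by blast
    have "4 * C4 * (real Q + 1) / c \<le> real (L i)" using i by linarith
    then have "4 * C4 * (real Q + 1) \<le> c * real (L i)" using c by (simp add: field_simps)
    moreover have "c * real (L i) < real (cf_q \<alpha> (k i))" using A[of i] unfolding A_conditions_def by blast
    ultimately have big: "4 * C4 * (real Q + 1) \<le> real (cf_q \<alpha> (k i))" by linarith
    show "\<exists>L p h H. scale \<alpha> z N0 L h H p \<and> Q \<le> h \<and> real H \<le> (4 * C4 / c) * real h \<and>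
      real N0 * \<bar>real L * \<alpha> - of_int p\<bar> \<le> 1 / (real Q + 1)"
      by (rule scale_of_A_conditions[OF ret0 z A[of i, unfolded l_def] c(1) C s big])
  qed
qed

section \<open>Averages along powers of the induced map\<close>

text \<open>Here \<open>v\<close> stands for the number of visits to \<open>{0..<z}\<close> up to a time \<open>L\<close> with \<open>\<bar>L\<alpha> - p\<bar>\<close> small, and \<open>e y\<close> for
  the number of visits of the orbit of \<open>y\<close> up to time \<open>nL\<close>.\<close>

definition (in return_map) drift_data ::
  "(real \<Rightarrow> real) \<Rightarrow> nat \<Rightarrow> real \<Rightarrow> real \<Rightarrow> nat \<Rightarrow> nat \<Rightarrow> nat \<Rightarrow> nat \<Rightarrow> (real \<Rightarrow> nat) \<Rightarrow> real set \<Rightarrow> bool" where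
  "drift_data f n \<kappa> \<epsilon> B W D v e E \<longleftrightarrow>
    (\<forall>y. e y \<le> n * (v + 32) \<and> n * v \<le> e y + 32 * n) \<and>
    (\<exists>K0. \<forall>K\<ge>K0. \<forall>y\<in>{0..<z}. real (card {j. j < K \<and> (T ^^ (n * j)) y \<in> E}) \<le> \<epsilon> * real K) \<and>
    (\<forall>u y s i. v + 32 \<le> u \<longrightarrow> u \<le> v + 32 + D \<longrightarrow> y \<in> {0..<z} - E \<longrightarrow> s \<le> B \<longrightarrow> i < W \<longrightarrow>
      \<bar>f ((T ^^ (s + n * (u + i))) y) - f ((T ^^ (s + (n * u - e y) + n * i)) y)\<bar> \<le> \<epsilon>) \<and>
    (\<exists>W2>0. \<forall>d\<ge>2. \<forall>y\<in>{0..<z}. \<kappa> * real W2 \<le> real (card {w. w < W2 \<and> \<not> d dvd e ((T ^^ (n * w)) y)}))"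

lemma (in return_map) drift_dataD:
  assumes "drift_data f n \<kappa> \<epsilon> B W D v e E"
  shows "e y \<le> n * (v + 32)" "n * v \<le> e y + 32 * n"
    and "\<exists>K0. \<forall>K\<ge>K0. \<forall>y\<in>{0..<z}. real (card {j. j < K \<and> (T ^^ (n * j)) y \<in> E}) \<le> \<epsilon> * real K"
    and "\<lbrakk>v + 32 \<le> u; u \<le> v + 32 + D; y \<in> {0..<z} - E; s \<le> B; i < W\<rbrakk> \<Longrightarrow>
      \<bar>f ((T ^^ (s + n * (u + i))) y) - f ((T ^^ (s + (n * u - e y) + n * i)) y)\<bar> \<le> \<epsilon>"
    and "\<exists>W2>0. \<forall>d\<ge>2. \<forall>y\<in>{0..<z}. \<kappa> * real W2 \<le> real (card {w. w < W2 \<and> \<not> d dvd e ((T ^^ (n * w)) y)})"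
  using assms unfolding drift_data_def by blast+

text \<open>\<kappa> is computed from \<open>nmax\<close> and the ratio \<open>M\<close> before
  \<epsilon> and the windows are given. One scale and one \<open>v\<close> serve all n up to
  \<open>nmax\<close>, because the scale is taken for \<open>N0 = 2 * (nmax + 1)\<close>.\<close>

lemma (in irrational_return) drifting_returns:
  assumes good_scales and f: "continuous_on {0..z} f" and nmax: "0 < nmax"
  shows "\<exists>\<kappa>>0. \<forall>\<epsilon>>0. \<forall>B W D. \<exists>v e E. \<forall>n. 0 < n \<longrightarrow> n \<le> nmax \<longrightarrow> drift_data f n \<kappa> \<epsilon> B W D v (e n) (E n)"
proof -
  define N0 where "N0 = 2 * (nmax + 1)"
  obtain M where M: "0 < M" and sc: "\<And>Q. \<exists>L p h H. scale \<alpha> z N0 L h H p \<and> Q \<le> h \<and> real H \<le> M * real h \<and>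
    real N0 * \<bar>real L * \<alpha> - of_int p\<bar> \<le> 1 / (real Q + 1)"
    using assms(1) unfolding good_scales_def by blast
  \<comment> \<open>The window 2 h + H is at most (2 + M) h long and contains at least h / (2 n) - 2
    good times, which is at least h / (4 n) once h \<ge> 8 n.\<close>
  define \<kappa> where "\<kappa> = 1 / (4 * real nmax * (2 + M))"
  have \<kappa>: "0 < \<kappa>" using nmax M by (simp add: \<kappa>_def)
  have "\<exists>v e E. \<forall>n. 0 < n \<longrightarrow> n \<le> nmax \<longrightarrow> drift_data f n \<kappa> \<epsilon> B W D v (e n) (E n)"
    if \<epsilon>: "0 < \<epsilon>" for \<epsilon> :: real and B W D :: nat
  proof -
    have "uniformly_continuous_on {0..z} f" by (rule compact_uniformly_continuous[OF f]) simp
    then obtain d where d: "0 < d" "\<And>y y'. y \<in> {0..z} \<Longrightarrow> y' \<in> {0..z} \<Longrightarrow> dist y' y < d \<Longrightarrow> dist (f y') (f y) < \<epsilon>"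
      using \<epsilon> unfolding uniformly_continuous_on_def by meson
    \<comment> \<open>Twice the number of iterates of \<open>T\<close> to be followed after the
      shift: the drift is at most n (64 + D), and \<open>s\<close> up to \<open>B\<close> and n i up
      to nmax W come on top.\<close>
    define tm where "tm = 2 * (nmax * (64 + D) + B + nmax * W)"
    \<comment> \<open>The three lower bounds serve the frequency of good times, the continuity of f
      at distance N0 \<delta>, and the density of the exceptional set.\<close>
    define Q where "Q = max (8 * nmax) (max (nat \<lceil>1 / d\<rceil>) (nat \<lceil>4 * real nmax * real (tm + 1) / \<epsilon>\<rceil>))"
    obtain L p h H where scale: "scale \<alpha> z N0 L h H p" and Qh: "Q \<le> h" and H: "real H \<le> M * real h"
      and \<delta>Q: "real N0 * \<bar>real L * \<alpha> - of_int p\<bar> \<le> 1 / (real Q + 1)" using sc by blast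
    interpret scale \<alpha> z N0 L h H p by (rule scale)
    have Q: "8 * nmax \<le> Q" "1 / d \<le> real Q" "4 * real nmax * real (tm + 1) / \<epsilon> \<le> real Q"
      unfolding Q_def by linarith+
    have N0d: "real N0 * \<delta> < d"
    proof -
      have "1 < d * (real Q + 1)" using Q(2) d(1) by (simp add: field_simps)
      then have "1 / (real Q + 1) < d" by (simp add: field_simps)
      then show ?thesis using \<delta>Q unfolding \<delta>_def by linarith
    qed
    have "drift_data f n \<kappa> \<epsilon> B W D (vis L 0) (vis (n * L)) (exceptional n tm)"
      if nn: "0 < n" "n \<le> nmax" for n
    proof -
      have n: "0 < n" "n \<le> nmax" "2 * (n + 1) \<le> N0" using nn by (auto simp: N0_def)
      have bounds: "vis (n * L) y \<le> n * (vis L 0 + 32)" "n * vis L 0 \<le> vis (n * L) y + 32 * n" for y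
      proof -
        have b: "\<bar>real (vis (n * L) y) - real n * real (vis L 0)\<bar> \<le> 32 * real n" by (rule vis_mult_bounded)
        have "real (vis (n * L) y) \<le> real (n * (vis L 0 + 32))" using b by (simp add: algebra_simps)
        then show "vis (n * L) y \<le> n * (vis L 0 + 32)" by (simp only: of_nat_le_iff)
        have "real (n * vis L 0) \<le> real (vis (n * L) y + 32 * n)" using b by simp
        then show "n * vis L 0 \<le> vis (n * L) y + 32 * n" by (simp only: of_nat_le_iff)
      qed
      have dens: "\<exists>K0. \<forall>K\<ge>K0. \<forall>y\<in>{0..<z}. real (card {j. j < K \<and> (T ^^ (n * j)) y \<in> exceptional n tm}) \<le> \<epsilon> * real K"
      proof (intro exI[of _ "nat \<lceil>2 * (real (tm + 1) * real (tm + 2)) / \<epsilon>\<rceil>"] allI impI ballI)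
        fix K y assume K: "nat \<lceil>2 * (real (tm + 1) * real (tm + 2)) / \<epsilon>\<rceil> \<le> K" and y: "y \<in> {0..<z}"
        define R where "R = (2 * n * K + tm + 1) div h"
        have h0: "0 < real h" "1 \<le> real h" using h_pos by auto
        have "R * h \<le> 2 * n * K + tm + 1" by (simp add: R_def)
        then have "real (R * h) \<le> real (2 * n * K + tm + 1)" by (simp only: of_nat_le_iff)
        then have "real R * real h \<le> 2 * real n * real K + real (tm + 1)" by simp
        then have "real R \<le> (2 * real n * real K + real (tm + 1)) / real h" using h0 by (simp add: field_simps)
        also have "\<dots> = (2 * real n / real h) * real K + real (tm + 1) / real h" by (simp add: add_divide_distrib)
        also have "real (tm + 1) / real h \<le> real (tm + 1) / 1" using h0 by (intro divide_left_mono) auto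
        finally have R: "real R \<le> (2 * real n / real h) * real K + real (tm + 1)" by simp
        have "real (card {j. j < K \<and> (T ^^ (n * j)) y \<in> exceptional n tm}) \<le> real ((tm + 1) * (R + 1))"
          using exceptional_density[OF n(1,3) y, of K tm] unfolding R_def by (simp only: of_nat_le_iff)
        also have "\<dots> = real (tm + 1) * (real R + 1)" by (simp only: of_nat_mult of_nat_add of_nat_1)
        also have "\<dots> \<le> real (tm + 1) * ((2 * real n / real h) * real K + real (tm + 2))"
          using R by (intro mult_left_mono) auto
        also have "\<dots> = (real (tm + 1) * (2 * real n / real h)) * real K + real (tm + 1) * real (tm + 2)"
          by (simp only: distrib_left mult.assoc)
        also have "\<dots> \<le> \<epsilon> / 2 * real K + \<epsilon> / 2 * real K"
        proof (rule add_mono)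
          have "4 * real nmax * real (tm + 1) / \<epsilon> \<le> real h" using Q(3) Qh by linarith
          then have "4 * real nmax * real (tm + 1) \<le> \<epsilon> * real h" using \<epsilon> by (simp add: field_simps)
          moreover have "4 * real n * real (tm + 1) \<le> 4 * real nmax * real (tm + 1)" using n by (intro mult_right_mono) auto
          ultimately have "4 * real n * real (tm + 1) \<le> \<epsilon> * real h" by linarith
          then have "real (tm + 1) * (2 * real n / real h) \<le> \<epsilon> / 2" using h0 by (simp add: field_simps)
          then show "real (tm + 1) * (2 * real n / real h) * real K \<le> \<epsilon> / 2 * real K" by (rule mult_right_mono) simp
          have "2 * (real (tm + 1) * real (tm + 2)) / \<epsilon> \<le> real K" using K by linarith
          then show "real (tm + 1) * real (tm + 2) \<le> \<epsilon> / 2 * real K" using \<epsilon> by (simp add: field_simps)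
        qed
        finally show "real (card {j. j < K \<and> (T ^^ (n * j)) y \<in> exceptional n tm}) \<le> \<epsilon> * real K" by simp
      qed
      have appr: "\<bar>f ((T ^^ (s + n * (u + i))) y) - f ((T ^^ (s + (n * u - vis (n * L) y) + n * i)) y)\<bar> \<le> \<epsilon>"
        if u: "vis L 0 + 32 \<le> u" "u \<le> vis L 0 + 32 + D" and y: "y \<in> {0..<z}" "y \<notin> exceptional n tm" and s: "s \<le> B" "i < W" for u y s i
      proof -
        define k where "k = s + n * i"
        have nu: "n * (vis L 0 + 32) \<le> n * u" using u(1) by (rule mult_le_mono2)
        have le: "vis (n * L) y \<le> n * u" using bounds(1)[of y] nu by linarith
        have "n * u \<le> n * (vis L 0 + 32 + D)" using u(2) by (rule mult_le_mono2)
        then have "n * u - vis (n * L) y \<le> n * (64 + D)" using bounds(2)[of y] by (simp add: algebra_simps)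
        also have "\<dots> \<le> nmax * (64 + D)" using n(2) by (rule mult_le_mono1)
        finally have a: "n * u - vis (n * L) y \<le> nmax * (64 + D)" .
        have ni: "n * i \<le> nmax * W" using n(2) s(2) by (intro mult_le_mono) auto
        have "n * u - vis (n * L) y + k \<le> nmax * (64 + D) + (B + nmax * W)"
          unfolding k_def by (rule add_mono[OF a add_mono[OF s(1) ni]])
        then have tm: "2 * (n * u - vis (n * L) y + k) \<le> tm" unfolding tm_def add.assoc by (rule mult_le_mono2)
        have "\<bar>(T ^^ (k + n * u)) y - (T ^^ (k + (n * u - vis (n * L) y))) y\<bar> < real (n + 1) * \<delta>"
          by (rule drift[OF n(1,3) y le tm])
        also have "\<dots> \<le> real N0 * \<delta>" using n(3) \<delta>_pos by (intro mult_right_mono) auto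
        finally have "dist ((T ^^ (k + n * u)) y) ((T ^^ (k + (n * u - vis (n * L) y))) y) < d" using N0d by (simp add: dist_real_def)
        moreover have "(T ^^ j) y \<in> {0..z}" for j
        proof -
          have "(T ^^ j) y \<in> {0..<z}" using y(1) T_in by (induction j) auto
          then show ?thesis by simp
        qed
        ultimately have "dist (f ((T ^^ (k + n * u)) y)) (f ((T ^^ (k + (n * u - vis (n * L) y))) y)) < \<epsilon>" by (intro d(2))
        moreover have "k + n * u = s + n * (u + i)" "k + (n * u - vis (n * L) y) = s + (n * u - vis (n * L) y) + n * i"
          by (simp_all add: k_def algebra_simps)
        ultimately show ?thesis by (simp add: dist_real_def)
      qed
      have freq: "\<kappa> * real (2 * h + H) \<le> real (card {w. w < 2 * h + H \<and> \<not> d dvd vis (n * L) ((T ^^ (n * w)) y)})"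
        if "2 \<le> d" "y \<in> {0..<z}" for d y
      proof -
        have "real (2 * h + H) \<le> (2 + M) * real h" using H by (simp add: algebra_simps)
        then have "\<kappa> * real (2 * h + H) \<le> \<kappa> * ((2 + M) * real h)" using \<kappa> by (intro mult_left_mono) auto
        also have "\<dots> = real h / (4 * real nmax)" using nmax M by (simp add: \<kappa>_def)
        also have "\<dots> \<le> real h / (4 * real n)" using n by (intro divide_left_mono) auto
        also have "\<dots> \<le> real h / (2 * real n) - 2"
        proof -
          have "8 * n \<le> h" using Q(1) Qh n(2) by linarith
          then have "real (8 * n) \<le> real h" by (simp only: of_nat_le_iff)
          then show ?thesis using n(1) by (simp add: field_simps)
        qed
        also have "\<dots> \<le> real (card {w. w < 2 * h + H \<and> \<not> d dvd vis (n * L) ((T ^^ (n * w)) y)})"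
          by (rule nondivisible_frequency[OF n(1,3) that])
        finally show ?thesis .
      qed
      have "\<exists>W2>0. \<forall>d\<ge>2. \<forall>y\<in>{0..<z}. \<kappa> * real W2 \<le> real (card {w. w < W2 \<and> \<not> d dvd vis (n * L) ((T ^^ (n * w)) y)})"
        using freq h_pos by (intro exI[of _ "2 * h + H"]) auto
      then show ?thesis unfolding drift_data_def using bounds dens appr by (intro conjI) auto
    qed
    then show ?thesis
      by (intro exI[of _ "vis L 0"] exI[of _ "\<lambda>n. vis (n * L)"] exI[of _ "\<lambda>n. exceptional n tm"]) simp
  qed
  then show ?thesis using \<kappa> by blast
qed

lemma dvd_diff_iff:
  fixes k a b :: nat
  assumes "k dvd a" "b \<le> a"
  shows "k dvd a - b \<longleftrightarrow> k dvd b"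
  using assms dvd_diffD1[of k a b] dvd_diff_nat[of k a b] by blast

lemma sum_dvd_progression:
  fixes p a c :: nat
  assumes p: "prime p" and a: "\<not> p dvd a"
  shows "(\<Sum>r<p. of_bool (p dvd c + r * a) :: real) = 1"
proof -
  have p0: "0 < p" using p by (simp add: prime_gt_0_nat)
  have le: "r = r'" if "r < p" "r' < p" "(c + r * a) mod p = (c + r' * a) mod p" "r \<le> r'" for r r'
  proof -
    have "p dvd (c + r' * a) - (c + r * a)" using that by (subst mod_eq_dvd_iff_nat[symmetric]) auto
    also have "(c + r' * a) - (c + r * a) = (r' - r) * a" by (simp add: diff_mult_distrib)
    finally have "p dvd r' - r" using p a by (simp add: prime_dvd_mult_iff)
    then show ?thesis using that by (auto dest: dvd_imp_le)
  qed
  have inj: "inj_on (\<lambda>r. (c + r * a) mod p) {..<p}"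
  proof (rule inj_onI)
    fix r r' assume "r \<in> {..<p}" "r' \<in> {..<p}" "(c + r * a) mod p = (c + r' * a) mod p"
    then show "r = r'" using le[of r r'] le[of r' r] by (cases "r \<le> r'") auto
  qed
  moreover have "(\<lambda>r. (c + r * a) mod p) ` {..<p} \<subseteq> {..<p}" using p0 by auto
  ultimately have bij: "bij_betw (\<lambda>r. (c + r * a) mod p) {..<p} {..<p}" by (simp add: bij_betw_def endo_inj_surj)
  have "(\<Sum>r<p. of_bool (p dvd c + r * a) :: real) = (\<Sum>r<p. of_bool ((c + r * a) mod p = 0))" by (simp add: dvd_eq_mod_eq_0)
  also have "\<dots> = (\<Sum>r<p. of_bool (r = 0))" by (rule sum.reindex_bij_betw[OF bij])
  also have "\<dots> = (\<Sum>r<p. if r = 0 then 1 else 0)" by (rule sum.cong) auto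
  also have "\<dots> = 1" using p0 by (simp only: sum.delta[OF finite_lessThan]) simp
  finally show ?thesis .
qed

definition (in return_map) null_mean :: "nat \<Rightarrow> (real \<Rightarrow> real) \<Rightarrow> bool" where
  "null_mean n f \<longleftrightarrow> (\<forall>\<epsilon>>0. \<exists>K0. \<forall>K\<ge>K0. \<forall>y\<in>{0..<z}. \<bar>\<Sum>j<K. f ((T ^^ (n * j)) y)\<bar> \<le> \<epsilon> * real K)"

context irrational_return
begin

lemma T_funpow_in: "y \<in> {0..<z} \<Longrightarrow> (T ^^ j) y \<in> {0..<z}"
  by (induction j) (use T_in in auto)

lemma funpow_funpow: "(T ^^ a) ((T ^^ b) y) = (T ^^ (a + b)) y"
  by (simp add: funpow_add)

text \<open>The system is the product of \<open>T ^^ n\<close> with a counter read modulo p, and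
  \<open>w\<close> is the indicator of the multiples of p minus its mean. A drift (a, 0) with p not
  dividing a runs through all residues, so p successive translates of \<open>w\<close> add up to
  exactly 0, which gives \<open>kill\<close> with K = p.\<close>

lemma twisted_mean:
  assumes good: good_scales and f: "continuous_on {0..z} f" "\<And>y. y \<in> {0..<z} \<Longrightarrow> \<bar>f y\<bar> \<le> 1" and n: "0 < n" and p: "prime p" and \<epsilon>: "0 < \<epsilon>"
  shows "\<exists>K0. \<forall>K\<ge>K0. \<forall>y\<in>{0..<z}. \<bar>\<Sum>j<K. f ((T ^^ (n * j)) y) * (of_bool (p dvd j) - 1 / real p)\<bar> \<le> \<epsilon> * real K"
proof -
  define w where "w = (\<lambda>e::nat. of_bool (p dvd e) - 1 / real p)"
  have p2: "2 \<le> p" using p by (rule prime_ge_2_nat)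
  have w1: "\<bar>w e\<bar> \<le> 1" for e using p2 by (simp add: w_def)
  have w_shift: "w (e + u) = w e" if "p dvd u" for e u using that by (simp add: w_def dvd_add_left_iff)
  define V where "V = (\<lambda>(x, e). ((T ^^ n) x, Suc e))"
  define F where "F = (\<lambda>s t (x, e). f ((T ^^ s) x) * w (e + t))"
  from drifting_returns[OF good f(1) n] obtain \<kappa> where \<kappa>: "0 < \<kappa>"
    and dr: "\<forall>\<epsilon>>0. \<forall>B W D. \<exists>v e E. \<forall>k. 0 < k \<longrightarrow> k \<le> n \<longrightarrow> drift_data f k \<kappa> \<epsilon> B W D v (e k) (E k)"
    by (elim exE conjE) (rule that)
  have Vpow: "(V ^^ k) (x, e) = ((T ^^ (n * k)) x, e + k)" for k x e
    by (induction k) (simp_all add: V_def funpow_funpow)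
  interpret drifting_averages "{0..<z} \<times> UNIV" V F n 1 "n * (64 + p)" "{(a, b). b = 0 \<and> \<not> p dvd a}" \<kappa>
  proof
    show "V x \<in> {0..<z} \<times> UNIV" if "x \<in> {0..<z} \<times> UNIV" for x
      using that T_funpow_in[of "fst x" n] by (auto simp: V_def)
    show "\<bar>F s t x\<bar> \<le> 1" if "x \<in> {0..<z} \<times> UNIV" for s t x
    proof -
      obtain y e where x: "x = (y, e)" "y \<in> {0..<z}" using \<open>x \<in> {0..<z} \<times> UNIV\<close> by auto
      show ?thesis unfolding x(1) F_def prod.case abs_mult using f(2)[OF T_funpow_in[OF x(2)]] w1 by (intro mult_le_one) auto
    qed
    show "F s t (V x) = F (s + n) (t + 1) x" for s t x
      by (cases x) (simp add: F_def V_def funpow_funpow)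
    show "n * b \<noteq> 1 * a" if "(a, b) \<in> {(a, b). b = 0 \<and> \<not> p dvd a}" for a b
    proof -
      have "b = 0" "\<not> p dvd a" using that by auto
      moreover from this have "a \<noteq> 0" by (metis dvd_0_right)
      ultimately show ?thesis by simp
    qed
    show "\<exists>K>0. \<forall>(a, b)\<in>{(a, b). b = 0 \<and> \<not> p dvd a}. \<forall>x\<in>{0..<z} \<times> UNIV. \<forall>s t.
      \<bar>\<Sum>r<K. F s (t + r * nat \<bar>int (n * b) - int (1 * a)\<bar>) x\<bar> \<le> \<epsilon>' * real K" if "\<epsilon>' > 0" for \<epsilon>'
    proof (intro exI[of _ p] conjI)
      show "0 < p" using p2 by simp
      have "(\<Sum>r<p. F s (t + r * a) (y, e)) = 0" if "\<not> p dvd a" for a s t y e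
      proof -
        have "(\<Sum>r<p. F s (t + r * a) (y, e)) = (\<Sum>r<p. f ((T ^^ s) y) * (of_bool (p dvd (e + t) + r * a) - 1 / real p))"
          unfolding F_def prod.case w_def add.assoc ..
        also have "\<dots> = f ((T ^^ s) y) * ((\<Sum>r<p. of_bool (p dvd (e + t) + r * a)) - (\<Sum>r<p. 1 / real p))"
          unfolding sum_distrib_left[symmetric] sum_subtractf ..
        finally have "(\<Sum>r<p. F s (t + r * a) (y, e)) = f ((T ^^ s) y) * ((\<Sum>r<p. of_bool (p dvd (e + t) + r * a)) - (\<Sum>r<p. 1 / real p))" .
        then show ?thesis unfolding sum_dvd_progression[OF p that] using p2 by simp
      qed
      then show "\<forall>(a, b)\<in>{(a, b). b = 0 \<and> \<not> p dvd a}. \<forall>x\<in>{0..<z} \<times> UNIV. \<forall>s t.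
        \<bar>\<Sum>r<p. F s (t + r * nat \<bar>int (n * b) - int (1 * a)\<bar>) x\<bar> \<le> \<epsilon>' * real p"
        using \<open>\<epsilon>' > 0\<close> by auto
    qed
    show "\<kappa> > 0" by (rule \<kappa>)
    show "\<exists>u al bl E.
      (\<forall>x\<in>{0..<z} \<times> UNIV. al x \<le> n * (64 + p) \<and> bl x \<le> n * (64 + p)) \<and>
      (\<exists>K0. \<forall>K\<ge>K0. \<forall>x\<in>{0..<z} \<times> UNIV. real (card {j. j < K \<and> (V ^^ j) x \<in> E}) \<le> \<epsilon>' * real K) \<and>
      (\<forall>x\<in>({0..<z} \<times> UNIV) - E. \<forall>s\<le>B. \<forall>t\<le>B. \<forall>i<W. \<bar>F s t ((V ^^ (u + i)) x) - F (s + al x) (t + bl x) ((V ^^ i) x)\<bar> \<le> \<epsilon>') \<and>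
      (\<exists>W2>0. \<forall>x\<in>{0..<z} \<times> UNIV. real (card {w. w < W2 \<and> (al ((V ^^ w) x), bl ((V ^^ w) x)) \<in> {(a, b). b = 0 \<and> \<not> p dvd a}}) \<ge> \<kappa> * real W2)"
      if \<epsilon>': "\<epsilon>' > 0" for \<epsilon>' B W
    proof -
      obtain v e E where "\<forall>k. 0 < k \<longrightarrow> k \<le> n \<longrightarrow> drift_data f k \<kappa> \<epsilon>' B W p v (e k) (E k)"
        using dr[rule_format, OF \<epsilon>', of B W p] by blast
      then have ves: "drift_data f n \<kappa> \<epsilon>' B W p v (e n) (E n)" using n by simp
      have bounds: "e n y \<le> n * (v + 32)" "n * v \<le> e n y + 32 * n" for y
        by (rule drift_dataD[OF ves])+
      obtain K0 where K0: "\<And>K y. K \<ge> K0 \<Longrightarrow> y \<in> {0..<z} \<Longrightarrow> real (card {j. j < K \<and> (T ^^ (n * j)) y \<in> E n}) \<le> \<epsilon>' * real K"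
        using drift_dataD(3)[OF ves] by blast
      have appr: "\<bar>f ((T ^^ (s + n * (u + i))) y) - f ((T ^^ (s + (n * u - e n y) + n * i)) y)\<bar> \<le> \<epsilon>'"
        if "v + 32 \<le> u" "u \<le> v + 32 + p" "y \<in> {0..<z} - E n" "s \<le> B" "i < W" for u y s i
        using that by (rule drift_dataD(4)[OF ves])
      obtain W2 where W2: "0 < W2" "\<forall>d\<ge>2. \<forall>y\<in>{0..<z}. \<kappa> * real W2 \<le> real (card {w. w < W2 \<and> \<not> d dvd e n ((T ^^ (n * w)) y)})"
        using drift_dataD(5)[OF ves] by blast
      \<comment> \<open>A multiple of p, so that u steps leave the counter unchanged modulo p and p
        divides the drift n u - e exactly when it divides e. Reaching it takes at most p above v +
        32, whence the value p for the parameter \<open>D\<close> of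
        \<open>drift_data\<close>.\<close>
      define u where "u = p * ((v + 32) div p + 1)"
      have u: "v + 32 \<le> u" "u \<le> v + 32 + p" "p dvd u"
      proof -
        have pd: "0 < p" using p2 by simp
        show "v + 32 \<le> u" using dividend_less_times_div[OF pd, of "v + 32"] by (simp add: u_def)
        show "u \<le> v + 32 + p" using times_div_less_eq_dividend[of p "v + 32"] by (simp add: u_def)
      qed (simp add: u_def)
      have nu: "n * (v + 32) \<le> n * u" "n * u \<le> n * (v + 32 + p)" using u by (auto intro: mult_le_mono2)
      show ?thesis
      proof (intro exI conjI)
        show "\<forall>x\<in>{0..<z} \<times> (UNIV :: nat set). (\<lambda>x. n * u - e n (fst x)) x \<le> n * (64 + p) \<and> (\<lambda>_. 0) x \<le> n * (64 + p)"
        proof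
          fix x :: "real \<times> nat"
          show "(\<lambda>x. n * u - e n (fst x)) x \<le> n * (64 + p) \<and> (\<lambda>_. 0) x \<le> n * (64 + p)"
            using bounds(2)[of "fst x"] nu(2) by (simp add: algebra_simps)
        qed
        show "\<forall>K\<ge>K0. \<forall>x\<in>{0..<z} \<times> UNIV. real (card {j. j < K \<and> (V ^^ j) x \<in> E n \<times> UNIV}) \<le> \<epsilon>' * real K"
          using K0 by (auto simp: Vpow)
        show "\<forall>x\<in>({0..<z} \<times> UNIV) - E n \<times> UNIV. \<forall>s\<le>B. \<forall>t\<le>B. \<forall>i<W.
          \<bar>F s t ((V ^^ (u + i)) x) - F (s + (\<lambda>x. n * u - e n (fst x)) x) (t + (\<lambda>_. 0) x) ((V ^^ i) x)\<bar> \<le> \<epsilon>'"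
        proof (intro ballI allI impI)
          fix x :: "real \<times> nat" and s t i assume x: "x \<in> ({0..<z} \<times> UNIV) - E n \<times> UNIV" and s: "s \<le> B" "t \<le> B" "i < W"
          obtain y c where xy: "x = (y, c)" by (cases x)
          have y: "y \<in> {0..<z} - E n" using x xy by auto
          have eq: "c + (u + i) + t = (c + i + t) + u" by simp
          have "F s t ((V ^^ (u + i)) x) - F (s + (n * u - e n y)) t ((V ^^ i) x) =
            (f ((T ^^ (s + n * (u + i))) y) - f ((T ^^ (s + (n * u - e n y) + n * i)) y)) * w (c + i + t)"
            unfolding xy Vpow F_def prod.case funpow_funpow eq w_shift[OF u(3)] left_diff_distrib ..
          also have "\<bar>\<dots>\<bar> \<le> \<epsilon>' * 1" unfolding abs_mult using appr[OF u(1,2) y s(1,3)] w1 \<epsilon>' by (intro mult_mono) auto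
          finally show "\<bar>F s t ((V ^^ (u + i)) x) - F (s + (\<lambda>x. n * u - e n (fst x)) x) (t + (\<lambda>_. 0) x) ((V ^^ i) x)\<bar> \<le> \<epsilon>'"
            by (simp add: xy)
        qed
        show "W2 > 0" by (rule W2)
        show "\<forall>x\<in>{0..<z} \<times> UNIV. real (card {w. w < W2 \<and> ((\<lambda>x. n * u - e n (fst x)) ((V ^^ w) x), (\<lambda>_. 0) ((V ^^ w) x)) \<in> {(a, b). b = 0 \<and> \<not> p dvd a}}) \<ge> \<kappa> * real W2"
        proof
          fix x :: "real \<times> nat" assume "x \<in> {0..<z} \<times> UNIV"
          then obtain y c where xy: "x = (y, c)" "y \<in> {0..<z}" by auto
          have "p dvd n * u - e n y' \<longleftrightarrow> p dvd e n y'" for y'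
          proof -
            have "e n y' \<le> n * u" using bounds(1)[of y'] nu(1) by linarith
            then show ?thesis using u(3) by (intro dvd_diff_iff) auto
          qed
          then have "{w. w < W2 \<and> ((\<lambda>x. n * u - e n (fst x)) ((V ^^ w) x), (\<lambda>_. 0 :: nat) ((V ^^ w) x)) \<in> {(a, b). b = 0 \<and> \<not> p dvd a}}
            = {w. w < W2 \<and> \<not> p dvd e n ((T ^^ (n * w)) y)}"
            by (auto simp: xy Vpow)
          then show "real (card {w. w < W2 \<and> ((\<lambda>x. n * u - e n (fst x)) ((V ^^ w) x), (\<lambda>_. 0) ((V ^^ w) x)) \<in> {(a, b). b = 0 \<and> \<not> p dvd a}}) \<ge> \<kappa> * real W2"
            using W2(2)[rule_format, OF p2 xy(2)] by simp
        qed
      qed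
    qed
  qed
  obtain K0 where K0: "\<And>K x. K \<ge> K0 \<Longrightarrow> x \<in> {0..<z} \<times> UNIV \<Longrightarrow> \<bar>\<Sum>j<K. F 0 0 ((V ^^ j) x)\<bar> \<le> \<epsilon> * real K"
    using uniform_averages[OF \<epsilon>] by blast
  show ?thesis
  proof (intro exI[of _ K0] allI impI ballI)
    fix K y assume "K0 \<le> K" "y \<in> {0..<z}"
    then have "\<bar>\<Sum>j<K. F 0 0 ((V ^^ j) (y, 0))\<bar> \<le> \<epsilon> * real K" by (intro K0) auto
    then show "\<bar>\<Sum>j<K. f ((T ^^ (n * j)) y) * (of_bool (p dvd j) - 1 / real p)\<bar> \<le> \<epsilon> * real K"
      unfolding Vpow F_def prod.case w_def by simp
  qed
qed

text \<open>The iterates of step p n are those of step n at the indices divisible by p. The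
  indicator of these indices is the constant 1 / p, handled by \<open>null_mean n f\<close>, plus
  the centred weight of \<open>twisted_mean\<close>.\<close>

lemma null_mean_prime_mult:
  assumes good: good_scales and f: "continuous_on {0..z} f" "\<And>y. y \<in> {0..<z} \<Longrightarrow> \<bar>f y\<bar> \<le> 1" and n: "0 < n" and p: "prime p"
    and null: "null_mean n f"
  shows "null_mean (p * n) f"
  unfolding null_mean_def
proof (intro allI impI)
  fix \<epsilon> :: real assume \<epsilon>: "0 < \<epsilon>"
  have p2: "2 \<le> p" using p by (rule prime_ge_2_nat)
  define \<rho> where "\<rho> = \<epsilon> / (2 * real p)"
  have \<rho>: "0 < \<rho>" using \<epsilon> p2 by (simp add: \<rho>_def)
  obtain K1 where K1: "\<And>K y. K \<ge> K1 \<Longrightarrow> y \<in> {0..<z} \<Longrightarrow> \<bar>\<Sum>j<K. f ((T ^^ (n * j)) y) * (of_bool (p dvd j) - 1 / real p)\<bar> \<le> \<rho> * real K"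
    using twisted_mean[OF good f n p \<rho>] by blast
  obtain K2 where K2: "\<And>K y. K \<ge> K2 \<Longrightarrow> y \<in> {0..<z} \<Longrightarrow> \<bar>\<Sum>j<K. f ((T ^^ (n * j)) y)\<bar> \<le> \<rho> * real K"
    using null \<rho> unfolding null_mean_def by blast
  show "\<exists>K0. \<forall>K\<ge>K0. \<forall>y\<in>{0..<z}. \<bar>\<Sum>j<K. f ((T ^^ (p * n * j)) y)\<bar> \<le> \<epsilon> * real K"
  proof (intro exI[of _ "max K1 K2"] allI impI ballI)
    fix K y assume K: "max K1 K2 \<le> K" and y: "y \<in> {0..<z}"
    have "K \<le> p * K" using p2 by simp
    then have pK: "K1 \<le> p * K" "K2 \<le> p * K" using K by linarith+
    define g where "g = (\<lambda>j. f ((T ^^ (n * j)) y))"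
    have eq: "(\<Sum>j<p * K. g j * of_bool (p dvd j)) = (\<Sum>j<K. g (p * j))"
    proof -
      have "(\<Sum>j<p * K. g j * of_bool (p dvd j)) = (\<Sum>j<p * K. if p dvd j then g j else 0)" by (rule sum.cong) auto
      also have "\<dots> = (\<Sum>j\<in>{j\<in>{..<p * K}. p dvd j}. g j)" by (rule sum.inter_filter[symmetric]) simp
      also have "{j\<in>{..<p * K}. p dvd j} = (*) p ` {..<K}" using p2 by (auto elim!: dvdE)
      also have "(\<Sum>j\<in>(*) p ` {..<K}. g j) = (\<Sum>j<K. g (p * j))"
        using p2 by (subst sum.reindex) (auto simp: inj_on_def)
      finally show ?thesis .
    qed
    have "(\<Sum>j<K. f ((T ^^ (p * n * j)) y)) = (\<Sum>j<K. g (p * j))" by (simp add: g_def mult_ac)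
    also have "\<dots> = (\<Sum>j<p * K. g j * (of_bool (p dvd j) - 1 / real p)) + (1 / real p) * (\<Sum>j<p * K. g j)"
      unfolding eq[symmetric] sum_distrib_left sum.distrib[symmetric] by (intro sum.cong refl) (simp add: algebra_simps)
    finally have eq': "(\<Sum>j<K. f ((T ^^ (p * n * j)) y)) =
      (\<Sum>j<p * K. g j * (of_bool (p dvd j) - 1 / real p)) + (1 / real p) * (\<Sum>j<p * K. g j)" .
    have s: "\<bar>\<Sum>j<K. f ((T ^^ (p * n * j)) y)\<bar> \<le> \<bar>\<Sum>j<p * K. g j * (of_bool (p dvd j) - 1 / real p)\<bar> + \<bar>(1 / real p) * (\<Sum>j<p * K. g j)\<bar>"
      unfolding eq' by (rule abs_triangle_ineq)
    have 1: "\<bar>\<Sum>j<p * K. g j * (of_bool (p dvd j) - 1 / real p)\<bar> \<le> \<epsilon> / 2 * real K"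
      using K1[OF pK(1) y] p2 by (simp add: g_def \<rho>_def)
    have 2: "\<bar>(1 / real p) * (\<Sum>j<p * K. g j)\<bar> \<le> \<epsilon> / 2 * real K"
    proof -
      have "\<bar>\<Sum>j<p * K. g j\<bar> \<le> \<epsilon> / 2 * real K" using K2[OF pK(2) y] p2 by (simp add: g_def \<rho>_def)
      moreover have "\<bar>(1 / real p) * (\<Sum>j<p * K. g j)\<bar> \<le> 1 * \<bar>\<Sum>j<p * K. g j\<bar>"
        unfolding abs_mult using p2 by (intro mult_right_mono) auto
      ultimately show ?thesis by linarith
    qed
    show "\<bar>\<Sum>j<K. f ((T ^^ (p * n * j)) y)\<bar> \<le> \<epsilon> * real K" using s 1 2 by linarith
  qed
qed

lemma null_mean_all:
  assumes good: good_scales and f: "continuous_on {0..z} f" "\<And>y. y \<in> {0..<z} \<Longrightarrow> \<bar>f y\<bar> \<le> 1"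
    and null: "null_mean 1 f" and n: "0 < n"
  shows "null_mean n f"
  using n
proof (induction n rule: less_induct)
  case (less n)
  show ?case
  proof (cases "n = 1")
    case False
    then obtain p where p: "prime p" "p dvd n" using prime_factor_nat by blast
    then obtain m where m: "n = p * m" by blast
    have m0: "0 < m" using less.prems m by auto
    then have mn: "m < n" unfolding m using prime_gt_1_nat[OF p(1)] by simp
    show ?thesis unfolding m by (rule null_mean_prime_mult[OF good f m0 p(1) less.IH[OF mn m0]])
  qed (use null in simp)
qed

text \<open>The product of \<open>T ^^ n\<close> and \<open>T ^^ m\<close> is observed on the
  diagonal. A progression of difference D = |n b - m a| moves only the second index, where the
  vanishing averages along \<open>T ^^ D\<close> give \<open>kill\<close>; this is why all exponents
  are assumed in \<open>null\<close>.\<close>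

lemma joint_mean:
  assumes good: good_scales and f: "continuous_on {0..z} f" "\<And>y. y \<in> {0..<z} \<Longrightarrow> \<bar>f y\<bar> \<le> 1"
    and null: "\<And>k. 0 < k \<Longrightarrow> null_mean k f" and nm: "prime n" "prime m" "n \<noteq> m" and \<epsilon>: "0 < \<epsilon>"
  shows "\<exists>K0. \<forall>K\<ge>K0. \<forall>y\<in>{0..<z}. \<bar>\<Sum>j<K. f ((T ^^ (n * j)) y) * f ((T ^^ (m * j)) y)\<bar> \<le> \<epsilon> * real K"
proof -
  define N where "N = max n m"
  have n0: "0 < n" "n \<le> N" "0 < m" "m \<le> N" "2 \<le> n" using nm by (auto simp: N_def prime_gt_0_nat prime_ge_2_nat)
  define V where "V = (\<lambda>(x, y). ((T ^^ n) x, (T ^^ m) y))"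
  define F where "F = (\<lambda>s t (x, y). f ((T ^^ s) x) * f ((T ^^ t) y))"
  \<comment> \<open>As n and m are distinct primes, n b = m a would force n to divide a, so it is
    enough that n does not divide the first drift. The bounds on a and b leave finitely many
    differences D, whence one K for \<open>kill\<close>.\<close>
  define Adm where "Adm = {(a, b). a \<le> N * 64 \<and> b \<le> N * 64 \<and> \<not> n dvd a}"
  let ?X = "{0..<z} \<times> {0..<z}"
  have "0 < N" using n0 by linarith
  from drifting_returns[OF good f(1) this] obtain \<kappa> where \<kappa>: "0 < \<kappa>"
    and dr: "\<forall>\<epsilon>>0. \<forall>B W D. \<exists>v e E. \<forall>k. 0 < k \<longrightarrow> k \<le> N \<longrightarrow> drift_data f k \<kappa> \<epsilon> B W D v (e k) (E k)"
    by (elim exE conjE) (rule that)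
  have Vpow: "(V ^^ k) (x, y) = ((T ^^ (n * k)) x, (T ^^ (m * k)) y)" for k x y
    by (induction k) (simp_all add: V_def funpow_funpow)
  have f1: "\<bar>f ((T ^^ s) y)\<bar> \<le> 1" if "y \<in> {0..<z}" for s y using f(2) T_funpow_in[OF that] by blast
  interpret drifting_averages ?X V F n m "N * 64" Adm \<kappa>
  proof
    show "V x \<in> ?X" if "x \<in> ?X" for x
      using that T_funpow_in[of "fst x" n] T_funpow_in[of "snd x" m] by (auto simp: V_def)
    show "\<bar>F s t x\<bar> \<le> 1" if "x \<in> ?X" for s t x
    proof -
      obtain y y' where x: "x = (y, y')" "y \<in> {0..<z}" "y' \<in> {0..<z}" using \<open>x \<in> ?X\<close> by auto
      show ?thesis unfolding x(1) F_def prod.case abs_mult using f1 x by (intro mult_le_one) auto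
    qed
    show "F s t (V x) = F (s + n) (t + m) x" for s t x
      by (cases x) (simp add: F_def V_def funpow_funpow)
    show "n * b \<noteq> m * a" if "(a, b) \<in> Adm" for a b
    proof
      assume "n * b = m * a"
      then have "n dvd m * a" by (metis dvd_triv_left)
      moreover have "\<not> n dvd m" using nm primes_dvd_imp_eq by blast
      ultimately show False using that nm(1) by (simp add: Adm_def prime_dvd_mult_iff)
    qed
    show "\<exists>K>0. \<forall>(a, b)\<in>Adm. \<forall>x\<in>?X. \<forall>s t.
      \<bar>\<Sum>r<K. F s (t + r * nat \<bar>int (n * b) - int (m * a)\<bar>) x\<bar> \<le> \<epsilon>' * real K" if \<epsilon>': "\<epsilon>' > 0" for \<epsilon>'
    proof -
      have "\<forall>k. \<exists>K0. 0 < k \<longrightarrow> (\<forall>K\<ge>K0. \<forall>y\<in>{0..<z}. \<bar>\<Sum>j<K. f ((T ^^ (k * j)) y)\<bar> \<le> \<epsilon>' * real K)"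
        using null \<epsilon>' unfolding null_mean_def by blast
      then obtain K0 where K0: "\<And>k K y. 0 < k \<Longrightarrow> K0 k \<le> K \<Longrightarrow> y \<in> {0..<z} \<Longrightarrow> \<bar>\<Sum>j<K. f ((T ^^ (k * j)) y)\<bar> \<le> \<epsilon>' * real K"
        by metis
      define Dm where "Dm = N * (N * 64)"
      define K where "K = Max (insert 1 (K0 ` {..Dm}))"
      have K: "1 \<le> K" "K0 k \<le> K" if "k \<le> Dm" for k unfolding K_def using that by (intro Max_ge; auto)+
      have "\<bar>\<Sum>r<K. F s (t + r * nat \<bar>int (n * b) - int (m * a)\<bar>) (x, y)\<bar> \<le> \<epsilon>' * real K"
        if ab: "(a, b) \<in> Adm" and xy: "x \<in> {0..<z}" "y \<in> {0..<z}" for a b x y s t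
      proof -
        define D where "D = nat \<bar>int (n * b) - int (m * a)\<bar>"
        have "n * b \<le> Dm" "m * a \<le> Dm" unfolding Dm_def using ab n0 by (auto simp: Adm_def intro!: mult_le_mono)
        moreover have "n * b \<noteq> m * a"
        proof
          assume "n * b = m * a"
          then have "n dvd m * a" by (metis dvd_triv_left)
          moreover have "\<not> n dvd m" using nm primes_dvd_imp_eq by blast
          ultimately show False using ab nm(1) by (simp add: Adm_def prime_dvd_mult_iff)
        qed
        ultimately have D: "0 < D" "D \<le> Dm" unfolding D_def by linarith+
        have "(\<Sum>r<K. F s (t + r * D) (x, y)) = f ((T ^^ s) x) * (\<Sum>r<K. f ((T ^^ (D * r)) ((T ^^ t) y)))"
          unfolding F_def prod.case sum_distrib_left funpow_funpow by (simp only: mult.commute add.commute)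
        also have "\<bar>\<dots>\<bar> \<le> 1 * (\<epsilon>' * real K)"
          unfolding abs_mult using f1[OF xy(1)] K0[OF D(1) K(2)[OF D(2)] T_funpow_in[OF xy(2)]] by (intro mult_mono) auto
        finally show ?thesis by (simp add: D_def)
      qed
      then show ?thesis using K(1)[of 0] by (intro exI[of _ K]) auto
    qed
    show "\<kappa> > 0" by (rule \<kappa>)
    show "\<exists>u al bl E.
      (\<forall>x\<in>?X. al x \<le> N * 64 \<and> bl x \<le> N * 64) \<and>
      (\<exists>K0. \<forall>K\<ge>K0. \<forall>x\<in>?X. real (card {j. j < K \<and> (V ^^ j) x \<in> E}) \<le> \<epsilon>' * real K) \<and>
      (\<forall>x\<in>?X - E. \<forall>s\<le>B. \<forall>t\<le>B. \<forall>i<W. \<bar>F s t ((V ^^ (u + i)) x) - F (s + al x) (t + bl x) ((V ^^ i) x)\<bar> \<le> \<epsilon>') \<and>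
      (\<exists>W2>0. \<forall>x\<in>?X. real (card {w. w < W2 \<and> (al ((V ^^ w) x), bl ((V ^^ w) x)) \<in> Adm}) \<ge> \<kappa> * real W2)"
      if \<epsilon>': "\<epsilon>' > 0" for \<epsilon>' B W
    proof -
      have half: "\<epsilon>' / 2 > 0" using \<epsilon>' by simp
      obtain v e E where ves': "\<forall>k. 0 < k \<longrightarrow> k \<le> N \<longrightarrow> drift_data f k \<kappa> (\<epsilon>' / 2) B W 0 v (e k) (E k)"
        using dr[rule_format, OF half, of B W 0] by blast
      then have ves: "drift_data f k \<kappa> (\<epsilon>' / 2) B W 0 v (e k) (E k)" if "0 < k \<and> k \<le> N" for k using that by simp
      have kn: "0 < n \<and> n \<le> N" and km: "0 < m \<and> m \<le> N" using n0 by auto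
      \<comment> \<open>\<open>v\<close> is the same for all exponents, so a common u keeps both
        drifts at most 64 N.\<close>
      define u where "u = v + 32"
      have bounds: "e k y \<le> k * (v + 32)" "k * v \<le> e k y + 32 * k" if "0 < k \<and> k \<le> N" for k y
        by (rule drift_dataD[OF ves[OF that]])+
      have al: "k * u - e k y \<le> N * 64" if k: "0 < k \<and> k \<le> N" for k y
      proof -
        have "k * u - e k y \<le> k * 64" using bounds(2)[OF k, of y] by (simp add: u_def algebra_simps)
        also have "\<dots> \<le> N * 64" using k by simp
        finally show ?thesis .
      qed
      obtain K1 where K1: "\<And>K y. K \<ge> K1 \<Longrightarrow> y \<in> {0..<z} \<Longrightarrow> real (card {j. j < K \<and> (T ^^ (n * j)) y \<in> E n}) \<le> \<epsilon>' / 2 * real K"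
        using drift_dataD(3)[OF ves[OF kn]] by blast
      obtain K2 where K2: "\<And>K y. K \<ge> K2 \<Longrightarrow> y \<in> {0..<z} \<Longrightarrow> real (card {j. j < K \<and> (T ^^ (m * j)) y \<in> E m}) \<le> \<epsilon>' / 2 * real K"
        using drift_dataD(3)[OF ves[OF km]] by blast
      have appr: "\<bar>f ((T ^^ (s + k * (u + i))) y) - f ((T ^^ (s + (k * u - e k y) + k * i)) y)\<bar> \<le> \<epsilon>' / 2"
        if "0 < k \<and> k \<le> N" "y \<in> {0..<z} - E k" "s \<le> B" "i < W" for k y s i
        by (rule drift_dataD(4)[OF ves[OF that(1)] _ _ that(2-)]) (simp_all add: u_def)
      obtain W2 where W2: "0 < W2" "\<forall>d\<ge>2. \<forall>y\<in>{0..<z}. \<kappa> * real W2 \<le> real (card {w. w < W2 \<and> \<not> d dvd e n ((T ^^ (n * w)) y)})"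
        using drift_dataD(5)[OF ves[OF kn]] by blast
      show ?thesis
      proof (intro exI conjI)
        show "\<forall>x\<in>?X. (\<lambda>x. n * u - e n (fst x)) x \<le> N * 64 \<and> (\<lambda>x. m * u - e m (snd x)) x \<le> N * 64"
          using al[OF kn] al[OF km] by blast
        show "\<forall>K\<ge>max K1 K2. \<forall>x\<in>?X. real (card {j. j < K \<and> (V ^^ j) x \<in> {(x, y). x \<in> E n \<or> y \<in> E m}}) \<le> \<epsilon>' * real K"
        proof (intro allI impI ballI)
          fix K x assume K: "max K1 K2 \<le> K" and "x \<in> ?X"
          then obtain y y' where xy: "x = (y, y')" "y \<in> {0..<z}" "y' \<in> {0..<z}" by auto
          have "{j. j < K \<and> (V ^^ j) x \<in> {(x, y). x \<in> E n \<or> y \<in> E m}} =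
            {j. j < K \<and> (T ^^ (n * j)) y \<in> E n} \<union> {j. j < K \<and> (T ^^ (m * j)) y' \<in> E m}"
            by (auto simp: xy Vpow)
          then have "card {j. j < K \<and> (V ^^ j) x \<in> {(x, y). x \<in> E n \<or> y \<in> E m}} \<le>
            card {j. j < K \<and> (T ^^ (n * j)) y \<in> E n} + card {j. j < K \<and> (T ^^ (m * j)) y' \<in> E m}"
            by (simp only: card_Un_le)
          then have "real (card {j. j < K \<and> (V ^^ j) x \<in> {(x, y). x \<in> E n \<or> y \<in> E m}}) \<le>
            real (card {j. j < K \<and> (T ^^ (n * j)) y \<in> E n}) + real (card {j. j < K \<and> (T ^^ (m * j)) y' \<in> E m})"
            unfolding of_nat_add[symmetric] of_nat_le_iff .
          moreover have "K1 \<le> K" "K2 \<le> K" using K by auto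
          ultimately show "real (card {j. j < K \<and> (V ^^ j) x \<in> {(x, y). x \<in> E n \<or> y \<in> E m}}) \<le> \<epsilon>' * real K"
            using K1[OF _ xy(2), of K] K2[OF _ xy(3), of K] by linarith
        qed
        show "\<forall>x\<in>?X - {(x, y). x \<in> E n \<or> y \<in> E m}. \<forall>s\<le>B. \<forall>t\<le>B. \<forall>i<W.
          \<bar>F s t ((V ^^ (u + i)) x) - F (s + (\<lambda>x. n * u - e n (fst x)) x) (t + (\<lambda>x. m * u - e m (snd x)) x) ((V ^^ i) x)\<bar> \<le> \<epsilon>'"
        proof (intro ballI allI impI)
          fix x s t i assume x: "x \<in> ?X - {(x, y). x \<in> E n \<or> y \<in> E m}" and s: "s \<le> B" "t \<le> B" "i < W"
          obtain y y' where xy: "x = (y, y')" by (cases x)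
          have y: "y \<in> {0..<z} - E n" "y' \<in> {0..<z} - E m" using x xy by auto
          define a b a' b' where "a = f ((T ^^ (s + n * (u + i))) y)" and "b = f ((T ^^ (t + m * (u + i))) y')"
            and "a' = f ((T ^^ (s + (n * u - e n y) + n * i)) y)" and "b' = f ((T ^^ (t + (m * u - e m y') + m * i)) y')"
          have d: "\<bar>a - a'\<bar> \<le> \<epsilon>' / 2" "\<bar>b - b'\<bar> \<le> \<epsilon>' / 2"
            unfolding a_def b_def a'_def b'_def by (rule appr[OF kn y(1) s(1,3)], rule appr[OF km y(2) s(2,3)])
          have l: "\<bar>b\<bar> \<le> 1" "\<bar>a'\<bar> \<le> 1" unfolding b_def a'_def using y by (auto intro!: f1)
          have "a * b - a' * b' = (a - a') * b + a' * (b - b')" by (simp add: algebra_simps)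
          also have "\<bar>\<dots>\<bar> \<le> \<bar>(a - a') * b\<bar> + \<bar>a' * (b - b')\<bar>" by (rule abs_triangle_ineq)
          also have "\<dots> \<le> \<epsilon>' / 2 * 1 + 1 * (\<epsilon>' / 2)"
            unfolding abs_mult using d l \<epsilon>' by (intro add_mono mult_mono) auto
          finally have "\<bar>a * b - a' * b'\<bar> \<le> \<epsilon>'" by simp
          then show "\<bar>F s t ((V ^^ (u + i)) x) - F (s + (\<lambda>x. n * u - e n (fst x)) x) (t + (\<lambda>x. m * u - e m (snd x)) x) ((V ^^ i) x)\<bar> \<le> \<epsilon>'"
            unfolding xy Vpow F_def prod.case funpow_funpow fst_conv snd_conv a_def b_def a'_def b'_def .
        qed
        show "W2 > 0" by (rule W2)
        show "\<forall>x\<in>?X. real (card {w. w < W2 \<and> ((\<lambda>x. n * u - e n (fst x)) ((V ^^ w) x), (\<lambda>x. m * u - e m (snd x)) ((V ^^ w) x)) \<in> Adm}) \<ge> \<kappa> * real W2"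
        proof
          fix x assume "x \<in> ?X"
          then obtain y y' where xy: "x = (y, y')" "y \<in> {0..<z}" by auto
          have "n dvd n * u - e n y'' \<longleftrightarrow> n dvd e n y''" for y''
          proof -
            have "e n y'' \<le> n * u" using bounds(1)[OF kn, of y''] by (simp only: u_def)
            then show ?thesis by (intro dvd_diff_iff) auto
          qed
          then have "{w. w < W2 \<and> ((\<lambda>x. n * u - e n (fst x)) ((V ^^ w) x), (\<lambda>x. m * u - e m (snd x)) ((V ^^ w) x)) \<in> Adm}
            = {w. w < W2 \<and> \<not> n dvd e n ((T ^^ (n * w)) y)}"
            using al[OF kn] al[OF km] by (auto simp: xy Vpow Adm_def)
          then show "real (card {w. w < W2 \<and> ((\<lambda>x. n * u - e n (fst x)) ((V ^^ w) x), (\<lambda>x. m * u - e m (snd x)) ((V ^^ w) x)) \<in> Adm}) \<ge> \<kappa> * real W2"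
            using W2(2)[rule_format, OF n0(5) xy(2)] by simp
        qed
      qed
    qed
  qed
  obtain K0 where K0: "\<And>K x. K \<ge> K0 \<Longrightarrow> x \<in> ?X \<Longrightarrow> \<bar>\<Sum>j<K. F 0 0 ((V ^^ j) x)\<bar> \<le> \<epsilon> * real K"
    using uniform_averages[OF \<epsilon>] by blast
  show ?thesis
  proof (intro exI[of _ K0] allI impI ballI)
    fix K y assume "K0 \<le> K" "y \<in> {0..<z}"
    then have "\<bar>\<Sum>j<K. F 0 0 ((V ^^ j) (y, y))\<bar> \<le> \<epsilon> * real K" by (intro K0) auto
    then show "\<bar>\<Sum>j<K. f ((T ^^ (n * j)) y) * f ((T ^^ (m * j)) y)\<bar> \<le> \<epsilon> * real K"
      unfolding Vpow F_def prod.case by simp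
  qed
qed

end

section \<open>The zeta function and the Dirichlet series of the Moebius function\<close>

text \<open>(s - 1) times the integral of (n + 1)^(-s) - x^(-s) over x from n + 1 to n + 2. The
  subtraction gains a power of n, which extends convergence to Re s > 0.\<close>

definition zeta_term :: "nat \<Rightarrow> complex \<Rightarrow> complex" where
  "zeta_term n s = (s - 1) * of_nat (Suc n) powr (- s) + of_nat (Suc (Suc n)) powr (1 - s) - of_nat (Suc n) powr (1 - s)"

text \<open>On \<open>Re s > 1\<close> the sum of the differences of powers telescopes, so that \<open>zeta_reg s = (s - 1) \<zeta>(s)\<close>.\<close>

definition zeta_reg :: "complex \<Rightarrow> complex" where
  "zeta_reg s = 1 + (\<Sum>n. zeta_term n s)"

lemma segment_real_bounds:
  assumes "z \<in> closed_segment (of_real a) (of_real b :: complex)" "a \<le> b"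
  obtains x where "z = of_real x" "a \<le> x" "x \<le> b"
proof -
  have "z \<in> of_real ` {a..b}" using assms by (simp add: closed_segment_of_real closed_segment_eq_real_ivl)
  then show thesis using that by auto
qed

text \<open>The mean value inequality is applied twice: first to z^(-s), then to \<open>r\<close>,
  whose derivative is 1 - s times the difference just estimated and whose increment from a to a + 1
  is the term.\<close>

lemma norm_zeta_term_le:
  assumes "Re s > 0"
  shows "norm (zeta_term n s) \<le> norm s * norm (s - 1) * real (Suc n) powr (- Re s - 1)"
proof -
  define a where "a = real (Suc n)"
  define S where "S = closed_segment (of_real a) (of_real (a + 1) :: complex)"
  define B where "B = norm s * a powr (- Re s - 1)"
  have a: "a > 0" by (simp add: a_def)
  have S: "\<exists>x. z = of_real x \<and> a \<le> x \<and> x \<le> a + 1" if "z \<in> S" for z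
    using that segment_real_bounds[of z a "a + 1"] unfolding S_def by auto
  have aS: "of_real a \<in> S" "of_real (a + 1) \<in> S" "convex S" by (auto simp: S_def)
  have nonneg: "z \<notin> \<real>\<^sub>\<le>\<^sub>0" if "z \<in> S" for z
    using S[OF that] a by (auto simp: complex_nonpos_Reals_iff)
  have dist: "norm (z - of_real a) \<le> 1" if "z \<in> S" for z
  proof -
    obtain x where x: "z = of_real x" "a \<le> x" "x \<le> a + 1" using S[OF \<open>z \<in> S\<close>] by blast
    then have "z - of_real a = of_real (x - a)" by simp
    then show ?thesis using x by (simp only: norm_of_real)
  qed
  have B0: "0 \<le> B" by (simp add: B_def)
  have 1: "norm (z powr (- s) - of_real a powr (- s)) \<le> B" if z: "z \<in> S" for z
  proof -
    have "norm (z powr (- s) - of_real a powr (- s)) \<le> B * norm (z - of_real a)"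
    proof (rule field_differentiable_bound[OF aS(3) _ _ z aS(1)])
      fix w assume w: "w \<in> S"
      show "((\<lambda>z. z powr (- s)) has_field_derivative - s * w powr (- s - 1)) (at w within S)"
        using has_field_derivative_powr[OF nonneg[OF w], of "- s"] by (rule has_field_derivative_at_within)
      obtain x where x: "w = of_real x" "a \<le> x" using S[OF w] by blast
      have "norm (w powr (- s - 1)) = x powr (- Re s - 1)" using x a by (simp add: norm_powr_real_powr)
      also have "\<dots> \<le> a powr (- Re s - 1)" using x a assms by (intro powr_mono2') auto
      finally show "norm (- s * w powr (- s - 1)) \<le> B" by (simp add: norm_mult B_def mult_left_mono)
    qed
    also have "\<dots> \<le> B * 1" using dist[OF z] B0 by (intro mult_left_mono)
    finally show ?thesis by simp
  qed
  define r where "r = (\<lambda>z. z powr (1 - s) - (1 - s) * of_real a powr (- s) * z)"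
  have "norm (r (of_real (a + 1)) - r (of_real a)) \<le> (norm (s - 1) * B) * norm (of_real (a + 1) - of_real a :: complex)"
  proof (rule field_differentiable_bound[OF aS(3) _ _ aS(2) aS(1)])
    fix w assume w: "w \<in> S"
    have "(r has_field_derivative (1 - s) * w powr (1 - s - 1) - (1 - s) * of_real a powr (- s)) (at w)"
      unfolding r_def using nonneg[OF w] by (auto intro!: derivative_eq_intros has_field_derivative_powr)
    moreover have "(1 - s) * w powr (1 - s - 1) - (1 - s) * of_real a powr (- s) = (1 - s) * (w powr (- s) - of_real a powr (- s))"
      by (simp add: right_diff_distrib)
    ultimately show "(r has_field_derivative (1 - s) * (w powr (- s) - of_real a powr (- s))) (at w within S)"
      by (simp only: has_field_derivative_at_within)
    show "norm ((1 - s) * (w powr (- s) - of_real a powr (- s))) \<le> norm (s - 1) * B"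
      unfolding norm_mult norm_minus_commute[of 1] using 1[OF w] by (intro mult_left_mono) auto
  qed
  also have "norm (of_real (a + 1) - of_real a :: complex) = 1" by simp
  also have "r (of_real (a + 1)) - r (of_real a) = zeta_term n s"
  proof -
    have *: "of_real (a + 1) = (of_nat (Suc (Suc n)) :: complex)" "of_real a = (of_nat (Suc n) :: complex)"
      "(of_nat (Suc (Suc n)) :: complex) = of_nat (Suc n) + 1"
      by (simp_all add: a_def)
    have "p - (1 - s) * c * (q + 1) - (p' - (1 - s) * c * q) = (s - 1) * c + p - p'" for p p' c q :: complex
      by (simp add: algebra_simps)
    then show ?thesis unfolding r_def zeta_term_def *(1,2) unfolding *(3) .
  qed
  finally show ?thesis by (simp add: B_def a_def mult_ac)
qed

lemma summable_Suc_powr: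
  assumes "e > 0"
  shows "summable (\<lambda>n. real (Suc n) powr (- e - 1))"
proof -
  have "- e - 1 < - 1" using assms by simp
  then show ?thesis using summable_Suc_iff[of "\<lambda>n. real n powr (- e - 1)"] summable_real_powr_iff[of "- e - 1"] by blast
qed

lemma zeta_term_holomorphic: "zeta_term n holomorphic_on A"
  unfolding zeta_term_def
  by (intro holomorphic_on_diff holomorphic_on_add holomorphic_on_mult holomorphic_on_powr_right
      holomorphic_on_minus holomorphic_on_ident holomorphic_on_const)

lemma zeta_reg_holomorphic: "zeta_reg holomorphic_on {s. Re s > 0}"
proof (rule holomorphic_uniform_sequence)
  show "open {s. Re s > 0}" by (rule open_halfspace_Re_gt)
  show "(\<lambda>s. 1 + (\<Sum>n<N. zeta_term n s)) holomorphic_on {s. Re s > 0}" for N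
    by (intro holomorphic_intros zeta_term_holomorphic)
  fix s0 assume s0: "s0 \<in> {s. Re s > 0}"
  define d where "d = Re s0 / 2"
  have d: "d > 0" using s0 by (simp add: d_def)
  have Re: "Re s \<ge> d" if "s \<in> cball s0 d" for s
  proof -
    have "\<bar>Re (s0 - s)\<bar> \<le> d" using that abs_Re_le_cmod[of "s0 - s"] by (simp add: dist_norm)
    then show ?thesis unfolding d_def minus_complex.simps by linarith
  qed
  define C where "C = norm s0 + d"
  have C: "norm s \<le> C" if "s \<in> cball s0 d" for s
    using that norm_triangle_sub[of s s0] by (simp add: C_def dist_norm norm_minus_commute)
  have "uniform_limit (cball s0 d) (\<lambda>N s. \<Sum>n<N. zeta_term n s) (\<lambda>s. \<Sum>n. zeta_term n s) sequentially"
  proof (rule Weierstrass_m_test)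
    show "summable (\<lambda>n. C * (C + 1) * real (Suc n) powr (- d - 1))"
      by (intro summable_mult summable_Suc_powr d)
    fix n s assume s: "s \<in> cball s0 d"
    have "norm (zeta_term n s) \<le> norm s * norm (s - 1) * real (Suc n) powr (- Re s - 1)"
      using Re[OF s] d by (intro norm_zeta_term_le) auto
    also have "\<dots> \<le> C * (C + 1) * real (Suc n) powr (- d - 1)"
    proof (intro mult_mono)
      show "norm (s - 1) \<le> C + 1" using C[OF s] norm_triangle_ineq4[of s 1] by simp
      show "real (Suc n) powr (- Re s - 1) \<le> real (Suc n) powr (- d - 1)"
        using Re[OF s] by (intro powr_mono) auto
    qed (use C[OF s] norm_ge_zero[of s] in \<open>auto intro!: mult_nonneg_nonneg simp: C_def d less_imp_le\<close>)
    finally show "norm (zeta_term n s) \<le> C * (C + 1) * real (Suc n) powr (- d - 1)" .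
  qed
  then have "uniform_limit (cball s0 d) (\<lambda>N s. 1 + (\<Sum>n<N. zeta_term n s)) zeta_reg sequentially"
    unfolding zeta_reg_def by (intro uniform_limit_intros)
  then show "\<exists>d>0. cball s0 d \<subseteq> {s. Re s > 0} \<and> uniform_limit (cball s0 d) (\<lambda>N s. 1 + (\<Sum>n<N. zeta_term n s)) zeta_reg sequentially"
    using d Re by (intro exI[of _ d]) force
qed

lemma zeta_reg_1: "zeta_reg 1 = 1"
proof -
  have "zeta_term n 1 = 0" for n
    unfolding zeta_term_def using of_nat_neq_0[where ?'a = complex, of n] of_nat_neq_0[where ?'a = complex, of "Suc n"]
    by (simp del: of_nat_Suc)
  then show ?thesis by (simp add: zeta_reg_def)
qed

lemma norm_nat_powr: "norm (of_nat n powr (s :: complex)) = real n powr Re s"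
  by (subst norm_powr_real_powr) simp_all

lemma nat_powr_mult: "of_nat (m * n) powr (s :: complex) = of_nat m powr s * of_nat n powr s"
  unfolding of_nat_mult by (rule powr_times_real) simp_all

lemma summable_nat_powr: "Re s > 1 \<Longrightarrow> summable (\<lambda>n. norm (of_nat n powr (- s) :: complex))"
  unfolding norm_nat_powr using summable_real_powr_iff[of "- Re s"] by simp

lemma zeta_reg_eq:
  assumes "Re s > 1"
  shows "zeta_reg s = (s - 1) * (\<Sum>n. of_nat n powr (- s))"
proof -
  have sm: "summable (\<lambda>n. of_nat n powr (- s))" using summable_nat_powr[OF assms] by (rule summable_norm_cancel)
  have 1: "(\<lambda>n. of_nat (Suc n) powr (- s)) sums (\<Sum>n. of_nat n powr (- s))"
    using sm by (subst sums_Suc_iff) (simp add: summable_sums)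
  have "(\<lambda>n. of_nat (Suc n) powr (1 - s)) \<longlonglongrightarrow> 0"
  proof (rule tendsto_norm_zero_cancel)
    have "(\<lambda>n. real (Suc n) powr (1 - Re s)) \<longlonglongrightarrow> 0"
      using assms by (intro tendsto_neg_powr filterlim_compose[OF filterlim_real_sequentially filterlim_Suc]) auto
    then show "(\<lambda>n. norm (of_nat (Suc n) powr (1 - s))) \<longlonglongrightarrow> 0" unfolding norm_nat_powr by simp
  qed
  from telescope_sums[OF this] have "(\<lambda>n. of_nat (Suc (Suc n)) powr (1 - s) - of_nat (Suc n) powr (1 - s)) sums (- 1)" by simp
  from sums_add[OF sums_mult[OF 1, of "s - 1"] this]
  have "(\<lambda>n. zeta_term n s) sums ((s - 1) * (\<Sum>n. of_nat n powr (- s)) - 1)"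
    by (simp add: zeta_term_def add_diff_eq)
  then show ?thesis by (simp add: zeta_reg_def sums_iff)
qed

section \<open>The Moebius function at multiples of a prime\<close>

lemma squarefree_prime_mult:
  fixes p m :: nat
  assumes "prime p"
  shows "squarefree (p * m) \<longleftrightarrow> \<not> p dvd m \<and> squarefree m"
proof
  assume sq: "squarefree (p * m)"
  have "\<not> p dvd m"
  proof
    assume "p dvd m"
    then have "p ^ 2 dvd p * m" by (simp add: power2_eq_square)
    then have "p dvd 1" using squarefreeD[OF sq] by blast
    then show False using assms by (simp add: prime_nat_iff)
  qed
  moreover have "squarefree m" by (rule squarefree_mono[OF _ sq]) simp
  ultimately show "\<not> p dvd m \<and> squarefree m" ..
next
  assume "\<not> p dvd m \<and> squarefree m"
  then show "squarefree (p * m)"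
    using assms by (intro squarefree_mult_coprime) (auto simp: prime_imp_coprime squarefree_prime)
qed

lemma squarefree_imp_nonzero: "squarefree (n :: nat) \<Longrightarrow> n \<noteq> 0"
  by (rule notI) simp

lemma moebius_mu_prime_mult:
  assumes "prime p"
  shows "moebius_mu (p * m) = (if p dvd m then 0 else - moebius_mu m)"
proof (cases "p dvd m \<or> \<not> squarefree m")
  case True
  then show ?thesis using squarefree_prime_mult[OF assms, of m] by (auto simp: moebius_mu_def)
next
  case False
  then have m: "m \<noteq> 0" using squarefree_imp_nonzero by blast
  have "prime_factors (p * m) = insert p (prime_factors m)"
    using m assms by (subst prime_factors_product) (auto simp: prime_prime_factors)
  moreover have "p \<notin> prime_factors m" using False by (auto simp: in_prime_factors_iff)
  ultimately show ?thesis using False squarefree_prime_mult[OF assms, of m] by (simp add: moebius_mu_def)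
qed

lemma abs_moebius_mu_le: "\<bar>moebius_mu n\<bar> \<le> 1"
  by (simp add: moebius_mu_def power_abs)

lemma norm_moebius_mu_le: "norm (of_int (moebius_mu n) :: complex) \<le> 1"
  using abs_moebius_mu_le[of n] by (simp add: norm_of_int flip: of_int_abs)

section \<open>Absolutely convergent Dirichlet series and finite Euler products\<close>

lemma dirichlet_summable_norm:
  assumes "Re s > 1" "\<And>n. norm (c n :: complex) \<le> 1"
  shows "summable (\<lambda>n. norm (c n * of_nat n powr (- s)))"
proof (rule summable_comparison_test'[OF summable_nat_powr[OF assms(1)]])
  fix n :: nat
  show "norm (norm (c n * of_nat n powr (- s))) \<le> norm (of_nat n powr (- s))"
    using assms(2)[of n] by (simp add: norm_mult mult_left_le_one_le)
qed

lemma dirichlet_summable_on: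
  assumes "Re s > 1" "\<And>n. norm (c n :: complex) \<le> 1"
  shows "(\<lambda>n. c n * of_nat n powr (- s)) summable_on X"
  by (rule summable_on_subset_banach[OF norm_summable_imp_summable_on[OF dirichlet_summable_norm[OF assms]]]) auto

lemma powr_summable_on: "Re s > 1 \<Longrightarrow> (\<lambda>n. of_nat n powr (- s) :: complex) summable_on X"
  using dirichlet_summable_on[of s "\<lambda>_. 1" X] by simp

definition powr_tail :: "real \<Rightarrow> nat \<Rightarrow> real" where
  "powr_tail \<sigma> N = infsum (\<lambda>n. real n powr (- \<sigma>)) {N<..}"

lemma real_powr_summable_on: "\<sigma> > 1 \<Longrightarrow> (\<lambda>n. real n powr (- \<sigma>)) summable_on X"
  by (rule summable_on_subset_banach[where A = UNIV])
    (simp_all add: summable_on_UNIV_nonneg_real_iff summable_real_powr_iff)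

lemma powr_tail_tendsto_0:
  assumes "\<sigma> > 1"
  shows "powr_tail \<sigma> \<longlonglongrightarrow> 0"
proof -
  let ?f = "\<lambda>n. real n powr (- \<sigma>)"
  have split: "powr_tail \<sigma> N = infsum ?f UNIV - (\<Sum>n\<le>N. ?f n)" for N
  proof -
    have "{..N} \<union> {N<..} = UNIV" by auto
    then have "infsum ?f UNIV = infsum ?f {..N} + infsum ?f {N<..}"
      using infsum_Un_disjoint[OF real_powr_summable_on[OF assms] real_powr_summable_on[OF assms], of "{..N}" "{N<..}"] by force
    then show ?thesis by (simp add: powr_tail_def)
  qed
  have "?f sums infsum ?f UNIV"
    by (rule has_sum_imp_sums, rule has_sum_infsum, rule real_powr_summable_on[OF assms])
  then have "(\<lambda>N. \<Sum>n\<le>N. ?f n) \<longlonglongrightarrow> infsum ?f UNIV" by (simp add: sums_def_le)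
  then have "(\<lambda>N. infsum ?f UNIV - (\<Sum>n\<le>N. ?f n)) \<longlonglongrightarrow> infsum ?f UNIV - infsum ?f UNIV" by (intro tendsto_intros)
  then show ?thesis by (simp add: split[abs_def])
qed

lemma dirichlet_tail_bound:
  assumes s: "Re s > 1" and c: "\<And>n. norm (c n :: complex) \<le> 1" and AB: "A \<subseteq> B" "B - A \<subseteq> {N<..}"
  shows "norm (infsum (\<lambda>n. c n * of_nat n powr (- s)) B - infsum (\<lambda>n. c n * of_nat n powr (- s)) A) \<le> powr_tail (Re s) N"
proof -
  let ?f = "\<lambda>n. c n * of_nat n powr (- s)"
  let ?g = "\<lambda>n. real n powr (- Re s)"
  note sf = dirichlet_summable_on[where c = c, OF s c]
  have "infsum ?f B = infsum ?f A + infsum ?f (B - A)"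
    using infsum_Un_disjoint[OF sf sf, of A "B - A"] AB(1) by (simp add: Un_absorb1)
  then have "norm (infsum ?f B - infsum ?f A) = norm (infsum ?f (B - A))" by simp
  also have "\<dots> \<le> infsum ?g (B - A)"
  proof (rule norm_infsum_le[where X = "B - A"])
    show "(?f has_sum infsum ?f (B - A)) (B - A)" by (rule has_sum_infsum[OF sf])
    show "(?g has_sum infsum ?g (B - A)) (B - A)" by (rule has_sum_infsum[OF real_powr_summable_on[OF s]])
    fix n show "norm (c n * of_nat n powr (- s)) \<le> real n powr (- Re s)"
      using c[of n] by (simp add: norm_mult norm_nat_powr mult_left_le_one_le)
  qed
  also have "\<dots> \<le> infsum ?g {N<..}"
    by (rule infsum_mono2) (use AB(2) real_powr_summable_on[OF s] in auto)
  finally show ?thesis by (simp add: powr_tail_def)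
qed

definition sifted :: "nat set \<Rightarrow> nat set" where
  "sifted P = {n. 0 < n \<and> (\<forall>p\<in>P. \<not> p dvd n)}"

lemma infsum_multiples:
  assumes "0 < p"
  shows "infsum (\<lambda>n. of_nat n powr (- s)) ((*) p ` A) = of_nat p powr (- s) * infsum (\<lambda>n. of_nat n powr (- s) :: complex) A"
proof -
  have "infsum (\<lambda>n. of_nat n powr (- s)) ((*) p ` A) = infsum (\<lambda>n. of_nat p powr (- s) * of_nat n powr (- s) :: complex) A"
    using assms by (subst infsum_reindex) (auto simp: inj_on_def o_def nat_powr_mult simp del: of_nat_mult)
  then show ?thesis by (simp add: infsum_cmult_right')
qed

text \<open>Sieve of Eratosthenes: the multiples of a further prime p in \<open>sifted P\<close> are
  p times \<open>sifted P\<close>, since a prime of P divides p m only if it divides m.\<close>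

lemma infsum_sifted:
  assumes "Re s > 1" "finite P" "\<And>p. p \<in> P \<Longrightarrow> prime p"
  shows "infsum (\<lambda>n. of_nat n powr (- s) :: complex) (sifted P) = (\<Prod>p\<in>P. 1 - of_nat p powr (- s)) * infsum (\<lambda>n. of_nat n powr (- s)) {0<..}"
  using assms(2,3)
proof (induction P)
  case empty
  have "sifted {} = {0<..}" by (auto simp: sifted_def)
  then show ?case by simp
next
  case (insert p P)
  let ?f = "\<lambda>n. of_nat n powr (- s) :: complex"
  have p: "prime p" "0 < p" using insert by (auto simp: prime_gt_0_nat)
  have dvdP: "q dvd p * m \<longleftrightarrow> q dvd m" if "q \<in> P" for q m
  proof
    assume "q dvd p * m"
    moreover have "prime q" using insert that by auto
    moreover have "\<not> q dvd p" using insert that p by (metis primes_dvd_imp_eq \<open>prime q\<close>)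
    ultimately show "q dvd m" using prime_dvd_mult_iff by blast
  qed auto
  have split: "sifted P = sifted (insert p P) \<union> (*) p ` sifted P"
  proof (intro equalityI subsetI)
    fix n assume n: "n \<in> sifted P"
    show "n \<in> sifted (insert p P) \<union> (*) p ` sifted P"
    proof (cases "p dvd n")
      case True
      then obtain m where m: "n = p * m" by (elim dvdE)
      then have "m \<in> sifted P" using n dvdP by (auto simp: sifted_def)
      then show ?thesis using m by auto
    qed (use n in \<open>auto simp: sifted_def\<close>)
  qed (use dvdP p in \<open>auto simp: sifted_def\<close>)
  have disj: "sifted (insert p P) \<inter> (*) p ` sifted P = {}" by (auto simp: sifted_def)
  note sm = powr_summable_on[OF assms(1)]
  have "infsum ?f (sifted P) = infsum ?f (sifted (insert p P)) + of_nat p powr (- s) * infsum ?f (sifted P)"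
    using infsum_Un_disjoint[OF sm sm disj] unfolding split[symmetric] infsum_multiples[OF p(2)] .
  then have "infsum ?f (sifted (insert p P)) = (1 - of_nat p powr (- s)) * infsum ?f (sifted P)"
    by (simp add: algebra_simps)
  then show ?case using insert by simp
qed

definition smooth_sqfree :: "nat set \<Rightarrow> nat set" where
  "smooth_sqfree P = {n. squarefree n \<and> prime_factors n \<subseteq> P}"

text \<open>A further prime p adds to each m the number p m with the opposite Moebius value, which
  multiplies the sum by 1 - p^(-s).\<close>

lemma sum_smooth_sqfree:
  assumes "finite P" "\<And>p. p \<in> P \<Longrightarrow> prime p"
  shows "finite (smooth_sqfree P) \<and>
    (\<Sum>n\<in>smooth_sqfree P. of_int (moebius_mu n) * of_nat n powr (- s)) = (\<Prod>p\<in>P. 1 - of_nat p powr (- s) :: complex)"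
  using assms
proof (induction P)
  case empty
  have "smooth_sqfree {} = {1}"
  proof -
    have one: "n = 1" if "squarefree n" "prime_factors n = {}" for n :: nat
    proof (rule ccontr)
      assume "n \<noteq> 1"
      then obtain p where "prime p" "p dvd n" using prime_factor_nat by blast
      then have "p \<in> prime_factors n" using squarefree_imp_nonzero[OF that(1)] by (simp add: in_prime_factors_iff)
      then show False using that(2) by simp
    qed
    show ?thesis
    proof (intro equalityI subsetI)
      fix n assume "n \<in> smooth_sqfree {}"
      then have "squarefree n" "prime_factors n = {}" unfolding smooth_sqfree_def by blast+
      then show "n \<in> {1}" using one by blast
    next
      show "n \<in> smooth_sqfree {}" if "n \<in> {1}" for n using that by (simp add: smooth_sqfree_def)
    qed
  qed
  then show ?case by (simp add: moebius_mu_def)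
next
  case (insert p P)
  let ?f = "\<lambda>n. of_int (moebius_mu n) * of_nat n powr (- s) :: complex"
  have p: "prime p" "0 < p" using insert by (auto simp: prime_gt_0_nat)
  have IH: "finite (smooth_sqfree P)" "(\<Sum>n\<in>smooth_sqfree P. ?f n) = (\<Prod>p\<in>P. 1 - of_nat p powr (- s))"
    using insert by auto
  have ndvd: "\<not> p dvd m" if "m \<in> smooth_sqfree P" for m
  proof
    assume "p dvd m"
    then have "p \<in> prime_factors m" using that p squarefree_imp_nonzero[of m] by (auto simp: smooth_sqfree_def in_prime_factors_iff)
    then show False using that insert(2) by (auto simp: smooth_sqfree_def)
  qed
  have pf: "prime_factors (p * m) = insert p (prime_factors m)" if "m \<noteq> 0" for m
    using that p by (subst prime_factors_product) (auto simp: prime_prime_factors)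
  have split: "smooth_sqfree (insert p P) = smooth_sqfree P \<union> (*) p ` smooth_sqfree P"
  proof (intro equalityI subsetI)
    fix n assume n: "n \<in> smooth_sqfree (insert p P)"
    show "n \<in> smooth_sqfree P \<union> (*) p ` smooth_sqfree P"
    proof (cases "p dvd n")
      case True
      then obtain m where m: "n = p * m" by (elim dvdE)
      have sq: "\<not> p dvd m" "squarefree m" using n squarefree_prime_mult[OF p(1), of m] by (auto simp: smooth_sqfree_def m)
      have "m \<noteq> 0" using squarefree_imp_nonzero[OF sq(2)] .
      then have "prime_factors m \<subseteq> P" using n pf sq by (auto simp: smooth_sqfree_def m in_prime_factors_iff)
      then show ?thesis using m sq by (auto simp: smooth_sqfree_def)
    qed (use n in \<open>auto simp: smooth_sqfree_def in_prime_factors_iff\<close>)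
  next
    fix n assume "n \<in> smooth_sqfree P \<union> (*) p ` smooth_sqfree P"
    then show "n \<in> smooth_sqfree (insert p P)"
    proof
      assume "n \<in> (*) p ` smooth_sqfree P"
      then obtain m where m: "n = p * m" "m \<in> smooth_sqfree P" by auto
      then have "m \<noteq> 0" using squarefree_imp_nonzero by (auto simp: smooth_sqfree_def)
      then show ?thesis using m ndvd[OF m(2)] pf squarefree_prime_mult[OF p(1), of m] by (auto simp: smooth_sqfree_def)
    qed (auto simp: smooth_sqfree_def)
  qed
  have disj: "smooth_sqfree P \<inter> (*) p ` smooth_sqfree P = {}" using ndvd by (metis IntE dvd_triv_left equals0I imageE)
  have eq: "(\<Sum>n\<in>(*) p ` smooth_sqfree P. ?f n) = (\<Sum>m\<in>smooth_sqfree P. - (of_nat p powr (- s)) * ?f m)"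
  proof (subst sum.reindex)
    show "inj_on ((*) p) (smooth_sqfree P)" using p by (auto simp: inj_on_def)
    show "sum (?f \<circ> (*) p) (smooth_sqfree P) = (\<Sum>m\<in>smooth_sqfree P. - (of_nat p powr (- s)) * ?f m)"
      by (rule sum.cong) (auto simp: moebius_mu_prime_mult[OF p(1)] ndvd nat_powr_mult simp del: of_nat_mult)
  qed
  have "(\<Sum>n\<in>smooth_sqfree (insert p P). ?f n) = (1 - of_nat p powr (- s)) * (\<Sum>n\<in>smooth_sqfree P. ?f n)"
  proof -
    have "(\<Sum>m\<in>smooth_sqfree P. - (of_nat p powr (- s)) * ?f m) = - (of_nat p powr (- s)) * (\<Sum>n\<in>smooth_sqfree P. ?f n)"
      by (rule sum_distrib_left[symmetric])
    moreover have "(\<Sum>n\<in>smooth_sqfree (insert p P). ?f n) = (\<Sum>n\<in>smooth_sqfree P. ?f n) + (\<Sum>n\<in>(*) p ` smooth_sqfree P. ?f n)"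
      unfolding split using IH(1) disj by (intro sum.union_disjoint) auto
    ultimately show ?thesis using eq by (simp add: left_diff_distrib)
  qed
  then show ?case using IH insert(1,2) split by simp
qed

definition primes_le :: "nat \<Rightarrow> nat set" where
  "primes_le N = {p. prime p \<and> p \<le> N}"

lemma finite_primes_le [simp]: "finite (primes_le N)"
  by (rule finite_subset[of _ "{..N}"]) (auto simp: primes_le_def)

lemma prime_primes_le: "p \<in> primes_le N \<Longrightarrow> prime p"
  by (simp add: primes_le_def)

definition euler_prod :: "nat \<Rightarrow> complex \<Rightarrow> complex" where
  "euler_prod N s = (\<Prod>p\<in>primes_le N. 1 - of_nat p powr (- s))"

definition mu_series :: "complex \<Rightarrow> complex" where
  "mu_series s = (\<Sum>n. of_int (moebius_mu n) * of_nat n powr (- s))"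

lemma mu_series_eq_infsum:
  assumes "Re s > 1"
  shows "mu_series s = infsum (\<lambda>n. of_int (moebius_mu n) * of_nat n powr (- s)) UNIV"
  unfolding mu_series_def
  using has_sum_imp_sums[OF has_sum_infsum[OF dirichlet_summable_on[where c = "\<lambda>n. of_int (moebius_mu n)", OF assms norm_moebius_mu_le]]]
  by (simp add: sums_iff)

text \<open>A squarefree n \<le> N has all its prime factors up to N, so the expanded product
  contains every nonzero term up to N and differs from the series only in the tail.\<close>

lemma euler_prod_tendsto:
  assumes "Re s > 1"
  shows "(\<lambda>N. euler_prod N s) \<longlonglongrightarrow> mu_series s"
proof -
  have "norm (mu_series s - euler_prod N s) \<le> powr_tail (Re s) N" for N
  proof -
    let ?D = "smooth_sqfree (primes_le N)"
    let ?f = "\<lambda>n. of_int (moebius_mu n) * of_nat n powr (- s) :: complex"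
    have D: "finite ?D" "(\<Sum>n\<in>?D. ?f n) = euler_prod N s"
      using sum_smooth_sqfree[of "primes_le N" s, OF finite_primes_le prime_primes_le[of _ N]] unfolding euler_prod_def by blast+
    let ?B = "?D \<union> {N<..}"
    have z: "?f n = 0" if "n \<notin> ?B" for n
    proof -
      have "n \<le> N" using that by auto
      have "\<not> squarefree n"
      proof
        assume sq: "squarefree n"
        have "prime_factors n \<subseteq> primes_le N"
        proof
          fix q assume "q \<in> prime_factors n"
          then have "prime q" "q dvd n" "n \<noteq> 0" by (auto simp: in_prime_factors_iff)
          then have "q \<le> n" by (intro dvd_imp_le) auto
          then show "q \<in> primes_le N" using \<open>prime q\<close> \<open>n \<le> N\<close> by (simp add: primes_le_def)
        qed
        then show False using sq that by (simp add: smooth_sqfree_def)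
      qed
      then show ?thesis by (simp add: moebius_mu_def)
    qed
    have "mu_series s = infsum ?f ?B"
      unfolding mu_series_eq_infsum[OF assms] by (rule infsum_cong_neutral) (use z in auto)
    then show ?thesis
      using dirichlet_tail_bound[where c = "\<lambda>n. of_int (moebius_mu n)" and A = ?D and B = ?B and N = N, OF assms norm_moebius_mu_le] D
      by auto
  qed
  then have "(\<lambda>N. mu_series s - euler_prod N s) \<longlonglongrightarrow> 0"
    by (intro Lim_null_comparison[OF _ powr_tail_tendsto_0[OF assms]]) auto
  from tendsto_diff[OF tendsto_const[of "mu_series s"] this] show ?thesis by simp
qed

text \<open>Sifting by the primes up to N leaves only 1 and numbers above N.\<close>

lemma euler_prod_zeta_tendsto:
  assumes "Re s > 1"
  shows "(\<lambda>N. euler_prod N s * (\<Sum>n. of_nat n powr (- s))) \<longlonglongrightarrow> 1"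
proof -
  let ?f = "\<lambda>n. of_nat n powr (- s) :: complex"
  have zs: "(\<Sum>n. ?f n) = infsum ?f {0<..}"
  proof -
    have "infsum ?f {0<..} = infsum ?f UNIV" by (rule infsum_cong_neutral) auto
    then show ?thesis using has_sum_imp_sums[OF has_sum_infsum[OF powr_summable_on[OF assms]]] by (simp add: sums_iff)
  qed
  have "norm (euler_prod N s * (\<Sum>n. ?f n) - 1) \<le> powr_tail (Re s) N" for N
  proof -
    have eq: "euler_prod N s * (\<Sum>n. ?f n) = infsum ?f (sifted (primes_le N))"
      unfolding zs euler_prod_def by (rule infsum_sifted[OF assms finite_primes_le prime_primes_le, symmetric])
    have sub: "{1} \<subseteq> sifted (primes_le N)" by (auto simp: sifted_def primes_le_def)
    have "sifted (primes_le N) - {1} \<subseteq> {N<..}"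
    proof
      fix n assume n: "n \<in> sifted (primes_le N) - {1}"
      then obtain p where p: "prime p" "p dvd n" using prime_factor_nat[of n] by auto
      then have "p \<le> n" "\<not> p \<le> N" using n by (auto simp: sifted_def primes_le_def dest: dvd_imp_le)
      then show "n \<in> {N<..}" by simp
    qed
    from dirichlet_tail_bound[where c = "\<lambda>_. 1", OF assms _ sub this] show ?thesis by (simp add: eq)
  qed
  then have "(\<lambda>N. euler_prod N s * (\<Sum>n. ?f n) - 1) \<longlonglongrightarrow> 0"
    by (intro Lim_null_comparison[OF _ powr_tail_tendsto_0[OF assms]]) auto
  from tendsto_add[OF this tendsto_const[of 1]] show ?thesis by simp
qed

text \<open>The finite Euler products tend to \<open>mu_series s\<close>, and multiplied by the zeta
  series they tend to 1; uniqueness of limits makes the two series inverse to each other.\<close>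

lemma zeta_reg_nonzero_mu_series:
  assumes "Re s > 1"
  shows "zeta_reg s \<noteq> 0" "mu_series s = (s - 1) / zeta_reg s"
proof -
  have "(\<lambda>N. euler_prod N s * (\<Sum>n. of_nat n powr (- s))) \<longlonglongrightarrow> mu_series s * (\<Sum>n. of_nat n powr (- s))"
    by (intro tendsto_intros euler_prod_tendsto assms)
  then have "mu_series s * (\<Sum>n. of_nat n powr (- s)) = 1"
    using euler_prod_zeta_tendsto[OF assms] LIMSEQ_unique by blast
  then have "mu_series s * zeta_reg s = s - 1"
    unfolding zeta_reg_eq[OF assms] by (simp add: algebra_simps)
  moreover have "s \<noteq> 1" using assms by auto
  ultimately show "zeta_reg s \<noteq> 0" by auto
  with \<open>mu_series s * zeta_reg s = s - 1\<close> show "mu_series s = (s - 1) / zeta_reg s" by (simp add: eq_divide_eq)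
qed

section \<open>The line of abscissa one\<close>

lemma Re_Ln_one_minus_sums:
  fixes v :: complex
  assumes "0 \<le> r" "r < 1" "norm v = 1"
  shows "(\<lambda>n. - (r ^ n * Re (v ^ n) / real n)) sums ln (norm (1 - of_real r * v))" "1 - of_real r * v \<noteq> 0"
proof -
  have n: "norm (- (of_real r * v)) < 1" using assms by (simp add: norm_mult)
  show nz: "1 - of_real r * v \<noteq> 0"
  proof
    assume "1 - of_real r * v = 0"
    then have "norm (of_real r * v) = 1" by (metis eq_iff_diff_eq_0 norm_one)
    then show False using n by simp
  qed
  have "(\<lambda>n. Re (- ((- (- (of_real r * v))) ^ n) / of_nat n)) sums Re (ln (1 + - (of_real r * v)))"
    by (rule sums_Re[OF Ln_series'[OF n]])
  moreover have "(\<lambda>n. Re (- ((- (- (of_real r * v))) ^ n) / of_nat n)) = (\<lambda>n. - (r ^ n * Re (v ^ n) / real n))"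
  proof
    fix n :: nat
    have eq: "- ((- (- (of_real r * v))) ^ n) / of_nat n = of_real (- (r ^ n / real n)) * v ^ n"
      by (simp add: power_mult_distrib)
    have "Re (of_real x * y) = x * Re y" for x and y :: complex by simp
    with eq show "Re (- ((- (- (of_real r * v))) ^ n) / of_nat n) = - (r ^ n * Re (v ^ n) / real n)"
      by (metis minus_mult_left times_divide_eq_left)
  qed
  moreover have "Re (ln (1 + - (of_real r * v))) = ln (norm (1 - of_real r * v))"
    using nz by (simp add: Re_Ln)
  ultimately show "(\<lambda>n. - (r ^ n * Re (v ^ n) / real n)) sums ln (norm (1 - of_real r * v))" by (simp only:)
qed

text \<open>In the power series of the logarithms the n-th terms combine to - r^n / n times 3 + 4 Re
  (w^n) + Re (w^(2n)), and this last factor is 2 (Re (w^n) + 1)^2 because w^n lies on the unit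
  circle.\<close>

lemma mertens_inequality:
  fixes w :: complex
  assumes r: "0 \<le> r" "r < 1" and w: "norm w = 1"
  shows "norm (1 - of_real r :: complex) ^ 3 * norm (1 - of_real r * w) ^ 4 * norm (1 - of_real r * w\<^sup>2) \<le> 1"
proof -
  let ?a = "norm (1 - of_real r * (1 :: complex))" and ?b = "norm (1 - of_real r * w)" and ?c = "norm (1 - of_real r * w\<^sup>2)"
  have w2: "norm (w\<^sup>2) = 1" using w by (simp add: norm_power)
  note A = Re_Ln_one_minus_sums[OF r, of 1] and B = Re_Ln_one_minus_sums[OF r w] and C = Re_Ln_one_minus_sums[OF r w2]
  have sum: "(\<lambda>n. 3 * - (r ^ n * Re (1 ^ n) / real n) + 4 * - (r ^ n * Re (w ^ n) / real n) + - (r ^ n * Re ((w\<^sup>2) ^ n) / real n))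
      sums (3 * ln ?a + 4 * ln ?b + ln ?c)"
    using A(1) B(1) C(1) by (intro sums_add sums_mult) auto
  have le: "3 * - (r ^ n * Re (1 ^ n) / real n) + 4 * - (r ^ n * Re (w ^ n) / real n) + - (r ^ n * Re ((w\<^sup>2) ^ n) / real n) \<le> 0" for n
  proof -
    have "norm (w ^ n) = 1" using w by (simp add: norm_power)
    then have nn: "(Re (w ^ n))\<^sup>2 + (Im (w ^ n))\<^sup>2 = 1" by (metis cmod_power2 one_power2)
    have "(w\<^sup>2) ^ n = (w ^ n)\<^sup>2" by (simp add: power_mult[symmetric] mult.commute)
    then have "Re ((w\<^sup>2) ^ n) = 2 * (Re (w ^ n))\<^sup>2 - 1" using nn by (simp add: Re_power2)
    then have "3 + 4 * Re (w ^ n) + Re ((w\<^sup>2) ^ n) = 2 * (Re (w ^ n) + 1)\<^sup>2" by (simp add: power2_eq_square algebra_simps)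
    then have "0 \<le> (r ^ n / real n) * (3 + 4 * Re (w ^ n) + Re ((w\<^sup>2) ^ n))" using r by simp
    then show ?thesis by (simp add: algebra_simps add_divide_distrib)
  qed
  have "3 * ln ?a + 4 * ln ?b + ln ?c \<le> 0"
    by (rule sums_le[OF le sum sums_zero])
  moreover have pos: "?a > 0" "?b > 0" "?c > 0" using A(2) B(2) C(2) by auto
  moreover have "ln (?a ^ 3 * ?b ^ 4 * ?c) = 3 * ln ?a + 4 * ln ?b + ln ?c"
    using pos by (simp add: ln_mult ln_realpow)
  ultimately have "?a ^ 3 * ?b ^ 4 * ?c \<le> 1" by (metis ln_le_zero_iff mult_pos_pos zero_less_power)
  then show ?thesis by simp
qed

lemma euler_prod_mertens:
  assumes "\<sigma> > 1"
  shows "norm (euler_prod N (of_real \<sigma>)) ^ 3 * norm (euler_prod N (of_real \<sigma> + \<i> * of_real t)) ^ 4 *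
    norm (euler_prod N (of_real \<sigma> + 2 * \<i> * of_real t)) \<le> 1"
proof -
  let ?F = "\<lambda>s p. 1 - of_nat p powr (- s) :: complex"
  have "norm (?F (of_real \<sigma>) p) ^ 3 * norm (?F (of_real \<sigma> + \<i> * of_real t) p) ^ 4 * norm (?F (of_real \<sigma> + 2 * \<i> * of_real t) p) \<le> 1"
    if p: "p \<in> primes_le N" for p
  proof -
    have p2: "p \<ge> 2" using prime_primes_le[OF p] by (simp add: prime_ge_2_nat)
    then have p0: "of_nat p \<noteq> (0 :: complex)" by simp
    define r where "r = real p powr (- \<sigma>)"
    define w where "w = (of_nat p :: complex) powr (- (\<i> * of_real t))"
    have "norm w = 1" using p2 by (simp add: w_def norm_nat_powr)
    moreover have "0 \<le> r" "r < 1" using p2 assms by (auto simp: r_def powr_less_one)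
    ultimately have m: "norm (1 - of_real r :: complex) ^ 3 * norm (1 - of_real r * w) ^ 4 * norm (1 - of_real r * w\<^sup>2) \<le> 1"
      by (intro mertens_inequality)
    have 1: "of_nat p powr (- of_real \<sigma>) = (of_real r :: complex)"
      using powr_of_real[of "real p" "- \<sigma>"] by (simp add: r_def)
    have 2: "of_nat p powr (- (of_real \<sigma> + \<i> * of_real t)) = of_real r * w"
      unfolding 1[symmetric] w_def using p0 by (simp add: powr_add[symmetric])
    have "of_nat p powr (- (of_real \<sigma> + 2 * \<i> * of_real t)) = of_nat p powr (- of_real \<sigma>) * (of_nat p powr (- (\<i> * of_real t)) * of_nat p powr (- (\<i> * of_real t)))"
      using p0 by (simp add: powr_add[symmetric] algebra_simps)
    then have 3: "of_nat p powr (- (of_real \<sigma> + 2 * \<i> * of_real t)) = of_real r * w\<^sup>2"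
      unfolding 1 w_def power2_eq_square .
    show ?thesis using m unfolding 1 2 3 .
  qed
  then have "(\<Prod>p\<in>primes_le N. norm (?F (of_real \<sigma>) p) ^ 3 * norm (?F (of_real \<sigma> + \<i> * of_real t) p) ^ 4 * norm (?F (of_real \<sigma> + 2 * \<i> * of_real t) p)) \<le> 1"
    by (intro prod_le_1) auto
  then show ?thesis
    by (simp only: euler_prod_def prod_norm[symmetric] prod_power_distrib prod.distrib)
qed

lemma mu_series_mertens:
  assumes "\<sigma> > 1"
  shows "norm (mu_series (of_real \<sigma>)) ^ 3 * norm (mu_series (of_real \<sigma> + \<i> * of_real t)) ^ 4 *
    norm (mu_series (of_real \<sigma> + 2 * \<i> * of_real t)) \<le> 1"
proof (rule tendsto_upperbound)
  show "(\<lambda>N. norm (euler_prod N (of_real \<sigma>)) ^ 3 * norm (euler_prod N (of_real \<sigma> + \<i> * of_real t)) ^ 4 *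
    norm (euler_prod N (of_real \<sigma> + 2 * \<i> * of_real t))) \<longlonglongrightarrow>
    norm (mu_series (of_real \<sigma>)) ^ 3 * norm (mu_series (of_real \<sigma> + \<i> * of_real t)) ^ 4 *
    norm (mu_series (of_real \<sigma> + 2 * \<i> * of_real t))"
    using assms by (intro tendsto_intros euler_prod_tendsto) auto
qed (use euler_prod_mertens[OF assms] in auto)

text \<open>At 1 + x the factor s - 1 puts x^3 into the inequality for \<open>mu_series\<close>,
  while a zero at 1 + i t would put a factor x^4 on the other side. After division by x^3 the
  right-hand side keeps one factor x and tends to 0, but the left-hand side tends to 2
  |t|^5.\<close>

lemma zeta_reg_nonzero_line:
  assumes "t \<noteq> 0"
  shows "zeta_reg (1 + \<i> * of_real t) \<noteq> 0"
proof
  let ?s = "1 + \<i> * of_real t"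
  assume zero: "zeta_reg ?s = 0"
  have op: "open {s. Re s > 0}" by (rule open_halfspace_Re_gt)
  have cont: "isCont zeta_reg s" if "Re s > 0" for s
    by (rule field_differentiable_imp_continuous_at[OF holomorphic_on_imp_differentiable_at[OF zeta_reg_holomorphic op]]) (use that in simp)
  have "zeta_reg field_differentiable (at ?s)"
    using zeta_reg_holomorphic op by (simp add: holomorphic_on_imp_differentiable_at)
  then obtain D where D: "(zeta_reg has_field_derivative D) (at ?s)" by (auto simp: field_differentiable_def)
  have lim0: "filterlim (\<lambda>x::real. complex_of_real x) (at 0) (at_right 0)"
    unfolding filterlim_at by (auto simp: eventually_at_right_less intro!: tendsto_eq_intros eventually_at_rightI[of 0 1])
  have quot: "((\<lambda>x. zeta_reg (?s + of_real x) / of_real x) \<longlongrightarrow> D) (at_right 0)"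
    using filterlim_compose[OF D[unfolded DERIV_def zero] lim0] by simp
  have l0: "((\<lambda>x::real. complex_of_real x) \<longlongrightarrow> 0) (at_right 0)"
    using lim0 by (simp add: filterlim_at)
  have c: "((\<lambda>x. zeta_reg (s + of_real x)) \<longlongrightarrow> zeta_reg s) (at_right 0)" if "Re s > 0" for s
  proof -
    have "((\<lambda>x. s + complex_of_real x) \<longlongrightarrow> s + 0) (at_right 0)" by (intro tendsto_intros l0)
    then show ?thesis using isCont_tendsto_compose[OF cont[OF that]] by simp
  qed
  let ?l = "\<lambda>x::real. norm (of_real x + \<i> * of_real t) ^ 4 * norm (of_real x + 2 * \<i> * of_real t :: complex)"
  let ?r = "\<lambda>x::real. norm (zeta_reg (1 + of_real x)) ^ 3 * (norm (zeta_reg (?s + of_real x) / of_real x) ^ 4 * norm (complex_of_real x)) *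
      norm (zeta_reg (1 + 2 * \<i> * of_real t + of_real x))"
  have ineq: "?l x \<le> ?r x" if x: "x > 0" for x
  proof -
    let ?a = "zeta_reg (1 + of_real x)" and ?b = "zeta_reg (?s + of_real x)" and ?c = "zeta_reg (1 + 2 * \<i> * of_real t + of_real x)"
    have mu: "mu_series (s + of_real (1 + x)) = (s + of_real x) / zeta_reg (1 + s + of_real x)" "zeta_reg (1 + s + of_real x) \<noteq> 0"
      if "Re s = 0" for s
      using zeta_reg_nonzero_mu_series[of "s + of_real (1 + x)"] x that by (simp_all add: algebra_simps)
    have m0: "mu_series (of_real (1 + x)) = of_real x / ?a" "?a \<noteq> 0" using mu[of 0] by simp_all
    have m1: "mu_series (of_real (1 + x) + \<i> * of_real t) = (of_real x + \<i> * of_real t) / ?b" "?b \<noteq> 0"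
      using mu[of "\<i> * of_real t"] by (simp_all add: algebra_simps)
    have m2: "mu_series (of_real (1 + x) + 2 * \<i> * of_real t) = (of_real x + 2 * \<i> * of_real t) / ?c" "?c \<noteq> 0"
      using mu[of "2 * \<i> * of_real t"] by (simp_all add: algebra_simps)
    have "norm (of_real x / ?a) ^ 3 * norm ((of_real x + \<i> * of_real t) / ?b) ^ 4 * norm ((of_real x + 2 * \<i> * of_real t) / ?c) \<le> 1"
      using mu_series_mertens[of "1 + x" t] x unfolding m0(1) m1(1) m2(1) by simp
    then have "x ^ 3 * ?l x \<le> norm ?a ^ 3 * norm ?b ^ 4 * norm ?c"
      using m0(2) m1(2) m2(2) x by (simp add: norm_divide power_divide divide_simps mult_ac)
    also have "\<dots> = x ^ 3 * ?r x"
    proof -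
      have "x ^ 3 * (norm (?b / of_real x) ^ 4 * norm (complex_of_real x)) = norm ?b ^ 4"
        using x by (simp add: norm_divide power_divide power3_eq_cube power4_eq_xxxx)
      then show ?thesis by (simp add: mult_ac)
    qed
    finally show ?thesis using x by simp
  qed
  have "(?r \<longlongrightarrow> norm (zeta_reg 1) ^ 3 * (norm D ^ 4 * norm (0 :: complex)) * norm (zeta_reg (1 + 2 * \<i> * of_real t))) (at_right 0)"
    by (intro tendsto_intros c quot l0) auto
  moreover have "(?l \<longlongrightarrow> norm (0 + \<i> * of_real t :: complex) ^ 4 * norm (0 + 2 * \<i> * of_real t :: complex)) (at_right 0)"
    by (intro tendsto_intros l0)
  moreover have "\<forall>\<^sub>F x in at_right 0. ?l x \<le> ?r x"
    using ineq by (auto simp: eventually_at_filter)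
  ultimately have "norm (0 + \<i> * of_real t :: complex) ^ 4 * norm (0 + 2 * \<i> * of_real t :: complex) \<le>
      norm (zeta_reg 1) ^ 3 * (norm D ^ 4 * norm (0 :: complex)) * norm (zeta_reg (1 + 2 * \<i> * of_real t))"
    by (intro tendsto_le[of "at_right 0"]) auto
  then have "\<bar>t\<bar> ^ 4 * (2 * \<bar>t\<bar>) \<le> 0" by (simp add: norm_mult)
  moreover have "\<bar>t\<bar> ^ 4 * (2 * \<bar>t\<bar>) > 0" using assms by (intro mult_pos_pos zero_less_power) auto
  ultimately show False by simp
qed

lemma zeta_reg_nonzero:
  assumes "Re s \<ge> 1"
  shows "zeta_reg s \<noteq> 0"
proof (cases "Re s > 1")
  case True
  then show ?thesis by (rule zeta_reg_nonzero_mu_series)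
next
  case False
  then have s: "s = 1 + \<i> * of_real (Im s)" using assms by (simp add: complex_eq_iff)
  show ?thesis
  proof (cases "Im s = 0")
    case True
    then have "s = 1" using s by simp
    then show ?thesis by (simp add: zeta_reg_1)
  next
    case False
    then show ?thesis by (subst s) (rule zeta_reg_nonzero_line)
  qed
qed

section \<open>Newman's contour\<close>

lemma powr_mean_value:
  fixes a e :: real
  assumes "0 < a"
  obtains \<xi> where "a < \<xi>" "\<xi> < a + 1" "(a + 1) powr e - a powr e = e * \<xi> powr (e - 1)"
proof -
  have "\<exists>\<xi>>a. \<xi> < a + 1 \<and> (a + 1) powr e - a powr e = (a + 1 - a) * (e * \<xi> powr (e - 1))"
    using assms by (intro MVT2) (auto intro!: derivative_eq_intros)
  then show thesis using that by auto
qed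

lemma powr_tail_le:
  assumes x: "x > 0" and N: "N \<ge> 1"
  shows "powr_tail (1 + x) N \<le> real N powr (- x) / x"
  unfolding powr_tail_def
proof (rule infsum_le_finite_sums)
  show "(\<lambda>n. real n powr (- (1 + x))) summable_on {N<..}" using x by (intro real_powr_summable_on) simp
  have part: "(\<Sum>n\<in>{N<..M}. real n powr (- (1 + x))) \<le> (real N powr (- x) - real M powr (- x)) / x" if "M \<ge> N" for M
    using that
  proof (induction M rule: dec_induct)
    case (step M)
    have M: "0 < real M" using step N by simp
    obtain \<xi> where \<xi>: "real M < \<xi>" "\<xi> < real M + 1" "(real M + 1) powr (- x) - real M powr (- x) = - x * \<xi> powr (- x - 1)"
      using powr_mean_value[OF M] by blast
    have "real (Suc M) powr (- x - 1) \<le> \<xi> powr (- x - 1)" using \<xi> M x by (intro powr_mono2') auto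
    then have "x * real (Suc M) powr (- x - 1) \<le> x * \<xi> powr (- x - 1)" using x by (intro mult_left_mono) auto
    moreover have "real (Suc M) powr (- x) - real M powr (- x) = - x * \<xi> powr (- x - 1)"
      using \<xi>(3) by (simp add: add.commute)
    ultimately have "x * real (Suc M) powr (- x - 1) \<le> real M powr (- x) - real (Suc M) powr (- x)" by linarith
    moreover have "- (1 + x) = - x - 1" by simp
    ultimately have "real (Suc M) powr (- (1 + x)) \<le> (real M powr (- x) - real (Suc M) powr (- x)) / x"
      using x by (simp only: pos_le_divide_eq mult.commute)
    moreover have "{N<..Suc M} = insert (Suc M) {N<..M}" using step by auto
    ultimately show ?case using step.IH by (simp add: diff_divide_distrib)
  qed simp
  fix F assume F: "finite F" "F \<subseteq> {N<..}"
  define M where "M = Max (insert N F)"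
  have M: "N \<le> M" "F \<subseteq> {N<..M}" using F by (auto simp: M_def)
  have "(\<Sum>n\<in>F. real n powr (- (1 + x))) \<le> (\<Sum>n\<in>{N<..M}. real n powr (- (1 + x)))"
    using M(2) by (intro sum_mono2) auto
  also have "\<dots> \<le> (real N powr (- x) - real M powr (- x)) / x" by (rule part[OF M(1)])
  also have "\<dots> \<le> real N powr (- x) / x" using x by (intro divide_right_mono) auto
  finally show "(\<Sum>n\<in>F. real n powr (- (1 + x))) \<le> real N powr (- x) / x" .
qed

text \<open>Comparison with an integral through the mean value theorem on [M, M + 1]. For y > 1 the
  summands increase, so each is compared with the interval to its right and the last one remains as
  the extra term.\<close>

lemma sum_powr_le:
  assumes y: "y > 0" and N: "N \<ge> 1"
  shows "(\<Sum>n\<in>{1..N}. real n powr (y - 1)) \<le> real N powr (y - 1) + real N powr y / y"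
proof (cases "y \<le> 1")
  case True
  have "(\<Sum>n\<in>{1..N}. real n powr (y - 1)) \<le> real N powr y / y" using N
  proof (induction N rule: dec_induct)
    case base
    then show ?case using y True by simp
  next
    case (step M)
    have M: "0 < real M" using step by simp
    obtain \<xi> where \<xi>: "real M < \<xi>" "\<xi> < real M + 1" "(real M + 1) powr y - real M powr y = y * \<xi> powr (y - 1)"
      using powr_mean_value[OF M] by blast
    have "real (Suc M) powr (y - 1) \<le> \<xi> powr (y - 1)" using \<xi> M True by (intro powr_mono2') auto
    then have "y * real (Suc M) powr (y - 1) \<le> y * \<xi> powr (y - 1)" using y by (intro mult_left_mono) auto
    moreover have "real (Suc M) powr y - real M powr y = y * \<xi> powr (y - 1)" using \<xi>(3) by (simp add: add.commute)
    ultimately have "y * real (Suc M) powr (y - 1) \<le> real (Suc M) powr y - real M powr y" by linarith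
    then have "real (Suc M) powr (y - 1) \<le> real (Suc M) powr y / y - real M powr y / y"
      using y by (simp only: diff_divide_distrib[symmetric] pos_le_divide_eq mult.commute)
    then show ?case using step.IH by simp
  qed
  then show ?thesis by (simp add: add_increasing)
next
  case False
  show ?thesis using N
  proof (induction N rule: dec_induct)
    case base
    then show ?case using y by simp
  next
    case (step M)
    have M: "0 < real M" using step by simp
    obtain \<xi> where \<xi>: "real M < \<xi>" "\<xi> < real M + 1" "(real M + 1) powr y - real M powr y = y * \<xi> powr (y - 1)"
      using powr_mean_value[OF M] by blast
    have "real M powr (y - 1) \<le> \<xi> powr (y - 1)" using \<xi> M False by (intro powr_mono2) auto
    then have "y * real M powr (y - 1) \<le> y * \<xi> powr (y - 1)" using y by (intro mult_left_mono) auto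
    moreover have "real (Suc M) powr y - real M powr y = y * \<xi> powr (y - 1)" using \<xi>(3) by (simp add: add.commute)
    ultimately have "y * real M powr (y - 1) \<le> real (Suc M) powr y - real M powr y" by linarith
    then have "real M powr (y - 1) \<le> real (Suc M) powr y / y - real M powr y / y"
      using y by (simp only: diff_divide_distrib[symmetric] pos_le_divide_eq mult.commute)
    then show ?case using step.IH by simp
  qed
qed

definition mu_sum :: "nat \<Rightarrow> complex \<Rightarrow> complex" where
  "mu_sum N z = (\<Sum>n\<in>{1..N}. of_int (moebius_mu n) * of_nat n powr (- (1 + z)))"

lemma mu_sum_tail:
  assumes "Re z > 0" "N \<ge> 1"
  shows "norm (mu_series (1 + z) - mu_sum N z) \<le> real N powr (- Re z) / Re z"
proof -
  let ?c = "\<lambda>n. of_int (moebius_mu n) :: complex"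
  have r: "Re (1 + z) > 1" using assms by simp
  have "infsum (\<lambda>n. ?c n * of_nat n powr (- (1 + z))) {..N} = mu_sum N z"
    unfolding mu_sum_def infsum_finite[OF finite_atMost]
    by (rule sum.mono_neutral_right) (auto simp: moebius_mu_def)
  then have "norm (mu_series (1 + z) - mu_sum N z) \<le> powr_tail (Re (1 + z)) N"
    using dirichlet_tail_bound[where c = ?c and A = "{..N}" and B = UNIV and N = N, OF r norm_moebius_mu_le subset_UNIV]
    unfolding mu_series_eq_infsum[OF r] by (simp add: Compl_eq_Diff_UNIV[symmetric])
  also have "\<dots> \<le> real N powr (- Re z) / Re z" using powr_tail_le[OF assms] by simp
  finally show ?thesis .
qed

lemma mu_sum_left:
  assumes "Re z < 0" "N \<ge> 1"
  shows "norm (mu_sum N z) \<le> real N powr (- Re z) * (1 / real N + 1 / (- Re z))"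
proof -
  have "norm (mu_sum N z) \<le> (\<Sum>n\<in>{1..N}. real n powr (- Re z - 1))"
    unfolding mu_sum_def
  proof (rule sum_norm_le)
    fix n show "norm (of_int (moebius_mu n) * of_nat n powr (- (1 + z))) \<le> real n powr (- Re z - 1)"
    proof -
      have "Re (- (1 + z)) = - Re z - 1" by simp
      then show ?thesis unfolding norm_mult norm_nat_powr using norm_moebius_mu_le[of n]
        by (simp only:) (intro mult_left_le_one_le norm_ge_zero powr_ge_zero)
    qed
  qed
  also have "\<dots> \<le> real N powr (- Re z - 1) + real N powr (- Re z) / (- Re z)"
    using assms by (intro sum_powr_le) auto
  also have "real N powr (- Re z - 1) = real N powr (- Re z) * (1 / real N)"
    using assms by (simp add: powr_diff)
  finally show ?thesis by (simp add: algebra_simps)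
qed

text \<open>On the circle z times its conjugate is R^2, which turns the kernel into 2 Re z / R^2.
  The factor Re z compensates the division by Re z in \<open>mu_sum_tail\<close> and
  \<open>mu_sum_left\<close>.\<close>

lemma newman_kernel:
  assumes "norm z = R" "R > 0"
  shows "norm ((1 + z\<^sup>2 / of_real R ^ 2) / z) = 2 * \<bar>Re z\<bar> / R\<^sup>2"
proof -
  have z: "z \<noteq> 0" using assms by auto
  have "z * cnj z = of_real R ^ 2" using assms(1) complex_norm_square[of z] by simp
  then have "1 + z\<^sup>2 / of_real R ^ 2 = z * (z + cnj z) / of_real R ^ 2"
    using assms(2) by (simp add: field_simps power2_eq_square)
  then have "(1 + z\<^sup>2 / of_real R ^ 2) / z = of_real (2 * Re z / R\<^sup>2)"
    using z by (simp add: complex_add_cnj)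
  then show ?thesis using assms(2) by (simp only: norm_of_real) simp
qed

lemma contour_integral_part_circlepath_combine:
  assumes "a < c" "c < b" "f contour_integrable_on part_circlepath z r a b"
  shows "contour_integral (part_circlepath z r a c) f + contour_integral (part_circlepath z r c b) f =
    contour_integral (part_circlepath z r a b) f"
  using assms contour_integrable_part_circlepath_iff[of a b f z r]
    Henstock_Kurzweil_Integration.integral_combine[of a c b "\<lambda>t. f (z + r * cis t) * r * \<i> * cis t"]
  by (simp add: contour_integral_part_circlepath_eq)

lemma arc_point:
  assumes "w \<in> path_image (part_circlepath 0 R a b)" "a \<le> b" "R > 0"
  shows "\<exists>t. a \<le> t \<and> t \<le> b \<and> norm w = R \<and> Re w = R * cos t \<and> \<bar>Im w\<bar> \<le> R"
proof -
  have "w \<in> (\<lambda>x. of_real R * cis x) ` {a..b}"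
    using assms by (simp add: path_image_part_circlepath' closed_segment_eq_real_ivl)
  then obtain t where t: "a \<le> t" "t \<le> b" "w = of_real R * cis t" by auto
  have "norm w = R" "Re w = R * cos t" using t(3) assms(3) by (simp_all add: norm_mult)
  moreover have "\<bar>Im w\<bar> \<le> R" using abs_Im_le_cmod[of w] \<open>norm w = R\<close> by simp
  ultimately show ?thesis using t by blast
qed

text \<open>The estimates on the arcs divide by Re w; the points where it vanishes are discarded as
  a finite exceptional set.\<close>

lemma imaginary_points_finite: "finite {w. norm w = R \<and> Re w = 0}"
proof (rule finite_subset)
  show "{w. norm w = R \<and> Re w = 0} \<subseteq> {\<i> * of_real R, - \<i> * of_real R}"
  proof
    fix w assume w: "w \<in> {w. norm w = R \<and> Re w = 0}"
    then have "\<bar>Im w\<bar> = R" by (auto simp: cmod_eq_Im)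
    then show "w \<in> {\<i> * of_real R, - \<i> * of_real R}" using w by (auto simp: complex_eq_iff abs_if split: if_splits)
  qed
qed simp

text \<open>There are no zeros with Re z \<ge> 0. In the compact rectangle to the left the zeros
  form a compact set whose largest real part is negative, and half of its absolute value, capped at
  1 / 2, is a safe width.\<close>

lemma zero_free_strip:
  obtains d where "0 < d" "d < 1" "\<And>z. - d \<le> Re z \<Longrightarrow> \<bar>Im z\<bar> \<le> R \<Longrightarrow> zeta_reg (1 + z) \<noteq> 0"
proof -
  define K where "K = {z. Re z \<in> {-1/2..0} \<and> Im z \<in> {-R..R}}"
  have "K = cbox (Complex (-1/2) (-R)) (Complex 0 R)" by (auto simp: K_def in_cbox_complex_iff)
  then have cK: "compact K" by simp
  have contK: "continuous_on K (\<lambda>z. zeta_reg (1 + z))"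
  proof (rule continuous_on_compose2[OF holomorphic_on_imp_continuous_on[OF zeta_reg_holomorphic]])
    show "continuous_on K (\<lambda>z. 1 + z)" by (intro continuous_intros)
  qed (auto simp: K_def)
  define A where "A = {z \<in> K. zeta_reg (1 + z) = 0}"
  have cA: "compact A"
  proof -
    have "closed A" unfolding A_def
      using continuous_closed_preimage_constant[OF contK compact_imp_closed[OF cK], of 0] by simp
    moreover have "A = K \<inter> A" by (auto simp: A_def)
    ultimately show ?thesis using compact_Int_closed[OF cK] by metis
  qed
  show thesis
  proof (cases "A = {}")
    case True
    have "zeta_reg (1 + z) \<noteq> 0" if "- (1/2) \<le> Re z" "\<bar>Im z\<bar> \<le> R" for z
    proof (cases "Re z \<ge> 0")
      case False
      then have "z \<in> K" using that by (auto simp: K_def)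
      then show ?thesis using True by (auto simp: A_def)
    qed (auto intro!: zeta_reg_nonzero)
    then show thesis using that[of "1/2"] by auto
  next
    case False
    have "continuous_on A Re" by (intro continuous_intros)
    from continuous_attains_sup[OF cA False this] obtain w
      where w: "w \<in> A" "\<And>z. z \<in> A \<Longrightarrow> Re z \<le> Re w" by blast
    have "Re w < 0"
    proof (rule ccontr)
      assume "\<not> Re w < 0"
      then have "zeta_reg (1 + w) \<noteq> 0" by (intro zeta_reg_nonzero) auto
      then show False using w(1) by (simp add: A_def)
    qed
    define d where "d = min (1/2) (- Re w / 2)"
    have d: "0 < d" "d \<le> 1/2" "d \<le> - Re w / 2" using \<open>Re w < 0\<close> by (auto simp: d_def)
    have "zeta_reg (1 + z) \<noteq> 0" if "- d \<le> Re z" "\<bar>Im z\<bar> \<le> R" for z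
    proof (cases "Re z \<ge> 0")
      case False
      then have K: "z \<in> K" using that d by (auto simp: K_def)
      show ?thesis
      proof
        assume "zeta_reg (1 + z) = 0"
        then have "Re z \<le> Re w" using w(2) K by (auto simp: A_def)
        then show False using that(1) d \<open>Re w < 0\<close> by linarith
      qed
    qed (auto intro!: zeta_reg_nonzero)
    then show thesis using that[of d] d by auto
  qed
qed

text \<open>Newman's contour. Since \<open>mu_series (1 + z) = z / zeta_reg (1 + z)\<close>, the kernel cancels the pole at \<open>0\<close>
  on the side of the full series, so Cauchy's theorem on a convex set is enough there.\<close>

lemma newman_estimate:
  fixes R d B \<delta> :: real and N :: nat
  assumes R: "R > 0" and d: "d > 0" "d < 1"
    and nz: "\<And>z. - d < Re z \<Longrightarrow> \<bar>Im z\<bar> < 2 * R \<Longrightarrow> zeta_reg (1 + z) \<noteq> 0"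
    and B: "0 \<le> B" "\<And>z. - \<delta> \<le> Re z \<Longrightarrow> Re z \<le> 0 \<Longrightarrow> \<bar>Im z\<bar> \<le> R \<Longrightarrow> norm ((1 + z\<^sup>2 / of_real R ^ 2) / zeta_reg (1 + z)) \<le> B"
    and \<delta>: "0 < \<delta>" "\<delta> < d" and N: "N \<ge> 1"
  shows "2 * pi * norm (mu_sum N 0) \<le> 4 * pi / R + 2 * pi / real N + 2 * B * \<delta> + 2 * R * B * real N powr (- \<delta>)"
proof -
  define h where "h = (\<lambda>z. of_nat N powr z * ((1 + z\<^sup>2 / of_real R ^ 2) / zeta_reg (1 + z)))"
  \<comment> \<open>The partial sum keeps the simple pole at 0, so its integral over the whole
    circle produces \<open>mu_sum N 0\<close>.\<close>
  define k where "k = (\<lambda>z. (mu_sum N z * of_nat N powr z * (1 + z\<^sup>2 / of_real R ^ 2)) / z)"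
  define S where "S = {z. - d < Re z} \<inter> {z. - (2 * R) < Im z} \<inter> {z. Im z < 2 * R}"
  have S: "z \<in> S \<longleftrightarrow> - d < Re z \<and> \<bar>Im z\<bar> < 2 * R" for z by (auto simp: S_def)
  have oS: "open S" unfolding S_def by (intro open_Int open_halfspace_Re_gt open_halfspace_Im_gt open_halfspace_Im_lt)
  have cS: "convex S" unfolding S_def
    by (intro convex_Int convex_halfspace_Re_gt convex_halfspace_Im_gt convex_halfspace_Im_lt)
  have hS: "h holomorphic_on S"
  proof -
    have "(\<lambda>z. zeta_reg (1 + z)) holomorphic_on S"
      by (rule holomorphic_on_compose_gen[OF _ zeta_reg_holomorphic, unfolded o_def])
        (use d in \<open>auto simp: S intro!: holomorphic_intros\<close>)
    then show ?thesis unfolding h_def using nz R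
      by (intro holomorphic_intros) (auto simp: S)
  qed
  have msum: "mu_sum N holomorphic_on A" for A
    unfolding mu_sum_def by (intro holomorphic_intros)
  have kS: "k holomorphic_on - {0}"
    unfolding k_def by (intro holomorphic_intros msum) (use R in auto)
  define C1 where "C1 = part_circlepath 0 R 0 (pi / 2)"
  define C2 where "C2 = part_circlepath 0 R (pi / 2) (3 * pi / 2)"
  define C3 where "C3 = part_circlepath 0 R (3 * pi / 2) (2 * pi)"
  \<comment> \<open>The closed contour for \<open>h\<close> runs along \<open>C1\<close> from R to
    \<open>p1\<close>, through \<open>p2\<close> and \<open>p3\<close> on the line Re z = -\<delta>,
    to \<open>p4\<close>, and along \<open>C3\<close> back to R, whereas \<open>k\<close> is
    integrated over the full circle.\<close>
  define p1 where "p1 = \<i> * of_real R"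
  define p2 where "p2 = - of_real \<delta> + \<i> * of_real R"
  define p3 where "p3 = - of_real \<delta> - \<i> * of_real R"
  define p4 where "p4 = - \<i> * of_real R"
  have arc1: "Re w \<ge> 0 \<and> norm w = R \<and> w \<in> S \<and> w \<noteq> 0" if w: "w \<in> path_image C1" for w
  proof -
    obtain t where t: "0 \<le> t" "t \<le> pi / 2" "norm w = R" "Re w = R * cos t" "\<bar>Im w\<bar> \<le> R"
      using arc_point[OF w[unfolded C1_def] _ R] pi_gt_zero by force
    then have "Re w \<ge> 0" using R by (simp add: cos_ge_zero)
    then show ?thesis using t R d by (auto simp: S)
  qed
  have arc3: "Re w \<ge> 0 \<and> norm w = R \<and> w \<in> S \<and> w \<noteq> 0" if w: "w \<in> path_image C3" for w
  proof -
    obtain t where t: "3 * pi / 2 \<le> t" "t \<le> 2 * pi" "norm w = R" "Re w = R * cos t" "\<bar>Im w\<bar> \<le> R"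
      using arc_point[OF w[unfolded C3_def] _ R] pi_gt_zero by force
    have "cos t = cos (t - 2 * pi)" by (simp add: cos_diff)
    also have "\<dots> \<ge> 0" using t by (intro cos_ge_zero) auto
    finally have "Re w \<ge> 0" using t R by simp
    then show ?thesis using t R d by (auto simp: S)
  qed
  have arc2: "Re w \<le> 0 \<and> norm w = R \<and> w \<noteq> 0" if w: "w \<in> path_image C2" for w
  proof -
    obtain t where t: "pi / 2 \<le> t" "t \<le> 3 * pi / 2" "norm w = R" "Re w = R * cos t" "\<bar>Im w\<bar> \<le> R"
      using arc_point[OF w[unfolded C2_def] _ R] pi_gt_zero by force
    have "cos t = - cos (t - pi)" by (simp add: cos_diff)
    also have "\<dots> \<le> 0"
    proof -
      have "0 \<le> cos (t - pi)" using t by (intro cos_ge_zero) auto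
      then show ?thesis by linarith
    qed
    finally have "Re w \<le> 0" using t R by (simp add: mult_nonneg_nonpos)
    then show ?thesis using t R by auto
  qed
  have seg: "w \<in> S \<and> - \<delta> \<le> Re w \<and> Re w \<le> 0 \<and> \<bar>Im w\<bar> \<le> R"
    if "w \<in> closed_segment p1 p2 \<union> closed_segment p2 p3 \<union> closed_segment p3 p4" for w
  proof -
    define Q where "Q = cbox (Complex (- \<delta>) (- R)) (Complex 0 R)"
    have Q: "z \<in> Q \<longleftrightarrow> - \<delta> \<le> Re z \<and> Re z \<le> 0 \<and> \<bar>Im z\<bar> \<le> R" for z
      by (auto simp: Q_def in_cbox_complex_iff)
    have "p1 \<in> Q" "p2 \<in> Q" "p3 \<in> Q" "p4 \<in> Q"
      using \<delta> R by (auto simp: Q p1_def p2_def p3_def p4_def)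
    moreover have "convex Q" by (simp add: Q_def convex_box)
    ultimately have "w \<in> Q" using that closed_segment_subset[of _ Q] by blast
    then show ?thesis using \<delta> R by (auto simp: Q S)
  qed
  have ends: "pathstart C1 = of_real R" "pathfinish C1 = p1" "pathstart C3 = p4" "pathfinish C3 = of_real R"
  proof -
    have e: "3 * pi / 2 = 3 / 2 * pi" by simp
    have cs: "cos (3 * pi / 2) = 0" "sin (3 * pi / 2) = - 1" unfolding e by (rule cos_3over2_pi sin_3over2_pi)+
    have "exp (\<i> * of_real (pi / 2)) = \<i>" "exp (\<i> * of_real (3 * pi / 2)) = - \<i>" "exp (\<i> * of_real (2 * pi)) = 1"
      unfolding cis_conv_exp[symmetric] by (simp_all add: complex_eq_iff cs)
    then show "pathstart C1 = of_real R" "pathfinish C1 = p1" "pathstart C3 = p4" "pathfinish C3 = of_real R"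
      by (simp_all add: C1_def C3_def p1_def p4_def)
  qed
  have valid: "valid_path C1" "valid_path C2" "valid_path C3" by (simp_all add: C1_def C2_def C3_def)
  have int_h: "h contour_integrable_on g" if "valid_path g" "path_image g \<subseteq> S" for g
    by (rule contour_integrable_holomorphic_simple[OF hS oS that])
  have int_k: "k contour_integrable_on g" if "valid_path g" "path_image g \<subseteq> - {0}" for g
    by (rule contour_integrable_holomorphic_simple[OF kS _ that]) auto
  have ih: "h contour_integrable_on C1" "h contour_integrable_on C3" "h contour_integrable_on linepath p1 p2"
    "h contour_integrable_on linepath p2 p3" "h contour_integrable_on linepath p3 p4"
    using arc1 arc3 seg valid by (auto intro!: int_h)
  have ik: "k contour_integrable_on C1" "k contour_integrable_on C2" "k contour_integrable_on C3"
    using arc1 arc2 arc3 valid by (auto intro!: int_k)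
  have closed: "contour_integral C1 h + (contour_integral (linepath p1 p2) h + (contour_integral (linepath p2 p3) h +
     (contour_integral (linepath p3 p4) h + contour_integral C3 h))) = 0"
  proof -
    let ?g = "C1 +++ (linepath p1 p2 +++ (linepath p2 p3 +++ (linepath p3 p4 +++ C3)))"
    have "(h has_contour_integral 0) ?g"
    proof (rule Cauchy_theorem_convex_simple[OF hS cS])
      show "valid_path ?g" using valid ends by (intro valid_path_join) auto
      show "path_image ?g \<subseteq> S"
        using arc1 arc3 seg by (intro subset_path_image_join) auto
      show "pathfinish ?g = pathstart ?g" using ends by simp
    qed
    then have "contour_integral ?g h = 0" by (rule contour_integral_unique)
    then show ?thesis using ih valid ends by simp
  qed
  have circ: "contour_integral C1 k + contour_integral C2 k + contour_integral C3 k = 2 * of_real pi * \<i> * mu_sum N 0"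
  proof -
    have "((\<lambda>z. mu_sum N z * of_nat N powr z * (1 + z\<^sup>2 / of_real R ^ 2) / (z - 0)) has_contour_integral
      2 * of_real pi * \<i> * (mu_sum N 0 * of_nat N powr 0 * (1 + 0\<^sup>2 / of_real R ^ 2))) (circlepath 0 R)"
      by (rule Cauchy_integral_circlepath_simple) (use R in \<open>auto intro!: holomorphic_intros msum\<close>)
    then have hc: "(k has_contour_integral 2 * of_real pi * \<i> * mu_sum N 0) (part_circlepath 0 R 0 (2 * pi))"
      using N by (simp add: k_def circlepath_def)
    have ik1: "k contour_integrable_on part_circlepath 0 R 0 (2 * pi)" using hc by (rule has_contour_integral_integrable)
    have "contour_integral C1 k + contour_integral (part_circlepath 0 R (pi / 2) (2 * pi)) k = 2 * of_real pi * \<i> * mu_sum N 0"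
      unfolding C1_def using contour_integral_part_circlepath_combine[OF _ _ ik1, of "pi / 2"] contour_integral_unique[OF hc] by simp
    moreover have "k contour_integrable_on part_circlepath 0 R (pi / 2) (2 * pi)"
    proof (rule int_k)
      show "path_image (part_circlepath 0 R (pi / 2) (2 * pi)) \<subseteq> - {0}"
      proof
        fix w assume "w \<in> path_image (part_circlepath 0 R (pi / 2) (2 * pi))"
        from arc_point[OF this _ R] have "norm w = R" by auto
        then show "w \<in> - {0}" using R by auto
      qed
    qed simp
    then have "contour_integral C2 k + contour_integral C3 k = contour_integral (part_circlepath 0 R (pi / 2) (2 * pi)) k"
      unfolding C2_def C3_def by (intro contour_integral_part_circlepath_combine) auto
    ultimately show ?thesis by (simp only: add.assoc)
  qed
  have normN: "norm (of_nat N powr z) = real N powr Re z" for z by (rule norm_nat_powr)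
  have kernel: "norm ((1 + w\<^sup>2 / of_real R ^ 2) / w) = 2 * \<bar>Re w\<bar> / R\<^sup>2" if "norm w = R" for w
    by (rule newman_kernel[OF that R])
  have right: "norm (h w - k w) \<le> 2 / R\<^sup>2" if w: "Re w > 0" "norm w = R" for w
  proof -
    have w0: "w \<noteq> 0" using w by auto
    have "mu_series (1 + w) = w / zeta_reg (1 + w)" using zeta_reg_nonzero_mu_series(2)[of "1 + w"] w by simp
    then have "h w = (of_nat N powr w * ((1 + w\<^sup>2 / of_real R ^ 2) / w)) * mu_series (1 + w)"
      using w0 by (simp add: h_def)
    moreover have "k w = (of_nat N powr w * ((1 + w\<^sup>2 / of_real R ^ 2) / w)) * mu_sum N w"
      by (simp add: k_def)
    ultimately have "h w - k w = (of_nat N powr w * ((1 + w\<^sup>2 / of_real R ^ 2) / w)) * (mu_series (1 + w) - mu_sum N w)"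
      by (simp only: right_diff_distrib)
    then have "norm (h w - k w) = real N powr Re w * (2 * \<bar>Re w\<bar> / R\<^sup>2) * norm (mu_series (1 + w) - mu_sum N w)"
      by (simp only: norm_mult normN kernel[OF w(2)])
    also have "\<dots> \<le> real N powr Re w * (2 * \<bar>Re w\<bar> / R\<^sup>2) * (real N powr (- Re w) / Re w)"
      by (rule mult_left_mono[OF mu_sum_tail]) (use w N in auto)
    also have "\<dots> = (real N powr Re w * real N powr (- Re w)) * (2 / R\<^sup>2)" using w by simp
    also have "real N powr Re w * real N powr (- Re w) = 1" using N by (simp add: powr_minus)
    finally show ?thesis by simp
  qed
  have left: "norm (k w) \<le> 2 / R\<^sup>2 + 2 / (R * real N)" if w: "Re w < 0" "norm w = R" for w
  proof -
    have "k w = (of_nat N powr w * ((1 + w\<^sup>2 / of_real R ^ 2) / w)) * mu_sum N w"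
      by (simp add: k_def)
    then have "norm (k w) = real N powr Re w * (2 * \<bar>Re w\<bar> / R\<^sup>2) * norm (mu_sum N w)"
      by (simp only: norm_mult normN kernel[OF w(2)])
    also have "\<dots> \<le> real N powr Re w * (2 * \<bar>Re w\<bar> / R\<^sup>2) * (real N powr (- Re w) * (1 / real N + 1 / (- Re w)))"
      by (rule mult_left_mono[OF mu_sum_left[OF w(1) N]]) simp
    also have "\<dots> = (real N powr Re w * real N powr (- Re w)) * (2 * \<bar>Re w\<bar> / R\<^sup>2 * (1 / real N + 1 / (- Re w)))" by simp
    also have "real N powr Re w * real N powr (- Re w) = 1" using N by (simp add: powr_minus)
    also have "2 * \<bar>Re w\<bar> / R\<^sup>2 * (1 / real N + 1 / (- Re w)) = 2 * \<bar>Re w\<bar> / R\<^sup>2 / real N + 2 / R\<^sup>2"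
    proof -
      have "2 * y / R\<^sup>2 * (1 / real N + 1 / y) = 2 * y / R\<^sup>2 / real N + 2 / R\<^sup>2" if "y > 0" for y
        using that by (simp add: distrib_left)
      moreover have "\<bar>Re w\<bar> = - Re w" "- Re w > 0" using w by simp_all
      ultimately show ?thesis by (simp only:)
    qed
    also have "2 * \<bar>Re w\<bar> / R\<^sup>2 / real N \<le> 2 * R / R\<^sup>2 / real N"
      using abs_Re_le_cmod[of w] w by (intro divide_right_mono) auto
    also have "2 * R / R\<^sup>2 / real N = 2 / (R * real N)" using R by (simp add: power2_eq_square)
    finally show ?thesis by simp
  qed
  have bC: "norm (contour_integral C1 h - contour_integral C1 k) \<le> pi / R"
    "norm (contour_integral C3 h - contour_integral C3 k) \<le> pi / R"
  proof -
    have "norm (contour_integral C1 h - contour_integral C1 k) \<le> 2 / R\<^sup>2 * R * (pi / 2 - 0)"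
    proof (rule has_contour_integral_bound_part_circlepath_strong[OF _ imaginary_points_finite[of R]])
      show "((\<lambda>w. h w - k w) has_contour_integral contour_integral C1 h - contour_integral C1 k) (part_circlepath 0 R 0 (pi / 2))"
        using ih(1) ik(1) unfolding C1_def[symmetric] by (intro has_contour_integral_diff has_contour_integral_integral)
      fix w assume "w \<in> path_image (part_circlepath 0 R 0 (pi / 2)) - {w. norm w = R \<and> Re w = 0}"
      then show "norm (h w - k w) \<le> 2 / R\<^sup>2" using arc1[of w] by (intro right) (auto simp: C1_def)
    qed (use R in auto)
    then show "norm (contour_integral C1 h - contour_integral C1 k) \<le> pi / R" using R by (simp add: power2_eq_square)
    have "norm (contour_integral C3 h - contour_integral C3 k) \<le> 2 / R\<^sup>2 * R * (2 * pi - 3 * pi / 2)"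
    proof (rule has_contour_integral_bound_part_circlepath_strong[OF _ imaginary_points_finite[of R]])
      show "((\<lambda>w. h w - k w) has_contour_integral contour_integral C3 h - contour_integral C3 k) (part_circlepath 0 R (3 * pi / 2) (2 * pi))"
        using ih(2) ik(3) unfolding C3_def[symmetric] by (intro has_contour_integral_diff has_contour_integral_integral)
      fix w assume "w \<in> path_image (part_circlepath 0 R (3 * pi / 2) (2 * pi)) - {w. norm w = R \<and> Re w = 0}"
      then show "norm (h w - k w) \<le> 2 / R\<^sup>2" using arc3[of w] by (intro right) (auto simp: C3_def)
    qed (use R in auto)
    then show "norm (contour_integral C3 h - contour_integral C3 k) \<le> pi / R" using R by (simp add: power2_eq_square)
  qed
  have bC2: "norm (contour_integral C2 k) \<le> 2 * pi / R + 2 * pi / real N"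
  proof -
    have "norm (contour_integral C2 k) \<le> (2 / R\<^sup>2 + 2 / (R * real N)) * R * (3 * pi / 2 - pi / 2)"
    proof (rule has_contour_integral_bound_part_circlepath_strong[OF _ imaginary_points_finite[of R]])
      show "(k has_contour_integral contour_integral C2 k) (part_circlepath 0 R (pi / 2) (3 * pi / 2))"
        using ik(2) unfolding C2_def[symmetric] by (intro has_contour_integral_integral)
      fix w assume "w \<in> path_image (part_circlepath 0 R (pi / 2) (3 * pi / 2)) - {w. norm w = R \<and> Re w = 0}"
      then show "norm (k w) \<le> 2 / R\<^sup>2 + 2 / (R * real N)" using arc2[of w] by (intro left) (auto simp: C2_def)
    qed (use R in auto)
    also have "\<dots> = 2 * pi / R + 2 * pi / real N" using R N by (simp add: field_simps power2_eq_square)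
    finally show ?thesis .
  qed
  have hb: "norm (h w) \<le> B * real N powr Re w" if "w \<in> closed_segment p1 p2 \<union> closed_segment p2 p3 \<union> closed_segment p3 p4" for w
  proof -
    have "norm (h w) = real N powr Re w * norm ((1 + w\<^sup>2 / of_real R ^ 2) / zeta_reg (1 + w))"
      unfolding h_def norm_mult normN ..
    also have "\<dots> \<le> real N powr Re w * B" using seg[OF that] by (intro mult_left_mono B) auto
    finally show ?thesis by (simp add: mult.commute)
  qed
  have hb1: "norm (h w) \<le> B" if w: "w \<in> closed_segment p1 p2 \<union> closed_segment p2 p3 \<union> closed_segment p3 p4" for w
  proof -
    have "real N powr Re w \<le> real N powr 0" using seg[OF w] N by (intro powr_mono) auto
    then have "B * real N powr Re w \<le> B * 1" using N B(1) by (intro mult_left_mono) auto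
    then show ?thesis using hb[OF w] by simp
  qed
  have hb2: "norm (h w) \<le> B * real N powr (- \<delta>)" if w: "w \<in> closed_segment p2 p3" for w
  proof -
    obtain u where "w = (1 - u) *\<^sub>R p2 + u *\<^sub>R p3" using w by (auto simp: closed_segment_def)
    then have "Re w = (1 - u) * (- \<delta>) + u * (- \<delta>)" by (simp add: p2_def p3_def)
    then have "Re w = - \<delta>" by (simp add: algebra_simps)
    then show ?thesis using hb[of w] w by simp
  qed
  have l: "norm (contour_integral (linepath p1 p2) h) \<le> B * \<delta>" "norm (contour_integral (linepath p3 p4) h) \<le> B * \<delta>"
    "norm (contour_integral (linepath p2 p3) h) \<le> 2 * R * B * real N powr (- \<delta>)"
  proof -
    have "norm (p2 - p1) = \<delta>" "norm (p4 - p3) = \<delta>" using \<delta> by (simp_all add: p1_def p2_def p3_def p4_def)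
    moreover have "norm (p3 - p2) = 2 * R"
    proof -
      have "p3 - p2 = - (\<i> * of_real (2 * R))" by (simp add: p2_def p3_def)
      then show ?thesis using R by (simp add: norm_mult)
    qed
    moreover have "norm (contour_integral (linepath p1 p2) h) \<le> B * norm (p2 - p1)"
      using hb1 B(1) ih by (intro has_contour_integral_bound_linepath[OF has_contour_integral_integral]) auto
    moreover have "norm (contour_integral (linepath p3 p4) h) \<le> B * norm (p4 - p3)"
      using hb1 B(1) ih by (intro has_contour_integral_bound_linepath[OF has_contour_integral_integral]) auto
    moreover have "norm (contour_integral (linepath p2 p3) h) \<le> (B * real N powr (- \<delta>)) * norm (p3 - p2)"
      using hb2 B(1) ih by (intro has_contour_integral_bound_linepath[OF has_contour_integral_integral]) auto
    ultimately show "norm (contour_integral (linepath p1 p2) h) \<le> B * \<delta>" "norm (contour_integral (linepath p3 p4) h) \<le> B * \<delta>"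
      "norm (contour_integral (linepath p2 p3) h) \<le> 2 * R * B * real N powr (- \<delta>)" by (simp_all add: mult_ac)
  qed
  \<comment> \<open>On the right arcs h - k is controlled by the tail of the series, on the left arc
    \<open>k\<close> alone by the size of the finite sum, and on the segments \<open>h\<close> alone
    by \<open>B\<close>, with the extra factor N^(-\<delta>) on the vertical one.\<close>
  have "2 * of_real pi * \<i> * mu_sum N 0 = contour_integral C2 k - (contour_integral C1 h - contour_integral C1 k)
     - (contour_integral C3 h - contour_integral C3 k) - contour_integral (linepath p1 p2) h
     - contour_integral (linepath p2 p3) h - contour_integral (linepath p3 p4) h"
    using closed circ by (simp add: algebra_simps add_eq_0_iff)
  then have "norm (2 * of_real pi * \<i> * mu_sum N 0) \<le> norm (contour_integral C2 k) + norm (contour_integral C1 h - contour_integral C1 k)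
     + norm (contour_integral C3 h - contour_integral C3 k) + norm (contour_integral (linepath p1 p2) h)
     + norm (contour_integral (linepath p2 p3) h) + norm (contour_integral (linepath p3 p4) h)"
    by (simp only:) (intro order_trans[OF norm_triangle_ineq4] add_mono order_refl)
  also have "norm (2 * of_real pi * \<i> * mu_sum N 0) = 2 * pi * norm (mu_sum N 0)" by (simp add: norm_mult)
  finally show ?thesis using bC bC2 l by simp
qed

text \<open>The constants are chosen in the order R from \<epsilon>, the width d and the bound B for
  this R, then \<delta> from B, and N last, for the two terms of \<open>newman_estimate\<close> that
  contain N.\<close>

lemma mu_sum_tendsto: "(\<lambda>N. mu_sum N 0) \<longlonglongrightarrow> 0"
proof (rule LIMSEQ_I)
  fix \<epsilon> :: real assume e: "\<epsilon> > 0"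
  define R where "R = 8 / \<epsilon>"
  have R: "R > 0" using e by (simp add: R_def)
  obtain d where d: "0 < d" "d < 1" "\<And>z. - d \<le> Re z \<Longrightarrow> \<bar>Im z\<bar> \<le> 2 * R \<Longrightarrow> zeta_reg (1 + z) \<noteq> 0"
    using zero_free_strip[of "2 * R"] by blast
  define Q where "Q = cbox (Complex (- d / 2) (- R)) (Complex 0 R)"
  have Q: "z \<in> Q \<longleftrightarrow> - d / 2 \<le> Re z \<and> Re z \<le> 0 \<and> \<bar>Im z\<bar> \<le> R" for z
    by (auto simp: Q_def in_cbox_complex_iff)
  have "continuous_on Q (\<lambda>z. (1 + z\<^sup>2 / of_real R ^ 2) / zeta_reg (1 + z))"
  proof (intro continuous_intros ballI)
    show "continuous_on Q (\<lambda>z. zeta_reg (1 + z))"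
    proof (rule continuous_on_compose2[OF holomorphic_on_imp_continuous_on[OF zeta_reg_holomorphic]])
      show "continuous_on Q (\<lambda>z. 1 + z)" by (intro continuous_intros)
    qed (use d in \<open>auto simp: Q\<close>)
    show "zeta_reg (1 + z) \<noteq> 0" if "z \<in> Q" for z using that d R by (intro d(3)) (auto simp: Q)
  qed (use R in auto)
  then have "compact ((\<lambda>z. (1 + z\<^sup>2 / of_real R ^ 2) / zeta_reg (1 + z)) ` Q)"
    by (rule compact_continuous_image) (simp add: Q_def)
  then obtain B where B: "B > 0" "\<And>z. z \<in> Q \<Longrightarrow> norm ((1 + z\<^sup>2 / of_real R ^ 2) / zeta_reg (1 + z)) \<le> B"
    using compact_imp_bounded bounded_pos by (metis (no_types, lifting) imageI)
  define \<delta> where "\<delta> = min (d / 2) (\<epsilon> / (2 * B))"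
  have \<delta>: "0 < \<delta>" "\<delta> < d" "\<delta> \<le> d / 2" "2 * B * \<delta> \<le> \<epsilon>"
    using d B(1) e by (auto simp: \<delta>_def min_def field_simps)
  have est: "2 * pi * norm (mu_sum N 0) \<le> 4 * pi / R + 2 * pi / real N + 2 * B * \<delta> + 2 * R * B * real N powr (- \<delta>)"
    if "N \<ge> 1" for N
    by (rule newman_estimate[OF R d(1,2) _ _ _ \<delta>(1,2) that]) (use d B \<delta> in \<open>auto simp: Q\<close>)
  have "(\<lambda>N. 2 * pi / real N + 2 * R * B * real N powr (- \<delta>)) \<longlonglongrightarrow> 0 + 2 * R * B * 0"
    using \<delta> by (intro tendsto_intros tendsto_neg_powr real_tendsto_divide_at_top[OF tendsto_const] filterlim_real_sequentially) auto
  then have "\<forall>\<^sub>F N in sequentially. 2 * pi / real N + 2 * R * B * real N powr (- \<delta>) < \<epsilon>"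
    using e by (intro order_tendstoD(2)[of _ 0]) auto
  then obtain N0 where N0: "\<And>N. N \<ge> N0 \<Longrightarrow> 2 * pi / real N + 2 * R * B * real N powr (- \<delta>) < \<epsilon>"
    by (auto simp: eventually_sequentially)
  have "norm (mu_sum N 0 - 0) < \<epsilon>" if "N \<ge> max 1 N0" for N
  proof -
    have "2 * pi * norm (mu_sum N 0) < 4 * pi / R + \<epsilon> + \<epsilon>" using est[of N] N0[of N] that \<delta>(4) by simp
    also have "4 * pi / R = pi * \<epsilon> / 2" using e by (simp add: R_def)
    also have "pi * \<epsilon> / 2 + \<epsilon> + \<epsilon> \<le> 2 * pi * \<epsilon>"
    proof -
      have "3 * \<epsilon> \<le> pi * \<epsilon>" using e pi_gt3 by (intro mult_right_mono) auto
      then show ?thesis using e by linarith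
    qed
    finally show ?thesis by simp
  qed
  then show "\<exists>N0. \<forall>N\<ge>N0. norm (mu_sum N 0 - 0) < \<epsilon>" by blast
qed

lemma moebius_harmonic_tendsto: "(\<lambda>N. \<Sum>n\<in>{1..N}. real_of_int (moebius_mu n) / real n) \<longlonglongrightarrow> 0"
proof -
  have "mu_sum N 0 = of_real (\<Sum>n\<in>{1..N}. real_of_int (moebius_mu n) / real n)" for N
    by (simp add: mu_sum_def powr_minus field_simps)
  then have "(\<lambda>N. Re (mu_sum N 0)) = (\<lambda>N. \<Sum>n\<in>{1..N}. real_of_int (moebius_mu n) / real n)" by simp
  then show ?thesis using tendsto_Re[OF mu_sum_tendsto] by simp
qed

section \<open>Katai's criterion\<close>

lemma one_minus_ge_exp:
  fixes x :: real
  assumes "0 \<le> x" "x \<le> 1 / 2"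
  shows "exp (- 2 * x) \<le> 1 - x"
proof -
  have "2 * x\<^sup>2 \<le> x" using assms mult_right_mono[of x "1/2" x] by (simp add: power2_eq_square)
  then have "- 2 * x \<le> ln (1 - x)" using ln_one_minus_pos_lower_bound[OF assms] by simp
  then have "exp (- 2 * x) \<le> exp (ln (1 - x))" by simp
  then show ?thesis using assms by simp
qed

text \<open>If the sums stayed at most A, the finite Euler products, and with them
  \<open>mu_series\<close> at every \<sigma> > 1, would have norm at least exp (-2 A). But there
  \<open>mu_series\<close> is \<sigma> - 1 divided by \<open>zeta_reg\<close>, which tends to 0 as
  \<sigma> tends to 1.\<close>

lemma prime_harmonic_unbounded:
  fixes A :: real
  shows "\<exists>N. A < (\<Sum>p\<in>primes_le N. 1 / real p)"
proof (rule ccontr)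
  assume "\<not> ?thesis"
  then have le: "(\<Sum>p\<in>primes_le N. 1 / real p) \<le> A" for N by (simp add: not_less)
  have lower: "exp (- 2 * A) \<le> norm (euler_prod N (of_real \<sigma>))" if \<sigma>: "\<sigma> > 1" for N \<sigma>
  proof -
    have "exp (- 2 * A) \<le> exp (\<Sum>p\<in>primes_le N. - 2 * (1 / real p))"
      unfolding sum_distrib_left[symmetric] using le[of N] by simp
    also have "\<dots> = (\<Prod>p\<in>primes_le N. exp (- 2 * (1 / real p)))" by (simp add: exp_sum)
    also have "\<dots> \<le> (\<Prod>p\<in>primes_le N. norm (1 - of_nat p powr (- of_real \<sigma>) :: complex))"
    proof (rule prod_mono)
      fix p assume "p \<in> primes_le N"
      then have p: "real p \<ge> 2" using prime_primes_le prime_ge_2_nat by fastforce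
      have "exp (- 2 * (1 / real p)) \<le> 1 - 1 / real p" using p by (intro one_minus_ge_exp) (auto simp: field_simps)
      also have "real p powr (- \<sigma>) \<le> real p powr (- 1)" using p \<sigma> by (intro powr_mono) auto
      then have "1 - 1 / real p \<le> 1 - real p powr (- \<sigma>)" using p by (simp add: powr_minus field_simps)
      also have "\<dots> = norm (1 :: complex) - norm (of_nat p powr (- of_real \<sigma>) :: complex)" by (simp add: norm_nat_powr)
      also have "\<dots> \<le> norm (1 - of_nat p powr (- of_real \<sigma>) :: complex)" by (rule norm_triangle_ineq2)
      finally show "0 \<le> exp (- 2 * (1 / real p)) \<and> exp (- 2 * (1 / real p)) \<le> norm (1 - of_nat p powr (- of_real \<sigma>) :: complex)"
        by simp
    qed
    also have "\<dots> = norm (euler_prod N (of_real \<sigma>))" by (simp add: euler_prod_def prod_norm)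
    finally show ?thesis .
  qed
  have mu: "exp (- 2 * A) \<le> norm (mu_series (of_real \<sigma>))" if \<sigma>: "\<sigma> > 1" for \<sigma>
    by (rule tendsto_lowerbound[OF tendsto_norm[OF euler_prod_tendsto]]) (use lower[OF \<sigma>] \<sigma> in auto)
  have op: "open {s. Re s > 0}" by (rule open_halfspace_Re_gt)
  have "isCont zeta_reg 1"
    by (rule field_differentiable_imp_continuous_at[OF holomorphic_on_imp_differentiable_at[OF zeta_reg_holomorphic op]]) simp
  moreover have "(\<lambda>n. of_real (1 + 1 / real (Suc n)) :: complex) \<longlonglongrightarrow> of_real (1 + 0)"
    by (intro tendsto_intros LIMSEQ_Suc[OF lim_1_over_n])
  then have s1: "(\<lambda>n. of_real (1 + 1 / real (Suc n)) :: complex) \<longlonglongrightarrow> 1" by simp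
  ultimately have z1: "(\<lambda>n. zeta_reg (of_real (1 + 1 / real (Suc n)))) \<longlonglongrightarrow> zeta_reg 1"
    by (rule isCont_tendsto_compose)
  have "(\<lambda>n. (of_real (1 + 1 / real (Suc n)) - 1) / zeta_reg (of_real (1 + 1 / real (Suc n)))) \<longlonglongrightarrow> (1 - 1) / zeta_reg 1"
    by (rule tendsto_divide[OF tendsto_diff[OF s1 tendsto_const] z1]) (simp add: zeta_reg_1)
  moreover have "(of_real (1 + 1 / real (Suc n)) - 1) / zeta_reg (of_real (1 + 1 / real (Suc n))) = mu_series (of_real (1 + 1 / real (Suc n)))" for n
    by (rule zeta_reg_nonzero_mu_series(2)[symmetric]) simp
  ultimately have "(\<lambda>n. mu_series (of_real (1 + 1 / real (Suc n)))) \<longlonglongrightarrow> 0" by simp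
  then have "(\<lambda>n. norm (mu_series (of_real (1 + 1 / real (Suc n))))) \<longlonglongrightarrow> norm (0 :: complex)" by (rule tendsto_norm)
  then have "exp (- 2 * A) \<le> norm (0 :: complex)"
  proof (rule tendsto_lowerbound)
    show "\<forall>\<^sub>F n in sequentially. exp (- 2 * A) \<le> norm (mu_series (of_real (1 + 1 / real (Suc n))))"
      by (intro always_eventually allI mu) simp
  qed simp
  then show False by simp
qed

section \<open>Counting multiples of primes, and the Turan-Kubilius inequality\<close>

lemma sum_inverse_squares_le:
  assumes "finite P" "\<And>p. p \<in> P \<Longrightarrow> 2 \<le> p"
  shows "(\<Sum>p\<in>P. 1 / (real p)\<^sup>2) \<le> 1"
proof -
  have part: "(\<Sum>n\<in>{2..M}. 1 / (real n)\<^sup>2) \<le> 1 - 1 / real M" if "M \<ge> 1" for M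
    using that
  proof (induction M rule: dec_induct)
    case (step M)
    have "1 / (real (Suc M))\<^sup>2 \<le> 1 / real M - 1 / real (Suc M)"
    proof -
      have "1 / (real (Suc M))\<^sup>2 \<le> 1 / (real M * real (Suc M))"
        using step by (intro divide_left_mono) (auto simp: power2_eq_square)
      also have "\<dots> = 1 / real M - 1 / real (Suc M)" using step by (simp add: field_simps)
      finally show ?thesis .
    qed
    moreover have "{2..Suc M} = insert (Suc M) {2..M}" using step by auto
    ultimately show ?case using step.IH by simp
  qed simp
  define M where "M = Max (insert 1 P)"
  have M: "1 \<le> M" "P \<subseteq> {2..M}" using assms by (auto simp: M_def)
  have "(\<Sum>p\<in>P. 1 / (real p)\<^sup>2) \<le> (\<Sum>n\<in>{2..M}. 1 / (real n)\<^sup>2)" using M(2) by (intro sum_mono2) auto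
  also have "\<dots> \<le> 1 - 1 / real M" by (rule part[OF M(1)])
  finally show ?thesis by (smt (verit) divide_nonneg_nonneg of_nat_0_le_iff)
qed

lemma sum_multiples:
  fixes F :: "nat \<Rightarrow> real"
  assumes "0 < d"
  shows "(\<Sum>n\<in>{1..N}. of_bool (d dvd n) * F n) = (\<Sum>m\<in>{1..N div d}. F (d * m))"
proof -
  have "(\<Sum>n\<in>{1..N}. of_bool (d dvd n) * F n) = (\<Sum>n\<in>{n\<in>{1..N}. d dvd n}. F n)"
  proof -
    have "(\<Sum>n\<in>{1..N}. of_bool (d dvd n) * F n) = (\<Sum>n\<in>{1..N}. if d dvd n then F n else 0)"
      by (intro sum.cong) auto
    then show ?thesis by (simp only: sum.inter_filter[OF finite_atLeastAtMost])
  qed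
  also have "{n\<in>{1..N}. d dvd n} = (*) d ` {1..N div d}"
  proof (intro equalityI subsetI)
    fix n assume "n \<in> {n\<in>{1..N}. d dvd n}"
    then obtain m where m: "n = d * m" "1 \<le> n" "n \<le> N" by auto
    then have "1 \<le> m" "m \<le> N div d" using assms by (auto simp: less_eq_div_iff_mult_less_eq mult.commute Suc_le_eq)
    then show "n \<in> (*) d ` {1..N div d}" using m by auto
  next
    fix n assume "n \<in> (*) d ` {1..N div d}"
    then show "n \<in> {n\<in>{1..N}. d dvd n}" using assms by (auto simp: less_eq_div_iff_mult_less_eq mult.commute Suc_le_eq)
  qed
  also have "(\<Sum>n\<in>(*) d ` {1..N div d}. F n) = (\<Sum>m\<in>{1..N div d}. F (d * m))"
    using assms by (subst sum.reindex) (auto simp: inj_on_def)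
  finally show ?thesis .
qed

lemma count_multiples: "0 < d \<Longrightarrow> (\<Sum>n\<in>{1..N}. of_bool (d dvd n) :: real) = real (N div d)"
  using sum_multiples[where F = "\<lambda>_. 1"] by simp

lemma real_div_bounds:
  assumes "0 < d"
  shows "real (N div d) \<le> real N / real d" "real N / real d - 1 \<le> real (N div d)"
proof -
  have "N div d * d \<le> N" by simp
  then have "real (N div d) * real d \<le> real N" by (metis of_nat_le_iff of_nat_mult)
  then show "real (N div d) \<le> real N / real d" using assms by (simp add: field_simps)
  have "N \<le> (N div d) * d + d" using dividend_less_div_times[OF assms, of N] by simp
  then have "real N \<le> real (N div d) * real d + real d" by (metis of_nat_add of_nat_le_iff of_nat_mult)
  then show "real N / real d - 1 \<le> real (N div d)" using assms by (simp add: field_simps)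
qed

definition prime_count :: "nat set \<Rightarrow> nat \<Rightarrow> real" where
  "prime_count P n = (\<Sum>p\<in>P. of_bool (p dvd n))"

lemma sum_diagonal:
  fixes f :: "'a \<Rightarrow> real"
  assumes "finite P"
  shows "(\<Sum>p\<in>P. \<Sum>q\<in>P. of_bool (p = q) * f p) = (\<Sum>p\<in>P. f p)"
proof (rule sum.cong[OF refl])
  fix p assume "p \<in> P"
  have "(\<Sum>q\<in>P. of_bool (p = q) * f p) = (\<Sum>q\<in>P. if p = q then f p else 0)"
    by (rule sum.cong) auto
  also have "\<dots> = f p" using assms \<open>p \<in> P\<close> by (simp add: sum.delta')
  finally show "(\<Sum>q\<in>P. of_bool (p = q) * f p) = f p" .
qed

text \<open>The square is expanded. For distinct p and q there are at most N / (p q) common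
  multiples, so the second moment exceeds N A^2 by at most the diagonal N A; the term with
  \<open>card P\<close> comes from rounding in the lower bound for the first moment.\<close>

lemma turan_kubilius:
  assumes P: "finite P" "\<And>p. p \<in> P \<Longrightarrow> prime p"
  defines "A \<equiv> \<Sum>p\<in>P. 1 / real p"
  shows "(\<Sum>n\<in>{1..N}. (prime_count P n - A)\<^sup>2) \<le> real N * A + 2 * A * real (card P)"
proof -
  have A0: "0 \<le> A" by (simp add: A_def sum_nonneg)
  have p0: "0 < p" if "p \<in> P" for p using P(2)[OF that] by (simp add: prime_gt_0_nat)
  have S1: "(\<Sum>n\<in>{1..N}. prime_count P n) = (\<Sum>p\<in>P. real (N div p))"
  proof -
    have "(\<Sum>n\<in>{1..N}. prime_count P n) = (\<Sum>p\<in>P. \<Sum>n\<in>{1..N}. of_bool (p dvd n))"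
      unfolding prime_count_def by (rule sum.swap)
    also have "\<dots> = (\<Sum>p\<in>P. real (N div p))" by (intro sum.cong refl count_multiples p0)
    finally show ?thesis .
  qed
  have lower: "real N * A - real (card P) \<le> (\<Sum>n\<in>{1..N}. prime_count P n)"
  proof -
    have "real N * A - real (card P) = (\<Sum>p\<in>P. real N / real p - 1)"
      by (simp add: A_def sum_subtractf sum_distrib_left)
    also have "\<dots> \<le> (\<Sum>p\<in>P. real (N div p))" using real_div_bounds(2) p0 by (intro sum_mono) auto
    finally show ?thesis unfolding S1 .
  qed
  have pair: "(\<Sum>n\<in>{1..N}. of_bool (p dvd n) * of_bool (q dvd n)) \<le> real N * (1 / real p * (1 / real q)) + of_bool (p = q) * (real N / real p)"
    if pq: "p \<in> P" "q \<in> P" for p q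
  proof (cases "p = q")
    case True
    have "(\<Sum>n\<in>{1..N}. of_bool (p dvd n) * of_bool (q dvd n)) = (\<Sum>n\<in>{1..N}. of_bool (p dvd n) :: real)"
      unfolding True by (rule sum.cong) auto
    also have "\<dots> \<le> real N / real p" unfolding count_multiples[OF p0[OF pq(1)]] by (rule real_div_bounds[OF p0[OF pq(1)]])
    finally show ?thesis using True by (simp add: add_increasing)
  next
    case False
    have cop: "coprime p q" using False P(2) pq by (simp add: primes_coprime)
    have "(\<Sum>n\<in>{1..N}. of_bool (p dvd n) * of_bool (q dvd n)) = (\<Sum>n\<in>{1..N}. of_bool (p * q dvd n) :: real)"
      by (rule sum.cong) (use cop divides_mult[of p _ q] dvd_mult_left dvd_mult_right in \<open>auto simp: of_bool_def\<close>)
    also have "\<dots> \<le> real N / real (p * q)"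
    proof -
      have "0 < p * q" using p0 pq by simp
      then show ?thesis unfolding count_multiples[OF \<open>0 < p * q\<close>] by (rule real_div_bounds)
    qed
    finally show ?thesis using False by simp
  qed
  have upper: "(\<Sum>n\<in>{1..N}. (prime_count P n)\<^sup>2) \<le> real N * A\<^sup>2 + real N * A"
  proof -
    have "(\<Sum>n\<in>{1..N}. (prime_count P n)\<^sup>2) = (\<Sum>n\<in>{1..N}. \<Sum>p\<in>P. \<Sum>q\<in>P. of_bool (p dvd n) * of_bool (q dvd n))"
      by (simp add: prime_count_def power2_eq_square sum_product)
    also have "\<dots> = (\<Sum>p\<in>P. \<Sum>q\<in>P. \<Sum>n\<in>{1..N}. of_bool (p dvd n) * of_bool (q dvd n))"
      by (subst sum.swap, rule sum.cong[OF refl], rule sum.swap)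
    also have "\<dots> \<le> (\<Sum>p\<in>P. \<Sum>q\<in>P. real N * (1 / real p * (1 / real q)) + of_bool (p = q) * (real N / real p))"
      by (intro sum_mono pair)
    also have "\<dots> = (\<Sum>p\<in>P. \<Sum>q\<in>P. real N * (1 / real p * (1 / real q))) + (\<Sum>p\<in>P. \<Sum>q\<in>P. of_bool (p = q) * (real N / real p))"
      by (simp add: sum.distrib)
    also have "(\<Sum>p\<in>P. \<Sum>q\<in>P. real N * (1 / real p * (1 / real q))) = real N * A\<^sup>2"
      unfolding A_def power2_eq_square sum_product by (simp only: sum_distrib_left)
    also have "(\<Sum>p\<in>P. \<Sum>q\<in>P. of_bool (p = q) * (real N / real p)) = real N * A"
      unfolding sum_diagonal[OF P(1)] by (simp add: A_def sum_distrib_left)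
    finally show ?thesis .
  qed
  have "(\<Sum>n\<in>{1..N}. (prime_count P n - A)\<^sup>2) = (\<Sum>n\<in>{1..N}. (prime_count P n)\<^sup>2 - 2 * A * prime_count P n + A\<^sup>2)"
    by (intro sum.cong refl) (simp add: power2_eq_square algebra_simps)
  also have "\<dots> = (\<Sum>n\<in>{1..N}. (prime_count P n)\<^sup>2) - 2 * A * (\<Sum>n\<in>{1..N}. prime_count P n) + real N * A\<^sup>2"
    by (simp add: sum.distrib sum_subtractf sum_distrib_left)
  also have "\<dots> \<le> (real N * A\<^sup>2 + real N * A) - 2 * A * (real N * A - real (card P)) + real N * A\<^sup>2"
    using upper mult_left_mono[OF lower, of "2 * A"] A0 by linarith
  also have "\<dots> = real N * A + 2 * A * real (card P)" by (simp add: power2_eq_square algebra_simps)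
  finally show ?thesis .
qed

lemma abs_sum_mult_le_sqrt:
  fixes b h :: "nat \<Rightarrow> real"
  assumes "\<And>n. \<bar>b n\<bar> \<le> 1" "(\<Sum>n\<in>{1..N}. (h n)\<^sup>2) \<le> real N * C" "0 \<le> C"
  shows "\<bar>\<Sum>n\<in>{1..N}. b n * h n\<bar> \<le> real N * sqrt C"
proof -
  have "(\<Sum>n\<in>{1..N}. b n * h n)\<^sup>2 \<le> (\<Sum>n\<in>{1..N}. (b n)\<^sup>2) * (\<Sum>n\<in>{1..N}. (h n)\<^sup>2)"
    by (rule Cauchy_Schwarz_ineq_sum)
  also have "\<dots> \<le> real N * (real N * C)"
  proof (rule mult_mono)
    have "(\<Sum>n\<in>{1..N}. (b n)\<^sup>2) \<le> (\<Sum>n\<in>{1..N}. 1)"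
      using assms(1) by (intro sum_mono) (simp add: abs_square_le_1)
    then show "(\<Sum>n\<in>{1..N}. (b n)\<^sup>2) \<le> real N" by simp
  qed (use assms in \<open>auto intro: sum_nonneg\<close>)
  also have "\<dots> = (real N * sqrt C)\<^sup>2" using assms(3) by (simp add: power_mult_distrib power2_eq_square)
  finally show ?thesis using assms(3) by (simp add: abs_le_square_iff[symmetric])
qed

text \<open>By \<open>turan_kubilius\<close>, A may be replaced by \<open>prime_count P n\<close>
  under the sum at the cost of N sqrt (A + 1). With n = p m this becomes, up to an error N, minus
  the sum over m of the Moebius function times \<open>h m\<close>; Cauchy-Schwarz removes the
  Moebius function and leaves the correlations of g along p m and q m.\<close>

lemma katai_estimate:
  fixes g :: "nat \<Rightarrow> real"
  assumes g: "\<And>n. \<bar>g n\<bar> \<le> 1" and P: "finite P" "\<And>p. p \<in> P \<Longrightarrow> prime p"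
    and corr: "\<And>p q. p \<in> P \<Longrightarrow> q \<in> P \<Longrightarrow> p \<noteq> q \<Longrightarrow>
      \<bar>\<Sum>m\<in>{1..N div max p q}. g (p * m) * g (q * m)\<bar> * (real (card P))\<^sup>2 \<le> real N"
    and N: "2 * (\<Sum>p\<in>P. 1 / real p) * real (card P) \<le> real N"
  defines "A \<equiv> \<Sum>p\<in>P. 1 / real p"
  shows "A * \<bar>\<Sum>n\<in>{1..N}. real_of_int (moebius_mu n) * g n\<bar> \<le> real N * (2 * sqrt (A + 1) + 1)"
proof -
  define b where "b = (\<lambda>n. real_of_int (moebius_mu n))"
  have b1: "\<bar>b n\<bar> \<le> 1" for n unfolding b_def using abs_moebius_mu_le[of n] by linarith
  have bg1: "\<bar>b n * g m\<bar> \<le> 1" for n m unfolding abs_mult using b1 g by (intro mult_le_one) auto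
  have A0: "0 \<le> A" by (simp add: A_def sum_nonneg)
  have p0: "0 < p" if "p \<in> P" for p using P(2)[OF that] by (simp add: prime_gt_0_nat)
  define S where "S = (\<Sum>n\<in>{1..N}. b n * g n)"
  have dev: "\<bar>\<Sum>n\<in>{1..N}. (b n * g n) * (prime_count P n - A)\<bar> \<le> real N * sqrt (A + 1)"
  proof (rule abs_sum_mult_le_sqrt[OF bg1])
    have "(\<Sum>n\<in>{1..N}. (prime_count P n - A)\<^sup>2) \<le> real N * A + 2 * A * real (card P)"
      unfolding A_def by (rule turan_kubilius[OF P])
    also have "\<dots> \<le> real N * (A + 1)" using N by (simp add: A_def algebra_simps)
    finally show "(\<Sum>n\<in>{1..N}. (prime_count P n - A)\<^sup>2) \<le> real N * (A + 1)" .
  qed (use A0 in auto)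
  define h where "h = (\<lambda>m. \<Sum>p\<in>P. of_bool (m \<le> N div p) * g (p * m))"
  have hsq: "(\<Sum>m\<in>{1..N}. (h m)\<^sup>2) \<le> real N * (A + 1)"
  proof -
    have pq: "(\<Sum>m\<in>{1..N}. (of_bool (m \<le> N div p) * g (p * m)) * (of_bool (m \<le> N div q) * g (q * m))) =
      (\<Sum>m\<in>{1..N div max p q}. g (p * m) * g (q * m))" if "p \<in> P" "q \<in> P" for p q
    proof -
      have "N div max p q = min (N div p) (N div q)"
      proof (cases "p \<le> q")
        case True
        then show ?thesis using div_le_mono2[OF p0[OF that(1)] True, of N] by simp
      next
        case False
        then show ?thesis using div_le_mono2[OF p0[OF that(2)], of p N] by simp
      qed
      then have iff: "m \<le> N div max p q \<longleftrightarrow> m \<le> N div p \<and> m \<le> N div q" for m by auto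
      have "(\<Sum>m\<in>{1..N}. (of_bool (m \<le> N div p) * g (p * m)) * (of_bool (m \<le> N div q) * g (q * m))) =
        (\<Sum>m\<in>{1..N}. if m \<le> N div max p q then g (p * m) * g (q * m) else 0)"
        unfolding iff by (rule sum.cong) auto
      also have "\<dots> = (\<Sum>m\<in>{m\<in>{1..N}. m \<le> N div max p q}. g (p * m) * g (q * m))"
        by (rule sum.inter_filter[symmetric]) simp
      also have "{m\<in>{1..N}. m \<le> N div max p q} = {1..N div max p q}"
        using div_le_dividend[of N "max p q"] by (auto intro: order_trans)
      finally show ?thesis .
    qed
    have each: "(\<Sum>m\<in>{1..N div max p q}. g (p * m) * g (q * m)) \<le> of_bool (p = q) * (real N / real p) + real N / (real (card P))\<^sup>2"
      if pq: "p \<in> P" "q \<in> P" for p q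
    proof (cases "p = q")
      case True
      have "(\<Sum>m\<in>{1..N div p}. g (p * m) * g (p * m)) \<le> (\<Sum>m\<in>{1..N div p}. 1)"
        using g by (intro sum_mono) (metis abs_square_le_1 power2_eq_square)
      also have "\<dots> \<le> real N / real p" using real_div_bounds(1)[OF p0[OF pq(1)], of N] by simp
      finally show ?thesis using True by (simp add: add_increasing2)
    next
      case False
      have "card P > 0" using P(1) pq card_gt_0_iff by blast
      then have "\<bar>\<Sum>m\<in>{1..N div max p q}. g (p * m) * g (q * m)\<bar> \<le> real N / (real (card P))\<^sup>2"
        using corr[OF pq False] by (simp add: field_simps)
      then show ?thesis using False by simp
    qed
    have "(\<Sum>m\<in>{1..N}. (h m)\<^sup>2) = (\<Sum>m\<in>{1..N}. \<Sum>p\<in>P. \<Sum>q\<in>P. (of_bool (m \<le> N div p) * g (p * m)) * (of_bool (m \<le> N div q) * g (q * m)))"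
      by (simp only: h_def power2_eq_square sum_product)
    also have "\<dots> = (\<Sum>p\<in>P. \<Sum>q\<in>P. \<Sum>m\<in>{1..N}. (of_bool (m \<le> N div p) * g (p * m)) * (of_bool (m \<le> N div q) * g (q * m)))"
      by (subst sum.swap, rule sum.cong[OF refl], rule sum.swap)
    also have "\<dots> = (\<Sum>p\<in>P. \<Sum>q\<in>P. \<Sum>m\<in>{1..N div max p q}. g (p * m) * g (q * m))"
      by (intro sum.cong refl pq)
    also have "\<dots> \<le> (\<Sum>p\<in>P. \<Sum>q\<in>P. of_bool (p = q) * (real N / real p) + real N / (real (card P))\<^sup>2)"
      by (intro sum_mono each)
    also have "\<dots> = (\<Sum>p\<in>P. \<Sum>q\<in>P. of_bool (p = q) * (real N / real p)) + (\<Sum>p\<in>P. \<Sum>q\<in>P. real N / (real (card P))\<^sup>2)"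
      by (simp only: sum.distrib)
    also have "(\<Sum>p\<in>P. \<Sum>q\<in>P. of_bool (p = q) * (real N / real p)) = real N * A"
      unfolding sum_diagonal[OF P(1)] by (simp add: A_def sum_distrib_left)
    also have "(\<Sum>p\<in>P. \<Sum>q\<in>P. real N / (real (card P))\<^sup>2) \<le> real N"
      by (simp add: power2_eq_square)
    finally show ?thesis by (simp add: algebra_simps)
  qed
  have main: "\<bar>\<Sum>m\<in>{1..N}. b m * h m\<bar> \<le> real N * sqrt (A + 1)"
    by (rule abs_sum_mult_le_sqrt[OF b1 hsq]) (use A0 in auto)
  have sw: "(\<Sum>n\<in>{1..N}. (b n * g n) * prime_count P n) = (\<Sum>p\<in>P. \<Sum>m\<in>{1..N div p}. b (p * m) * g (p * m))"
  proof -
    have "(\<Sum>n\<in>{1..N}. (b n * g n) * prime_count P n) = (\<Sum>p\<in>P. \<Sum>n\<in>{1..N}. of_bool (p dvd n) * (b n * g n))"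
      unfolding prime_count_def sum_distrib_left by (subst sum.swap) (simp add: mult.commute)
    also have "\<dots> = (\<Sum>p\<in>P. \<Sum>m\<in>{1..N div p}. b (p * m) * g (p * m))"
      by (intro sum.cong refl sum_multiples p0)
    finally show ?thesis .
  qed
  have hs: "(\<Sum>m\<in>{1..N}. b m * h m) = (\<Sum>p\<in>P. \<Sum>m\<in>{1..N div p}. b m * g (p * m))"
  proof -
    have "(\<Sum>m\<in>{1..N}. b m * h m) = (\<Sum>p\<in>P. \<Sum>m\<in>{1..N}. if m \<le> N div p then b m * g (p * m) else 0)"
      unfolding h_def sum_distrib_left by (subst sum.swap) (auto intro!: sum.cong)
    also have "\<dots> = (\<Sum>p\<in>P. \<Sum>m\<in>{m\<in>{1..N}. m \<le> N div p}. b m * g (p * m))"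
      by (intro sum.cong refl sum.inter_filter[symmetric]) simp
    also have "\<dots> = (\<Sum>p\<in>P. \<Sum>m\<in>{1..N div p}. b m * g (p * m))"
      using div_le_dividend[of N] by (intro sum.cong refl) (auto intro: order_trans)
    finally show ?thesis .
  qed
  \<comment> \<open>\<open>b (p * m) = - b m\<close> unless p divides m. For each p these
    exceptional m contribute at most N / p^2, and the inverse squares sum to at most 1.\<close>
  have err: "\<bar>(\<Sum>n\<in>{1..N}. (b n * g n) * prime_count P n) + (\<Sum>m\<in>{1..N}. b m * h m)\<bar> \<le> real N"
  proof -
    have each: "\<bar>(\<Sum>m\<in>{1..N div p}. b (p * m) * g (p * m)) + (\<Sum>m\<in>{1..N div p}. b m * g (p * m))\<bar> \<le> real N * (1 / (real p)\<^sup>2)"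
      if p: "p \<in> P" for p
    proof -
      have bp: "b (p * m) + b m = of_bool (p dvd m) * b m" for m
        using moebius_mu_prime_mult[OF P(2)[OF p], of m] by (simp add: b_def)
      have "(\<Sum>m\<in>{1..N div p}. b (p * m) * g (p * m)) + (\<Sum>m\<in>{1..N div p}. b m * g (p * m)) =
        (\<Sum>m\<in>{1..N div p}. of_bool (p dvd m) * (b m * g (p * m)))"
        unfolding sum.distrib[symmetric] distrib_right[symmetric] bp by (simp add: mult.assoc)
      also have "\<bar>\<dots>\<bar> \<le> (\<Sum>m\<in>{1..N div p}. of_bool (p dvd m))"
        by (rule order_trans[OF sum_abs sum_mono]) (use bg1 in \<open>auto simp: abs_mult of_bool_def\<close>)
      also have "\<dots> = real (N div p div p)" by (rule count_multiples[OF p0[OF p]])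
      also have "\<dots> \<le> real N / real (p * p)" unfolding div_mult2_eq[symmetric] using p0[OF p] by (intro real_div_bounds) simp
      finally show ?thesis by (simp add: power2_eq_square)
    qed
    have "\<bar>(\<Sum>n\<in>{1..N}. (b n * g n) * prime_count P n) + (\<Sum>m\<in>{1..N}. b m * h m)\<bar> \<le> (\<Sum>p\<in>P. real N * (1 / (real p)\<^sup>2))"
      unfolding sw hs sum.distrib[of _ _ P, symmetric] by (rule order_trans[OF sum_abs sum_mono[OF each]])
    also have "\<dots> = real N * (\<Sum>p\<in>P. 1 / (real p)\<^sup>2)" by (simp add: sum_distrib_left)
    also have "\<dots> \<le> real N * 1"
      using P by (intro mult_left_mono sum_inverse_squares_le) (auto simp: prime_ge_2_nat)
    finally show ?thesis by simp
  qed
  have "A * S = (\<Sum>n\<in>{1..N}. (b n * g n) * prime_count P n) - (\<Sum>n\<in>{1..N}. (b n * g n) * (prime_count P n - A))"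
    unfolding sum_subtractf[symmetric] S_def sum_distrib_left by (intro sum.cong refl) (simp add: algebra_simps)
  then have "\<bar>A * S\<bar> \<le> real N + real N * sqrt (A + 1) + real N * sqrt (A + 1)"
    using err main dev by linarith
  then show ?thesis using A0 by (simp add: S_def b_def abs_mult algebra_simps)
qed

text \<open>P is chosen with A large before N, so the correlations are needed only for finitely many
  pairs at a time. The estimate then bounds the average by 5 / sqrt A, which is below
  \<epsilon>.\<close>

theorem katai_criterion:
  fixes g :: "nat \<Rightarrow> real"
  assumes g: "\<And>n. \<bar>g n\<bar> \<le> 1"
    and corr: "\<And>p q. prime p \<Longrightarrow> prime q \<Longrightarrow> p \<noteq> q \<Longrightarrow> (\<lambda>N. (\<Sum>m\<in>{1..N}. g (p * m) * g (q * m)) / real N) \<longlonglongrightarrow> 0"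
  shows "(\<lambda>N. (\<Sum>n\<in>{1..N}. real_of_int (moebius_mu n) * g n) / real N) \<longlonglongrightarrow> 0"
proof (rule LIMSEQ_I)
  fix \<epsilon> :: real assume e: "\<epsilon> > 0"
  obtain M where M: "max 1 ((5 / \<epsilon>)\<^sup>2) < (\<Sum>p\<in>primes_le M. 1 / real p)" using prime_harmonic_unbounded by blast
  define P where "P = primes_le M"
  define A where "A = (\<Sum>p\<in>P. 1 / real p)"
  have A: "1 < A" "(5 / \<epsilon>)\<^sup>2 < A" using M by (auto simp: A_def P_def)
  have P: "finite P" "\<And>p. p \<in> P \<Longrightarrow> prime p" by (auto simp: P_def prime_primes_le)
  have p0: "0 < p" if "p \<in> P" for p using P(2)[OF that] by (simp add: prime_gt_0_nat)
  define c where "c = (real (card P))\<^sup>2 + 1"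
  have c: "c > 0" "(real (card P))\<^sup>2 \<le> c" by (auto simp: c_def add_nonneg_pos)
  have ev: "\<forall>\<^sub>F N in sequentially. \<bar>\<Sum>m\<in>{1..N div max p q}. g (p * m) * g (q * m)\<bar> * (real (card P))\<^sup>2 \<le> real N"
    if pq: "p \<in> P" "q \<in> P" "p \<noteq> q" for p q
  proof -
    have "\<forall>\<^sub>F N in sequentially. norm ((\<Sum>m\<in>{1..N}. g (p * m) * g (q * m)) / real N) < 1 / c"
      using corr[OF P(2)[OF pq(1)] P(2)[OF pq(2)] pq(3)] c unfolding tendsto_iff by (simp add: dist_real_def)
    moreover have "filterlim (\<lambda>N. N div max p q) at_top sequentially"
      unfolding filterlim_at_top eventually_sequentially
    proof (intro allI exI impI)
      fix Z N assume "Z * max p q \<le> N"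
      then show "Z \<le> N div max p q" using p0[OF pq(1)] by (simp add: less_eq_div_iff_mult_less_eq)
    qed
    ultimately have "\<forall>\<^sub>F N in sequentially. norm ((\<Sum>m\<in>{1..N div max p q}. g (p * m) * g (q * m)) / real (N div max p q)) < 1 / c"
      by (rule eventually_compose_filterlim)
    then show ?thesis
    proof eventually_elim
      case (elim N)
      let ?s = "\<bar>\<Sum>m\<in>{1..N div max p q}. g (p * m) * g (q * m)\<bar>"
      have "?s * c \<le> real (N div max p q)"
      proof (cases "N div max p q = 0")
        case False
        then show ?thesis using elim c by (simp add: field_simps)
      qed simp
      then have "?s * (real (card P))\<^sup>2 \<le> real (N div max p q)" using c(2) mult_left_mono[OF c(2), of ?s] by simp
      also have "\<dots> \<le> real N" using div_le_dividend[of N "max p q"] by simp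
      finally show ?case .
    qed
  qed
  have "\<forall>\<^sub>F N in sequentially. \<forall>p\<in>P. \<forall>q\<in>P. p \<noteq> q \<longrightarrow> \<bar>\<Sum>m\<in>{1..N div max p q}. g (p * m) * g (q * m)\<bar> * (real (card P))\<^sup>2 \<le> real N"
  proof (intro eventually_ball_finite[OF P(1)] ballI)
    fix p q assume "p \<in> P" "q \<in> P"
    then show "\<forall>\<^sub>F N in sequentially. p \<noteq> q \<longrightarrow> \<bar>\<Sum>m\<in>{1..N div max p q}. g (p * m) * g (q * m)\<bar> * (real (card P))\<^sup>2 \<le> real N"
      using ev[of p q] by (cases "p = q") auto
  qed
  moreover have "\<forall>\<^sub>F N in sequentially. 2 * A * real (card P) + 1 \<le> real N"
    by (rule eventually_sequentiallyI[of "nat \<lceil>2 * A * real (card P) + 1\<rceil>"]) linarith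
  ultimately have "\<forall>\<^sub>F N in sequentially. norm ((\<Sum>n\<in>{1..N}. real_of_int (moebius_mu n) * g n) / real N - 0) < \<epsilon>"
  proof eventually_elim
    case (elim N)
    let ?S = "\<bar>\<Sum>n\<in>{1..N}. real_of_int (moebius_mu n) * g n\<bar>"
    have N: "real N > 0" using elim(2) A by (smt (verit) mult_nonneg_nonneg of_nat_0_le_iff)
    have "A * ?S \<le> real N * (2 * sqrt (A + 1) + 1)"
      unfolding A_def by (rule katai_estimate[OF g P]) (use elim in \<open>auto simp: A_def\<close>)
    also have "2 * sqrt (A + 1) + 1 < 5 * sqrt A"
    proof -
      have "sqrt (A + 1) < sqrt (2\<^sup>2 * A)" using A by (intro real_sqrt_less_mono) simp
      then have "sqrt (A + 1) < 2 * sqrt A" by (simp add: real_sqrt_mult)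
      moreover have "1 < sqrt A" using A by simp
      ultimately show ?thesis by linarith
    qed
    finally have "A * ?S < real N * (5 * sqrt A)" using N by simp
    moreover have "A = sqrt A * sqrt A" using A by simp
    ultimately have "sqrt A * (sqrt A * ?S) < sqrt A * (real N * 5)" by (metis mult.assoc mult.commute)
    moreover have sA: "0 < sqrt A" using A by simp
    ultimately have "sqrt A * ?S < real N * 5" by (simp only: mult_less_cancel_left_pos)
    also have "real N * 5 < sqrt A * (\<epsilon> * real N)"
    proof -
      have "sqrt ((5 / \<epsilon>)\<^sup>2) < sqrt A" using A(2) by (rule real_sqrt_less_mono)
      moreover have "sqrt ((5 / \<epsilon>)\<^sup>2) = 5 / \<epsilon>" using e by (intro real_sqrt_unique) auto
      ultimately have "5 / \<epsilon> < sqrt A" by (simp only:)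
      then have "5 < \<epsilon> * sqrt A" using e by (simp add: divide_less_eq mult.commute)
      then have "real N * 5 < real N * (\<epsilon> * sqrt A)" using N by (rule mult_strict_left_mono)
      then show ?thesis by (simp only: mult_ac)
    qed
    finally have "?S < \<epsilon> * real N" using sA by (simp only: mult_less_cancel_left_pos)
    then show ?case using N by (simp add: field_simps)
  qed
  then show "\<exists>N0. \<forall>N\<ge>N0. norm ((\<Sum>n\<in>{1..N}. real_of_int (moebius_mu n) * g n) / real N - 0) < \<epsilon>"
    by (simp add: eventually_sequentially)
qed

text \<open>Partial summation writes the sum as N s_N minus the sum of s_k for k < N, where s_k are
  the harmonic sums; both parts are o(N) since s_k tends to 0.\<close>

lemma moebius_mean_tendsto: "(\<lambda>N. (\<Sum>n\<in>{1..N}. real_of_int (moebius_mu n)) / real N) \<longlonglongrightarrow> 0"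
proof (rule LIMSEQ_I)
  fix \<epsilon> :: real assume e: "\<epsilon> > 0"
  define s where "s = (\<lambda>N. \<Sum>n\<in>{1..N}. real_of_int (moebius_mu n) / real n)"
  obtain N1 where N1: "\<And>N. N \<ge> N1 \<Longrightarrow> \<bar>s N\<bar> < \<epsilon> / 4"
    using LIMSEQ_D[OF moebius_harmonic_tendsto, of "\<epsilon> / 4"] e unfolding s_def by auto
  have abel: "(\<Sum>n\<in>{1..N}. real_of_int (moebius_mu n)) = real N * s N - (\<Sum>k<N. s k)" for N
  proof (induction N)
    case (Suc N)
    have "s (Suc N) = s N + real_of_int (moebius_mu (Suc N)) / real (Suc N)" by (simp add: s_def)
    then have "real (Suc N) * s (Suc N) = real (Suc N) * s N + real_of_int (moebius_mu (Suc N))" by (simp add: field_simps)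
    then show ?case using Suc by (simp add: algebra_simps)
  qed (simp add: s_def)
  define C where "C = (\<Sum>k<N1. \<bar>s k\<bar>)"
  have C0: "0 \<le> C" by (simp add: C_def sum_nonneg)
  have "norm ((\<Sum>n\<in>{1..N}. real_of_int (moebius_mu n)) / real N - 0) < \<epsilon>" if N: "N \<ge> max (Suc N1) (nat \<lceil>4 * C / \<epsilon>\<rceil>)" for N
  proof -
    have N0: "real N > 0" using N by simp
    have "(\<Sum>k<N. \<bar>s k\<bar>) \<le> (\<Sum>k<N. (if k < N1 then \<bar>s k\<bar> else 0) + \<epsilon> / 4)"
      using N1 e by (intro sum_mono) (auto simp: less_imp_le not_less)
    also have "\<dots> = (\<Sum>k<N. if k < N1 then \<bar>s k\<bar> else 0) + real N * (\<epsilon> / 4)" by (simp only: sum.distrib) simp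
    also have "(\<Sum>k<N. if k < N1 then \<bar>s k\<bar> else 0) = C"
    proof -
      have "{k\<in>{..<N}. k < N1} = {..<N1}" using N by auto
      then show ?thesis unfolding C_def by (subst sum.inter_filter[symmetric]) auto
    qed
    finally have "\<bar>\<Sum>k<N. s k\<bar> \<le> C + real N * (\<epsilon> / 4)" using sum_abs[of s "{..<N}"] by linarith
    moreover have "\<bar>real N * s N\<bar> \<le> real N * (\<epsilon> / 4)"
      unfolding abs_mult using N1[of N] N by (intro mult_mono) auto
    moreover have "C \<le> real N * (\<epsilon> / 4)"
    proof -
      have "4 * C / \<epsilon> \<le> real N" using N by linarith
      then show ?thesis using e by (simp add: field_simps)
    qed
    ultimately have "\<bar>\<Sum>n\<in>{1..N}. real_of_int (moebius_mu n)\<bar> \<le> 3 * (real N * (\<epsilon> / 4))" unfolding abel by linarith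
    also have "\<dots> < \<epsilon> * real N" using e N0 by simp
    finally show ?thesis using N0 by (simp add: field_simps)
  qed
  then show "\<exists>N0. \<forall>N\<ge>N0. norm ((\<Sum>n\<in>{1..N}. real_of_int (moebius_mu n)) / real N - 0) < \<epsilon>" by blast
qed

section \<open>Disjointness\<close>

lemma sum_from_0: "(\<Sum>j<Suc N. a j) = a 0 + (\<Sum>m\<in>{1..N}. a m :: real)"
  by (induction N) simp_all

lemma null_average_shift:
  fixes a :: "nat \<Rightarrow> real"
  assumes "\<And>\<epsilon>. \<epsilon> > 0 \<Longrightarrow> \<exists>K0. \<forall>K\<ge>K0. \<bar>\<Sum>j<K. a j\<bar> \<le> \<epsilon> * real K"
  shows "(\<lambda>N. (\<Sum>m\<in>{1..N}. a m) / real N) \<longlonglongrightarrow> 0"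
proof (rule LIMSEQ_I)
  fix \<epsilon> :: real assume e: "\<epsilon> > 0"
  obtain K0 where K0: "\<And>K. K \<ge> K0 \<Longrightarrow> \<bar>\<Sum>j<K. a j\<bar> \<le> \<epsilon> / 4 * real K" using assms[of "\<epsilon> / 4"] e by auto
  show "\<exists>N0. \<forall>N\<ge>N0. norm ((\<Sum>m\<in>{1..N}. a m) / real N - 0) < \<epsilon>"
  proof (intro exI[of _ "max (Suc K0) (nat \<lceil>4 * \<bar>a 0\<bar> / \<epsilon>\<rceil>)"] allI impI)
    fix N assume N: "max (Suc K0) (nat \<lceil>4 * \<bar>a 0\<bar> / \<epsilon>\<rceil>) \<le> N"
    then have N1: "1 \<le> real N" by simp
    have "4 * \<bar>a 0\<bar> / \<epsilon> \<le> real N" using N by linarith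
    then have a0: "\<bar>a 0\<bar> \<le> \<epsilon> / 4 * real N" using e by (simp add: field_simps)
    have "\<bar>\<Sum>j<Suc N. a j\<bar> \<le> \<epsilon> / 4 * real (Suc N)" using N by (intro K0) simp
    also have "\<dots> \<le> \<epsilon> / 4 * (2 * real N)" using N1 e by (intro mult_left_mono) auto
    finally have "\<bar>\<Sum>m\<in>{1..N}. a m\<bar> \<le> 3 * (\<epsilon> / 4 * real N)" using a0 unfolding sum_from_0 by linarith
    also have "\<dots> < \<epsilon> * real N" using e N1 by simp
    finally show "norm ((\<Sum>m\<in>{1..N}. a m) / real N - 0) < \<epsilon>" using N1 by (simp add: field_simps)
  qed
qed

lemma (in return_map) first_return_eq_T:
  assumes y: "y \<in> {0..<z}"
  shows "first_return (rot \<alpha>) {0..<z} y = T y"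
proof -
  have y1: "y \<in> {0..<1}" using y z by auto
  define n where "n = (LEAST n. 0 < n \<and> (rot \<alpha> ^^ n) y \<in> {0..<z})"
  have mem: "(rot \<alpha> ^^ n) y \<in> {0..<z} \<longleftrightarrow> frac (y + real n * \<alpha>) < z" for n by (simp add: rot_funpow[OF y1])
  show ?thesis
  proof (cases "frac (y + \<alpha>) < z")
    case True
    have "n = 1" unfolding n_def
    proof (rule Least_equality)
      show "0 < (1 :: nat) \<and> (rot \<alpha> ^^ 1) y \<in> {0..<z}" unfolding mem using True by simp
    qed simp
    then have "first_return (rot \<alpha>) {0..<z} y = (rot \<alpha> ^^ 1) y" unfolding first_return_def n_def by (simp only:)
    then show ?thesis unfolding rot_funpow[OF y1] using True by (simp add: T_def)
  next
    case False
    have "n = 2" unfolding n_def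
    proof (rule Least_equality)
      show "0 < (2 :: nat) \<and> (rot \<alpha> ^^ 2) y \<in> {0..<z}" unfolding mem using ret[OF False] by (simp add: algebra_simps)
      fix k assume k: "0 < k \<and> (rot \<alpha> ^^ k) y \<in> {0..<z}"
      then have "k \<noteq> 1" using False unfolding mem by auto
      then show "2 \<le> k" using k by simp
    qed
    then have "first_return (rot \<alpha>) {0..<z} y = (rot \<alpha> ^^ 2) y" unfolding first_return_def n_def by (simp only:)
    then show ?thesis unfolding rot_funpow[OF y1] using False by (simp add: T_def)
  qed
qed

lemma (in irrational_return) moebius_disjoint:
  assumes good: good_scales and f: "continuous_on {0..z} f" and x: "x \<in> {0..<z}"
  shows "(\<lambda>N. (\<Sum>n<N. f ((T ^^ n) x) * real_of_int (moebius_mu n)) / real N) \<longlonglongrightarrow> 0"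
proof -
  obtain c where c: "\<forall>\<epsilon>>0. \<exists>K0. \<forall>K\<ge>K0. \<forall>x\<in>{0..<z}. \<bar>(\<Sum>j<K. f ((T ^^ j) x)) - c * real K\<bar> \<le> \<epsilon> * real K"
    using T_mean[OF f] by blast
  have "compact (f ` {0..z})" using compact_continuous_image[OF f] by simp
  then obtain C0 where C0: "\<And>y. y \<in> {0..z} \<Longrightarrow> \<bar>f y\<bar> \<le> C0" using compact_imp_bounded by (fastforce simp: bounded_iff)
  \<comment> \<open>\<open>C\<close> bounds |f - c| on [0, z], so that \<open>h\<close> has values
    in [-1, 1] as \<open>katai_criterion\<close> and the mean value lemmas require; the summand 1
    keeps it positive.\<close>
  define C where "C = max C0 0 + \<bar>c\<bar> + 1"
  have C: "0 < C" by (simp add: C_def)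
  define h where "h = (\<lambda>y. (f y - c) / C)"
  have f_h: "f y = C * h y + c" for y using C by (simp add: h_def)
  have hc: "continuous_on {0..z} h" unfolding h_def using C by (intro continuous_intros f) auto
  have h1: "\<bar>h y\<bar> \<le> 1" if "y \<in> {0..<z}" for y
  proof -
    have "\<bar>f y\<bar> \<le> C0" using that by (intro C0) auto
    then have "\<bar>f y - c\<bar> \<le> C" unfolding C_def by linarith
    then show ?thesis using C by (simp add: h_def abs_divide)
  qed
  have null1: "null_mean 1 h"
    unfolding null_mean_def
  proof (intro allI impI)
    fix \<epsilon> :: real assume e: "0 < \<epsilon>"
    have "0 < C * \<epsilon>" using C e by simp
    then obtain K0 where K0: "\<forall>K\<ge>K0. \<forall>x\<in>{0..<z}. \<bar>(\<Sum>j<K. f ((T ^^ j) x)) - c * real K\<bar> \<le> C * \<epsilon> * real K"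
      using c by blast
    show "\<exists>K0. \<forall>K\<ge>K0. \<forall>y\<in>{0..<z}. \<bar>\<Sum>j<K. h ((T ^^ (1 * j)) y)\<bar> \<le> \<epsilon> * real K"
    proof (intro exI[of _ K0] allI impI ballI)
      fix K y assume K: "K0 \<le> K" and y: "y \<in> {0..<z}"
      have "C * (\<Sum>j<K. h ((T ^^ j) y)) = (\<Sum>j<K. f ((T ^^ j) y)) - c * real K"
        by (simp add: f_h sum.distrib sum_distrib_left)
      then have "\<bar>C * (\<Sum>j<K. h ((T ^^ j) y))\<bar> \<le> C * \<epsilon> * real K" using K0 K y by simp
      then have "C * \<bar>\<Sum>j<K. h ((T ^^ j) y)\<bar> \<le> C * (\<epsilon> * real K)" using C by (simp add: abs_mult mult.assoc)
      then have "\<bar>\<Sum>j<K. h ((T ^^ j) y)\<bar> \<le> \<epsilon> * real K" using C by (simp only: mult_le_cancel_left_pos)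
      then show "\<bar>\<Sum>j<K. h ((T ^^ (1 * j)) y)\<bar> \<le> \<epsilon> * real K" by simp
    qed
  qed
  note null = null_mean_all[OF good hc h1 null1]
  define g where "g = (\<lambda>n. h ((T ^^ n) x))"
  have "(\<lambda>N. (\<Sum>n\<in>{1..N}. real_of_int (moebius_mu n) * g n) / real N) \<longlonglongrightarrow> 0"
  proof (rule katai_criterion)
    show "\<bar>g n\<bar> \<le> 1" for n unfolding g_def by (rule h1[OF T_funpow_in[OF x]])
    fix p q :: nat assume pq: "prime p" "prime q" "p \<noteq> q"
    show "(\<lambda>N. (\<Sum>m\<in>{1..N}. g (p * m) * g (q * m)) / real N) \<longlonglongrightarrow> 0"
    proof (rule null_average_shift)
      fix \<epsilon> :: real assume "\<epsilon> > 0"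
      from joint_mean[OF good hc h1 null pq this]
      show "\<exists>K0. \<forall>K\<ge>K0. \<bar>\<Sum>j<K. g (p * j) * g (q * j)\<bar> \<le> \<epsilon> * real K" using x unfolding g_def by blast
    qed
  qed
  then have "(\<lambda>N. C * ((\<Sum>n\<in>{1..N}. real_of_int (moebius_mu n) * g n) / real N) +
      c * ((\<Sum>n\<in>{1..N}. real_of_int (moebius_mu n)) / real N)) \<longlonglongrightarrow> C * 0 + c * 0"
    by (intro tendsto_intros moebius_mean_tendsto)
  moreover have "C * ((\<Sum>n\<in>{1..N}. real_of_int (moebius_mu n) * g n) / real N) + c * ((\<Sum>n\<in>{1..N}. real_of_int (moebius_mu n)) / real N)
    = (\<Sum>n\<in>{1..N}. f ((T ^^ n) x) * real_of_int (moebius_mu n)) / real N" for N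
    unfolding times_divide_eq_right add_divide_distrib[symmetric] sum_distrib_left sum.distrib[symmetric] f_h g_def
    by (intro arg_cong2[of _ _ _ _ "(/)"] sum.cong refl) (simp add: algebra_simps)
  ultimately have lim: "(\<lambda>N. (\<Sum>n\<in>{1..N}. f ((T ^^ n) x) * real_of_int (moebius_mu n)) / real N) \<longlonglongrightarrow> 0" by simp
  define a where "a = (\<lambda>n. f ((T ^^ n) x) * real_of_int (moebius_mu n))"
  \<comment> \<open>As \<mu>(0) = 0, starting the sum at 0 instead of 1 changes only the
    normalisation, from N to N + 1.\<close>
  have a0: "a 0 = 0" by (simp add: a_def moebius_mu_def)
  have "(\<lambda>N. (\<Sum>n\<in>{1..N}. a n) / real N * (real N / real (Suc N))) \<longlonglongrightarrow> 0 * 1"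
    using lim unfolding a_def by (intro tendsto_mult LIMSEQ_n_over_Suc_n)
  moreover have "(\<Sum>n\<in>{1..N}. a n) / real N * (real N / real (Suc N)) = (\<Sum>n<Suc N. a n) / real (Suc N)" for N
    unfolding sum_from_0 a0 by (cases "N = 0") auto
  ultimately have "(\<lambda>N. (\<Sum>n<Suc N. a n) / real (Suc N)) \<longlonglongrightarrow> 0" by simp
  then have "(\<lambda>N. (\<Sum>n<N. a n) / real N) \<longlonglongrightarrow> 0" by (rule LIMSEQ_imp_Suc)
  then show ?thesis by (simp only: a_def)
qed

theorem theorem1p4:
  fixes \<alpha> z x :: real and T f :: "real \<Rightarrow> real"
  assumes "0 < \<alpha>" "\<alpha> < 1" "\<alpha> \<notin> \<rat>"
    and "0 < z" "z \<le> 1"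
    and "\<forall>y\<in>{0..<1}. y \<notin> {0..<z} \<longrightarrow> rot \<alpha> y \<in> {0..<z}"
    and "\<forall>y\<in>{0..<z}. T y = first_return (rot \<alpha>) {0..<z} y"
    and "interval_exchange 3 z T"
    and "A_assumptions \<alpha> z"
    and "x \<in> {0..<z}"
    and "continuous_on {0..z} f"
  shows "(\<lambda>N. (\<Sum>n<N. f ((T ^^ n) x) * real_of_int (moebius_mu n)) / real N) \<longlonglongrightarrow> 0"
proof -
  interpret irrational \<alpha> by standard (use assms(1-3) in auto)
  \<comment> \<open>The theorem admits z = 1 while \<open>return_map\<close> requires z < 1; the
    case z = 1 is excluded by (A4).\<close>
  have z1: "z < 1" using A_assumptions_z_less_1 assms(5,9) by blast
  interpret R: irrational_return \<alpha> z
  proof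
    show "frac (y + \<alpha>) < z" if "0 \<le> y" "y < 1" "\<not> y < z" for y
      using assms(6) that by (auto simp: rot_def)
  qed (use assms(4) z1 in auto)
  have "(T ^^ n) x = (R.T ^^ n) x" for n
  proof (induction n)
    case (Suc n)
    then show ?case
      using assms(7) R.T_funpow_in[OF assms(10), of n] R.first_return_eq_T by simp
  qed simp
  then show ?thesis
    using R.moebius_disjoint[OF R.A_assumptions_good_scales[OF assms(9)] assms(11,10)] by simp
qed

end
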